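(* Let $A$ be an injective sectorial operator on a Banach space $X$ such that $-A$ generates an asymptotically analytic $C_0$-semigroup $(T(t))_{t\ge 0}$ on $X$. Suppose that $\overline{\mathbb{C}_-}\setminus\{0\}\subset\rho(A)$ and that there exist $\alpha\ge 1$, $a>0$ and $C>0$ such that for each $\lambda\in\overline{\mathbb{C}_-}\setminus\{0\}$ with $|\lambda|\le 1$, $$\|(\lambda-A)^{-1}\|_{\mathcal{L}(X)}\le C|\lambda|^{-\alpha}(\log(2+1/|\lambda|))^{a}.$$ Let $\sigma>\alpha-1$. Then, for each $\delta>0$ there exists $c_{\delta,\sigma}>0$ such that for each $t\ge 1$, $$\|T(t)A^{\sigma}(1+A)^{-\sigma}\|_{\mathcal{L}(X)}\le c_{\delta,\sigma}\,t^{1-\frac{\sigma+1}{\alpha}}\log(1+t)^{\frac{a(\sigma+1)}{\alpha}+1+\delta}.$$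
   Context: $\mathbb{C}_-=\{z\in\mathbb{C}:\operatorname{Re} z<0\}$; $\rho(A)$ is the set of $\lambda$ for which $\lambda-A$ has a bounded inverse. A linear operator $A$ on $X$ is sectorial of angle $\omega\in(0,\pi)$ if $\sigma(A)\subset\overline{S_\omega}$, with $S_\omega=\{z: 0<|\arg z|<\omega\}$, and $\|\lambda(\lambda-A)^{-1}\|$ is bounded for $\lambda\in\mathbb{C}\setminus\overline{S_{\omega'}}$ for every $\omega'\in(\omega,\pi)$. Fractional powers are those of the functional calculus of sectorial operators. The non-analytic growth bound of a $C_0$-semigroup $(T(t))_{t\ge 0}$ is $$\zeta(T)=\inf\{w\in\mathbb{R}:\ \sup_{t>0}e^{-tw}\|T(t)-S(t)\|_{\mathcal{L}(X)}<\infty\ \text{for some } S\in\mathcal{H}(\mathcal{L}(X))\},$$ where $\mathcal{H}(\mathcal{L}(X))$ is the set of functions $S:(0,\infty)\to\mathcal{L}(X)$ having an exponentially bounded analytic extension to some sector containing $(0,\infty)$. The semigroup is asymptotically analytic if $\zeta(T)<0$. *)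

theory Defs
  imports "HOL-Analysis.Analysis"
begin

class complex_banach = banach +
  fixes scaleC :: "complex \<Rightarrow> 'a \<Rightarrow> 'a" (infixr "*\<^sub>C" 75)
  assumes scaleC_add_right: "c *\<^sub>C (x + y) = c *\<^sub>C x + c *\<^sub>C y"
    and scaleC_add_left: "(c + d) *\<^sub>C x = c *\<^sub>C x + d *\<^sub>C x"
    and scaleC_scaleC: "c *\<^sub>C d *\<^sub>C x = (c * d) *\<^sub>C x"
    and scaleC_of_real: "of_real r *\<^sub>C x = r *\<^sub>R x"
    and norm_scaleC: "norm (c *\<^sub>C x) = cmod c * norm x"

lemma scaleC_scaleR: "c *\<^sub>C r *\<^sub>R x = r *\<^sub>R c *\<^sub>C (x::'a::complex_banach)"
  by (simp add: scaleC_of_real[symmetric] scaleC_scaleC mult.commute)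

lemma bounded_linear_scaleC_right: "bounded_linear (\<lambda>x::'a::complex_banach. c *\<^sub>C x)"
  by (rule bounded_linear_intro[where K = "cmod c"])
     (simp_all add: scaleC_add_right scaleC_scaleR norm_scaleC)

instantiation complex :: complex_banach
begin

definition scaleC_complex :: "complex \<Rightarrow> complex \<Rightarrow> complex"
  where "scaleC_complex c z = c * z"

instance
  by standard (simp_all add: scaleC_complex_def algebra_simps norm_mult scaleR_conv_of_real)

end

text \<open>Real-linear bounded operators into a complex Banach space form a complex Banach space under
  pointwise scaling; the complex-linear ones are the subspace \<open>clinear_ops\<close>, which for equal domain
  and codomain is the space of bounded operators on a complex Banach space, with its operator
  norm.\<close>

instantiation blinfun :: (real_normed_vector, complex_banach) complex_banach
begin

lift_definition scaleC_blinfun :: "complex \<Rightarrow> 'a \<Rightarrow>\<^sub>L 'b \<Rightarrow> 'a \<Rightarrow>\<^sub>L 'b"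
  is "\<lambda>c f x. c *\<^sub>C f x"
  by (rule bounded_linear_compose[OF bounded_linear_scaleC_right])

instance
proof
  fix c d :: complex and r :: real and f g :: "'a \<Rightarrow>\<^sub>L 'b"
  have le: "norm (c *\<^sub>C f) \<le> cmod c * norm f" for c and f :: "'a \<Rightarrow>\<^sub>L 'b"
  proof (rule norm_blinfun_bound)
    fix x
    show "norm (blinfun_apply (c *\<^sub>C f) x) \<le> cmod c * norm f * norm x"
      using mult_left_mono[OF norm_blinfun[of f x], of "cmod c"]
      by (simp add: scaleC_blinfun.rep_eq norm_scaleC mult.assoc)
  qed simp
  show add: "c *\<^sub>C (f + g) = c *\<^sub>C f + c *\<^sub>C g"
    by (rule blinfun_eqI) (simp add: scaleC_blinfun.rep_eq plus_blinfun.rep_eq scaleC_add_right)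
  show "(c + d) *\<^sub>C f = c *\<^sub>C f + d *\<^sub>C f"
    by (rule blinfun_eqI) (simp add: scaleC_blinfun.rep_eq plus_blinfun.rep_eq scaleC_add_left)
  show assoc: "c *\<^sub>C d *\<^sub>C f = (c * d) *\<^sub>C f" for c d and f :: "'a \<Rightarrow>\<^sub>L 'b"
    by (rule blinfun_eqI) (simp add: scaleC_blinfun.rep_eq scaleC_scaleC)
  show real: "of_real r *\<^sub>C f = r *\<^sub>R f" for r
    by (rule blinfun_eqI) (simp add: scaleC_blinfun.rep_eq scaleR_blinfun.rep_eq scaleC_of_real)
  show "norm (c *\<^sub>C f) = cmod c * norm f"
  proof (cases "c = 0")
    case True
    then show ?thesis using real[of 0] by simp
  next
    case False
    have "f = inverse c *\<^sub>C c *\<^sub>C f"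
      using False real[of 1] by (simp add: assoc)
    then have "norm f \<le> cmod (inverse c) * norm (c *\<^sub>C f)"
      using le[of "inverse c" "c *\<^sub>C f"] by simp
    then have "cmod c * norm f \<le> norm (c *\<^sub>C f)"
      using False by (simp add: norm_inverse norm_divide field_simps)
    with le[of c f] show ?thesis by simp
  qed
qed

end

definition clinear_ops :: "('a::complex_banach \<Rightarrow>\<^sub>L 'b::complex_banach) set"
  where "clinear_ops = {B. \<forall>c x. blinfun_apply B (c *\<^sub>C x) = c *\<^sub>C blinfun_apply B x}"

text \<open>A not necessarily everywhere defined operator is identified with its graph; the inverse of an
  operator is then \<open>converse\<close>, and the composition ``first \<open>A\<close>, then \<open>B\<close>'' with its natural domain
  is \<open>A O B\<close>.\<close>

type_synonym 'a lop = "('a \<times> 'a) set"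

definition graph_of :: "('a::complex_banach \<Rightarrow>\<^sub>L 'a) \<Rightarrow> 'a lop"
  where "graph_of B = {(x, blinfun_apply B x) |x. True}"

definition linear_operator :: "'a::complex_banach lop \<Rightarrow> bool"
  where "linear_operator A \<longleftrightarrow>
    (0, 0) \<in> A \<and>
    (\<forall>x y x' y'. (x, y) \<in> A \<and> (x', y') \<in> A \<longrightarrow> (x + x', y + y') \<in> A) \<and>
    (\<forall>c x y. (x, y) \<in> A \<longrightarrow> (c *\<^sub>C x, c *\<^sub>C y) \<in> A) \<and>
    single_valued A"

definition injective_operator :: "'a::complex_banach lop \<Rightarrow> bool"
  where "injective_operator A \<longleftrightarrow> (\<forall>x. (x, 0) \<in> A \<longrightarrow> x = 0)"

definition neg_op :: "'a::complex_banach lop \<Rightarrow> 'a lop"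
  where "neg_op A = {(x, - y) |x y. (x, y) \<in> A}"

definition shift_op :: "complex \<Rightarrow> 'a::complex_banach lop \<Rightarrow> 'a lop"
  where "shift_op c A = {(x, c *\<^sub>C x + y) |x y. (x, y) \<in> A}"

definition is_resolvent :: "'a::complex_banach lop \<Rightarrow> complex \<Rightarrow> ('a \<Rightarrow>\<^sub>L 'a) \<Rightarrow> bool"
  where "is_resolvent A l R \<longleftrightarrow> R \<in> clinear_ops \<and> graph_of R = (shift_op l (neg_op A))\<inverse>"

definition resolvent_set :: "'a::complex_banach lop \<Rightarrow> complex set"
  where "resolvent_set A = {l. \<exists>R. is_resolvent A l R}"

definition resolvent :: "'a::complex_banach lop \<Rightarrow> complex \<Rightarrow> ('a \<Rightarrow>\<^sub>L 'a)"
  where "resolvent A l = (THE R. is_resolvent A l R)"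

definition op_spectrum :: "'a::complex_banach lop \<Rightarrow> complex set"
  where "op_spectrum A = - resolvent_set A"

lemma is_resolvent_resolvent:
  assumes "l \<in> resolvent_set A"
  shows "is_resolvent A l (resolvent A l)"
proof -
  obtain R where R: "is_resolvent A l R"
    using assms by (auto simp: resolvent_set_def)
  have "R' = R" if "is_resolvent A l R'" for R'
  proof (rule blinfun_eqI)
    fix x
    have "graph_of R' = graph_of R" using R that by (simp add: is_resolvent_def)
    moreover have "(x, blinfun_apply R' x) \<in> graph_of R'" by (simp add: graph_of_def)
    ultimately show "blinfun_apply R' x = blinfun_apply R x" by (auto simp: graph_of_def)
  qed
  with R show ?thesis unfolding resolvent_def by (rule theI)
qed

text \<open>The open sector contains the positive half-line, as it has to for holomorphic functions on it
  and for the contours below; the sector with \<open>0 < \<bar>Arg z\<bar> < \<phi>\<close> has the same closure. Here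
  \<open>Arg\<close> takes values in \<open>{-pi<..pi}\<close>, so that \<open>sector pi\<close> is the plane slit along
  \<open>{..0}\<close>.\<close>

definition sector :: "real \<Rightarrow> complex set"
  where "sector \<phi> = {z. z \<noteq> 0 \<and> \<bar>Arg z\<bar> < \<phi>}"

definition sectorial_of_angle :: "real \<Rightarrow> 'a::complex_banach lop \<Rightarrow> bool"
  where "sectorial_of_angle \<omega> A \<longleftrightarrow>
    linear_operator A \<and> 0 < \<omega> \<and> \<omega> < pi \<and>
    op_spectrum A \<subseteq> closure (sector \<omega>) \<and>
    (\<forall>\<omega>'. \<omega> < \<omega>' \<and> \<omega>' < pi \<longrightarrow>
      bounded ((\<lambda>l. l *\<^sub>C resolvent A l) ` (- closure (sector \<omega>'))))"

definition sectorial :: "'a::complex_banach lop \<Rightarrow> bool"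
  where "sectorial A \<longleftrightarrow> (\<exists>\<omega>. sectorial_of_angle \<omega> A)"

definition H0_infty :: "real \<Rightarrow> (complex \<Rightarrow> complex) set"
  where "H0_infty \<phi> = {f. f holomorphic_on sector \<phi> \<and>
    (\<exists>C s. s > 0 \<and>
      (\<forall>z\<in>sector \<phi>. cmod (f z) \<le> C * min (cmod z powr s) (cmod z powr (- s))))}"

text \<open>\<open>1/(2\<pi>i) \<integral> f(z) (z - A)\<^sup>-\<^sup>1 dz\<close> over the boundary of \<open>sector \<theta>\<close>, oriented with the sector on
  the left: outwards along \<open>arg z = - \<theta>\<close>, inwards along \<open>arg z = \<theta>\<close>. The
  integrands are norm-continuous and absolutely integrable; Bochner's \<open>integral\<^sup>L\<close> is not available
  because the space of operators is not second countable.\<close>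

definition sector_integral ::
    "'a::complex_banach lop \<Rightarrow> real \<Rightarrow> (complex \<Rightarrow> complex) \<Rightarrow> ('a \<Rightarrow>\<^sub>L 'a)"
  where "sector_integral A \<theta> f =
    (1 / (2 * of_real pi * \<i>)) *\<^sub>C
      (integral {0<..} (\<lambda>r. (f (rcis r (- \<theta>)) * cis (- \<theta>)) *\<^sub>C resolvent A (rcis r (- \<theta>)))
       - integral {0<..} (\<lambda>r. (f (rcis r \<theta>) * cis \<theta>) *\<^sub>C resolvent A (rcis r \<theta>)))"

text \<open>The primary calculus, defined for functions of the form \<open>f z = g z + c / (1 + z) + d\<close> on
  \<open>sector \<phi>\<close> with \<open>g \<in> H0_infty \<phi>\<close>:
  \<open>f(A) = g(A) + c (1 + A)\<^sup>-\<^sup>1 + d\<close>, where \<open>(1 + A)\<^sup>-\<^sup>1 = - resolvent A (- 1)\<close>. The value does not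
  depend on the choice of \<open>\<omega>\<close> and \<open>\<theta>\<close>.\<close>

definition primary_calculus ::
    "'a::complex_banach lop \<Rightarrow> real \<Rightarrow> (complex \<Rightarrow> complex) \<Rightarrow> ('a \<Rightarrow>\<^sub>L 'a) \<Rightarrow> bool"
  where "primary_calculus A \<phi> f U \<longleftrightarrow>
    (\<exists>\<omega> \<theta> g c d. sectorial_of_angle \<omega> A \<and> \<omega> < \<theta> \<and> \<theta> < \<phi> \<and> \<phi> \<le> pi \<and>
      g \<in> H0_infty \<phi> \<and> (\<forall>z\<in>sector \<phi>. f z = g z + c / (1 + z) + d) \<and>
      U = sector_integral A \<theta> g - c *\<^sub>C resolvent A (- 1) + d *\<^sub>C id_blinfun)"

text \<open>The extended calculus \<open>f(A) = e(A)\<^sup>-\<^sup>1 (e f)(A)\<close>, where \<open>e\<close> is a regulariser of \<open>f\<close>, that is,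
  \<open>e\<close> and \<open>e f\<close> belong to the primary calculus and \<open>e(A)\<close> is injective. The
  operator does not depend on the regulariser, so the union over all of them is the graph obtained
  from any one of them; it is empty if there is no regulariser.\<close>

definition functional_calculus :: "'a::complex_banach lop \<Rightarrow> (complex \<Rightarrow> complex) \<Rightarrow> 'a lop"
  where "functional_calculus A f =
    {(x, y). \<exists>\<phi> e U V. f holomorphic_on sector \<phi> \<and>
       primary_calculus A \<phi> e U \<and> inj (blinfun_apply U) \<and>
       primary_calculus A \<phi> (\<lambda>z. e z * f z) V \<and>
       blinfun_apply U y = blinfun_apply V x}"

definition frac_power :: "'a::complex_banach lop \<Rightarrow> real \<Rightarrow> 'a lop"
  where "frac_power A s = functional_calculus A (\<lambda>z. z powr of_real s)"

text \<open>Semigroups and the functions \<open>S\<close> below are only relevant on \<open>{0..}\<close> and \<open>{0<..}\<close>; their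
  values elsewhere are unconstrained.\<close>

definition C0_semigroup :: "(real \<Rightarrow> 'a::complex_banach \<Rightarrow>\<^sub>L 'a) \<Rightarrow> bool"
  where "C0_semigroup T \<longleftrightarrow>
    (\<forall>t\<ge>0. T t \<in> clinear_ops) \<and>
    T 0 = id_blinfun \<and>
    (\<forall>s\<ge>0. \<forall>t\<ge>0. T (s + t) = T s o\<^sub>L T t) \<and>
    (\<forall>x. ((\<lambda>t. blinfun_apply (T t) x) \<longlongrightarrow> x) (at_right 0))"

definition generator :: "(real \<Rightarrow> 'a::complex_banach \<Rightarrow>\<^sub>L 'a) \<Rightarrow> 'a lop"
  where "generator T =
    {(x, y). ((\<lambda>t. (1 / t) *\<^sub>R (blinfun_apply (T t) x - x)) \<longlongrightarrow> y) (at_right 0)}"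

definition banach_holomorphic_on :: "(complex \<Rightarrow> 'b::complex_banach) \<Rightarrow> complex set \<Rightarrow> bool"
  where "banach_holomorphic_on F G \<longleftrightarrow>
    (\<forall>z\<in>G. \<exists>D. (F has_derivative (\<lambda>h. h *\<^sub>C D)) (at z within G))"

definition exp_bounded_analytic :: "(real \<Rightarrow> 'a::complex_banach \<Rightarrow>\<^sub>L 'a) set"
  where "exp_bounded_analytic =
    {S. \<exists>\<theta> F. 0 < \<theta> \<and> \<theta> \<le> pi \<and>
       (\<forall>z\<in>sector \<theta>. F z \<in> clinear_ops) \<and>
       banach_holomorphic_on F (sector \<theta>) \<and>
       (\<forall>t>0. F (of_real t) = S t) \<and>
       (\<exists>M w. \<forall>z\<in>sector \<theta>. norm (F z) \<le> M * exp (w * cmod z))}"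

text \<open>Valued in the extended reals, since the infimum can be \<open>- \<infinity>\<close>.\<close>

definition nonanalytic_growth_bound :: "(real \<Rightarrow> 'a::complex_banach \<Rightarrow>\<^sub>L 'a) \<Rightarrow> ereal"
  where "nonanalytic_growth_bound T =
    Inf (ereal ` {w. \<exists>S\<in>exp_bounded_analytic.
      bdd_above ((\<lambda>t. exp (- t * w) * norm (T t - S t)) ` {0<..})})"

definition asymptotically_analytic :: "(real \<Rightarrow> 'a::complex_banach \<Rightarrow>\<^sub>L 'a) \<Rightarrow> bool"
  where "asymptotically_analytic T \<longleftrightarrow> nonanalytic_growth_bound T < 0"

end

theory Submission
  imports Defs "HOL-Complex_Analysis.Complex_Analysis"
begin

text \<open>
  Write \<open>T = S + (T - S)\<close> with \<open>S\<close> analytic on a sector and \<open>T - S\<close> exponentially decaying. Cauchy's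
  formula for \<open>S\<close> on the boundary of a sector, with the factor \<open>exp (p (t - z))\<close>, expresses \<open>S(t)\<close> by two
  functions of \<open>p\<close> whose derivatives are \<open>- exp (p t)\<close> times Laplace transforms of \<open>S\<close> along the two rays.
  Since \<open>(p + A)\<^sup>-\<^sup>1\<close> is the Laplace transform of \<open>T\<close>, up to exponentially small terms \<open>T(t)\<close> is
  \<open>1 / (2 \<pi> \<i>)\<close> times the increment of a primitive of \<open>exp (z t) (z + A)\<^sup>-\<^sup>1\<close> between two conjugate points
  of the left half-plane; no convergence at infinity is involved. By the Neumann series the resolvent
  extends to the left of the curve \<open>Re z = - c |Im z|\<^sup>\<alpha> log(2 + 1 / |Im z|)\<^sup>-\<^sup>a\<close>. The path follows this curve down to
  height \<open>1 / (2 t)\<close> and passes to the right of the origin there. On it, \<open>A\<^sup>\<sigma> (1 + A)\<^sup>-\<^sup>\<sigma>\<close> gains a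
  factor \<open>|z|\<^sup>\<sigma>\<close>, which makes the integrand a multiple of \<open>t\<^sup>-\<^sup>m L(t) / |Im z|\<close> with
  \<open>m = (\<sigma> + 1) / \<alpha> - 1\<close> and \<open>L(t)\<close> a power of \<open>log (1 + t)\<close>.
\<close>

section \<open>Complex-linear operators and norming functionals\<close>

text \<open>The exponents come from one balance. At height y the curve lies at distance
  \<open>h = c * y^\<alpha> * Lg y^(-a)\<close> from the axis, and the tested operator has size
  \<open>y^(\<sigma> - \<alpha>) * Lg y^a\<close>. Decay in t is bought by
  \<open>exp (- h * t) <= const * (h * t)^(-m)\<close>, and
  \<open>m = (\<sigma> + 1) / \<alpha> - 1\<close> is the exponent for which
  \<open>y^(- \<alpha> * m) * y^(\<sigma> - \<alpha>) = 1 / y\<close>. The hypothesis on \<sigma>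
  says m > 0. The logarithms add up to \<open>Lg y^(a * (m + 1))\<close>, and integrating
  \<open>1 / y\<close> from \<open>1 / (2 * t)\<close> to \<open>1 / 2\<close> costs one further
  logarithm. A second obstacle is that fractional powers are given as graphs with arbitrary
  regularisers, so they cannot be estimated directly. They are compared with explicit Stieltjes
  integrals of resolvents through the relation \<open>represents\<close>, which is multiplicative
  and determines the operator. Operator-valued integrals are treated by applying complex-linear
  functionals, so that the theorems of Cauchy and Fubini are used for scalar functions.\<close>

lemma bounded_bilinear_scaleC: "bounded_bilinear (%c (x::'a::complex_banach). c *\<^sub>C x)"
proof
 fix c c' :: complex and x x' :: 'a and r :: real
 show "(r *\<^sub>R c) *\<^sub>C x = r *\<^sub>R c *\<^sub>C x"
  by (simp add: scaleR_conv_of_real scaleC_scaleC[symmetric] scaleC_of_real)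
 show "\<exists>K. \<forall>c (x::'a). norm (c *\<^sub>C x) <= norm c * norm x * K"
  by (rule exI[of _ 1]) (simp add: norm_scaleC)
qed (simp_all add: scaleC_add_left scaleC_add_right scaleC_scaleR)

lemmas scaleC_zero_left [simp] = bounded_bilinear.zero_left[OF bounded_bilinear_scaleC]
 and scaleC_zero_right [simp] = bounded_bilinear.zero_right[OF bounded_bilinear_scaleC]
 and scaleC_minus_left = bounded_bilinear.minus_left[OF bounded_bilinear_scaleC]
 and scaleC_minus_right = bounded_bilinear.minus_right[OF bounded_bilinear_scaleC]
 and scaleC_diff_left = bounded_bilinear.diff_left[OF bounded_bilinear_scaleC]
 and scaleC_diff_right = bounded_bilinear.diff_right[OF bounded_bilinear_scaleC]
 and continuous_on_scaleC [continuous_intros] =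
  bounded_bilinear.continuous_on[OF bounded_bilinear_scaleC]

lemma scaleC_one [simp]: "1 *\<^sub>C x = (x::'a::complex_banach)"
 using scaleC_of_real[of 1 x] by simp

lemma scaleC_complex_eq [simp]: "(c::complex) *\<^sub>C z = c * z"
 by (simp add: scaleC_complex_def)

lemmas scaleC_simps = scaleC_add_left scaleC_add_right scaleC_diff_left scaleC_diff_right
 scaleC_minus_left scaleC_minus_right scaleC_scaleC scaleC_blinfun.rep_eq

lemma clinear_opsD: "B \<in> clinear_ops ==> B (c *\<^sub>C x) = c *\<^sub>C B x"
 by (simp add: clinear_ops_def)

lemma clinear_ops_intros:
 "id_blinfun \<in> clinear_ops" "0 \<in> clinear_ops"
 "B \<in> clinear_ops ==> B' \<in> clinear_ops ==> B + B' \<in> clinear_ops"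
 "B \<in> clinear_ops ==> B' \<in> clinear_ops ==> B - B' \<in> clinear_ops"
 "B \<in> clinear_ops ==> - B \<in> clinear_ops"
 "B \<in> clinear_ops ==> c *\<^sub>C B \<in> clinear_ops"
 by (simp_all add: clinear_ops_def plus_blinfun.rep_eq minus_blinfun.rep_eq uminus_blinfun.rep_eq
   scaleC_blinfun.rep_eq scaleC_simps mult.commute)

lemma clinear_ops_compose:
 "B \<in> clinear_ops ==> B' \<in> clinear_ops ==> B o\<^sub>L B' \<in> clinear_ops"
 by (simp add: clinear_ops_def)

lemma scaleC_compose_left: "(c *\<^sub>C f) o\<^sub>L g = c *\<^sub>C (f o\<^sub>L g)"
 by (rule blinfun_eqI) (simp add: scaleC_blinfun.rep_eq)

lemma scaleC_compose_right: "f \<in> clinear_ops ==> f o\<^sub>L (c *\<^sub>C g) = c *\<^sub>C (f o\<^sub>L g)"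
 by (rule blinfun_eqI) (simp add: scaleC_blinfun.rep_eq clinear_opsD)

lemmas compose_diff_left = bounded_bilinear.diff_left[OF bounded_bilinear_blinfun_compose]
 and compose_diff_right = bounded_bilinear.diff_right[OF bounded_bilinear_blinfun_compose]
 and compose_add_left = bounded_bilinear.add_left[OF bounded_bilinear_blinfun_compose]
 and compose_add_right = bounded_bilinear.add_right[OF bounded_bilinear_blinfun_compose]
 and compose_minus_left = bounded_bilinear.minus_left[OF bounded_bilinear_blinfun_compose]
 and compose_minus_right = bounded_bilinear.minus_right[OF bounded_bilinear_blinfun_compose]
 and compose_scaleR_left = bounded_bilinear.scaleR_left[OF bounded_bilinear_blinfun_compose]
 and compose_scaleR_right = bounded_bilinear.scaleR_right[OF bounded_bilinear_blinfun_compose]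

lemma compose_id [simp]: "id_blinfun o\<^sub>L f = f" "f o\<^sub>L id_blinfun = f"
 by (rule blinfun_eqI; simp)+

text \<open>The defect \<open>B (c *\<^sub>C x) - c *\<^sub>C B x\<close> is bounded and real-linear
  in B, hence commutes with the integral.\<close>

lemma integral_clinear_ops:
 fixes F :: "real => 'a::complex_banach \<Rightarrow>\<^sub>L 'b::complex_banach"
 assumes "!!r. r \<in> I ==> F r \<in> clinear_ops"
 shows "integral I F \<in> clinear_ops"
proof (cases "F integrable_on I")
 case True
 have "blinfun_apply (integral I F) (c *\<^sub>C x) - c *\<^sub>C blinfun_apply (integral I F) x = 0" for c x
 proof -
  let ?E = "%B. blinfun_apply B (c *\<^sub>C x) - c *\<^sub>C blinfun_apply B x"
  have "bounded_linear ?E"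
   by (intro bounded_linear_sub blinfun.bounded_linear_left
     bounded_linear_compose[OF bounded_linear_scaleC_right])
  then have "integral I (?E \<circ> F) = ?E (integral I F)"
   by (rule integral_linear[OF True])
  then have "?E (integral I F) = integral I (%r. ?E (F r))"
   by (simp add: o_def)
  also have "\<dots> = integral I (%r. 0)"
   using assms by (intro integral_cong) (simp add: clinear_opsD)
  finally show ?thesis by simp
 qed
 then show ?thesis by (simp add: clinear_ops_def)
\<comment> \<open>Without integrability the integral is 0 by convention, which is
  complex-linear.\<close>
qed (simp add: not_integrable_integral clinear_ops_intros)

text \<open>Partial real-linear functionals are encoded by their graphs, so that extension is
  inclusion and Zorn's lemma applies to sets. Being single-valued is a consequence: a vertical
  vector \<open>(0, r)\<close> with r > 0 would violate domination.\<close>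

definition dominated_graph :: "('a::real_normed_vector \<times> real) set => bool" where
 "dominated_graph g \<longleftrightarrow> subspace g \<and> (\<forall>(x,r)\<in>g. r <= norm x)"

lemma dominated_graph_single_valued:
 assumes g: "dominated_graph g" and "(x,r) \<in> g" "(x,s) \<in> g"
 shows "r = s"
proof -
 have le: "b <= a" if "(x,a) \<in> g" "(x,b) \<in> g" for a b
 proof -
  have "(x,b) - (x,a) \<in> g"
   using g that unfolding dominated_graph_def by (blast intro: subspace_diff)
  then have "(0, b - a) \<in> g" by simp
  then show ?thesis using g unfolding dominated_graph_def by fastforce
 qed
 show ?thesis using le assms(2,3) by (simp add: antisym)
qed

text \<open>The one-dimensional step of Hahn-Banach. A value s at y is admissible when it lies
  between all \<open>r - norm (x - y)\<close> and all \<open>norm (x' + y) - r'\<close>;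
  \<open>key\<close> is the compatibility of the two families. The cases c > 0 and c < 0 rescale to
  these two bounds.\<close>

lemma dominated_graph_extend:
 assumes g: "dominated_graph g"
 shows "\<exists>g'. dominated_graph g' \<and> g \<subseteq> g' \<and> (\<exists>r. (y,r) \<in> g')"
proof -
 have sub: "subspace g" and dom: "!!x r. (x,r) \<in> g ==> r <= norm x"
  using g by (auto simp: dominated_graph_def)
 have g0: "(0,0) \<in> g" using subspace_0[OF sub] by (simp add: zero_prod_def)
 have key: "r - norm (x - y) <= norm (x' + y) - r'" if "(x,r) \<in> g" "(x',r') \<in> g" for x r x' r'
 proof -
  have "(x,r) + (x',r') \<in> g" using that sub by (rule_tac subspace_add)
  then have "r + r' <= norm (x + x')" using dom by simp
  also have "\<dots> <= norm (x - y) + norm (x' + y)"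
   using norm_triangle_ineq[of "x - y" "x' + y"] by simp
  finally show ?thesis by linarith
 qed
 define s where "s = (SUP (x,r)\<in>g. r - norm (x - y))"
 have bdd: "bdd_above ((%(x,r). r - norm (x - y)) ` g)"
 proof (rule bdd_aboveI)
  fix q assume "q \<in> (%(x,r). r - norm (x - y)) ` g"
  then obtain x r where "(x,r) \<in> g" "q = r - norm (x - y)" by auto
  then show "q <= norm (0 + y) - 0" using key g0 by blast
 qed
 have lo: "r - norm (x - y) <= s" if "(x,r) \<in> g" for x r
  unfolding s_def using cSUP_upper[OF that bdd] by simp
 have hi: "s <= norm (x' + y) - r'" if "(x',r') \<in> g" for x' r'
  unfolding s_def using g0 key that by (intro cSUP_least) auto
 define g' where "g' = {b + c *\<^sub>R (y, s) |b c. b \<in> g}"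
 have mem: "(z,q) \<in> g' \<longleftrightarrow> (\<exists>x r c. (x,r) \<in> g \<and> z = x + c *\<^sub>R y \<and> q = r + c * s)" for z q
  unfolding g'_def by force
 have "subspace g'"
 proof (rule subspaceI)
  have "(0, 0) \<in> g'" unfolding mem using g0 by (intro exI[of _ 0]) simp
  then show "0 \<in> g'" by (simp add: zero_prod_def)
  fix p p' assume "p \<in> g'" "p' \<in> g'"
  then obtain b c b' c' where "b \<in> g" "b' \<in> g" "p = b + c *\<^sub>R (y,s)" "p' = b' + c' *\<^sub>R (y,s)"
   unfolding g'_def by blast
  then show "p + p' \<in> g'" unfolding g'_def
   using subspace_add[OF sub, of b b']
   by (intro CollectI exI[of _ "b + b'"] exI[of _ "c + c'"]) (simp add: scaleR_add_left algebra_simps)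
 next
  fix p k assume "p \<in> g'"
  then obtain b c where "b \<in> g" "p = b + c *\<^sub>R (y,s)"
   unfolding g'_def by blast
  then show "k *\<^sub>R p \<in> g'" unfolding g'_def
   using subspace_scale[OF sub, of b k]
   by (intro CollectI exI[of _ "k *\<^sub>R b"] exI[of _ "k * c"]) (simp add: scaleR_add_right)
 qed
 moreover have "q <= norm z" if zq: "(z,q) \<in> g'" for z q
 proof -
  obtain x r c where *: "(x,r) \<in> g" "z = x + c *\<^sub>R y" "q = r + c * s" using zq mem by auto
  have sc: "(k *\<^sub>R x, k * r) \<in> g" for k using subspace_scale[OF sub *(1), of k] by simp
  consider "c = 0" | "c > 0" | "c < 0" by linarith
  then show ?thesis
  proof cases
   case 1 then show ?thesis using * dom by simp
  next
   case 2
   have "s <= norm ((1/c) *\<^sub>R x + y) - (1/c) * r" using hi sc by blast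
   then have "c * s <= c * (norm ((1/c) *\<^sub>R x + y) - (1/c) * r)" using 2 by simp
   also have "\<dots> = norm (c *\<^sub>R ((1/c) *\<^sub>R x + y)) - r" using 2 by (simp add: right_diff_distrib)
   finally show ?thesis using 2 * by (simp add: scaleR_add_right del: norm_scaleR)
  next
   case 3
   have "(-1/c) * r - norm ((-1/c) *\<^sub>R x - y) <= s" using lo sc by blast
   then have "(-c) * ((-1/c) * r - norm ((-1/c) *\<^sub>R x - y)) <= (-c) * s" using 3 by (intro mult_left_mono) auto
   moreover have "(-c) *\<^sub>R ((-1/c) *\<^sub>R x - y) = z"
    using 3 * by (simp add: scaleR_diff_right)
   then have "(-c) * norm ((-1/c) *\<^sub>R x - y) = norm z"
    using norm_scaleR[of "-c" "(-1/c) *\<^sub>R x - y"] 3 by simp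
   moreover have "(-c) * ((-1/c) * r - norm ((-1/c) *\<^sub>R x - y)) = r - (-c) * norm ((-1/c) *\<^sub>R x - y)"
    using 3 by (simp add: algebra_simps)
   ultimately have "r - norm z <= (-c) * s" by metis
   then show ?thesis using * by simp
  qed
 qed
 moreover have "p \<in> g'" if "p \<in> g" for p
  unfolding g'_def using that by (intro CollectI exI[of _ p] exI[of _ 0]) (simp add: zero_prod_def)
 then have "g \<subseteq> g'" by blast
 moreover have "(y,s) \<in> g'" using g0 mem by (metis add_0 mult_1 scaleR_one)
 ultimately show ?thesis unfolding dominated_graph_def by blast
qed

text \<open>Zorn's lemma on the dominated graphs that contain the line through \<open>x0\<close>; by
  \<open>dominated_graph_extend\<close> a maximal graph is total.\<close>

lemma norming_real_functional:
 fixes x0 :: "'a::real_normed_vector"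
 obtains f where "linear f" "!!x. f x <= norm x" "f x0 = norm x0"
proof -
 define g0 where "g0 = range (%c. (c *\<^sub>R x0, c * norm x0))"
 have lin: "linear (%c. (c *\<^sub>R x0, c * norm x0))"
  by (rule linearI) (auto simp: algebra_simps)
 have g0: "dominated_graph g0"
  unfolding dominated_graph_def g0_def
  by (auto simp: subspace_UNIV intro!: linear_subspace_image lin mult_right_mono)
 define \<G> where "\<G> = {g. dominated_graph g \<and> g0 \<subseteq> g}"
 have "\<exists>M\<in>\<G>. \<forall>X\<in>\<G>. M \<subseteq> X --> X = M"
 proof (rule subset_Zorn_nonempty)
  show "\<G> ~= {}" using g0 by (auto simp: \<G>_def)
  fix \<C> assume ne: "\<C> ~= {}" and ch: "subset.chain \<G> \<C>"
  then have sub: "\<C> \<subseteq> \<G>" and lin: "!!a b. a \<in> \<C> ==> b \<in> \<C> ==> a \<subseteq> b \<or> b \<subseteq> a"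
   by (auto simp: subset.chain_def subset_chain_def)
  have ss: "subspace g" if "g \<in> \<C>" for g using sub that by (auto simp: \<G>_def dominated_graph_def)
  have "subspace (\<Union>\<C>)"
  proof (rule subspaceI)
   show "0 \<in> \<Union>\<C>" using ne ss by (meson Union_iff ex_in_conv subspace_0)
   show "c *\<^sub>R p \<in> \<Union>\<C>" if "p \<in> \<Union>\<C>" for p c using that ss by (meson Union_iff subspace_scale)
   fix p q assume "p \<in> \<Union>\<C>" "q \<in> \<Union>\<C>"
   then obtain a b where "p \<in> a" "a \<in> \<C>" "q \<in> b" "b \<in> \<C>" by auto
   then show "p + q \<in> \<Union>\<C>" using lin[of a b] ss by (meson Union_iff subspace_add subsetD)
  qed
  have b: "r <= norm x" if "(x,r) \<in> \<Union>\<C>" for x r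
   using sub that unfolding \<G>_def dominated_graph_def by blast
  have "case p of (x,r) => r <= norm x" if "p \<in> \<Union>\<C>" for p
   using b[of "fst p" "snd p"] that by (simp add: case_prod_beta del: Union_iff)
  then have "dominated_graph (\<Union>\<C>)"
   unfolding dominated_graph_def using \<open>subspace (\<Union>\<C>)\<close> by blast
  moreover have "g0 \<subseteq> \<Union>\<C>" using ne sub unfolding \<G>_def by blast
  ultimately show "\<Union>\<C> \<in> \<G>" unfolding \<G>_def by (intro CollectI conjI)
 qed
 then obtain M where M': "M \<in> \<G>" "\<forall>X\<in>\<G>. M \<subseteq> X --> X = M" by (elim bexE)
 then have M: "dominated_graph M" "g0 \<subseteq> M" by (simp_all add: \<G>_def)
 have max: "X = M" if "dominated_graph X" "M \<subseteq> X" for X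
  using M'(2)[rule_format, of X] that M(2) by (simp add: \<G>_def)
 have ex: "\<exists>r. (y,r) \<in> M" for y
  using dominated_graph_extend[OF M(1), of y] max by metis
 define f where "f y = (THE r. (y,r) \<in> M)" for y
 have f: "(y,r) \<in> M ==> f y = r" for y r
  unfolding f_def by (rule the_equality) (auto dest: dominated_graph_single_valued[OF M(1)])
 have fM: "(y, f y) \<in> M" for y using ex f by metis
 have sub: "subspace M" using M by (simp add: dominated_graph_def)
 show thesis
 proof
  show "linear f"
  proof (rule linearI)
   show "f (x + y) = f x + f y" for x y
    using subspace_add[OF sub fM[of x] fM[of y]] by (intro f) simp
   show "f (c *\<^sub>R x) = c *\<^sub>R f x" for c x
    using subspace_scale[OF sub fM[of x], of c] by (intro f) simp
  qed
  show "f x <= norm x" for x using fM M(1) by (auto simp: dominated_graph_def)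
  have "(1 *\<^sub>R x0, 1 * norm x0) \<in> g0" unfolding g0_def by blast
  then show "f x0 = norm x0" using M by (intro f) auto
 qed
qed

text \<open>The complexification \<open>f x - \<i> * f (\<i> x)\<close> of the real functional.
  Bounding real and imaginary part separately gives the constant 2.\<close>

lemma norming_functional:
 fixes x0 :: "'a::complex_banach"
 obtains \<phi> :: "'a \<Rightarrow>\<^sub>L complex"
 where "\<phi> \<in> clinear_ops" "norm \<phi> <= 2" "Re (\<phi> x0) = norm x0"
proof -
 obtain f where f: "linear f" "!!x::'a. f x <= norm x" "f x0 = norm x0"
  using norming_real_functional by blast
 have abs: "\<bar>f x\<bar> <= norm x" for x
  using f(2)[of x] f(2)[of "-x"] linear_neg[OF f(1), of x] by auto
 define F where "F x = Complex (f x) (- f (\<i> *\<^sub>C x))" for x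
 have F: "bounded_linear F"
 proof (rule bounded_linear_intro[where K=2])
  show "F (x + y) = F x + F y" for x y
   by (simp add: F_def scaleC_add_right linear_add[OF f(1)] complex_eq_iff)
  show "F (r *\<^sub>R x) = r *\<^sub>R F x" for r x
   by (simp add: F_def scaleC_scaleR linear_scale[OF f(1)] complex_eq_iff)
  show "norm (F x) <= norm x * 2" for x
  proof -
   have "norm (F x) <= \<bar>f x\<bar> + \<bar>f (\<i> *\<^sub>C x)\<bar>" using cmod_le[of "F x"] by (simp add: F_def)
   also have "\<dots> <= norm x + norm (\<i> *\<^sub>C x)" by (intro add_mono abs)
   finally show ?thesis by (simp add: norm_scaleC)
  qed
 qed
 have cl: "F (c *\<^sub>C x) = c * F x" for c x
 proof -
  have 1: "c *\<^sub>C x = Re c *\<^sub>R x + Im c *\<^sub>R (\<i> *\<^sub>C x)"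
  proof -
   have "c = of_real (Re c) + of_real (Im c) * \<i>" by (simp add: complex_eq_iff)
   then have "c *\<^sub>C x = (of_real (Re c) + of_real (Im c) * \<i>) *\<^sub>C x" by simp
   then show ?thesis by (simp only: scaleC_add_left scaleC_of_real flip: scaleC_scaleC)
  qed
  have 2: "\<i> *\<^sub>C c *\<^sub>C x = Re c *\<^sub>R (\<i> *\<^sub>C x) - Im c *\<^sub>R x"
   unfolding 1 scaleC_add_right scaleC_scaleR scaleC_scaleC
   by (simp add: scaleC_minus_left)
  show ?thesis unfolding F_def 2 unfolding 1
   by (simp add: complex_eq_iff linear_add[OF f(1)] linear_diff[OF f(1)] linear_scale[OF f(1)])
 qed
 show thesis
 proof
  have "norm (F x) <= 2 * norm x" for x
  proof -
   have "norm (F x) <= \<bar>f x\<bar> + \<bar>f (\<i> *\<^sub>C x)\<bar>" using cmod_le[of "F x"] by (simp add: F_def)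
   also have "\<dots> <= norm x + norm (\<i> *\<^sub>C x)" by (intro add_mono abs)
   finally show ?thesis by (simp add: norm_scaleC)
  qed
  then show "norm (Blinfun F) <= 2"
   by (intro norm_blinfun_bound) (auto simp: bounded_linear_Blinfun_apply[OF F])
  show "Blinfun F \<in> clinear_ops"
   by (simp add: clinear_ops_def bounded_linear_Blinfun_apply[OF F] cl)
  show "Re (Blinfun F x0) = norm x0"
   by (simp add: bounded_linear_Blinfun_apply[OF F] F_def f(3))
 qed
qed

text \<open>Applied to a space of operators, this reduces identities between operator-valued
  integrals to identities between scalar integrals.\<close>

lemma functional_eqI:
 fixes x y :: "'a::complex_banach"
 assumes "!!\<phi> :: 'a \<Rightarrow>\<^sub>L complex. \<phi> \<in> clinear_ops ==> \<phi> x = \<phi> y"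
 shows "x = y"
proof -
 obtain \<phi> :: "'a \<Rightarrow>\<^sub>L complex" where "\<phi> \<in> clinear_ops" "Re (\<phi> (x - y)) = norm (x - y)"
  using norming_functional by blast
 then show ?thesis using assms by (simp add: blinfun.diff_right)
qed

section \<open>Resolvents and sectors\<close>

lemma compose_assoc: "(f o\<^sub>L g) o\<^sub>L h = f o\<^sub>L (g o\<^sub>L h)"
 by (rule blinfun_eqI) simp

lemma linear_operatorD:
 assumes "linear_operator A"
 shows "(x,y) \<in> A ==> (x',y') \<in> A ==> (x + x', y + y') \<in> A"
  "(x,y) \<in> A ==> (c *\<^sub>C x, c *\<^sub>C y) \<in> A"
  "(x,y) \<in> A ==> (x',y') \<in> A ==> (x - x', y - y') \<in> A"
  "(x,y) \<in> A ==> (x,y') \<in> A ==> y = y'"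
proof -
 show add: "(x,y) \<in> A ==> (x',y') \<in> A ==> (x + x', y + y') \<in> A" for x y x' y'
  using assms by (simp add: linear_operator_def)
 show sc: "(x,y) \<in> A ==> (c *\<^sub>C x, c *\<^sub>C y) \<in> A" for c x y
  using assms by (simp add: linear_operator_def)
 show "(x,y) \<in> A ==> (x',y') \<in> A ==> (x - x', y - y') \<in> A"
  using add[OF _ sc[of x' y' "-1"]] by (simp add: scaleC_minus_left)
 show "(x,y) \<in> A ==> (x,y') \<in> A ==> y = y'"
  using assms unfolding linear_operator_def single_valued_def by blast
qed

lemma mem_shift_neg:
 "(u, w) \<in> shift_op z (neg_op A) \<longleftrightarrow> (\<exists>v. (u,v) \<in> A \<and> w = z *\<^sub>C u - v)"
 unfolding shift_op_def neg_op_def by auto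

lemma resolvent_clinear: "z \<in> resolvent_set A ==> resolvent A z \<in> clinear_ops"
 using is_resolvent_resolvent by (auto simp: is_resolvent_def)

lemma resolvent_eq_iff:
 assumes "z \<in> resolvent_set A"
 shows "resolvent A z x = u \<longleftrightarrow> (u, z *\<^sub>C u - x) \<in> A"
proof -
 have "graph_of (resolvent A z) = (shift_op z (neg_op A))\<inverse>"
  using is_resolvent_resolvent[OF assms] by (simp add: is_resolvent_def)
 then have "(x,u) \<in> graph_of (resolvent A z) \<longleftrightarrow> (u,x) \<in> shift_op z (neg_op A)" by auto
 moreover have "(x,u) \<in> graph_of (resolvent A z) \<longleftrightarrow> resolvent A z x = u"
  by (auto simp: graph_of_def)
 moreover have "(\<exists>v. (u,v) \<in> A \<and> x = z *\<^sub>C u - v) \<longleftrightarrow> (u, z *\<^sub>C u - x) \<in> A"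
  by (metis diff_diff_eq2 diff_add_cancel add_diff_cancel_left' add.commute)
 ultimately show ?thesis by (simp add: mem_shift_neg)
qed

lemma resolvent_in:
 "z \<in> resolvent_set A ==>
  (resolvent A z x, z *\<^sub>C resolvent A z x - x) \<in> A"
 using resolvent_eq_iff by blast

lemma resolvent_left:
 "z \<in> resolvent_set A ==> (u,v) \<in> A ==> resolvent A z (z *\<^sub>C u - v) = u"
 by (simp add: resolvent_eq_iff)

lemma resolvent_setI:
 assumes "R \<in> clinear_ops" "linear_operator A"
  and "!!x. (R x, z *\<^sub>C R x - x) \<in> A"
  and "!!u v. (u,v) \<in> A ==> R (z *\<^sub>C u - v) = u"
 shows "z \<in> resolvent_set A" "resolvent A z = R"
proof -
 have "graph_of R = (shift_op z (neg_op A))\<inverse>"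
 proof (intro set_eqI)
  fix p :: "'a \<times> 'a"
  obtain x u where p: "p = (x,u)" by fastforce
  have "p \<in> graph_of R \<longleftrightarrow> R x = u" by (auto simp: p graph_of_def)
  also have "\<dots> \<longleftrightarrow> (\<exists>v. (u,v) \<in> A \<and> x = z *\<^sub>C u - v)"
   using assms(3)[of x] assms(4) by force
  also have "\<dots> \<longleftrightarrow> p \<in> (shift_op z (neg_op A))\<inverse>" by (simp add: p mem_shift_neg)
  finally show "p \<in> graph_of R \<longleftrightarrow> p \<in> (shift_op z (neg_op A))\<inverse>" .
 qed
 then have 1: "is_resolvent A z R" using assms(1) by (simp add: is_resolvent_def)
 then show z: "z \<in> resolvent_set A" by (auto simp: resolvent_set_def)
 have "resolvent A z x = R x" for x
  using resolvent_eq_iff[OF z] assms(3) by blast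
 then show "resolvent A z = R" by (rule blinfun_eqI)
qed

lemma resolvent_identity:
 assumes A: "linear_operator A" and a: "a \<in> resolvent_set A" and b: "b \<in> resolvent_set A"
 shows "resolvent A a - resolvent A b = (b - a) *\<^sub>C (resolvent A a o\<^sub>L resolvent A b)"
proof (rule blinfun_eqI)
 fix x
 let ?v = "resolvent A b x"
 have "(?v, b *\<^sub>C ?v - x) \<in> A" by (rule resolvent_in[OF b])
 then have "resolvent A a (a *\<^sub>C ?v - (b *\<^sub>C ?v - x)) = ?v"
  by (rule resolvent_left[OF a])
 then have "resolvent A a (x - (b - a) *\<^sub>C ?v) = ?v"
  by (simp add: scaleC_simps algebra_simps)
 then show "(resolvent A a - resolvent A b) x =
  ((b - a) *\<^sub>C (resolvent A a o\<^sub>L resolvent A b)) x"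
  by (simp add: blinfun.diff_right blinfun.diff_left scaleC_blinfun.rep_eq
    clinear_opsD[OF resolvent_clinear[OF a]] algebra_simps)
qed

lemma resolvent_commute:
 assumes A: "linear_operator A" and a: "a \<in> resolvent_set A" and b: "b \<in> resolvent_set A"
 shows "resolvent A a o\<^sub>L resolvent A b = resolvent A b o\<^sub>L resolvent A a"
proof (cases "a = b")
 case False
 have "(b - a) *\<^sub>C (resolvent A a o\<^sub>L resolvent A b) = (b - a) *\<^sub>C (resolvent A b o\<^sub>L resolvent A a)"
  using resolvent_identity[OF A a b] resolvent_identity[OF A b a]
  by (metis minus_diff_eq scaleC_minus_left)
 then have "(1/(b-a)) *\<^sub>C (b - a) *\<^sub>C (resolvent A a o\<^sub>L resolvent A b) =
  (1/(b-a)) *\<^sub>C (b - a) *\<^sub>C (resolvent A b o\<^sub>L resolvent A a)" by simp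
 then show ?thesis using False by (simp add: scaleC_scaleC)
qed simp

text \<open>\<open>J\<close> is the inverse of 1 - N. Banach's fixed point theorem for
  \<open>y = x + N y\<close> produces it pointwise, and uniqueness of the fixed point makes it
  linear.\<close>

lemma clinear_fixpoint_inverse:
 fixes N :: "'a::complex_banach \<Rightarrow>\<^sub>L 'a"
 assumes N: "N \<in> clinear_ops" and lt: "norm N < 1"
 obtains J where "J \<in> clinear_ops" "!!x. J x = x + N (J x)"
  "!!y. J (y - N y) = y"
proof -
 have contr: "norm (N x) <= norm N * norm x" for x by (rule norm_blinfun)
 have uniq: "u = v" if "u - N u = v - N v" for u v
 proof -
  have "u - v = N (u - v)" using that by (simp add: blinfun.diff_right algebra_simps)
  then have "norm (u - v) <= norm N * norm (u - v)" using contr[of "u - v"] by simp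
  then have "(1 - norm N) * norm (u - v) <= 0" by (simp add: left_diff_distrib)
  moreover have "0 < 1 - norm N" using lt by simp
  ultimately have "norm (u - v) <= 0" by (simp add: mult_le_0_iff)
  then show ?thesis by simp
 qed
 have ex: "\<exists>y. x + N y = y" for x
 proof -
  have "\<exists>!y. y \<in> UNIV \<and> x + N y = y"
  proof (rule Banach_fix[where c="norm N"])
   show "dist (x + N y) (x + N z) <= norm N * dist y z" for y z
    using contr[of "y - z"] by (simp add: dist_norm blinfun.diff_right)
  qed (use lt in \<open>auto simp: complete_UNIV\<close>)
  then show ?thesis by blast
 qed
 define j where "j x = (SOME y. x + N y = y)" for x
 have j: "x + N (j x) = j x" for x unfolding j_def by (rule someI_ex[OF ex])
 have jm: "j x - N (j x) = x" for x using j[of x] by (metis add_diff_cancel_right')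
 have ju: "j x = y" if "y - N y = x" for x y
 proof (rule uniq)
  have "j x - N (j x) = x" using j[of x] by (metis add_diff_cancel_right')
  then show "j x - N (j x) = y - N y" using that by simp
 qed
 have bl: "bounded_linear j"
 proof (rule bounded_linear_intro[where K="1 / (1 - norm N)"])
  show "j (x + y) = j x + j y" for x y
  proof (rule ju)
   show "j x + j y - N (j x + j y) = x + y"
    by (metis add_diff_add blinfun.add_right jm)
  qed
  show "j (r *\<^sub>R x) = r *\<^sub>R j x" for r x
  proof (rule ju)
   show "r *\<^sub>R j x - N (r *\<^sub>R j x) = r *\<^sub>R x"
    by (metis blinfun.scaleR_right scaleR_diff_right jm)
  qed
  show "norm (j x) <= norm x * (1 / (1 - norm N))" for x
  proof -
   have "norm (j x) <= norm x + norm N * norm (j x)"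
    using norm_triangle_ineq[of x "N (j x)"] contr[of "j x"] j[of x] by simp
   then have "(1 - norm N) * norm (j x) <= norm x" by (simp add: left_diff_distrib)
   then show ?thesis using lt by (simp add: field_simps)
  qed
 qed
 show thesis
 proof
  show "Blinfun j \<in> clinear_ops"
   by (auto simp: clinear_ops_def bounded_linear_Blinfun_apply[OF bl] clinear_opsD[OF N]
     simp flip: scaleC_diff_right intro!: ju)
    (metis j add_diff_cancel_right')
  show "Blinfun j x = x + N (Blinfun j x)" for x
   by (simp add: bounded_linear_Blinfun_apply[OF bl] j)
  show "Blinfun j (y - N y) = y" for y
   by (simp add: bounded_linear_Blinfun_apply[OF bl] ju)
 qed
qed

text \<open>From \<open>z - A = (1 - (a - z) R) (a - A)\<close>, with R the resolvent at a, the
  candidate is R J, where J inverts \<open>1 - (a - z) R\<close>.\<close>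

lemma resolvent_set_neumann:
 assumes A: "linear_operator A" and a: "a \<in> resolvent_set A"
  and lt: "cmod (z - a) * norm (resolvent A a) < 1"
 shows "z \<in> resolvent_set A"
proof -
 let ?R = "resolvent A a"
 have Rc: "?R \<in> clinear_ops" by (rule resolvent_clinear[OF a])
 have "(a - z) *\<^sub>C ?R \<in> clinear_ops" "norm ((a - z) *\<^sub>C ?R) < 1"
  using Rc lt by (simp_all add: clinear_ops_intros norm_scaleC norm_minus_commute)
 then obtain J where J: "J \<in> clinear_ops"
  "!!x. blinfun_apply J x = x + (a - z) *\<^sub>C blinfun_apply ?R (blinfun_apply J x)"
  "!!y. blinfun_apply J (y - (a - z) *\<^sub>C blinfun_apply ?R y) = y"
  using clinear_fixpoint_inverse[of "(a - z) *\<^sub>C ?R"] by (auto simp: scaleC_blinfun.rep_eq)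
 have in1: "(blinfun_apply (?R o\<^sub>L J) x, z *\<^sub>C blinfun_apply (?R o\<^sub>L J) x - x) \<in> A" for x
 proof -
  have "(blinfun_apply ?R (blinfun_apply J x),
    a *\<^sub>C blinfun_apply ?R (blinfun_apply J x) - blinfun_apply J x) \<in> A"
   by (rule resolvent_in[OF a])
  moreover have "a *\<^sub>C blinfun_apply ?R (blinfun_apply J x) - blinfun_apply J x
   = z *\<^sub>C blinfun_apply ?R (blinfun_apply J x) - x"
   using J(2)[of x] by (simp add: scaleC_diff_left algebra_simps)
  ultimately show ?thesis by simp
 qed
 \<comment> \<open>R J is already a right inverse of z - A, so injectivity of z - A makes it a left
   inverse as well.\<close>
 have inj: "u = 0" if "(u, z *\<^sub>C u) \<in> A" for u
 proof -
  have "blinfun_apply ?R (a *\<^sub>C u - z *\<^sub>C u) = u" by (rule resolvent_left[OF a that])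
  then have "u = (a - z) *\<^sub>C blinfun_apply ?R u"
   by (simp add: clinear_opsD[OF Rc] flip: scaleC_diff_left)
  then have "norm u <= cmod (a - z) * (norm ?R * norm u)"
   by (metis norm_scaleC norm_blinfun mult_left_mono norm_ge_zero)
  then have "(1 - cmod (z - a) * norm ?R) * norm u <= 0"
   by (simp add: left_diff_distrib norm_minus_commute mult.assoc)
  moreover have "0 < 1 - cmod (z - a) * norm ?R" using lt by simp
  ultimately have "norm u <= 0" by (simp add: mult_le_0_iff)
  then show ?thesis by simp
 qed
 show ?thesis
 proof (rule resolvent_setI(1)[OF _ A in1])
  show "?R o\<^sub>L J \<in> clinear_ops" using Rc J(1) by (rule clinear_ops_compose)
  fix u v assume uv: "(u,v) \<in> A"
  let ?u = "blinfun_apply (?R o\<^sub>L J) (z *\<^sub>C u - v)"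
  have "(?u - u, (z *\<^sub>C ?u - (z *\<^sub>C u - v)) - v) \<in> A"
   by (rule linear_operatorD(3)[OF A in1 uv])
  then have "(?u - u, z *\<^sub>C (?u - u)) \<in> A" by (simp add: scaleC_diff_right)
  then show "?u = u" using inj[of "?u - u"] by simp
 qed
qed

text \<open>Carrying W on the right transfers a gain that the product with W has at a to the points
  near a. The resolvent identity bounds the difference by half of the left-hand side, which is
  absorbed.\<close>

lemma resolvent_tail_bound:
 assumes A: "linear_operator A" and a: "a \<in> resolvent_set A" and z: "z \<in> resolvent_set A"
  and le: "cmod (z - a) * norm (resolvent A a) <= 1/2"
 shows "norm (resolvent A z o\<^sub>L W) <= 2 * norm (resolvent A a o\<^sub>L W)"
proof -
 have "resolvent A z o\<^sub>L W = (resolvent A a o\<^sub>L W) +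
   (a - z) *\<^sub>C (resolvent A a o\<^sub>L (resolvent A z o\<^sub>L W))"
 proof -
  have "resolvent A z = resolvent A a + (a - z) *\<^sub>C (resolvent A a o\<^sub>L resolvent A z)"
   using resolvent_identity[OF A z a] resolvent_commute[OF A a z] by (simp add: diff_eq_eq add.commute)
  from arg_cong[OF this, of "%F. F o\<^sub>L W"] show ?thesis
   by (simp only: compose_add_left scaleC_compose_left compose_assoc)
 qed
 then have "norm (resolvent A z o\<^sub>L W) <= norm (resolvent A a o\<^sub>L W) +
   cmod (a - z) * norm (resolvent A a o\<^sub>L (resolvent A z o\<^sub>L W))"
  by (metis norm_triangle_ineq norm_scaleC)
 also have "\<dots> <= norm (resolvent A a o\<^sub>L W) + cmod (a - z) * (norm (resolvent A a) * norm (resolvent A z o\<^sub>L W))"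
  by (intro add_left_mono mult_left_mono norm_blinfun_compose) auto
 also have "\<dots> <= norm (resolvent A a o\<^sub>L W) + 1/2 * norm (resolvent A z o\<^sub>L W)"
  using mult_right_mono[OF le, of "norm (resolvent A z o\<^sub>L W)"] by (simp add: norm_minus_commute mult.assoc)
 finally show ?thesis by simp
qed

lemma open_resolvent_set:
 assumes A: "linear_operator A"
 shows "open (resolvent_set A)"
proof (rule openI)
 fix a assume a: "a \<in> resolvent_set A"
 \<comment> \<open>The added 1 keeps the radius meaningful when the resolvent vanishes.\<close>
 have "ball a (1 / (norm (resolvent A a) + 1)) \<subseteq> resolvent_set A"
 proof
  fix z assume "z \<in> ball a (1 / (norm (resolvent A a) + 1))"
  then have "cmod (z - a) * (norm (resolvent A a) + 1) < 1"
   by (simp add: dist_norm norm_minus_commute pos_less_divide_eq add_nonneg_pos)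
  moreover have "cmod (z - a) * norm (resolvent A a) <= cmod (z - a) * (norm (resolvent A a) + 1)"
   by (intro mult_left_mono) auto
  ultimately show "z \<in> resolvent_set A" by (intro resolvent_set_neumann[OF A a]) simp
 qed
 then show "\<exists>e>0. ball a e \<subseteq> resolvent_set A"
  by (intro exI[of _ "1 / (norm (resolvent A a) + 1)"]) (simp add: add_nonneg_pos)
qed

lemma resolvent_continuous_at:
 assumes A: "linear_operator A" and a: "a \<in> resolvent_set A"
 shows "(resolvent A \<longlongrightarrow> resolvent A a) (at a)"
proof -
 let ?N = "norm (resolvent A a)"
 have 1: "eventually (%z. z \<in> resolvent_set A) (at a)"
  by (rule eventually_at_in_open'[OF open_resolvent_set[OF A] a])
 have "((%z. cmod (z - a) * ?N) \<longlongrightarrow> cmod (a - a) * ?N) (at a)"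
  by (intro tendsto_intros)
 then have 2: "eventually (%z. cmod (z - a) * ?N < 1/2) (at a)"
  by (rule order_tendstoD(2)) simp
 have "eventually (%z. norm (resolvent A z - resolvent A a) <= cmod (z - a) * (2 * ?N * ?N)) (at a)"
  using 1 2
 proof eventually_elim
  case (elim z)
  have b: "norm (resolvent A z) <= 2 * ?N"
   using resolvent_tail_bound[OF A a elim(1), of id_blinfun] elim(2) by simp
  have "norm (resolvent A z - resolvent A a) = cmod (z - a) * norm (resolvent A z o\<^sub>L resolvent A a)"
   by (simp add: resolvent_identity[OF A elim(1) a] norm_scaleC norm_minus_commute)
  also have "\<dots> <= cmod (z - a) * (norm (resolvent A z) * ?N)"
   by (intro mult_left_mono norm_blinfun_compose) auto
  also have "\<dots> <= cmod (z - a) * (2 * ?N * ?N)"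
   by (intro mult_left_mono mult_right_mono b) auto
  finally show ?case .
 qed
 moreover have "((%z. cmod (z - a) * (2 * ?N * ?N)) \<longlongrightarrow> cmod (a - a) * (2 * ?N * ?N)) (at a)"
  by (intro tendsto_intros)
 then have "((%z. cmod (z - a) * (2 * ?N * ?N)) \<longlongrightarrow> 0) (at a)" by simp
 ultimately have "((%z. resolvent A z - resolvent A a) \<longlongrightarrow> 0) (at a)"
  by (rule Lim_null_comparison)
 then show ?thesis by (rule LIM_zero_cancel)
qed

lemma continuous_on_resolvent [continuous_intros]:
 assumes "linear_operator A" "continuous_on S f" "f ` S \<subseteq> resolvent_set A"
 shows "continuous_on S (%x. resolvent A (f x))"
proof -
 have "continuous_on (resolvent_set A) (resolvent A)"
  using resolvent_continuous_at[OF assms(1)]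
  by (intro continuous_at_imp_continuous_on ballI) (simp add: isCont_def)
 then show ?thesis by (rule continuous_on_compose2) (use assms in auto)
qed

lemma functional_resolvent_derivative:
 fixes \<phi> :: "('a::complex_banach \<Rightarrow>\<^sub>L 'a) \<Rightarrow>\<^sub>L complex"
 assumes A: "linear_operator A" and a: "a \<in> resolvent_set A" and \<phi>: "\<phi> \<in> clinear_ops"
 shows "((%z. \<phi> (resolvent A z)) has_field_derivative
  \<phi> (- (resolvent A a o\<^sub>L resolvent A a))) (at a)"
proof -
 have ev: "eventually (%z. z \<in> resolvent_set A \<and> z ~= a) (at a)"
  using eventually_at_in_open[OF open_resolvent_set[OF A] a] by eventually_elim auto
 have "((%z. \<phi> (- (resolvent A z o\<^sub>L resolvent A a))) \<longlongrightarrow>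
  \<phi> (- (resolvent A a o\<^sub>L resolvent A a))) (at a)"
  by (intro blinfun.tendsto tendsto_const tendsto_minus
    bounded_bilinear.tendsto[OF bounded_bilinear_blinfun_compose] resolvent_continuous_at[OF A a])
 then have "((%z. (\<phi> (resolvent A z) - \<phi> (resolvent A a)) / (z - a)) \<longlongrightarrow>
  \<phi> (- (resolvent A a o\<^sub>L resolvent A a))) (at a)"
 proof (rule Lim_transform_eventually)
  show "\<forall>\<^sub>F z in at a. \<phi> (- (resolvent A z o\<^sub>L resolvent A a)) =
   (\<phi> (resolvent A z) - \<phi> (resolvent A a)) / (z - a)"
   using ev
  proof eventually_elim
   case (elim z)
   have "\<phi> (resolvent A z) - \<phi> (resolvent A a) =
    (a - z) * \<phi> (resolvent A z o\<^sub>L resolvent A a)"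
    using elim by (simp add: resolvent_identity[OF A _ a] clinear_opsD[OF \<phi>] flip: blinfun.diff_right)
   then show ?case using elim by (simp add: blinfun.minus_right field_simps)
  qed
 qed
 then show ?thesis by (simp add: has_field_derivative_iff)
qed

lemma functional_resolvent_holomorphic:
 fixes \<phi> :: "('a::complex_banach \<Rightarrow>\<^sub>L 'a) \<Rightarrow>\<^sub>L complex"
 assumes "linear_operator A" "\<phi> \<in> clinear_ops" "f holomorphic_on S" "f ` S \<subseteq> resolvent_set A"
 shows "(%z. \<phi> (resolvent A (f z))) holomorphic_on S"
proof -
 have "(%z. \<phi> (resolvent A z)) holomorphic_on resolvent_set A"
  using functional_resolvent_derivative[OF assms(1) _ assms(2)]
  by (auto simp: holomorphic_on_open[OF open_resolvent_set[OF assms(1)]])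
 then show ?thesis
  using holomorphic_on_compose_gen[OF assms(3) _ assms(4)] by (simp add: o_def)
qed

text \<open>The cosine turns the condition on \<open>Arg\<close>, which jumps across the negative
  axis, into a comparison of continuous functions; openness and closures of sectors are read off
  from it.\<close>

lemma sector_Re: "z \<in> sector \<phi> \<longleftrightarrow> z ~= 0 \<and> cos \<phi> * cmod z < Re z" if "0 <= \<phi>" "\<phi> <= pi"
proof (cases "z = 0")
 case False
 have "Re z = cmod z * cos \<bar>Arg z\<bar>"
  using arg_cong[OF Arg_eq[OF False], of Re] by (simp add: abs_if Re_exp)
 moreover have "\<bar>Arg z\<bar> < \<phi> \<longleftrightarrow> cos \<phi> < cos \<bar>Arg z\<bar>"
  using cos_mono_less_eq[of \<phi> "\<bar>Arg z\<bar>"] that Arg_le_pi[of z] mpi_less_Arg[of z] by (auto simp: abs_if)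
 ultimately show ?thesis using False by (simp add: sector_def mult.commute)
qed (simp add: sector_def)

lemma open_sector: "open (sector \<phi>)" if "0 <= \<phi>" "\<phi> <= pi"
proof -
 have "sector \<phi> = {z. cos \<phi> * cmod z < Re z} \<inter> - {0}" using sector_Re[OF that] by auto
 moreover have "open ({z. cos \<phi> * cmod z < Re z} \<inter> - {0})"
  by (intro open_Int open_Collect_less continuous_intros open_Compl closed_singleton)
 ultimately show ?thesis by simp
qed

lemma closure_sector_subset:
 assumes "0 <= \<phi>" "\<phi> <= pi"
 shows "closure (sector \<phi>) \<subseteq> {z. cos \<phi> * cmod z <= Re z}"
proof (rule closure_minimal)
 show "closed {z. cos \<phi> * cmod z <= Re z}" by (intro closed_Collect_le continuous_intros)
 show "sector \<phi> \<subseteq> {z. cos \<phi> * cmod z <= Re z}"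
  by (intro subsetI CollectI less_imp_le) (simp add: sector_Re[OF assms])
qed

text \<open>Every point z of the closed cone, the vertex included, is the limit of the points z + e
  with e > 0, and these lie in the open sector.\<close>

lemma mem_closure_sector:
 assumes "0 < \<phi>" "\<phi> < pi" "cos \<phi> * cmod z <= Re z"
 shows "z \<in> closure (sector \<phi>)"
proof -
 have c: "cos \<phi> < 1" using cos_monotone_0_pi[of 0 \<phi>] assms by simp
 have mem: "z + of_real e \<in> sector \<phi>" if e: "e > 0" for e :: real
 proof -
  have ne: "z + of_real e ~= 0"
  proof
   assume "z + of_real e = 0"
   then have "z = - of_real e" by (simp add: eq_neg_iff_add_eq_0)
   then have "cos \<phi> * e <= - e" using assms(3) e by simp
   then have "(cos \<phi> + 1) * e <= 0" by (simp add: algebra_simps)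
   moreover have "cos \<phi> + 1 > 0" using cos_monotone_0_pi[of \<phi> pi] assms by simp
   ultimately show False using e by (simp add: mult_le_0_iff)
  qed
  have "cos \<phi> * cmod (z + of_real e) < Re z + e"
  proof (cases "cos \<phi> \<ge> 0")
   case True
   have "cos \<phi> * cmod (z + of_real e) <= cos \<phi> * (cmod z + e)"
    using norm_triangle_ineq[of z "of_real e"] e True by (intro mult_left_mono) auto
   also have "\<dots> < Re z + e" using assms(3) c e by (simp add: distrib_left add_le_less_mono)
   finally show ?thesis .
  next
   case False
   have "cmod z - e <= cmod (z + of_real e)"
    using norm_diff_ineq[of z "of_real e"] e by simp
   then have "cos \<phi> * cmod (z + of_real e) <= cos \<phi> * (cmod z - e)"
    using False by (intro mult_left_mono_neg) auto
   also have "\<dots> < Re z + e"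
   proof -
    have "- cos \<phi> < 1" using cos_monotone_0_pi[of \<phi> pi] assms by simp
    then have "- cos \<phi> * e < 1 * e" using e by (rule mult_strict_right_mono)
    then show ?thesis using assms(3) by (simp add: right_diff_distrib)
   qed
   finally show ?thesis .
  qed
  then show ?thesis using ne assms by (subst sector_Re) auto
 qed
 show ?thesis
  unfolding closure_approachable
 proof (intro allI impI)
  fix e :: real assume "e > 0"
  then have "z + of_real (e/2) \<in> sector \<phi>" "dist (z + of_real (e/2)) z < e"
   using mem[of "e/2"] by (simp_all add: dist_norm)
  then show "\<exists>y\<in>sector \<phi>. dist y z < e" by blast
 qed
qed

lemma rcis_mem_sector: "r > 0 ==> \<bar>\<xi>\<bar> < \<phi> ==> \<phi> <= pi ==> rcis r \<xi> \<in> sector \<phi>"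
 using cos_mono_less_eq[of \<phi> "\<bar>\<xi>\<bar>"]
 by (subst sector_Re) (auto simp: abs_if rcis_def cis_neq_zero norm_mult split: if_splits)

lemma rcis_notin_closure_sector:
 assumes "r > 0" "0 < \<omega>" "\<omega> < \<bar>\<xi>\<bar>" "\<bar>\<xi>\<bar> <= pi"
 shows "rcis r \<xi> \<notin> closure (sector \<omega>)"
proof
 assume "rcis r \<xi> \<in> closure (sector \<omega>)"
 then have "cos \<omega> * r <= r * cos \<xi>"
  using closure_sector_subset[of \<omega>] assms by (auto simp: rcis_def norm_mult)
 moreover have "cos \<xi> < cos \<omega>"
  using cos_monotone_0_pi[of \<omega> "\<bar>\<xi>\<bar>"] assms by (auto simp: abs_if split: if_splits)
 ultimately show False using assms by (simp add: mult.commute)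
qed

lemma sector_mono: "\<phi> <= \<phi>' ==> sector \<phi> \<subseteq> sector \<phi>'"
 by (auto simp: sector_def)

lemma sectorial_resolvent_set:
 assumes "sectorial_of_angle \<omega> A" "r > 0" "\<omega> < \<bar>\<xi>\<bar>" "\<bar>\<xi>\<bar> <= pi"
 shows "rcis r \<xi> \<in> resolvent_set A"
 using assms rcis_notin_closure_sector[of r \<omega> \<xi>]
 by (auto simp: sectorial_of_angle_def op_spectrum_def)

lemma sectorial_resolvent_bound:
 assumes A: "sectorial_of_angle \<omega> A" and "\<omega> < \<xi>"
 obtains M where "M > 0" "!!r \<xi>'. r > 0 ==> \<xi> <= \<bar>\<xi>'\<bar> ==> \<bar>\<xi>'\<bar> <= pi ==> norm (resolvent A (rcis r \<xi>')) <= M / r"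
proof (cases "\<xi> <= pi")
 \<comment> \<open>Angles above pi make the claim vacuous, so any constant serves.\<close>
 case False
 show thesis by (rule that[of 1]) (use False in auto)
next
 case True
 \<comment> \<open>Sectoriality gives bounds only off the closures of sectors strictly larger than
   \<omega>, hence the angle in between.\<close>
 define \<omega>' where "\<omega>' = (\<omega> + \<xi>) / 2"
 have w: "0 < \<omega>" "\<omega> < \<omega>'" "\<omega>' < pi" "\<omega>' < \<xi>"
  using assms True by (auto simp: \<omega>'_def sectorial_of_angle_def)
 then have "bounded ((%l. l *\<^sub>C resolvent A l) ` (- closure (sector \<omega>')))"
  using A by (simp add: sectorial_of_angle_def)
 then obtain M where M: "M > 0" "!!l. l \<notin> closure (sector \<omega>') ==> norm (l *\<^sub>C resolvent A l) <= M"
  unfolding bounded_pos by (metis (no_types, lifting) ComplI imageI)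
 show thesis
 proof (rule that[OF M(1)])
  fix r \<xi>' :: real assume r: "r > 0" "\<xi> <= \<bar>\<xi>'\<bar>" "\<bar>\<xi>'\<bar> <= pi"
  then have "rcis r \<xi>' \<notin> closure (sector \<omega>')" using w by (intro rcis_notin_closure_sector) auto
  from M(2)[OF this] show "norm (resolvent A (rcis r \<xi>')) <= M / r"
   using r by (simp add: norm_scaleC field_simps)
 qed
qed

section \<open>Integrals along rays\<close>

text \<open>Integrability of a function into a Banach space from approximations in the mean: f stays
  within h of an integrable f', and h has small integral. Riemann sums of f and f' differ by at most
  a Riemann sum of h, so the Cauchy criterion passes from f' to f.\<close>

lemma integrable_squeeze_norm:
 fixes f :: "real => 'b::banach"
 assumes ap: "!!e. e > 0 ==> \<exists>f' h. f' integrable_on cbox a b \<and> h integrable_on cbox a b \<and>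
   (\<forall>x\<in>cbox a b. norm (f x - f' x) <= (h x::real)) \<and> integral (cbox a b) h < e"
 shows "f integrable_on cbox a b"
 unfolding integrable_Cauchy
proof (intro allI impI)
 fix e :: real assume "e > 0"
 \<comment> \<open>The integral of h and the error of its Riemann sums take e/6 each, which makes
   e/3 for each of the two divisions; the last e/3 is for f'.\<close>
 then obtain f' h where f': "f' integrable_on cbox a b" and h: "h integrable_on cbox a b"
  and le: "!!x. x \<in> cbox a b ==> norm (f x - f' x) <= h x" and hi: "integral (cbox a b) h < e/6"
  using ap[of "e/6"] by auto
 obtain g1 where g1: "gauge g1" "!!p q. p tagged_division_of (cbox a b) ==> g1 fine p ==>
   q tagged_division_of (cbox a b) ==> g1 fine q ==>
   norm ((\<Sum>(x,K)\<in>p. measure lborel K *\<^sub>R f' x) - (\<Sum>(x,K)\<in>q. measure lborel K *\<^sub>R f' x)) < e/3"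
  using f' \<open>e > 0\<close> unfolding integrable_Cauchy by (metis divide_pos_pos zero_less_numeral)
 obtain g2 where g2: "gauge g2" "!!p. p tagged_division_of (cbox a b) ==> g2 fine p ==>
   norm ((\<Sum>(x,K)\<in>p. measure lborel K *\<^sub>R h x) - integral (cbox a b) h) < e/6"
  using integrable_integral[OF h] \<open>e > 0\<close> unfolding has_integral by (metis divide_pos_pos zero_less_numeral)
 have part: "norm ((\<Sum>(x,K)\<in>p. measure lborel K *\<^sub>R f x) - (\<Sum>(x,K)\<in>p. measure lborel K *\<^sub>R f' x)) < e/3"
  if p: "p tagged_division_of (cbox a b)" "g2 fine p" for p
 proof -
  have "norm ((\<Sum>(x,K)\<in>p. measure lborel K *\<^sub>R f x) - (\<Sum>(x,K)\<in>p. measure lborel K *\<^sub>R f' x)) =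
   norm (\<Sum>(x,K)\<in>p. measure lborel K *\<^sub>R (f x - f' x))"
   by (simp add: sum_subtractf[symmetric] case_prod_beta scaleR_diff_right)
  also have "\<dots> <= (\<Sum>(x,K)\<in>p. measure lborel K *\<^sub>R h x)"
  proof (rule sum_norm_le, clarify)
   fix x K assume "(x,K) \<in> p"
   then have "x \<in> cbox a b" using p(1) by (meson tagged_division_ofD(2,3) subsetD)
   then show "norm (measure lborel K *\<^sub>R (f x - f' x)) <= measure lborel K *\<^sub>R h x"
    using le by (simp add: mult_left_mono)
  qed
  also have "\<dots> < e/3" using g2(2)[OF p] hi unfolding real_norm_def abs_less_iff by linarith
  finally show ?thesis .
 qed
 show "\<exists>\<gamma>. gauge \<gamma> \<and> (\<forall>p q. p tagged_division_of cbox a b \<and> \<gamma> fine p \<and>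
   q tagged_division_of cbox a b \<and> \<gamma> fine q -->
   norm ((\<Sum>(x,K)\<in>p. measure lborel K *\<^sub>R f x) - (\<Sum>(x,K)\<in>q. measure lborel K *\<^sub>R f x)) < e)"
 proof (intro exI conjI allI impI; (elim conjE)?)
  show "gauge (%x. g1 x \<inter> g2 x)" using g1(1) g2(1) by (rule gauge_Int)
  fix p q assume p: "p tagged_division_of cbox a b" "(%x. g1 x \<inter> g2 x) fine p"
   and q: "q tagged_division_of cbox a b" "(%x. g1 x \<inter> g2 x) fine q"
  have fi: "g1 fine p" "g2 fine p" "g1 fine q" "g2 fine q" using p(2) q(2) by (auto simp: fine_Int)
  have tri: "norm (u - v) < e" if "norm (u - u') < e/3" "norm (v - v') < e/3" "norm (u' - v') < e/3"
   for u v u' v' :: 'b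
  proof -
   have "norm (u - v) <= norm (u - u') + norm (u' - v') + norm (v' - v)"
    using norm_triangle_ineq[of "u - u'" "u' - v"] norm_triangle_ineq[of "u' - v'" "v' - v"] by simp
   then show ?thesis using that by (simp add: norm_minus_commute)
  qed
  show "norm ((\<Sum>(x,K)\<in>p. measure lborel K *\<^sub>R f x) - (\<Sum>(x,K)\<in>q. measure lborel K *\<^sub>R f x)) < e"
   by (rule tri[OF part[OF p(1) fi(2)] part[OF q(1) fi(4)] g1(2)[OF p(1) fi(1) q(1) fi(3)]])
 qed
qed

text \<open>The common majorant on the half-line. In the variable x = ln r it becomes
  \<open>exp (- u * \<bar>x\<bar>)\<close>, so it controls both ends at once.\<close>

definition mp :: "real => real => real" where
 "mp u r = min (r powr u) (r powr (-u)) / r"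

lemma mp_nonneg: "r > 0 ==> mp u r \<ge> 0"
 by (simp add: mp_def)

lemma mp_le_one: "0 < r ==> r <= 1 ==> 0 <= u ==> mp u r = r powr (u - 1)"
 using powr_mono'[of "-u" u r] by (simp add: mp_def powr_diff min_def)

lemma mp_ge_one: "1 <= r ==> 0 <= u ==> mp u r = r powr (- u - 1)"
 using powr_mono[of "-u" u r] by (simp add: mp_def powr_diff min_def)

lemma mp_has_integral_initial:
 assumes "u > 0" "0 <= d" "d <= 1"
 shows "(mp u has_integral d powr u / u) {0<..d}"
proof -
 have "((%r. r powr (u-1)) has_integral d powr u / u) {0..d}"
  using has_integral_powr_from_0[of "u - 1" d] assms by simp
 then have "((%r. r powr (u-1)) has_integral d powr u / u) {0<..d}"
  by (rule has_integral_spike_set_eq[THEN iffD1, rotated 2])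
   (rule negligible_subset[of "{0}"]; auto)+
 then show ?thesis by (rule has_integral_eq[rotated]) (use assms mp_le_one in auto)
qed

lemma mp_integrable: assumes "u > 0" shows "mp u integrable_on {0<..}"
proof -
 have 1: "mp u integrable_on {0<..1}"
  using mp_has_integral_initial[of u 1] assms by (auto simp: integrable_on_def)
 have "((%r. r powr (-u-1)) has_integral - (1 powr (-u-1+1)) / (-u-1+1)) {1..}"
  using assms by (intro has_integral_powr_to_inf) auto
 then have "(mp u has_integral - (1 powr (-u-1+1)) / (-u-1+1)) {1..}"
  by (rule has_integral_eq[rotated]) (use assms mp_ge_one in auto)
 then have 2: "mp u integrable_on {1..}" by blast
 have "mp u integrable_on ({0<..1} \<union> {1..})"
  by (rule integrable_Un[OF _ 1 2]) (rule negligible_subset[of "{1}"]; auto)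
 also have "{0<..1} \<union> {1..} = {0::real<..}" by auto
 finally show ?thesis .
qed

lemma continuous_on_mp: "continuous_on {0<..} (mp u)"
 unfolding mp_def by (intro continuous_intros) auto

lemma mult_exp_mp: "exp x * mp u (exp x) = exp (- u * \<bar>x\<bar>)" if "u > 0"
proof -
 have "exp x * mp u (exp x) = min (exp (u * x)) (exp (- (u * x)))"
  by (simp add: mp_def powr_def)
 also have "\<dots> = exp (- u * \<bar>x\<bar>)"
  using that by (auto simp: min_def abs_if mult_le_0_iff zero_le_mult_iff)
 finally show ?thesis .
qed

text \<open>The difficulty is the end 0, where f may be unbounded. Cutting f off below d leaves an
  error with integral at most \<open>C * d^u / u\<close>, and \<open>integrable_squeeze_norm\<close>
  applies on each compact interval.\<close>

lemma integrable_mp: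
 fixes f :: "real => 'b::banach"
 assumes c: "continuous_on {0<..} f" and le: "!!r. r > 0 ==> norm (f r) <= C * mp u r" and u: "u > 0"
 shows "f integrable_on {0<..}"
proof (rule integrable_on_all_intervals_integrable_bound)
 show "(%r. C * mp u r) integrable_on {0<..}" using mp_integrable[OF u] by (rule integrable_on_mult_right)
 show "norm (f r) <= C * mp u r" if "r \<in> {0<..}" for r using that le by auto
 have C0: "C \<ge> 0" using order_trans[OF norm_ge_zero le[of 1]] by (simp add: mp_def)
 fix a b :: real
 show "(%r. if r \<in> {0<..} then f r else 0) integrable_on cbox a b"
 proof (rule integrable_squeeze_norm)
  fix e :: real assume e: "e > 0"
  have "(%n. C * exp (- u * real n) / u) \<longlonglongrightarrow> C * 0 / u"
   using u by (intro tendsto_intros filterlim_compose[OF exp_at_bot]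
     filterlim_tendsto_neg_mult_at_bot[OF tendsto_const _ filterlim_real_sequentially]) auto
  then have "eventually (%n. C * exp (- u * real n) / u < e) sequentially"
   by (rule order_tendstoD(2)) (use e in simp)
  then obtain n where n: "C * exp (- u * real n) / u < e" by (auto simp: eventually_sequentially)
  define d where "d = exp (- real n)"
  have d: "0 < d" "d <= 1" "d powr u = exp (- u * real n)"
   by (auto simp: d_def powr_def)
  define f' where "f' r = (if r \<in> {d..} then f r else 0)" for r
  define h where "h r = (if r \<in> {0<..d} then C * mp u r else 0)" for r
  have "f integrable_on {max d a..b}"
   using d by (intro integrable_continuous_real continuous_on_subset[OF c]) auto
  moreover have "{d..} \<inter> cbox a b = {max d a..b}" by auto
  ultimately have f': "f' integrable_on cbox a b"
   unfolding f'_def integrable_restrict_Int by simp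
  have "((%r. C * mp u r) has_integral C * (d powr u / u)) {0<..d}"
   by (intro has_integral_mult_right mp_has_integral_initial[OF u]) (use d in auto)
  then have hh: "(h has_integral C * (d powr u / u)) UNIV"
   unfolding h_def by (simp only: has_integral_restrict_UNIV)
  have hp: "h r \<ge> 0" for r using C0 mp_nonneg[of r u] by (auto simp: h_def)
  have hi: "h integrable_on cbox a b" using hh by (meson integrable_on_def integrable_on_subcbox subset_UNIV)
  show "\<exists>f' h. f' integrable_on cbox a b \<and> h integrable_on cbox a b \<and>
   (\<forall>x\<in>cbox a b. norm ((if x \<in> {0<..} then f x else 0) - f' x) <= (h x::real)) \<and> integral (cbox a b) h < e"
  proof (intro exI conjI ballI)
   show "f' integrable_on cbox a b" by fact
   show "h integrable_on cbox a b" by fact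
   show "norm ((if x \<in> {0<..} then f x else 0) - f' x) <= h x" for x
    using le d hp[of x] by (auto simp: f'_def h_def)
   have "integral (cbox a b) h <= integral UNIV h"
    using hi hh hp by (intro integral_subset_le) auto
   also have "\<dots> = C * (d powr u / u)" using hh by (rule integral_unique)
   also have "\<dots> < e" using n d by simp
   finally show "integral (cbox a b) h < e" .
  qed
 qed
qed

lemma norm_integral_mp_le:
 fixes f :: "real => 'b::banach"
 assumes "continuous_on {0<..} f" "!!r. r > 0 ==> norm (f r) <= C * mp u r" "u > 0"
 shows "norm (integral {0<..} f) <= C * integral {0<..} (mp u)"
proof -
 have "norm (integral {0<..} f) <= integral {0<..} (%r. C * mp u r)"
  using assms by (intro Henstock_Kurzweil_Integration.integral_norm_bound_integral integrable_mp[OF assms]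
    integrable_on_mult_right mp_integrable) auto
 then show ?thesis by simp
qed

text \<open>The truncations are symmetric in ln r, to match the rectangles in the proof of
  \<open>ray_rotate\<close>.\<close>

lemma truncated_integral_LIMSEQ:
 fixes f :: "real => complex"
 assumes c: "continuous_on {0<..} f" and le: "!!r. r > 0 ==> norm (f r) <= C * mp u r" and u: "u > 0"
 shows "(%n. integral {exp (- real n)..exp (real n)} f) \<longlonglongrightarrow> integral {0<..} f"
proof -
 let ?I = "%n::nat. {exp (- real n)..exp (real n)}"
 let ?f = "%n r. if r \<in> ?I n then f r else 0"
 have sub: "?I n \<subseteq> {0<..}" for n by (auto intro: less_le_trans[OF exp_gt_zero])
 have fi: "f integrable_on ?I n" for n
  by (intro integrable_continuous_real continuous_on_subset[OF c sub])
 have eq: "integral {0<..} (?f n) = integral (?I n) f" for n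
  using integral_restrict_Int[of "{0<..}" "?I n" f] sub[of n] by (simp add: Int_absorb2)
 have "(%n. integral {0<..} (?f n)) \<longlonglongrightarrow> integral {0<..} f"
 proof (rule dominated_convergence(2))
  show "?f n integrable_on {0<..}" for n
   using fi[of n] sub[of n] by (subst integrable_restrict_Int) (simp add: Int_absorb2)
  show "(%r. C * mp u r) integrable_on {0<..}" by (intro integrable_on_mult_right mp_integrable u)
  show "norm (?f n r) <= C * mp u r" if "r \<in> {0<..}" for n r
   using le[of r] that by (auto intro: order_trans[OF norm_ge_zero])
  show "(%n. ?f n r) \<longlonglongrightarrow> f r" if "r \<in> {0<..}" for r
  proof (rule tendsto_eventually)
   have "eventually (%n. real n \<ge> \<bar>ln r\<bar>) sequentially"
    using filterlim_real_sequentially by (simp add: filterlim_at_top)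
   then show "eventually (%n. ?f n r = f r) sequentially"
   proof eventually_elim
    case (elim n)
    then have "exp (- real n) <= exp (ln r)" "exp (ln r) <= exp (real n)" by auto
    moreover have "exp (ln r) = r" using that by simp
    ultimately show ?case by (simp only:) simp
   qed
  qed
 qed
 then show ?thesis by (simp only: eq)
qed

lemma blinfun_apply_integral:
 fixes f :: "real => 'b::banach" and \<phi> :: "'b \<Rightarrow>\<^sub>L 'c::banach"
 assumes "f integrable_on S"
 shows "\<phi> (integral S f) = integral S (%r. \<phi> (f r))"
 using integral_linear[OF assms blinfun.bounded_linear_right, of \<phi>] by (simp add: o_def)

lemma exp_rcis: "exp (Complex x y) = rcis (exp x) y"
 by (simp add: exp_eq_polar rcis_def)

text \<open>In the logarithmic coordinate the rays become horizontal lines in a strip. The strip is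
  convex, so \<open>F (exp z) * exp z\<close> has a primitive Q there. The vertical sides at real
  parts n and -n are bounded by a multiple of \<open>exp (- u * n)\<close>.\<close>

lemma ray_rotate:
 fixes F :: "complex => complex"
 assumes th: "\<xi>1 <= \<xi>2" and F: "F holomorphic_on U" "open U"
  and sub: "!!r \<xi>. r > 0 ==> \<xi>1 <= \<xi> ==> \<xi> <= \<xi>2 ==> rcis r \<xi> \<in> U"
  and bd: "!!r \<xi>. r > 0 ==> \<xi>1 <= \<xi> ==> \<xi> <= \<xi>2 ==> cmod (F (rcis r \<xi>)) <= C * mp u r"
  and u: "u > 0"
 shows "integral {0<..} (%r. F (rcis r \<xi>1) * cis \<xi>1) = integral {0<..} (%r. F (rcis r \<xi>2) * cis \<xi>2)"
proof -
 define S where "S = {z. \<xi>1 <= Im z \<and> Im z <= \<xi>2}"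
 define G where "G z = F (exp z) * exp z" for z
 have inU: "exp z \<in> U" if "z \<in> S" for z
  using that sub[of "exp (Re z)" "Im z"] exp_rcis[of "Re z" "Im z"] by (simp add: S_def)
 have hol: "G holomorphic_on (exp -` U)"
  unfolding G_def using holomorphic_on_compose_gen[OF holomorphic_on_exp F(1)]
  by (intro holomorphic_intros) (auto simp: o_def)
 have op: "open (exp -` U)" using F(2) by (intro open_vimage continuous_intros)
 have SU: "S \<subseteq> exp -` U" using inU by auto
 have conv: "convex S"
 proof -
  have "S = {z. Im z \<ge> \<xi>1} \<inter> {z. Im z <= \<xi>2}" by (auto simp: S_def)
  then show ?thesis by (simp add: convex_Int convex_halfspace_Im_ge convex_halfspace_Im_le)
 qed
 obtain Q where Q: "!!z. z \<in> S ==> (Q has_field_derivative G z) (at z within S)"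
 proof (rule holomorphic_convex_primitive[OF conv, of "{}" G])
  show "continuous_on S G" using hol SU holomorphic_on_imp_continuous_on continuous_on_subset by blast
  show "G field_differentiable at x" if "x \<in> interior S - {}" for x
   using SU that interior_subset[of S] by (intro holomorphic_on_imp_differentiable_at[OF hol op]) auto
 qed auto
 have ftc: "integral {a..b} (%r. F (rcis r \<xi>) * cis \<xi>) = Q (Complex (ln b) \<xi>) - Q (Complex (ln a) \<xi>)"
  if ab: "0 < a" "a <= b" and t: "\<xi>1 <= \<xi>" "\<xi> <= \<xi>2" for a b \<xi>
 proof (rule integral_unique, rule fundamental_theorem_of_calculus[OF ab(2)])
  fix r assume r: "r \<in> {a..b}"
  then have r0: "r > 0" using ab by auto
  let ?c = "%r. Complex (ln r) \<xi>"
  have c: "(?c has_vector_derivative of_real (1/r)) (at r within {a..b})"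
   unfolding Complex_eq using r0
   by (auto intro!: derivative_eq_intros has_vector_derivative_of_real
     has_vector_derivative_add_const[THEN iffD2] simp: field_simps)
  have "?c ` {a..b} \<subseteq> S" using t by (auto simp: S_def)
  then have "(Q has_field_derivative G (?c r)) (at (?c r) within ?c ` {a..b})"
   using Q r t by (intro DERIV_subset[OF Q]) (auto simp: S_def)
  from field_vector_diff_chain_within[OF c this]
  have "((Q \<circ> ?c) has_vector_derivative of_real (1/r) * G (?c r)) (at r within {a..b})" .
  moreover have "of_real (1/r) * G (?c r) = F (rcis r \<xi>) * cis \<xi>"
   using r0 by (simp add: G_def exp_rcis) (simp add: rcis_def)
  ultimately show "((%r. Q (Complex (ln r) \<xi>)) has_vector_derivative F (rcis r \<xi>) * cis \<xi>) (at r within {a..b})"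
   by (simp add: o_def)
 qed
 have side: "cmod (Q (Complex x \<xi>2) - Q (Complex x \<xi>1)) <= (C * exp (- u * \<bar>x\<bar>)) * (\<xi>2 - \<xi>1)" for x
 proof -
  let ?L = "closed_segment (Complex x \<xi>1) (Complex x \<xi>2)"
  have L: "z \<in> ?L ==> Re z = x \<and> \<xi>1 <= Im z \<and> Im z <= \<xi>2" for z
   using th by (auto simp: closed_segment_same_Re closed_segment_eq_real_ivl)
  then have LS: "?L \<subseteq> S" by (auto simp: S_def)
  have "cmod (Q (Complex x \<xi>2) - Q (Complex x \<xi>1)) <=
    (C * exp (- u * \<bar>x\<bar>)) * cmod (Complex x \<xi>2 - Complex x \<xi>1)"
  proof (rule field_differentiable_bound[where S="?L" and f'=G])
   fix z assume z: "z \<in> ?L"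
   show "(Q has_field_derivative G z) (at z within ?L)" using z LS by (intro DERIV_subset[OF Q]) auto
   have "exp z = rcis (exp x) (Im z)" using L[OF z] exp_rcis[of "Re z" "Im z"] by (metis complex_surj)
   moreover have "cmod (F (rcis (exp x) (Im z))) <= C * mp u (exp x)" using L[OF z] by (intro bd) auto
   ultimately have "cmod (G z) <= C * (exp x * mp u (exp x))"
    by (simp add: G_def norm_mult mult.assoc mult_right_mono rcis_def)
   then show "cmod (G z) <= C * exp (- u * \<bar>x\<bar>)" by (simp add: mult_exp_mp[OF u])
  qed auto
  then show ?thesis using th by (simp add: cmod_def)
 qed
 let ?J = "%\<xi> n. integral {exp (- real n)..exp (real n)} (%r. F (rcis r \<xi>) * cis \<xi>)"
 have lim: "?J \<xi> \<longlonglongrightarrow> integral {0<..} (%r. F (rcis r \<xi>) * cis \<xi>)" if "\<xi>1 <= \<xi>" "\<xi> <= \<xi>2" for \<xi>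
 proof (rule truncated_integral_LIMSEQ[OF _ _ u])
  have "continuous_on {0<..} (%r. F (rcis r \<xi>))"
   using that sub by (intro continuous_on_compose2[OF holomorphic_on_imp_continuous_on[OF F(1)]])
    (auto simp: rcis_def intro!: continuous_intros)
  then show "continuous_on {0<..} (%r. F (rcis r \<xi>) * cis \<xi>)" by (intro continuous_intros)
  show "norm (F (rcis r \<xi>) * cis \<xi>) <= C * mp u r" if "r > 0" for r
   using bd that \<open>\<xi>1 <= \<xi>\<close> \<open>\<xi> <= \<xi>2\<close> by (simp add: norm_mult)
 qed
 have D: "cmod (?J \<xi>2 n - ?J \<xi>1 n) <= 2 * (\<xi>2 - \<xi>1) * C * exp (- u * real n)" for n
 proof -
  have "?J \<xi>2 n - ?J \<xi>1 n = (Q (Complex (real n) \<xi>2) - Q (Complex (real n) \<xi>1))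
   - (Q (Complex (- real n) \<xi>2) - Q (Complex (- real n) \<xi>1))"
   using th by (subst (1 2) ftc) auto
  also have "cmod \<dots> <= (C * exp (- u * \<bar>real n\<bar>)) * (\<xi>2 - \<xi>1) + (C * exp (- u * \<bar>- real n\<bar>)) * (\<xi>2 - \<xi>1)"
   by (intro order_trans[OF norm_triangle_ineq4] add_mono side)
  finally show ?thesis by (simp add: algebra_simps)
 qed
 have "(%n. 2 * (\<xi>2 - \<xi>1) * C * exp (- u * real n)) \<longlonglongrightarrow> 2 * (\<xi>2 - \<xi>1) * C * 0"
  using u by (intro tendsto_intros filterlim_compose[OF exp_at_bot]
     filterlim_tendsto_neg_mult_at_bot[OF tendsto_const _ filterlim_real_sequentially]) auto
 then have z: "(%n. 2 * (\<xi>2 - \<xi>1) * C * exp (- u * real n)) \<longlonglongrightarrow> 0" by simp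
 have "(%n. ?J \<xi>2 n - ?J \<xi>1 n) \<longlonglongrightarrow> 0"
  by (rule Lim_null_comparison[OF always_eventually[OF allI[OF D]] z])
 moreover have "(%n. ?J \<xi>2 n - ?J \<xi>1 n) \<longlonglongrightarrow>
  integral {0<..} (%r. F (rcis r \<xi>2) * cis \<xi>2) - integral {0<..} (%r. F (rcis r \<xi>1) * cis \<xi>1)"
  using th by (intro tendsto_diff lim) auto
 ultimately have "0 = integral {0<..} (%r. F (rcis r \<xi>2) * cis \<xi>2) - integral {0<..} (%r. F (rcis r \<xi>1) * cis \<xi>1)"
  by (rule LIMSEQ_unique)
 then show ?thesis by simp
qed

text \<open>From the identity \<open>|\<nu> + r e^(i \<xi>)|^2 = (1 + cos \<xi>) / 2 * (\<nu> + r)^2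
  + (1 - cos \<xi>) / 2 * (\<nu> - r)^2\<close>, whose last term is dropped.\<close>

lemma norm_add_rcis_ge:
 assumes "\<nu> \<ge> 0" "r \<ge> 0"
 shows "sqrt ((1 + cos \<xi>) / 2) * (\<nu> + r) <= cmod (of_real \<nu> + rcis r \<xi>)"
proof (rule power2_le_imp_le)
 have "(cmod (of_real \<nu> + rcis r \<xi>))\<^sup>2 = (\<nu> + r * cos \<xi>)\<^sup>2 + (r * sin \<xi>)\<^sup>2"
  by (simp add: cmod_power2 rcis_def)
 also have "\<dots> = \<nu>\<^sup>2 + 2 * \<nu> * r * cos \<xi> + r\<^sup>2 * ((cos \<xi>)\<^sup>2 + (sin \<xi>)\<^sup>2)"
  by algebra
 also have "\<dots> = (1 + cos \<xi>) / 2 * (\<nu> + r)\<^sup>2 + (1 - cos \<xi>) / 2 * (\<nu> - r)\<^sup>2"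
  by (simp add: power2_eq_square field_simps)
 finally have *: "(1 + cos \<xi>) / 2 * (\<nu> + r)\<^sup>2 <= (cmod (of_real \<nu> + rcis r \<xi>))\<^sup>2"
  using cos_le_one[of \<xi>] by simp
 show "(sqrt ((1 + cos \<xi>) / 2) * (\<nu> + r))\<^sup>2 <= (cmod (of_real \<nu> + rcis r \<xi>))\<^sup>2"
 proof -
  have "0 <= 1 + cos \<xi>" by (metis add_left_mono cos_ge_minus_one add.right_inverse)
  then have "0 <= (1 + cos \<xi>) / 2" by simp
  then have "(sqrt ((1 + cos \<xi>) / 2))\<^sup>2 = (1 + cos \<xi>) / 2" by (rule real_sqrt_pow2)
  with * show ?thesis unfolding power_mult_distrib by (simp only:)
 qed
qed simp

lemma norm_diff_rcis_ge:
 assumes "\<nu> \<ge> 0" "r \<ge> 0"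
 shows "sqrt ((1 - cos \<xi>) / 2) * (\<nu> + r) <= cmod (rcis r \<xi> - of_real \<nu>)"
proof -
 have "rcis r (\<xi> + pi) = - rcis r \<xi>" by (simp add: rcis_def complex_eq_iff)
 then show ?thesis
  using norm_add_rcis_ge[OF assms, of "\<xi> + pi"] by (simp add: norm_minus_commute)
qed

lemma inverse_square_le_mp: "r > 0 ==> 1 / (1 + r)\<^sup>2 <= mp 1 r"
proof -
 assume r: "r > 0"
 have "1 / (1 + r)\<^sup>2 <= min 1 (1 / r\<^sup>2)"
  using r by (auto simp: min_def divide_simps power2_eq_square) (simp add: algebra_simps add_nonneg_nonneg)+
 also have "\<dots> = mp 1 r" using r by (auto simp: mp_def min_def powr_minus divide_simps power2_eq_square)
 finally show ?thesis .
qed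

lemma inverse_sum_square_le_mp:
 assumes "r > 0" "t > 0" shows "1 / (t + r)\<^sup>2 <= 1 / (min t 1)\<^sup>2 * mp 1 r"
proof -
 have "min t 1 * (1 + r) <= t + r" using assms by (auto simp: min_def algebra_simps)
 then have "(min t 1 * (1 + r))\<^sup>2 <= (t + r)\<^sup>2" using assms by (intro power_mono) auto
 then have "1 / (t + r)\<^sup>2 <= 1 / (min t 1 * (1 + r))\<^sup>2" using assms by (intro divide_left_mono) auto
 also have "\<dots> = 1 / (min t 1)\<^sup>2 * (1 / (1 + r)\<^sup>2)" by (simp add: power_mult_distrib)
 also have "\<dots> <= 1 / (min t 1)\<^sup>2 * mp 1 r" by (intro mult_left_mono inverse_square_le_mp assms) auto
 finally show ?thesis .
qed


text \<open>The left factor of the product is the distance to t, the right one the distance to -t.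
  The angle must stay away from 0 and from pi for both to be comparable with t + r.\<close>

lemma norm_sq_diff_ge:
 assumes "t > 0" "r > 0" "0 < a" "a <= \<bar>\<xi>\<bar>" "\<bar>\<xi>\<bar> <= b" "b < pi"
 shows "min ((1 - cos a) / 2) ((1 + cos b) / 2) * (t + r)\<^sup>2 <= cmod ((rcis r \<xi>)\<^sup>2 - (of_real t)\<^sup>2)"
proof -
 let ?k = "min ((1 - cos a) / 2) ((1 + cos b) / 2)"
 have c': "cos \<xi> <= cos a" "cos b <= cos \<xi>"
  using cos_monotone_0_pi_le[of a "\<bar>\<xi>\<bar>"] cos_monotone_0_pi_le[of "\<bar>\<xi>\<bar>" b] assms by auto
 have "0 <= 1 + cos b" by (metis add_left_mono cos_ge_minus_one add.right_inverse)
 then have k0: "?k \<ge> 0" using cos_le_one[of a] by simp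
 have k1: "?k <= (1 - cos \<xi>) / 2" by (rule order_trans[OF min.cobounded1]) (use c' in simp)
 have k2: "?k <= (1 + cos \<xi>) / 2" by (rule order_trans[OF min.cobounded2]) (use c' in simp)
 have 1: "sqrt ?k * (t + r) <= cmod (rcis r \<xi> - of_real t)"
  using assms k1 by (intro order_trans[OF mult_right_mono norm_diff_rcis_ge] real_sqrt_le_mono) auto
 have 2: "sqrt ?k * (t + r) <= cmod (of_real t + rcis r \<xi>)"
  using assms k2 by (intro order_trans[OF mult_right_mono norm_add_rcis_ge] real_sqrt_le_mono) auto
 have "?k * (t + r)\<^sup>2 = (sqrt ?k * (t + r)) * (sqrt ?k * (t + r))"
  using k0 by (simp add: power2_eq_square mult_ac flip: real_sqrt_mult)
 also have "\<dots> <= cmod (rcis r \<xi> - of_real t) * cmod (of_real t + rcis r \<xi>)"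
  using assms k0 by (intro mult_mono 1 2) auto
 also have "\<dots> = cmod ((rcis r \<xi>)\<^sup>2 - (of_real t)\<^sup>2)"
  by (simp add: norm_mult[symmetric] power2_eq_square algebra_simps)
 finally show ?thesis .
qed

lemma arctan_half_line:
 assumes "t > 0"
 shows "integral {0<..} (%r. complex_of_real (t / (r\<^sup>2 + t\<^sup>2))) = pi / 2"
proof -
 let ?f = "%r. complex_of_real (t / (r\<^sup>2 + t\<^sup>2))"
 have l1: "(%n. integral {exp (- real n)..exp (real n)} ?f) \<longlonglongrightarrow> integral {0<..} ?f"
 proof (rule truncated_integral_LIMSEQ[where u=1 and C="2 * t * (1 / (min t 1)\<^sup>2)"])
  show "continuous_on {0<..} ?f" using assms by (intro continuous_intros) (auto simp: add_pos_pos)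
  fix r :: real assume r: "r > 0"
  have "(t + r)\<^sup>2 <= 2 * (r\<^sup>2 + t\<^sup>2)"
   using sum_squares_bound[of t r] by (simp add: power2_sum)
  then have "t / (r\<^sup>2 + t\<^sup>2) <= 2 * t * (1 / (t + r)\<^sup>2)"
  proof -
   have "t / (r\<^sup>2 + t\<^sup>2) = 2 * t / (2 * (r\<^sup>2 + t\<^sup>2))" by (simp del: distrib_left_numeral)
   also have "\<dots> <= 2 * t / (t + r)\<^sup>2"
    using r assms \<open>(t + r)\<^sup>2 <= 2 * (r\<^sup>2 + t\<^sup>2)\<close> by (intro divide_left_mono mult_pos_pos) (auto simp: add_pos_pos)
   finally show ?thesis by simp
  qed
  also have "\<dots> <= 2 * t * (1 / (min t 1)\<^sup>2 * mp 1 r)"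
   using r assms by (intro mult_left_mono inverse_sum_square_le_mp) auto
  finally show "norm (?f r) <= 2 * t * (1 / (min t 1)\<^sup>2) * mp 1 r"
   using r assms by (simp add: norm_divide norm_of_real del: of_real_divide)
 qed simp
 have l2: "integral {exp (- real n)..exp (real n)} ?f =
   of_real (arctan (exp (real n) / t) - arctan (exp (- real n) / t))" for n
 proof (rule integral_unique)
  have "((%r. t / (r\<^sup>2 + t\<^sup>2)) has_integral
   (arctan (exp (real n) / t) - arctan (exp (- real n) / t))) {exp (- real n)..exp (real n)}"
  proof (rule fundamental_theorem_of_calculus)
   fix r :: real
   have "((%r. arctan (r / t)) has_real_derivative t / (r\<^sup>2 + t\<^sup>2)) (at r within {exp (- real n)..exp (real n)})"
    using assms by (auto intro!: derivative_eq_intros simp: field_simps power2_eq_square)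
   then show "((%r. arctan (r / t)) has_vector_derivative t / (r\<^sup>2 + t\<^sup>2)) (at r within {exp (- real n)..exp (real n)})"
    by (simp add: has_real_derivative_iff_has_vector_derivative)
  qed auto
  then show "(?f has_integral of_real (arctan (exp (real n) / t) - arctan (exp (- real n) / t)))
    {exp (- real n)..exp (real n)}"
   by (rule has_integral_of_real)
 qed
 have l3: "(%n. complex_of_real (arctan (exp (real n) / t) - arctan (exp (- real n) / t))) \<longlonglongrightarrow>
   of_real (pi/2 - arctan (0 / t))"
 proof (intro tendsto_intros)
  have "LIM n sequentially. (1 / t) * exp (real n) :> at_top"
   using assms by (intro filterlim_tendsto_pos_mult_at_top[OF tendsto_const]
     filterlim_compose[OF exp_at_top filterlim_real_sequentially]) auto
  from filterlim_compose[OF tendsto_arctan_at_top this]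
  show "(%n. arctan (exp (real n) / t)) \<longlonglongrightarrow> pi / 2" by simp
  show "(%n. exp (- real n)) \<longlonglongrightarrow> 0"
   by (rule filterlim_compose[OF exp_at_bot])
    (use filterlim_real_sequentially in \<open>simp add: filterlim_uminus_at_bot\<close>)
 qed (use assms in auto)
 have "integral {0<..} ?f = of_real (pi/2 - arctan (0 / t))"
  by (rule LIMSEQ_unique[OF l1[unfolded l2] l3])
 then show ?thesis by simp
qed

text \<open>The kernel is \<open>1 / (z - t) - 1 / (z + t)\<close>. It has the residue of Cauchy's
  kernel at t but decays quadratically, so the rays may be rotated to the imaginary axis, where
  arctan evaluates the integral. The pole -t is never met because the angles stay below pi.\<close>

lemma sector_log_kernel:
 assumes t: "t > 0" and th: "0 < \<xi>" "\<xi> < pi"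
 shows "integral {0<..} (%r. 2 * of_real t / ((rcis r (-\<xi>))\<^sup>2 - (of_real t)\<^sup>2) * cis (-\<xi>))
  - integral {0<..} (%r. 2 * of_real t / ((rcis r \<xi>)\<^sup>2 - (of_real t)\<^sup>2) * cis \<xi>) = 2 * of_real pi * \<i>"
proof -
 define F :: "complex => complex" where "F z = 2 * of_real t / (z\<^sup>2 - (of_real t)\<^sup>2)" for z
 \<comment> \<open>Between a and b lie both \<xi> and pi / 2, so one bound serves the rotation in
   either direction.\<close>
 define a where "a = min \<xi> (pi/2)"
 define b where "b = max \<xi> (pi/2)"
 define k where "k = min ((1 - cos a) / 2) ((1 + cos b) / 2)"
 have ab: "0 < a" "b < pi" "a <= b" using th by (auto simp: a_def b_def min_def max_def)
 have "cos a < 1" "cos b > -1"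
  using cos_monotone_0_pi[of 0 a] cos_monotone_0_pi[of b pi] ab th by (auto simp: a_def b_def)
 then have k: "k > 0" by (simp add: k_def)
 let ?U = "- {of_real t, - of_real t :: complex}"
 have sq: "z\<^sup>2 - (of_real t)\<^sup>2 ~= 0" if "z \<in> ?U" for z :: complex
  using that by (auto simp: power2_eq_iff)
 have hol: "F holomorphic_on ?U" unfolding F_def using sq by (intro holomorphic_intros) auto
 have op: "open ?U" by (intro open_Compl finite_imp_closed) auto
 have low: "k * (t + r)\<^sup>2 <= cmod ((rcis r \<phi>)\<^sup>2 - (of_real t)\<^sup>2)" if "r > 0" "a <= \<bar>\<phi>\<bar>" "\<bar>\<phi>\<bar> <= b" for r \<phi>
  unfolding k_def using that ab t by (intro norm_sq_diff_ge) auto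
 have inU: "rcis r \<phi> \<in> ?U" if "r > 0" "a <= \<bar>\<phi>\<bar>" "\<bar>\<phi>\<bar> <= b" for r \<phi>
 proof -
  have "0 < k * (t + r)\<^sup>2" using k t that by simp
  with low[OF that] show ?thesis by (auto simp: power2_eq_iff)
 qed
 have bd: "cmod (F (rcis r \<phi>)) <= (2 * t / k * (1 / (min t 1)\<^sup>2)) * mp 1 r"
  if "r > 0" "a <= \<bar>\<phi>\<bar>" "\<bar>\<phi>\<bar> <= b" for r \<phi>
 proof -
  have "cmod (F (rcis r \<phi>)) <= 2 * t / (k * (t + r)\<^sup>2)"
   unfolding F_def norm_divide using low[OF that] t k that
   by (intro frac_le) (auto simp: norm_mult)
  also have "\<dots> = 2 * t / k * (1 / (t + r)\<^sup>2)" by simp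
  also have "\<dots> <= 2 * t / k * (1 / (min t 1)\<^sup>2 * mp 1 r)"
   using that t k by (intro mult_left_mono inverse_sum_square_le_mp) auto
  finally show ?thesis by simp
 qed
 let ?J = "%\<phi>. integral {0<..} (%r. F (rcis r \<phi>) * cis \<phi>)"
 have rot: "?J a' = ?J b'" if "a' <= b'" "!!x. a' <= x ==> x <= b' ==> a <= \<bar>x\<bar> \<and> \<bar>x\<bar> <= b" for a' b'
  using that by (intro ray_rotate[OF _ hol op inU bd]) auto
 have "?J \<xi> = ?J (pi/2)"
 proof (cases "\<xi> <= pi/2")
  case True then show ?thesis using th by (intro rot) (auto simp: a_def b_def)
 next
  case False then show ?thesis using th by (intro rot[symmetric]) (auto simp: a_def b_def)
 qed
 moreover have "?J (-\<xi>) = ?J (-(pi/2))"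
 proof (cases "\<xi> <= pi/2")
  case True then show ?thesis using th by (intro rot[symmetric]) (auto simp: a_def b_def)
 next
  case False then show ?thesis using th by (intro rot) (auto simp: a_def b_def)
 qed
 moreover have "?J (pi/2) = - (2 * \<i>) * integral {0<..} (%r. complex_of_real (t / (r\<^sup>2 + t\<^sup>2)))"
  unfolding integral_mult_right[symmetric]
 proof (rule integral_cong)
  fix r :: real assume "r \<in> {0<..}"
  have *: "(rcis r (pi/2))\<^sup>2 - (of_real t)\<^sup>2 = - of_real (r\<^sup>2 + t\<^sup>2)"
   by (simp add: rcis_def power_mult_distrib)
  then show "F (rcis r (pi/2)) * cis (pi/2) = - (2 * \<i>) * complex_of_real (t / (r\<^sup>2 + t\<^sup>2))"
   unfolding F_def * by (simp add: mult_ac del: of_real_add)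
 qed
 moreover have "?J (-(pi/2)) = (2 * \<i>) * integral {0<..} (%r. complex_of_real (t / (r\<^sup>2 + t\<^sup>2)))"
  unfolding integral_mult_right[symmetric]
 proof (rule integral_cong)
  fix r :: real assume "r \<in> {0<..}"
  have "cis (-(pi/2)) = - \<i>" by (simp add: complex_eq_iff)
  then have *: "(rcis r (-(pi/2)))\<^sup>2 - (of_real t)\<^sup>2 = - of_real (r\<^sup>2 + t\<^sup>2)" "cis (-(pi/2)) = -\<i>"
   by (simp_all add: rcis_def power_mult_distrib)
  then show "F (rcis r (-(pi/2))) * cis (-(pi/2)) = (2 * \<i>) * complex_of_real (t / (r\<^sup>2 + t\<^sup>2))"
   unfolding F_def * by (simp add: mult_ac del: of_real_add)
 qed
 ultimately show ?thesis unfolding F_def arctan_half_line[OF t] by simp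
qed

lemma norm_powr_of_real: "z ~= 0 ==> cmod (z powr of_real a) = cmod z powr a"
 by (simp add: powr_def norm_exp_eq_Re)

lemma rcis_powr:
 assumes "r > 0" "\<bar>\<xi>\<bar> < pi"
 shows "rcis r \<xi> powr of_real a = of_real (r powr a) * cis (a * \<xi>)"
proof -
 have "Ln (rcis r \<xi>) = Complex (ln r) \<xi>"
  using assms exp_rcis[of "ln r" \<xi>] by (intro Ln_unique) auto
 moreover have "rcis r \<xi> ~= 0" using assms by (simp add: rcis_def)
 ultimately have "rcis r \<xi> powr of_real a = exp (of_real a * Complex (ln r) \<xi>)"
  by (simp add: powr_def)
 also have "of_real a * Complex (ln r) \<xi> = Complex (a * ln r) (a * \<xi>)" by (simp add: complex_eq_iff)
 finally show ?thesis using assms by (simp add: exp_rcis rcis_def powr_def)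
qed

lemma powr_shift_le_mp:
 assumes "0 < s" "s < 1" "r > 0"
 shows "r powr (-s) / (r + 1) <= mp (min s (1 - s)) r"
proof (cases "r <= 1")
 case True
 have "r powr (-s) / (r + 1) <= r powr (-s) / 1" using assms by (intro divide_left_mono) auto
 also have "\<dots> <= r powr (min s (1-s) - 1)"
  using powr_mono'[of "min s (1-s) - 1" "-s" r] assms True by auto
 finally show ?thesis using mp_le_one[of r "min s (1-s)"] True assms by simp
next
 case False
 have "r powr (-s) / (r + 1) <= r powr (-s) / r" using assms by (intro divide_left_mono) auto
 also have "\<dots> = r powr (-s - 1)" using assms by (simp add: powr_diff)
 also have "\<dots> <= r powr (- min s (1-s) - 1)"
  using powr_mono[of "-s - 1" "- min s (1-s) - 1" r] assms False by auto
 finally show ?thesis using mp_ge_one[of r "min s (1-s)"] False assms by simp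
qed

text \<open>The Stieltjes constant, whose value is pi / sin (pi * s). It is divided out below to
  normalise the representing densities.\<close>

definition st :: "real => real" where
 "st s = integral {0<..} (%\<mu>. \<mu> powr (-s) / (\<mu> + 1))"

lemma st_integrable:
 assumes "0 < s" "s < 1"
 shows "(%\<mu>::real. \<mu> powr (-s) / (\<mu> + 1)) integrable_on {0<..}"
 by (rule integrable_mp[where C=1 and u="min s (1-s)"])
  (use assms powr_shift_le_mp in \<open>auto intro!: continuous_intros\<close>)

lemma st_pos:
 assumes "0 < s" "s < 1"
 shows "st s > 0"
proof -
 have sub: "{1..2} \<subseteq> {0::real<..}" by auto
 have i12: "(%\<mu>::real. \<mu> powr (-s) / (\<mu> + 1)) integrable_on {1..2}"
  by (intro integrable_continuous_real continuous_intros) auto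
 have "0 < 2 powr (-s) / (3::real)" by simp
 also have "\<dots> = integral {1..2} (%\<mu>::real. 2 powr (-s) / 3)" by simp
 also have "\<dots> <= integral {1..2} (%\<mu>::real. \<mu> powr (-s) / (\<mu> + 1))"
 proof (rule integral_le[OF _ i12])
  fix x :: real assume "x \<in> {1..2}"
  then show "2 powr (-s) / 3 <= x powr (-s) / (x + 1)"
   using assms powr_mono2'[of "-s" x 2] by (intro frac_le) auto
 qed auto
 also have "\<dots> <= st s"
  unfolding st_def by (rule integral_subset_le[OF sub i12 st_integrable[OF assms]]) auto
 finally show ?thesis .
qed

lemma stieltjes_real:
 assumes s: "0 < s" "s < 1" and \<rho>: "\<rho> > 0"
 shows "(%\<mu>. \<mu> powr (-s) / (\<mu> + \<rho>)) integrable_on {0<..}"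
  and "integral {0<..} (%\<mu>. \<mu> powr (-s) / (\<mu> + \<rho>)) = st s * \<rho> powr (-s)"
proof -
 let ?f = "%\<mu>::real. \<mu> powr (-s) / (\<mu> + \<rho>)"
 have img: "(%x. \<rho> * x) ` {0<..} = {0<..}"
  using \<rho> by (auto intro: image_eqI[of _ _ "_ / \<rho>"])
 have eq: "\<bar>\<rho>\<bar> * ?f (\<rho> * x) = \<rho> powr (-s) * (x powr (-s) / (x + 1))" if "x > 0" for x
 proof -
  have "\<rho> * x + \<rho> = \<rho> * (x + 1)" by (simp add: algebra_simps)
  then show ?thesis using that \<rho> by (simp only:) (simp add: powr_mult)
 qed
 have a: "(%x. \<bar>\<rho>\<bar> * ?f (\<rho> * x)) absolutely_integrable_on {0<..} \<and>
    integral {0<..} (%x. \<bar>\<rho>\<bar> * ?f (\<rho> * x)) = st s * \<rho> powr (-s)"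
 proof
  have i: "(%x. \<rho> powr (-s) * (x powr (-s) / (x + 1))) integrable_on {0<..}"
   by (intro integrable_on_mult_right st_integrable s)
  then have "(%x. \<bar>\<rho>\<bar> * ?f (\<rho> * x)) integrable_on {0<..}"
   by (rule integrable_eq) (use eq in auto)
  then show "(%x. \<bar>\<rho>\<bar> * ?f (\<rho> * x)) absolutely_integrable_on {0<..}"
   by (rule nonnegative_absolutely_integrable_1) (use \<rho> in auto)
  have "integral {0<..} (%x. \<bar>\<rho>\<bar> * ?f (\<rho> * x)) = integral {0<..} (%x. \<rho> powr (-s) * (x powr (-s) / (x + 1)))"
   by (rule integral_cong) (use eq in auto)
  then show "integral {0<..} (%x. \<bar>\<rho>\<bar> * ?f (\<rho> * x)) = st s * \<rho> powr (-s)"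
   unfolding st_def integral_mult_right by (simp only: mult.commute)
 qed
 have "?f absolutely_integrable_on ((%x. \<rho> * x) ` {0<..}) \<and> integral ((%x. \<rho> * x) ` {0<..}) ?f = st s * \<rho> powr (-s)"
  using \<rho> by (intro has_absolute_integral_change_of_variables_1'[where S="{0<..}" and f="?f" and g'="%_. \<rho>",
     THEN iffD1] a) (auto intro!: derivative_eq_intros inj_onI)
 then show "?f integrable_on {0<..}" "integral {0<..} ?f = st s * \<rho> powr (-s)"
  unfolding img by (auto simp: absolutely_integrable_on_def)
qed

section \<open>Stieltjes and Laplace integrals\<close>

lemma sector_pi: "sector pi = - \<real>\<^sub>\<le>\<^sub>0"
proof -
 have "z \<in> sector pi \<longleftrightarrow> z \<notin> \<real>\<^sub>\<le>\<^sub>0" for z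
 proof -
  have "z = 0 \<or> Re z <= - cmod z \<longleftrightarrow> Re z <= 0 \<and> Im z = 0"
  proof
   assume "z = 0 \<or> Re z <= - cmod z"
   moreover have "Im z = 0" if "Re z <= - cmod z"
   proof -
    have "(cmod z)\<^sup>2 <= (- Re z)\<^sup>2" using that by (intro power_mono) auto
    then show ?thesis by (simp add: cmod_power2)
   qed
   ultimately show "Re z <= 0 \<and> Im z = 0" by (auto intro: order_trans)
  next
   assume "Re z <= 0 \<and> Im z = 0"
   then show "z = 0 \<or> Re z <= - cmod z" by (simp add: cmod_eq_Re)
  qed
  then show ?thesis using sector_Re[of pi z] by (auto simp: complex_nonpos_Reals_iff)
 qed
 then show ?thesis by auto
qed

lemma sector_polar:
 assumes "z \<in> sector \<phi>"
 obtains r \<xi> where "z = rcis r \<xi>" "r > 0" "\<bar>\<xi>\<bar> < \<phi>" "\<bar>\<xi>\<bar> <= pi" "r = cmod z"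
 using assms Arg_le_pi[of z] mpi_less_Arg[of z] Arg_eq[of z]
 by (intro that[of "cmod z" "Arg z"]) (auto simp: sector_def rcis_def cis_conv_exp abs_if)

lemma sqrt_half_cos_pos: "\<bar>\<xi>\<bar> < pi ==> 0 < sqrt ((1 + cos \<xi>) / 2)"
 using cos_monotone_0_pi[of "\<bar>\<xi>\<bar>" pi] by simp

lemma norm_add_sector_ge:
 assumes "\<phi> <= pi" "z \<in> sector \<phi>" "\<nu> \<ge> 0"
 shows "sqrt ((1 + cos \<phi>) / 2) * (\<nu> + cmod z) <= cmod (of_real \<nu> + z)"
proof -
 obtain r \<xi> where z: "z = rcis r \<xi>" "r > 0" "\<bar>\<xi>\<bar> < \<phi>" "\<bar>\<xi>\<bar> <= pi" "r = cmod z"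
  using sector_polar[OF assms(2)] .
 have "cos \<phi> <= cos \<bar>\<xi>\<bar>" using z assms by (intro cos_monotone_0_pi_le) auto
 then have "sqrt ((1 + cos \<phi>) / 2) <= sqrt ((1 + cos \<xi>) / 2)" by (intro real_sqrt_le_mono) auto
 then have "sqrt ((1 + cos \<phi>) / 2) * (\<nu> + r) <= sqrt ((1 + cos \<xi>) / 2) * (\<nu> + r)"
  using z assms by (intro mult_right_mono) auto
 also have "\<dots> <= cmod (of_real \<nu> + rcis r \<xi>)" using z assms by (intro norm_add_rcis_ge) auto
 finally have "sqrt ((1 + cos \<phi>) / 2) * (\<nu> + r) <= cmod (of_real \<nu> + rcis r \<xi>)" .
 then show ?thesis using z(1,5) by metis
qed

text \<open>The path is rotated from the positive axis to the ray through v. There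
  \<open>\<mu> + v\<close> becomes \<open>(r + \<rho>) * cis \<xi>\<close>, and the integral is a
  unimodular factor times the real one. The pole -v stays outside the swept sector.\<close>

lemma stieltjes_complex:
 assumes s: "0 < s" "s < 1" and v: "v \<in> sector pi"
 shows "integral {0<..} (%\<mu>. of_real (\<mu> powr (-s)) / (of_real \<mu> + v)) = of_real (st s) * v powr of_real (-s)"
proof -
 obtain \<rho> \<xi> where v': "v = rcis \<rho> \<xi>" "\<rho> > 0" "\<bar>\<xi>\<bar> < pi"
  using sector_polar[OF v] by metis
 define F where "F z = z powr of_real (-s) / (z + v)" for z
 define k where "k = sqrt ((1 + cos \<xi>) / 2)"
 have k: "k > 0" unfolding k_def using sqrt_half_cos_pos v' by blast
 let ?U = "sector pi \<inter> - {- v}"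
 have hol: "F holomorphic_on ?U"
  unfolding F_def by (intro holomorphic_intros) (auto simp: sector_pi add_eq_0_iff2)
 have op: "open ?U" by (intro open_Int open_sector open_Compl) auto
 have low: "k * (\<rho> + r) <= cmod (rcis r \<tau> + v)" if "r > 0" "min 0 \<xi> <= \<tau>" "\<tau> <= max 0 \<xi>" for r \<tau>
 proof -
  have "rcis r \<tau> + v = cis \<xi> * (of_real \<rho> + rcis r (\<tau> - \<xi>))"
   by (simp add: v' rcis_def distrib_left cis_mult mult_ac)
  then have "cmod (rcis r \<tau> + v) = cmod (of_real \<rho> + rcis r (\<tau> - \<xi>))" by (simp add: norm_mult)
  moreover have "cos \<bar>\<xi>\<bar> <= cos \<bar>\<tau> - \<xi>\<bar>" using that v' by (intro cos_monotone_0_pi_le) auto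
  then have "k <= sqrt ((1 + cos (\<tau> - \<xi>)) / 2)" unfolding k_def by (intro real_sqrt_le_mono) auto
  then have "k * (\<rho> + r) <= sqrt ((1 + cos (\<tau> - \<xi>)) / 2) * (\<rho> + r)" using that v' by (intro mult_right_mono) auto
  moreover have "\<dots> <= cmod (of_real \<rho> + rcis r (\<tau> - \<xi>))" using that v' by (intro norm_add_rcis_ge) auto
  ultimately show ?thesis by simp
 qed
 have inU: "rcis r \<tau> \<in> ?U" if "r > 0" "min 0 \<xi> <= \<tau>" "\<tau> <= max 0 \<xi>" for r \<tau>
 proof -
  have "0 < k * (\<rho> + r)" using k v' that by simp
  with low[OF that] have "rcis r \<tau> + v ~= 0" by auto
  moreover have "rcis r \<tau> \<in> sector pi" using that v' by (intro rcis_mem_sector) auto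
  ultimately show ?thesis by (simp add: eq_neg_iff_add_eq_0)
 qed
 have bd: "cmod (F (rcis r \<tau>)) <= (1 / (k * min \<rho> 1)) * mp (min s (1 - s)) r"
  if "r > 0" "min 0 \<xi> <= \<tau>" "\<tau> <= max 0 \<xi>" for r \<tau>
 proof -
  have ne: "rcis r \<tau> ~= 0" using that by (simp add: rcis_def)
  have "min \<rho> 1 * (r + 1) <= \<rho> + r" using that v' by (auto simp: min_def algebra_simps)
  then have "k * (min \<rho> 1 * (r + 1)) <= k * (\<rho> + r)" using k by (intro mult_left_mono) auto
  then have low': "(k * min \<rho> 1) * (r + 1) <= cmod (rcis r \<tau> + v)" using low[OF that] by (simp add: mult.assoc)
  have "cmod (F (rcis r \<tau>)) = r powr (-s) / cmod (rcis r \<tau> + v)"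
   using that ne by (simp add: F_def norm_divide norm_powr_of_real del: of_real_minus) (simp add: rcis_def norm_mult)?
  also have "\<dots> <= r powr (-s) / ((k * min \<rho> 1) * (r + 1))"
  proof -
   have pos: "0 < (k * min \<rho> 1) * (r + 1)" using k v' that by simp
   then have "0 < cmod (rcis r \<tau> + v)" using low' by (rule less_le_trans)
   from mult_pos_pos[OF this pos] show ?thesis by (intro divide_left_mono low') auto
  qed
  also have "\<dots> = (1 / (k * min \<rho> 1)) * (r powr (-s) / (r + 1))" by simp
  also have "\<dots> <= (1 / (k * min \<rho> 1)) * mp (min s (1 - s)) r"
   using that s k v' by (intro mult_left_mono powr_shift_le_mp) auto
  finally show ?thesis .
 qed
 let ?J = "%\<tau>. integral {0<..} (%r. F (rcis r \<tau>) * cis \<tau>)"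
 have u: "min s (1 - s) > 0" using s by simp
 have "?J (min 0 \<xi>) = ?J (max 0 \<xi>)"
  by (rule ray_rotate[OF _ hol op inU bd u]) auto
 then have "?J 0 = ?J \<xi>" by (auto simp: min_def max_def split: if_splits)
 moreover have "?J 0 = integral {0<..} (%\<mu>. of_real (\<mu> powr (-s)) / (of_real \<mu> + v))"
 proof (rule integral_cong)
  fix r :: real assume "r \<in> {0<..}"
  then show "F (rcis r 0) * cis 0 = of_real (r powr (-s)) / (of_real r + v)"
   using rcis_powr[of r 0 "-s"] by (simp add: F_def)
 qed
 moreover have "?J \<xi> = integral {0<..} (%r. cis (- s * \<xi>) * of_real (r powr (-s) / (r + \<rho>)))"
 proof (rule integral_cong)
  fix r :: real assume r: "r \<in> {0<..}"
  have "rcis r \<xi> + v = of_real (r + \<rho>) * cis \<xi>" by (simp add: v' rcis_def algebra_simps)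
  then show "F (rcis r \<xi>) * cis \<xi> = cis (- s * \<xi>) * of_real (r powr (-s) / (r + \<rho>))"
   unfolding F_def using r v' rcis_powr[of r \<xi> "-s"] by (simp del: of_real_add)
 qed
 moreover have "((%r. complex_of_real (r powr (-s) / (r + \<rho>))) has_integral of_real (st s * \<rho> powr (-s))) {0<..}"
  using stieltjes_real[OF s v'(2)] by (intro has_integral_of_real) (simp add: has_integral_integral)
 then have "integral {0<..} (%r. cis (- s * \<xi>) * of_real (r powr (-s) / (r + \<rho>))) = cis (- s * \<xi>) * of_real (st s * \<rho> powr (-s))"
  by (intro integral_unique has_integral_mult_right)
 ultimately show ?thesis using rcis_powr[of \<rho> \<xi> "-s"] v' by (simp add: mult_ac)
qed

section \<open>Absolute integrability and Fubini's theorem\<close>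

lemma set_integrable_mp:
 fixes f :: "real => 'b::euclidean_space"
 assumes c: "continuous_on {0<..} f" and le: "!!r. r > 0 ==> norm (f r) <= C * mp u r" and u: "u > 0"
 shows "set_integrable lborel {0<..} f"
proof -
 have m: "(%r. indicator {0<..} r *\<^sub>R mp u r) \<in> borel_measurable borel"
  by (intro borel_measurable_continuous_on_indicator continuous_on_mp) auto
 have "mp u absolutely_integrable_on {0<..}"
  by (rule nonnegative_absolutely_integrable_1[OF mp_integrable[OF u]]) (simp add: mp_nonneg)
 then have "integrable lborel (%r. indicator {0<..} r *\<^sub>R mp u r)"
  unfolding set_integrable_def using m by (subst (asm) integrable_completion) auto
 then have i: "integrable lborel (%r. C * (indicator {0<..} r *\<^sub>R mp u r))" by simp
 show ?thesis
  unfolding set_integrable_def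
 proof (rule Bochner_Integration.integrable_bound[OF i])
  show "(%r. indicator {0<..} r *\<^sub>R f r) \<in> borel_measurable lborel"
   using borel_measurable_continuous_on_indicator[OF _ c] by simp
  show "AE r in lborel. norm (indicator {0<..} r *\<^sub>R f r) <= norm (C * (indicator {0<..} r *\<^sub>R mp u r))"
   using le by (auto simp: indicator_def intro!: AE_I2 order_trans[OF le abs_ge_self])
 qed
qed

text \<open>A product majorant makes f absolutely integrable on the quadrant, so the gauge integrals
  agree with Lebesgue integrals and may be exchanged.\<close>

lemma fubini_mp:
 fixes f :: "real => real => complex"
 assumes c: "continuous_on ({0<..} \<times> {0<..}) (%(x,y). f x y)"
  and le: "!!x y. x > 0 ==> y > 0 ==> cmod (f x y) <= C * mp u x * mp v y" and uv: "u > 0" "v > 0"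
 shows "integral {0<..} (%x. integral {0<..} (f x)) = integral {0<..} (%y. integral {0<..} (%x. f x y))"
proof -
 define F where "F p = indicator ({0<..} \<times> {0<..}) p *\<^sub>R (case p of (x,y) => f x y)" for p :: "real \<times> real"
 have F: "F (x,y) = indicator {0<..} x *\<^sub>R indicator {0<..} y *\<^sub>R f x y" for x y
  by (auto simp: F_def indicator_def)
 have cx: "continuous_on {0<..} (f x)" if "x > 0" for x
 proof -
  have "continuous_on {0<..} (%y. case (x,y) of (x,y) => f x y)"
   by (rule continuous_on_compose2[OF c]) (intro continuous_intros, use that in auto)
  then show ?thesis by simp
 qed
 have cy: "continuous_on {0<..} (%x. f x y)" if "y > 0" for y
 proof -
  have "continuous_on {0<..} (%x. case (x,y) of (x,y) => f x y)"
   by (rule continuous_on_compose2[OF c]) (intro continuous_intros, use that in auto)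
  then show ?thesis by simp
 qed
 have Fm: "F \<in> borel_measurable (lborel \<Otimes>\<^sub>M lborel)"
 proof -
  have "F \<in> borel_measurable borel" unfolding F_def
   by (rule borel_measurable_continuous_on_indicator[OF _ c]) (auto intro!: borel_open open_Times)
  then show ?thesis by (simp add: lborel_prod)
 qed
 have sx: "set_integrable lborel {0<..} (f x)" if "x > 0" for x
  by (rule set_integrable_mp[OF cx[OF that] le[OF that] uv(2)])
 have sy: "set_integrable lborel {0<..} (%x. f x y)" if "y > 0" for y
  by (rule set_integrable_mp[where C="C * mp v y", OF cy[OF that] _ uv(1)])
   (use le that in \<open>simp add: mult_ac\<close>)
 have mpi: "integrable lborel (%y. indicator {0<..} y *\<^sub>R mp w y)" if "w > 0" for w
  using set_integrable_mp[OF continuous_on_mp, of w 1 w] that mp_nonneg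
  by (simp add: set_integrable_def)
 have Fi: "integrable lborel (%y. F (x,y))" for x
  using sx[of x] by (cases "x > 0") (auto simp: F set_integrable_def)
 have C0: "C \<ge> 0" using order_trans[OF norm_ge_zero le[of 1 1]] by (simp add: mp_def)
 have "integrable (lborel \<Otimes>\<^sub>M lborel) F"
 proof (rule lborel_pair.Fubini_integrable[OF Fm])
  show "AE x in lborel. integrable lborel (%y. F (x, y))" using Fi by simp
  let ?g = "%x. C * (indicator {0<..} x *\<^sub>R mp u x) * (LINT y|lborel. indicator {0<..} y *\<^sub>R mp v y)"
  have gi: "integrable lborel ?g" using mpi[OF uv(1)] by simp
  show "integrable lborel (%x. \<integral> y. norm (F (x, y)) \<partial>lborel)"
  proof (rule Bochner_Integration.integrable_bound[OF gi])
   show "(%x. \<integral> y. norm (F (x, y)) \<partial>lborel) \<in> borel_measurable lborel"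
    using Fm by (intro lborel.borel_measurable_lebesgue_integral) (simp add: case_prod_beta')
   have "norm (\<integral> y. norm (F (x, y)) \<partial>lborel) <= norm (?g x)" for x
   proof -
    have "(\<integral> y. norm (F (x, y)) \<partial>lborel) <= (\<integral> y. C * (indicator {0<..} x *\<^sub>R mp u x) * (indicator {0<..} y *\<^sub>R mp v y) \<partial>lborel)"
    proof (rule integral_mono)
     show "integrable lborel (%y. norm (F (x, y)))" using Fi by simp
     show "integrable lborel (%y. C * (indicator {0<..} x *\<^sub>R mp u x) * (indicator {0<..} y *\<^sub>R mp v y))"
      using mpi[OF uv(2)] by simp
     show "norm (F (x, y)) <= C * (indicator {0<..} x *\<^sub>R mp u x) * (indicator {0<..} y *\<^sub>R mp v y)" for y
      using le[of x y] by (auto simp: F indicator_def)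
    qed
    also have "\<dots> = ?g x" by simp
    finally have "(\<integral> y. norm (F (x, y)) \<partial>lborel) <= ?g x" .
    moreover have "0 <= (\<integral> y. norm (F (x, y)) \<partial>lborel)" by (rule integral_nonneg_AE) simp
    ultimately show ?thesis by simp
   qed
   then show "AE x in lborel. norm (\<integral> y. norm (F (x, y)) \<partial>lborel) <= norm (?g x)" by simp
  qed
 qed
 then have int: "integrable (lborel \<Otimes>\<^sub>M lborel) (%(x,y). F (x,y))" by simp
 have swap: "(\<integral>y. (\<integral>x. F (x,y) \<partial>lborel) \<partial>lborel) = (\<integral>x. (\<integral>y. F (x,y) \<partial>lborel) \<partial>lborel)"
  using lborel_pair.Fubini_integral[OF int] by simp
 have ix: "(\<integral>y. F (x,y) \<partial>lborel) = indicator {0<..} x *\<^sub>R integral {0<..} (f x)" for x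
 proof (cases "x > 0")
  case True then show ?thesis
   using set_borel_integral_eq_integral(2)[OF sx[OF True]] by (simp add: F set_lebesgue_integral_def)
 qed (simp add: F)
 have iy: "(\<integral>x. F (x,y) \<partial>lborel) = indicator {0<..} y *\<^sub>R integral {0<..} (%x. f x y)" for y
 proof (cases "y > 0")
  case True then show ?thesis
   using set_borel_integral_eq_integral(2)[OF sy[OF True]] by (simp add: F set_lebesgue_integral_def)
 qed (simp add: F)
 have "integrable lborel (%x. \<integral>y. F (x,y) \<partial>lborel)"
  using lborel_pair.integrable_fst'[OF int] by simp
 then have "set_integrable lborel {0<..} (%x. integral {0<..} (f x))"
  unfolding set_integrable_def ix .
 from set_borel_integral_eq_integral(2)[OF this]
 have 1: "integral {0<..} (%x. integral {0<..} (f x)) = (\<integral>x. (\<integral>y. F (x,y) \<partial>lborel) \<partial>lborel)"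
  unfolding ix by (simp add: set_lebesgue_integral_def)
 have "integrable lborel (%y. \<integral>x. F (x,y) \<partial>lborel)"
  using lborel_pair.integrable_snd[OF int] by simp
 then have "set_integrable lborel {0<..} (%y. integral {0<..} (%x. f x y))"
  unfolding set_integrable_def iy .
 from set_borel_integral_eq_integral(2)[OF this]
 have 2: "integral {0<..} (%y. integral {0<..} (%x. f x y)) = (\<integral>y. (\<integral>x. F (x,y) \<partial>lborel) \<partial>lborel)"
  unfolding iy by (simp add: set_lebesgue_integral_def)
 show ?thesis using 1 2 swap by simp
qed

section \<open>Differentiation of Laplace integrals along a ray\<close>

lemma exp_decay_mp:
 assumes "\<eta> > 0" "t \<ge> 0"
 obtains C where "C > 0" "!!r. r > 0 ==> (1 + t + r)\<^sup>2 * exp (- \<eta> * r) <= C * mp 1 r"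
proof -
 \<comment> \<open>With x = 1 + t + r, the fourth power of
   \<open>\<eta> * x / 4 <= exp (\<eta> * x / 4)\<close> gives
   \<open>x^4 <= (4 / \<eta>)^4 * exp (\<eta> * x)\<close>: two powers for the weight and two for
   the decay in r.\<close>
 define C where "C = (4/\<eta>)^4 * exp (\<eta> * (1 + t))"
 show thesis
 proof
  show "C > 0" using assms by (simp add: C_def)
  fix r :: real assume r: "r > 0"
  define x where "x = 1 + t + r"
  have "\<eta> * x / 4 <= exp (\<eta> * x / 4)" using exp_ge_add_one_self[of "\<eta> * x / 4"] by linarith
  then have "(\<eta> * x / 4)^4 <= exp (\<eta> * x / 4)^4" using assms r by (intro power_mono) (auto simp: x_def)
  also have "\<dots> = exp (\<eta> * x)" by (simp flip: exp_of_nat_mult)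
  finally have "x^4 <= (4/\<eta>)^4 * exp (\<eta> * x)"
   using assms by (simp add: power_mult_distrib power_divide field_simps)
  also have "\<dots> = C * exp (\<eta> * r)" by (simp add: C_def x_def distrib_left exp_add)
  finally have x4: "x^4 * exp (- \<eta> * r) <= C" by (simp add: exp_minus field_simps)
  have "(1 + r)\<^sup>2 <= x\<^sup>2" using assms r by (intro power_mono) (auto simp: x_def)
  then have "x\<^sup>2 * (1 + r)\<^sup>2 <= x\<^sup>2 * x\<^sup>2" by (intro mult_left_mono) auto
  also have "\<dots> = x^4" by (simp flip: power_add)
  finally have "x\<^sup>2 * (1 + r)\<^sup>2 * exp (- \<eta> * r) <= x^4 * exp (- \<eta> * r)"
   by (intro mult_right_mono) auto
  then have "x\<^sup>2 * (1 + r)\<^sup>2 * exp (- \<eta> * r) <= C" using x4 by linarith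
  then have "x\<^sup>2 * exp (- \<eta> * r) <= C * (1 / (1 + r)\<^sup>2)" using r by (simp add: field_simps)
  also have "\<dots> <= C * mp 1 r" using \<open>C > 0\<close> r by (intro mult_left_mono inverse_square_le_mp) auto
  finally show "(1 + t + r)\<^sup>2 * exp (- \<eta> * r) <= C * mp 1 r" by (simp add: x_def)
 qed
qed

lemma norm_exp_second_order: "cmod (exp z - 1 - z) <= (cmod z)\<^sup>2 * exp (cmod z)"
proof -
 have "cmod (exp z - (\<Sum>i\<le>Suc 0. z ^ i / fact i)) <= exp \<bar>Re z\<bar> * cmod z ^ Suc (Suc 0) / fact (Suc 0)"
  by (rule Taylor_exp)
 moreover have "exp \<bar>Re z\<bar> * cmod z ^ Suc (Suc 0) <= exp (cmod z) * cmod z ^ Suc (Suc 0)"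
  by (intro mult_right_mono) (auto simp: abs_Re_le_cmod)
 ultimately show ?thesis by (simp add: power2_eq_square mult_ac diff_diff_add)
qed

text \<open>The gap \<open>Re (p * d) - w\<close> is split into halves: one pays for
  \<open>exp (h * (t + r))\<close>, the room needed to vary p by h, the other for the
  majorant.\<close>

lemma laplace_kernel_bound:
 assumes d: "cmod d = 1" and t: "t \<ge> 0" and p: "Re (p * d) > w" and M: "M \<ge> 0"
 obtains C \<eta> where "C > 0" "\<eta> > 0" "!!r a h. r > 0 ==> cmod a <= M * exp (w * r) ==> 0 <= h ==> h <= \<eta> ==>
  cmod (a * exp (p * (of_real t - of_real r * d))) * (1 + t + r)\<^sup>2 * exp (h * (t + r)) <= C * mp 1 r"
proof -
 define \<eta> where "\<eta> = (Re (p * d) - w) / 2"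
 have eta: "\<eta> > 0" using p by (simp add: \<eta>_def)
 obtain C where C: "C > 0" "!!r. r > 0 ==> (1 + t + r)\<^sup>2 * exp (- \<eta> * r) <= C * mp 1 r"
  using exp_decay_mp[OF eta t] by blast
 define K where "K = (M + 1) * exp (Re p * t + \<eta> * t)"
 show thesis
 proof
  show "K * C > 0" using C M by (simp add: K_def)
  show "\<eta> > 0" by (rule eta)
  fix r h :: real and a assume r: "r > 0" and a: "cmod a <= M * exp (w * r)" and h: "0 <= h" "h <= \<eta>"
  have "Re (p * (of_real t - of_real r * d)) = Re p * t - r * Re (p * d)"
   by (simp add: algebra_simps)
  then have "cmod (a * exp (p * (of_real t - of_real r * d))) = cmod a * exp (Re p * t - r * Re (p * d))"
   by (simp add: norm_mult norm_exp_eq_Re)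
  also have "\<dots> <= ((M + 1) * exp (w * r)) * exp (Re p * t - r * Re (p * d))"
   using a by (intro mult_right_mono) (auto simp: distrib_right intro: order_trans)
  also have "\<dots> = (M + 1) * exp (Re p * t) * exp (- (2 * \<eta>) * r)"
  proof -
   obtain D where D: "Re (p * d) = D" by simp
   have "w * r + (Re p * t - r * D) = Re p * t + - (2 * \<eta>) * r"
    unfolding \<eta>_def D by (simp add: field_simps)
   then show ?thesis unfolding D by (simp only: mult.assoc flip: exp_add)
  qed
  finally have 1: "cmod (a * exp (p * (of_real t - of_real r * d))) <= (M + 1) * exp (Re p * t) * exp (- (2 * \<eta>) * r)" .
  have 2: "exp (h * (t + r)) <= exp (\<eta> * (t + r))" using h t r by (simp add: mult_right_mono)
  have "cmod (a * exp (p * (of_real t - of_real r * d))) * exp (h * (t + r)) <=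
   ((M + 1) * exp (Re p * t) * exp (- (2 * \<eta>) * r)) * exp (\<eta> * (t + r))"
   using M by (intro mult_mono 1 2) auto
  also have "\<dots> = K * exp (- \<eta> * r)"
   by (simp add: K_def mult.assoc flip: exp_add) (simp add: algebra_simps)
  finally have "(cmod (a * exp (p * (of_real t - of_real r * d))) * exp (h * (t + r))) * (1 + t + r)\<^sup>2
    <= (K * exp (- \<eta> * r)) * (1 + t + r)\<^sup>2" by (intro mult_right_mono) auto
  also have "\<dots> = K * ((1 + t + r)\<^sup>2 * exp (- \<eta> * r))" by simp
  also have "\<dots> <= K * (C * mp 1 r)" using C(2)[OF r] M by (intro mult_left_mono) (auto simp: K_def)
  finally show "cmod (a * exp (p * (of_real t - of_real r * d))) * (1 + t + r)\<^sup>2 * exp (h * (t + r)) <= K * C * mp 1 r"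
   by (simp add: mult_ac)
 qed
qed

text \<open>Differentiation under the integral: the second-order bound for exp shows that the
  difference quotient misses the formal derivative by at most \<open>cmod h * K\<close>.\<close>

lemma laplace_deriv:
 fixes a :: "real => complex"
 assumes a: "continuous_on {0<..} a" "!!r. r > 0 ==> cmod (a r) <= M * exp (w * r)"
  and d: "cmod d = 1" and t: "t \<ge> 0" and p: "Re (p * d) > w"
 shows "((%p. integral {0<..} (%r. a r * exp (p * (of_real t - of_real r * d)))) has_field_derivative
  integral {0<..} (%r. a r * (of_real t - of_real r * d) * exp (p * (of_real t - of_real r * d)))) (at p)"
proof -
 define b where "b r = of_real t - of_real r * d" for r
 have M: "M \<ge> 0"
  using order_trans[OF norm_ge_zero a(2)[of 1]] by (simp add: zero_le_mult_iff)
 have bn: "cmod (b r) <= t + r" if "r > 0" for r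
  using norm_triangle_ineq4[of "of_real t" "of_real r * d"] that t d by (simp add: b_def norm_mult)
 have bc: "continuous_on S b" for S unfolding b_def by (intro continuous_intros)
 obtain C \<eta> where C: "C > 0" "\<eta> > 0" and B: "!!r a h. r > 0 ==> cmod a <= M * exp (w * r) ==> 0 <= h ==> h <= \<eta> ==>
  cmod (a * exp (p * b r)) * (1 + t + r)\<^sup>2 * exp (h * (t + r)) <= C * mp 1 r"
  using laplace_kernel_bound[OF d t p M] unfolding b_def by blast
 have sq: "1 <= (1 + t + r)\<^sup>2" "(t + r) <= (1 + t + r)\<^sup>2" "(t + r)\<^sup>2 <= (1 + t + r)\<^sup>2" if "r > 0" for r
  using t that by (auto simp: power2_eq_square algebra_simps intro!: add_nonneg_nonneg)
 have key: "cmod (a r * exp (p * b r)) * x * exp (h * (t + r)) <= C * mp 1 r"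
  if "r > 0" "0 <= h" "h <= \<eta>" "x <= (1 + t + r)\<^sup>2" for r h x
 proof -
  have "cmod (a r * exp (p * b r)) * x * exp (h * (t + r)) <= cmod (a r * exp (p * b r)) * (1 + t + r)\<^sup>2 * exp (h * (t + r))"
   using that by (intro mult_right_mono mult_left_mono) auto
  also have "\<dots> <= C * mp 1 r" using that by (intro B a(2)) auto
  finally show ?thesis .
 qed
 let ?f = "%q r. a r * exp (q * b r)"
 let ?g = "%r. a r * b r * exp (p * b r)"
 have fi: "?f (p + h) integrable_on {0<..}" if "cmod h <= \<eta>" for h
 proof (rule integrable_mp[where C=C and u=1])
  show "continuous_on {0<..} (?f (p + h))" by (intro continuous_intros a bc)
  fix r :: real assume r: "r > 0"
  have "cmod (?f (p + h) r) = cmod (a r * exp (p * b r)) * cmod (exp (h * b r))"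
   by (simp add: norm_mult distrib_right exp_add)
  also have "\<dots> <= cmod (a r * exp (p * b r)) * exp (cmod h * (t + r))"
  proof (intro mult_left_mono)
   have "cmod (exp (h * b r)) <= exp (cmod (h * b r))"
    unfolding norm_exp_eq_Re by (simp only: exp_le_cancel_iff complex_Re_le_cmod)
   also have "\<dots> <= exp (cmod h * (t + r))" using bn[OF r] by (simp add: norm_mult mult_left_mono)
   finally show "cmod (exp (h * b r)) <= exp (cmod h * (t + r))" .
  qed auto
  also have "\<dots> <= C * mp 1 r" using key[OF r _ that sq(1)[OF r]] by simp
  finally show "norm (?f (p + h) r) <= C * mp 1 r" .
 qed simp
 have gi: "?g integrable_on {0<..}"
 proof (rule integrable_mp[where C=C and u=1])
  show "continuous_on {0<..} ?g" by (intro continuous_intros a bc)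
  fix r :: real assume r: "r > 0"
  have "cmod (?g r) = cmod (a r * exp (p * b r)) * cmod (b r)" by (simp add: norm_mult)
  also have "\<dots> <= C * mp 1 r"
   using key[OF r, of 0 "cmod (b r)"] C order_trans[OF bn[OF r] sq(2)[OF r]] by simp
  finally show "norm (?g r) <= C * mp 1 r" .
 qed simp
 let ?J = "%q. integral {0<..} (?f q)"
 define K where "K = C * integral {0<..} (mp 1)"
 have est: "cmod ((?J (p + h) - ?J p) / h - integral {0<..} ?g) <= cmod h * K" if h: "h ~= 0" "cmod h <= \<eta>" for h
 proof -
  let ?e = "%r. ?f (p + h) r - ?f p r - h * ?g r"
  have fp: "?f p integrable_on {0<..}" using fi[of 0] C by simp
  have ei: "?J (p + h) - ?J p - h * integral {0<..} ?g = integral {0<..} ?e"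
   using fi[OF h(2)] fp gi by (simp add: integral_diff integrable_diff integrable_on_mult_right)
  have "cmod (integral {0<..} ?e) <= ((cmod h)\<^sup>2 * C) * integral {0<..} (mp 1)"
  proof (rule norm_integral_mp_le)
   show "continuous_on {0<..} ?e" by (intro continuous_intros a bc)
   fix r :: real assume r: "r > 0"
   have "?e r = a r * exp (p * b r) * (exp (h * b r) - 1 - h * b r)"
    by (simp add: distrib_right exp_add algebra_simps)
   then have "cmod (?e r) <= cmod (a r * exp (p * b r)) * ((cmod (h * b r))\<^sup>2 * exp (cmod (h * b r)))"
    by (simp only: norm_mult[of "a r * exp (p * b r)"]) (intro mult_left_mono norm_exp_second_order; simp)
   also have "\<dots> <= cmod (a r * exp (p * b r)) * (((cmod h)\<^sup>2 * (1 + t + r)\<^sup>2) * exp (cmod h * (t + r)))"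
   proof (intro mult_left_mono mult_mono)
    have "(cmod (b r))\<^sup>2 <= (1 + t + r)\<^sup>2"
     using bn[OF r] by (intro power_mono) auto
    then show "(cmod (h * b r))\<^sup>2 <= (cmod h)\<^sup>2 * (1 + t + r)\<^sup>2"
     by (simp add: norm_mult power_mult_distrib mult_left_mono)
    show "exp (cmod (h * b r)) <= exp (cmod h * (t + r))" using bn[OF r] by (simp add: norm_mult mult_left_mono)
   qed auto
   also have "\<dots> = (cmod h)\<^sup>2 * (cmod (a r * exp (p * b r)) * (1 + t + r)\<^sup>2 * exp (cmod h * (t + r)))"
    by (simp add: mult_ac)
   also have "\<dots> <= (cmod h)\<^sup>2 * (C * mp 1 r)"
    using key[OF r _ h(2) order_refl] by (intro mult_left_mono) auto
   finally show "norm (?e r) <= ((cmod h)\<^sup>2 * C) * mp 1 r" by (simp add: mult_ac)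
  qed simp
  then have "cmod (?J (p + h) - ?J p - h * integral {0<..} ?g) <= (cmod h)\<^sup>2 * K"
   unfolding ei K_def by (simp add: mult_ac)
  moreover have "(?J (p + h) - ?J p) / h - integral {0<..} ?g = (?J (p + h) - ?J p - h * integral {0<..} ?g) / h"
   using h by (simp add: field_simps)
  ultimately show ?thesis using h by (simp add: norm_divide divide_le_eq power2_eq_square mult_ac)
 qed
 have "((%h. (?J (p + h) - ?J p) / h - integral {0<..} ?g) \<longlongrightarrow> 0) (at 0)"
 proof (rule Lim_null_comparison)
  have "eventually (%h. h \<in> ball 0 \<eta> - {0}) (at (0::complex))"
   using C by (intro eventually_at_in_open) auto
  then show "\<forall>\<^sub>F h in at 0. cmod ((?J (p + h) - ?J p) / h - integral {0<..} ?g) <= cmod h * K"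
   by eventually_elim (use est in \<open>auto simp: dist_norm\<close>)
  have "((%h::complex. cmod h * K) \<longlongrightarrow> cmod 0 * K) (at 0)" by (intro tendsto_intros)
  then show "((%h::complex. cmod h * K) \<longlongrightarrow> 0) (at 0)" by simp
 qed
 then have "((%h. (?J (p + h) - ?J p) / h) \<longlongrightarrow> integral {0<..} ?g) (at 0)" by (rule LIM_zero_cancel)
 then show ?thesis unfolding DERIV_def b_def .
qed

section \<open>The functional calculus\<close>

text \<open>This is \<open>(\<nu> + A)^(-1)\<close>; for \<nu> > 0 it exists by sectoriality,
  whatever the angle.\<close>

definition pres :: "'a::complex_banach lop => real => 'a \<Rightarrow>\<^sub>L 'a" where
 "pres A \<nu> = - resolvent A (- of_real \<nu>)"

lemma rcis_pi_neg: "rcis r pi = - of_real r" "rcis r (-pi) = - of_real r"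
 by (simp_all add: rcis_def complex_eq_iff)

lemma sectorial_linear: "sectorial_of_angle \<omega> A ==> linear_operator A"
 by (simp add: sectorial_of_angle_def)

lemma sectorial_angle: "sectorial_of_angle \<omega> A ==> 0 < \<omega> \<and> \<omega> < pi"
 by (simp add: sectorial_of_angle_def)

lemma neg_real_resolvent_set:
 assumes "sectorial A" "\<nu> > 0"
 shows "- of_real \<nu> \<in> resolvent_set A"
proof -
 obtain \<omega> where w: "sectorial_of_angle \<omega> A" using assms by (auto simp: sectorial_def)
 have "rcis \<nu> pi \<in> resolvent_set A"
  using sectorial_angle[OF w] assms by (intro sectorial_resolvent_set[OF w]) auto
 then show ?thesis by (simp add: rcis_pi_neg)
qed

lemma sectorial_linear': "sectorial A ==> linear_operator A"
 by (auto simp: sectorial_def sectorial_linear)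

lemma pres_bound:
 assumes "sectorial A"
 obtains M where "M > 0" "!!\<nu>. \<nu> > 0 ==> norm (pres A \<nu>) <= M / \<nu>"
proof -
 obtain \<omega> where w: "sectorial_of_angle \<omega> A" using assms by (auto simp: sectorial_def)
 obtain M where M: "M > 0"
  "!!r \<xi>'. r > 0 ==> pi <= \<bar>\<xi>'\<bar> ==> \<bar>\<xi>'\<bar> <= pi ==> norm (resolvent A (rcis r \<xi>')) <= M / r"
  using sectorial_resolvent_bound[OF w, of pi] sectorial_angle[OF w] by metis
 show thesis
  by (rule that[OF M(1)]) (use M(2)[of _ pi] in \<open>simp add: pres_def rcis_pi_neg\<close>)
qed

lemma pres_clinear: "sectorial A ==> \<nu> > 0 ==> pres A \<nu> \<in> clinear_ops"
 unfolding pres_def by (intro clinear_ops_intros resolvent_clinear neg_real_resolvent_set)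

lemma continuous_on_pres:
 assumes "sectorial A" "continuous_on S \<nu>" "!!x. x \<in> S ==> \<nu> x > 0"
 shows "continuous_on S (%x. pres A (\<nu> x))"
 unfolding pres_def using assms
 by (intro continuous_intros sectorial_linear') (auto intro: neg_real_resolvent_set)

lemma pres_in:
 assumes "sectorial A" "\<nu> > 0"
 shows "(pres A \<nu> x, x - \<nu> *\<^sub>R pres A \<nu> x) \<in> A"
proof -
 have "(resolvent A (- of_real \<nu>) x,
   (- of_real \<nu>) *\<^sub>C resolvent A (- of_real \<nu>) x - x) \<in> A"
  by (rule resolvent_in[OF neg_real_resolvent_set[OF assms]])
 from linear_operatorD(2)[OF sectorial_linear'[OF assms(1)] this, of "-1"]
 show ?thesis
  by (simp add: pres_def blinfun.minus_left scaleC_minus_left scaleC_diff_right scaleC_scaleC scaleC_of_real add.commute)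
qed

lemma pres_left:
 assumes "sectorial A" "\<nu> > 0" "(u,v) \<in> A"
 shows "pres A \<nu> (\<nu> *\<^sub>R u + v) = u"
proof -
 have "resolvent A (- of_real \<nu>) ((- of_real \<nu>) *\<^sub>C u - v) = u"
  by (rule resolvent_left[OF neg_real_resolvent_set[OF assms(1,2)] assms(3)])
 then have "resolvent A (- of_real \<nu>) (- (\<nu> *\<^sub>R u + v)) = u"
  by (simp add: scaleC_minus_left scaleC_of_real)
 then show ?thesis by (simp add: pres_def blinfun.minus_left blinfun.minus_right del: minus_add_distrib)
qed

section \<open>Sector integrals tested with functionals\<close>

lemma compose_right_functional:
 fixes \<phi> :: "('a::complex_banach \<Rightarrow>\<^sub>L 'a) \<Rightarrow>\<^sub>L complex"
 assumes "\<phi> \<in> clinear_ops"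
 obtains \<psi> :: "('a \<Rightarrow>\<^sub>L 'a) \<Rightarrow>\<^sub>L complex"
 where "\<psi> \<in> clinear_ops" "!!B. \<psi> B = \<phi> (B o\<^sub>L W)"
proof -
 have bl: "bounded_linear (%B. \<phi> (B o\<^sub>L W))"
  by (intro bounded_linear_compose[OF blinfun.bounded_linear_right]
    bounded_bilinear.bounded_linear_left[OF bounded_bilinear_blinfun_compose])
 show thesis
  by (rule that[of "Blinfun (%B. \<phi> (B o\<^sub>L W))"])
   (simp_all add: bounded_linear_Blinfun_apply[OF bl] clinear_ops_def scaleC_compose_left
    clinear_opsD[OF assms, simplified])
qed

lemma compose_left_functional:
 fixes \<phi> :: "('a::complex_banach \<Rightarrow>\<^sub>L 'a) \<Rightarrow>\<^sub>L complex"
 assumes "\<phi> \<in> clinear_ops" "W \<in> clinear_ops"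
 obtains \<psi> :: "('a \<Rightarrow>\<^sub>L 'a) \<Rightarrow>\<^sub>L complex"
 where "\<psi> \<in> clinear_ops" "!!B. \<psi> B = \<phi> (W o\<^sub>L B)"
proof -
 have bl: "bounded_linear (%B. \<phi> (W o\<^sub>L B))"
  by (intro bounded_linear_compose[OF blinfun.bounded_linear_right]
    bounded_bilinear.bounded_linear_right[OF bounded_bilinear_blinfun_compose])
 show thesis
  by (rule that[of "Blinfun (%B. \<phi> (W o\<^sub>L B))"])
   (simp_all add: bounded_linear_Blinfun_apply[OF bl] clinear_ops_def scaleC_compose_right[OF assms(2)]
    clinear_opsD[OF assms(1), simplified])
qed

definition ray_admissible :: "real => (complex => complex) => bool" where
 "ray_admissible \<xi> h \<longleftrightarrow> (\<exists>C u. u > 0 \<and> (\<forall>\<tau>\<in>{\<xi>, -\<xi>}. continuous_on {0<..} (%r. h (rcis r \<tau>)) \<and>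
  (\<forall>r>0. cmod (h (rcis r \<tau>)) <= C * mp u r)))"

text \<open>The image of \<open>sector_integral\<close> under a functional, by
  \<open>functional_sector_integral\<close>; deformations of the contour happen on this scalar
  level.\<close>

definition scalar_sector_integral :: "real => (complex => complex) => complex" where
 "scalar_sector_integral \<xi> h = 1 / (2 * of_real pi * \<i>) *
  (integral {0<..} (%r. h (rcis r (-\<xi>)) * cis (-\<xi>)) - integral {0<..} (%r. h (rcis r \<xi>) * cis \<xi>))"

lemma ray_admissibleI:
 assumes "u > 0" "!!\<tau>. \<bar>\<tau>\<bar> = \<bar>\<xi>\<bar> ==> continuous_on {0<..} (%r. h (rcis r \<tau>))"
  and "!!\<tau> r. \<bar>\<tau>\<bar> = \<bar>\<xi>\<bar> ==> r > 0 ==> cmod (h (rcis r \<tau>)) <= C * mp u r"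
 shows "ray_admissible \<xi> h"
proof -
 have "\<forall>\<tau>\<in>{\<xi>, -\<xi>}. continuous_on {0<..} (%r. h (rcis r \<tau>)) \<and>
  (\<forall>r>0. cmod (h (rcis r \<tau>)) <= C * mp u r)"
  using assms(2,3) by auto
 with assms(1) show ?thesis unfolding ray_admissible_def by blast
qed

lemma ray_admissible_cmul:
 assumes "ray_admissible \<xi> h"
 shows "ray_admissible \<xi> (%z. c * h z)"
proof -
 obtain C u where a: "u > 0" "!!\<tau>. \<tau> \<in> {\<xi>, -\<xi>} ==> continuous_on {0<..} (%r. h (rcis r \<tau>))"
  "!!\<tau> r. \<tau> \<in> {\<xi>, -\<xi>} ==> r > 0 ==> cmod (h (rcis r \<tau>)) <= C * mp u r"
  using assms unfolding ray_admissible_def by metis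
 show ?thesis
 proof (rule ray_admissibleI[of u _ _ "cmod c * C"])
  fix \<tau> assume "\<bar>\<tau>\<bar> = \<bar>\<xi>\<bar>"
  then have t: "\<tau> \<in> {\<xi>, -\<xi>}" by auto
  show "continuous_on {0<..} (%r. c * h (rcis r \<tau>))" using a(2)[OF t] by (intro continuous_on_mult_left)
  show "cmod (c * h (rcis r \<tau>)) <= cmod c * C * mp u r" if "r > 0" for r
   using a(3)[OF t that] unfolding norm_mult mult.assoc by (rule mult_left_mono) simp
 qed (rule a(1))
qed

lemma ray_admissible_integrable:
 assumes "ray_admissible \<xi> h" "\<tau> \<in> {\<xi>, -\<xi>}"
 shows "(%r. h (rcis r \<tau>) * cis \<tau>) integrable_on {0<..}"
proof -
 obtain C u where "u > 0" "continuous_on {0<..} (%r. h (rcis r \<tau>))"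
  "!!r. r > 0 ==> cmod (h (rcis r \<tau>)) <= C * mp u r"
  using assms unfolding ray_admissible_def by metis
 then show ?thesis
  by (intro integrable_mp[where C=C and u=u] continuous_intros) (auto simp: norm_mult)
qed

lemma scalar_sector_integral_diff:
 assumes "ray_admissible \<xi> h" "ray_admissible \<xi> h'"
 shows "scalar_sector_integral \<xi> (%z. h z - h' z) = scalar_sector_integral \<xi> h - scalar_sector_integral \<xi> h'"
 using ray_admissible_integrable[OF assms(1)] ray_admissible_integrable[OF assms(2)]
 unfolding scalar_sector_integral_def by (simp add: left_diff_distrib integral_diff diff_divide_distrib)

lemma scalar_sector_integral_add:
 assumes "ray_admissible \<xi> h" "ray_admissible \<xi> h'"
 shows "scalar_sector_integral \<xi> (%z. h z + h' z) = scalar_sector_integral \<xi> h + scalar_sector_integral \<xi> h'"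
 using ray_admissible_integrable[OF assms(1)] ray_admissible_integrable[OF assms(2)]
 unfolding scalar_sector_integral_def
 by (simp add: distrib_right integral_add diff_divide_distrib add_divide_distrib)

lemma scalar_sector_integral_cmul:
 "scalar_sector_integral \<xi> (%z. c * h z) = c * scalar_sector_integral \<xi> h"
 unfolding scalar_sector_integral_def by (simp add: mult.assoc right_diff_distrib)

text \<open>Nothing singular lies in the sector, so the lower ray can be rotated through the
  positive axis onto the upper ray.\<close>

lemma scalar_sector_integral_zero:
 assumes "0 <= \<xi>" "\<xi> < \<phi>" "\<phi> <= pi" "h holomorphic_on sector \<phi>" "u > 0"
  and "!!z. z \<in> sector \<phi> ==> cmod (h z) <= C * mp u (cmod z)"
 shows "scalar_sector_integral \<xi> h = 0"
proof -
 have "integral {0<..} (%r. h (rcis r (-\<xi>)) * cis (-\<xi>)) = integral {0<..} (%r. h (rcis r \<xi>) * cis \<xi>)"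
 proof (rule ray_rotate[OF _ assms(4) _ _ _ assms(5)])
  show "open (sector \<phi>)" using assms by (intro open_sector) auto
  show mem: "rcis r \<tau> \<in> sector \<phi>" if "r > 0" "-\<xi> <= \<tau>" "\<tau> <= \<xi>" for r \<tau>
   using that assms by (intro rcis_mem_sector) auto
  show "cmod (h (rcis r \<tau>)) <= C * mp u r" if "r > 0" "-\<xi> <= \<tau>" "\<tau> <= \<xi>" for r \<tau>
   using assms(6)[OF mem[OF that]] that by (simp add: rcis_def norm_mult)
 qed (use assms in auto)
 then show ?thesis by (simp add: scalar_sector_integral_def)
qed

lemma H0_inftyE:
 assumes "g \<in> H0_infty \<phi>"
 obtains C s where "g holomorphic_on sector \<phi>" "C \<ge> 0" "s > 0"
  "!!z. z \<in> sector \<phi> ==> cmod (g z) <= C * (cmod z * mp s (cmod z))"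
proof -
 obtain C s where *: "g holomorphic_on sector \<phi>" "s > 0"
  "!!z. z \<in> sector \<phi> ==> cmod (g z) <= C * min (cmod z powr s) (cmod z powr (- s))"
  using assms by (auto simp: H0_infty_def)
 show thesis
 proof (rule that[of "max C 0" s])
  fix z assume z: "z \<in> sector \<phi>"
  then have "cmod z * mp s (cmod z) = min (cmod z powr s) (cmod z powr (- s))"
   by (simp add: mp_def sector_def)
  moreover have "C * min (cmod z powr s) (cmod z powr (- s)) <= max C 0 * min (cmod z powr s) (cmod z powr (- s))"
   by (intro mult_right_mono) auto
  ultimately show "cmod (g z) <= max C 0 * (cmod z * mp s (cmod z))" using *(3)[OF z] by simp
 qed (use * in auto)
qed

lemma H0_inftyI:
 assumes "g holomorphic_on sector \<phi>" "s > 0"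
  "!!z. z \<in> sector \<phi> ==> cmod (g z) <= C * (cmod z * mp s (cmod z))"
 shows "g \<in> H0_infty \<phi>"
 unfolding H0_infty_def
proof (intro CollectI conjI exI ballI)
 fix z assume z: "z \<in> sector \<phi>"
 then show "cmod (g z) <= C * min (cmod z powr s) (cmod z powr (- s))"
  using assms(3)[OF z] by (simp add: mp_def sector_def)
qed (use assms in auto)

lemma H0_infty_mult:
 assumes g: "g \<in> H0_infty \<phi>" and f: "f holomorphic_on sector \<phi>" "!!z. z \<in> sector \<phi> ==> cmod (f z) <= K"
 shows "(%z. g z * f z) \<in> H0_infty \<phi>"
proof -
 obtain C s where *: "g holomorphic_on sector \<phi>" "C \<ge> 0" "s > 0"
  "!!z. z \<in> sector \<phi> ==> cmod (g z) <= C * (cmod z * mp s (cmod z))"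
  using H0_inftyE[OF g] by metis
 show ?thesis
 proof (rule H0_inftyI[where C="C * K" and s=s])
  show "(%z. g z * f z) holomorphic_on sector \<phi>" by (intro holomorphic_intros * f)
  fix z assume z: "z \<in> sector \<phi>"
  have "cmod (g z * f z) <= (C * (cmod z * mp s (cmod z))) * K"
   unfolding norm_mult by (intro mult_mono * f z) (auto intro!: mult_nonneg_nonneg mp_nonneg * simp: mp_def)
  then show "cmod (g z * f z) <= C * K * (cmod z * mp s (cmod z))" by (simp add: mult_ac)
 qed (use * in auto)
qed

lemma H0_infty_mono: "\<phi>' <= \<phi> ==> g \<in> H0_infty \<phi> ==> g \<in> H0_infty \<phi>'"
 unfolding H0_infty_def using sector_mono[of \<phi>' \<phi>] holomorphic_on_subset by blast

lemma H0_infty_cong: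
 assumes "!!z. z \<in> sector \<phi> ==> g z = h z" "g \<in> H0_infty \<phi>"
 shows "h \<in> H0_infty \<phi>"
proof -
 have "h holomorphic_on sector \<phi>"
  using assms holomorphic_cong[of "sector \<phi>" "sector \<phi>" g h] by (auto simp: H0_infty_def)
 then show ?thesis using assms by (auto simp: H0_infty_def)
qed

lemma reciprocal_bound:
 assumes "0 < \<phi>" "\<phi> < pi" "z \<in> sector \<phi>" "\<nu> > 0"
 shows "cmod (1 / (of_real \<nu> + z)) <= (1 / sqrt ((1 + cos \<phi>) / 2)) * (1 / (\<nu> + cmod z))"
proof -
 let ?k = "sqrt ((1 + cos \<phi>) / 2)"
 have k: "?k > 0" using assms by (intro sqrt_half_cos_pos) auto
 have pos: "0 < ?k * (\<nu> + cmod z)" using k assms by (intro mult_pos_pos add_pos_nonneg) auto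
 have le: "?k * (\<nu> + cmod z) <= cmod (of_real \<nu> + z)" using assms by (intro norm_add_sector_ge) auto
 then have "1 / cmod (of_real \<nu> + z) <= 1 / (?k * (\<nu> + cmod z))"
  using pos mult_pos_pos[OF less_le_trans[OF pos le] pos] by (intro divide_left_mono) auto
 then show ?thesis by (simp add: norm_divide)
qed

lemma add_sector_nonzero: "z \<in> sector pi ==> \<nu> \<ge> 0 ==> of_real \<nu> + z \<in> sector pi"
 by (auto simp: sector_pi complex_nonpos_Reals_iff)

lemma sector_le_pi: "\<phi> <= pi ==> z \<in> sector \<phi> ==> z \<in> sector pi"
 using sector_mono by blast

lemma sector_nz: "z \<in> sector \<phi> ==> z ~= 0" by (simp add: sector_def)

lemma kernel_H0_infty:
 assumes "0 < \<phi>" "\<phi> < pi"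
 shows "(%z. z / (1 + z)\<^sup>2) \<in> H0_infty \<phi>"
proof (rule H0_inftyI[where s=1 and C="1 / ((1 + cos \<phi>) / 2)"])
 have nz: "1 + z ~= 0" if "z \<in> sector \<phi>" for z
  using sector_nz[OF add_sector_nonzero[OF sector_le_pi[OF _ that], of 1]] assms by simp
 show "(%z. z / (1 + z)\<^sup>2) holomorphic_on sector \<phi>" using nz by (intro holomorphic_intros) auto
 fix z assume z: "z \<in> sector \<phi>"
 have k: "0 < (1 + cos \<phi>) / 2" using sqrt_half_cos_pos[of \<phi>] assms by simp
 have "cmod (1 / (1 + z)) <= (1 / sqrt ((1 + cos \<phi>) / 2)) * (1 / (1 + cmod z))"
  using reciprocal_bound[OF assms z, of 1] by simp
 then have "(cmod (1 / (1 + z)))\<^sup>2 <= ((1 / sqrt ((1 + cos \<phi>) / 2)) * (1 / (1 + cmod z)))\<^sup>2"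
  by (intro power_mono) auto
 also have "\<dots> = (1 / ((1 + cos \<phi>) / 2)) * (1 / (1 + cmod z)\<^sup>2)"
  unfolding power_mult_distrib power_divide by (subst real_sqrt_pow2) (use k in auto)
 also have "\<dots> <= (1 / ((1 + cos \<phi>) / 2)) * mp 1 (cmod z)"
  using k sector_nz[OF z] by (intro mult_left_mono inverse_square_le_mp) auto
 finally have "cmod z * (cmod (1 / (1 + z)))\<^sup>2 <= cmod z * ((1 / ((1 + cos \<phi>) / 2)) * mp 1 (cmod z))"
  by (intro mult_left_mono) auto
 moreover have "cmod (z / (1 + z)\<^sup>2) = cmod z * (cmod (1 / (1 + z)))\<^sup>2"
  by (simp add: norm_divide norm_power power_divide)
 ultimately show "cmod (z / (1 + z)\<^sup>2) <= 1 / ((1 + cos \<phi>) / 2) * (cmod z * mp 1 (cmod z))"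
  by (simp only: mult_ac)
qed simp

lemma sector_integrand:
 assumes A: "sectorial_of_angle \<omega> A" and th: "\<omega> < \<xi>" "\<xi> < \<phi>" "\<phi> <= pi" and g: "g \<in> H0_infty \<phi>"
  and tau: "\<bar>\<tau>\<bar> = \<xi>"
 obtains C u where "u > 0" "continuous_on {0<..} (%r. g (rcis r \<tau>))"
  "continuous_on {0<..} (%r. resolvent A (rcis r \<tau>))"
  "!!r. r > 0 ==> cmod (g (rcis r \<tau>)) * norm (resolvent A (rcis r \<tau>)) <= C * mp u r" "C \<ge> 0"
proof -
 obtain C s where *: "g holomorphic_on sector \<phi>" "C \<ge> 0" "s > 0"
  "!!z. z \<in> sector \<phi> ==> cmod (g z) <= C * (cmod z * mp s (cmod z))"
  using H0_inftyE[OF g] by metis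
 obtain M where M: "M > 0" "!!r \<xi>'. r > 0 ==> \<xi> <= \<bar>\<xi>'\<bar> ==> \<bar>\<xi>'\<bar> <= pi ==> norm (resolvent A (rcis r \<xi>')) <= M / r"
  using sectorial_resolvent_bound[OF A th(1)] by metis
 have mem: "rcis r \<tau> \<in> sector \<phi>" if "r > 0" for r using that th tau by (intro rcis_mem_sector) auto
 have rc: "continuous_on {0<..} (%r. rcis r \<tau>)" unfolding rcis_def by (intro continuous_intros)
 show thesis
 proof (rule that[of s "C * M"])
  show "continuous_on {0<..} (%r. g (rcis r \<tau>))"
   using mem by (intro continuous_on_compose2[OF holomorphic_on_imp_continuous_on[OF *(1)] rc]) auto
  show "continuous_on {0<..} (%r. resolvent A (rcis r \<tau>))"
   using th tau by (intro continuous_intros sectorial_linear[OF A] rc) (auto intro!: sectorial_resolvent_set[OF A])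
  fix r :: real assume r: "r > 0"
  have n: "cmod (rcis r \<tau>) = r" using r by simp
  have "cmod (g (rcis r \<tau>)) * norm (resolvent A (rcis r \<tau>)) <= (C * (r * mp s r)) * (M / r)"
   using *(4)[OF mem[OF r]] M(2)[OF r, of \<tau>] r th tau n *(2) mp_nonneg[OF r, of s]
   by (intro mult_mono) auto
  then show "cmod (g (rcis r \<tau>)) * norm (resolvent A (rcis r \<tau>)) <= C * M * mp s r"
   using r by (simp add: mult_ac)
 qed (use * M in auto)
qed

lemma ray_admissible_functional:
 fixes \<phi>' :: "('a::complex_banach \<Rightarrow>\<^sub>L 'a) \<Rightarrow>\<^sub>L complex"
 assumes A: "sectorial_of_angle \<omega> A" and th: "\<omega> < \<xi>" "\<xi> < \<phi>" "\<phi> <= pi" and g: "g \<in> H0_infty \<phi>"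
 shows "ray_admissible \<xi> (%z. g z * \<phi>' (resolvent A z))"
proof -
 have th0: "\<xi> > 0" using sectorial_angle[OF A] th by simp
 obtain C1 u1 where 1: "u1 > 0" "continuous_on {0<..} (%r. g (rcis r \<xi>))"
  "continuous_on {0<..} (%r. resolvent A (rcis r \<xi>))"
  "!!r. r > 0 ==> cmod (g (rcis r \<xi>)) * norm (resolvent A (rcis r \<xi>)) <= C1 * mp u1 r" "C1 \<ge> 0"
  using sector_integrand[OF A th g, of \<xi>] th0 by (metis abs_of_pos)
 obtain C2 u2 where 2: "u2 > 0" "continuous_on {0<..} (%r. g (rcis r (-\<xi>)))"
  "continuous_on {0<..} (%r. resolvent A (rcis r (-\<xi>)))"
  "!!r. r > 0 ==> cmod (g (rcis r (-\<xi>))) * norm (resolvent A (rcis r (-\<xi>))) <= C2 * mp u2 r" "C2 \<ge> 0"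
  using sector_integrand[OF A th g, of "-\<xi>"] th0 by (metis abs_of_pos abs_minus_cancel)
 \<comment> \<open>A smaller exponent gives a weaker majorant, so the minimum works for both
   rays.\<close>
 have mono: "mp u r <= mp u' r" if "r > 0" "u' <= u" "u' > 0" for u u' r
 proof (cases "r <= 1")
  case True
  then show ?thesis using that powr_mono'[of "u' - 1" "u - 1" r] by (simp add: mp_le_one)
 next
  case False
  then show ?thesis using that powr_mono[of "-u-1" "-u'-1" r] by (simp add: mp_ge_one)
 qed
 define u where "u = min u1 u2"
 have b1: "cmod (g (rcis r \<xi>) * \<phi>' (resolvent A (rcis r \<xi>))) <= (norm \<phi>' * max C1 C2) * mp u r" if "r > 0" for r
 proof -
  have "cmod (g (rcis r \<xi>) * \<phi>' (resolvent A (rcis r \<xi>))) <= cmod (g (rcis r \<xi>)) * (norm \<phi>' * norm (resolvent A (rcis r \<xi>)))"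
   unfolding norm_mult by (intro mult_left_mono norm_blinfun) auto
  also have "\<dots> <= norm \<phi>' * (C1 * mp u1 r)" using mult_left_mono[OF 1(4)[OF that], of "norm \<phi>'"] by (simp add: mult_ac)
  also have "\<dots> <= norm \<phi>' * (max C1 C2 * mp u r)"
   using 1(1,5) 2(1) that mono[of r u u1] mp_nonneg[OF that, of u1] by (intro mult_left_mono mult_mono) (auto simp: u_def)
  finally show ?thesis by (simp add: mult_ac)
 qed
 have b2: "cmod (g (rcis r (-\<xi>)) * \<phi>' (resolvent A (rcis r (-\<xi>)))) <= (norm \<phi>' * max C1 C2) * mp u r" if "r > 0" for r
 proof -
  have "cmod (g (rcis r (-\<xi>)) * \<phi>' (resolvent A (rcis r (-\<xi>)))) <= cmod (g (rcis r (-\<xi>))) * (norm \<phi>' * norm (resolvent A (rcis r (-\<xi>))))"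
   unfolding norm_mult by (intro mult_left_mono norm_blinfun) auto
  also have "\<dots> <= norm \<phi>' * (C2 * mp u2 r)" using mult_left_mono[OF 2(4)[OF that], of "norm \<phi>'"] by (simp add: mult_ac)
  also have "\<dots> <= norm \<phi>' * (max C1 C2 * mp u r)"
   using 2(1,5) 1(1) that mono[of r u u2] mp_nonneg[OF that, of u2] by (intro mult_left_mono mult_mono) (auto simp: u_def)
  finally show ?thesis by (simp add: mult_ac)
 qed
 show ?thesis
 proof (rule ray_admissibleI)
  show "u > 0" using 1 2 by (simp add: u_def)
  fix \<tau> assume "\<bar>\<tau>\<bar> = \<bar>\<xi>\<bar>"
  then have t: "\<tau> = \<xi> \<or> \<tau> = -\<xi>" by auto
  show "continuous_on {0<..} (%r. g (rcis r \<tau>) * \<phi>' (resolvent A (rcis r \<tau>)))"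
   using t 1(2,3) 2(2,3)
   by (auto intro!: continuous_on_mult bounded_linear.continuous_on[OF blinfun.bounded_linear_right])
  show "cmod (g (rcis r \<tau>) * \<phi>' (resolvent A (rcis r \<tau>))) <= norm \<phi>' * max C1 C2 * mp u r" if "r > 0" for r
   using t b1[OF that] b2[OF that] by auto
 qed
qed

lemma functional_sector_integral:
 fixes \<phi>' :: "('a::complex_banach \<Rightarrow>\<^sub>L 'a) \<Rightarrow>\<^sub>L complex"
 assumes A: "sectorial_of_angle \<omega> A" and th: "\<omega> < \<xi>" "\<xi> < \<phi>" "\<phi> <= pi" and g: "g \<in> H0_infty \<phi>"
  and f: "\<phi>' \<in> clinear_ops"
 shows "\<phi>' (sector_integral A \<xi> g) =
  scalar_sector_integral \<xi> (%z. g z * \<phi>' (resolvent A z))"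
proof -
 have th0: "\<xi> > 0" using sectorial_angle[OF A] th by simp
 have int: "(%r. (g (rcis r \<tau>) * cis \<tau>) *\<^sub>C resolvent A (rcis r \<tau>)) integrable_on {0<..}" if t: "\<bar>\<tau>\<bar> = \<xi>" for \<tau>
 proof -
  obtain C u where *: "u > 0" "continuous_on {0<..} (%r. g (rcis r \<tau>))"
   "continuous_on {0<..} (%r. resolvent A (rcis r \<tau>))"
   "!!r. r > 0 ==> cmod (g (rcis r \<tau>)) * norm (resolvent A (rcis r \<tau>)) <= C * mp u r" "C \<ge> 0"
   using sector_integrand[OF A th g t] by metis
  show ?thesis
   by (rule integrable_mp[where C=C and u=u])
    (intro continuous_on_scaleC continuous_on_mult continuous_on_const *, use * in \<open>auto simp: norm_scaleC norm_mult\<close>)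
 qed
 have "\<phi>' (integral {0<..} (%r. (g (rcis r \<tau>) * cis \<tau>) *\<^sub>C resolvent A (rcis r \<tau>))) =
  integral {0<..} (%r. g (rcis r \<tau>) * \<phi>' (resolvent A (rcis r \<tau>)) * cis \<tau>)" if "\<bar>\<tau>\<bar> = \<xi>" for \<tau>
  by (subst blinfun_apply_integral[OF int[OF that]]) (simp add: clinear_opsD[OF f] mult_ac)
 then show ?thesis
  using th0 by (simp add: sector_integral_def scalar_sector_integral_def clinear_opsD[OF f] blinfun.diff_right)
qed

lemma sector_integral_clinear:
 assumes A: "sectorial_of_angle \<omega> A" and th: "\<omega> < \<xi>" "\<xi> <= pi"
 shows "sector_integral A \<xi> g \<in> clinear_ops"
proof -
 have "0 < \<xi>" using sectorial_angle[OF A] th by simp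
 then show ?thesis unfolding sector_integral_def using th
  by (intro clinear_ops_intros integral_clinear_ops resolvent_clinear sectorial_resolvent_set[OF A]) auto
qed

lemma sector_integral_commute:
 assumes A: "sectorial_of_angle \<omega> A" and th: "\<omega> < \<xi>" "\<xi> < \<phi>" "\<phi> <= pi" and g: "g \<in> H0_infty \<phi>"
  and W: "W \<in> clinear_ops" and comm: "!!z. z \<in> resolvent_set A ==> W o\<^sub>L resolvent A z = resolvent A z o\<^sub>L W"
 shows "W o\<^sub>L sector_integral A \<xi> g = sector_integral A \<xi> g o\<^sub>L W"
proof (rule functional_eqI)
 fix \<phi>' :: "('a \<Rightarrow>\<^sub>L 'a) \<Rightarrow>\<^sub>L complex" assume f: "\<phi>' \<in> clinear_ops"
 obtain p where p: "p \<in> clinear_ops" "!!B. p B = \<phi>' (W o\<^sub>L B)"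
  using compose_left_functional[OF f W] by metis
 obtain q where q: "q \<in> clinear_ops" "!!B. q B = \<phi>' (B o\<^sub>L W)"
  using compose_right_functional[OF f] by metis
 have th0: "\<xi> > 0" using sectorial_angle[OF A] th by simp
 have "rcis r \<tau> \<in> resolvent_set A" if "r > 0" "\<bar>\<tau>\<bar> = \<xi>" for r \<tau>
  using that th by (intro sectorial_resolvent_set[OF A]) auto
 then have "p (sector_integral A \<xi> g) = q (sector_integral A \<xi> g)"
  unfolding functional_sector_integral[OF A th g p(1)] functional_sector_integral[OF A th g q(1)]
  unfolding p(2) q(2) scalar_sector_integral_def using th0
  by (intro arg_cong2[where f="(*)"] arg_cong2[where f="(-)"] integral_cong) (auto simp: comm)
 then show "\<phi>' (W o\<^sub>L sector_integral A \<xi> g) = \<phi>' (sector_integral A \<xi> g o\<^sub>L W)"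
  by (simp add: p q)
qed

text \<open>The swept region contains no spectrum because both angles exceed \<omega>.\<close>

lemma sector_integral_angle_indep:
 assumes A: "sectorial_of_angle \<omega> A" and th: "\<omega> < \<xi>" "\<xi> <= \<xi>'" "\<xi>' < \<phi>" "\<phi> <= pi" and g: "g \<in> H0_infty \<phi>"
 shows "sector_integral A \<xi> g = sector_integral A \<xi>' g"
proof (rule functional_eqI)
 fix \<phi>' :: "('a \<Rightarrow>\<^sub>L 'a) \<Rightarrow>\<^sub>L complex" assume f: "\<phi>' \<in> clinear_ops"
 have th0: "\<xi> > 0" using sectorial_angle[OF A] th by simp
 obtain C s where *: "g holomorphic_on sector \<phi>" "C \<ge> 0" "s > 0"
  "!!z. z \<in> sector \<phi> ==> cmod (g z) <= C * (cmod z * mp s (cmod z))"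
  using H0_inftyE[OF g] by metis
 obtain M where M: "M > 0" "!!r \<xi>'. r > 0 ==> \<xi> <= \<bar>\<xi>'\<bar> ==> \<bar>\<xi>'\<bar> <= pi ==> norm (resolvent A (rcis r \<xi>')) <= M / r"
  using sectorial_resolvent_bound[OF A th(1)] by metis
 let ?h = "%z. g z * \<phi>' (resolvent A z)"
 let ?U = "sector \<phi> \<inter> resolvent_set A"
 have hol: "?h holomorphic_on ?U"
  by (intro holomorphic_intros functional_resolvent_holomorphic[OF sectorial_linear[OF A] f]
    holomorphic_on_subset[OF *(1)]) auto
 have op: "open ?U" using th th0 by (intro open_Int open_sector open_resolvent_set sectorial_linear[OF A]) auto
 have inU: "rcis r \<tau> \<in> ?U" if "r > 0" "\<xi> <= \<bar>\<tau>\<bar>" "\<bar>\<tau>\<bar> <= \<xi>'" for r \<tau>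
  using that th by (intro IntI rcis_mem_sector sectorial_resolvent_set[OF A]) auto
 have bd: "cmod (?h (rcis r \<tau>)) <= (C * M * norm \<phi>') * mp s r" if r: "r > 0" "\<xi> <= \<bar>\<tau>\<bar>" "\<bar>\<tau>\<bar> <= \<xi>'" for r \<tau>
 proof -
  have "cmod (?h (rcis r \<tau>)) <= (C * (r * mp s r)) * (norm \<phi>' * (M / r))"
   unfolding norm_mult
  proof (intro mult_mono)
   show "cmod (g (rcis r \<tau>)) <= C * (r * mp s r)" using *(4)[of "rcis r \<tau>"] inU[OF r] r by simp
   show "cmod (\<phi>' (resolvent A (rcis r \<tau>))) <= norm \<phi>' * (M / r)"
    using M(2)[of r \<tau>] r th by (intro order_trans[OF norm_blinfun] mult_left_mono) auto
  qed (use r * mp_nonneg in auto)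
  then show ?thesis using r by (simp add: mult_ac)
 qed
 have "integral {0<..} (%r. ?h (rcis r \<xi>) * cis \<xi>) = integral {0<..} (%r. ?h (rcis r \<xi>') * cis \<xi>')"
  using th th0 by (intro ray_rotate[OF _ hol op inU bd *(3)]) auto
 moreover have "integral {0<..} (%r. ?h (rcis r (-\<xi>')) * cis (-\<xi>')) = integral {0<..} (%r. ?h (rcis r (-\<xi>)) * cis (-\<xi>))"
  using th th0 by (intro ray_rotate[OF _ hol op inU bd *(3)]) auto
 ultimately show "\<phi>' (sector_integral A \<xi> g) = \<phi>' (sector_integral A \<xi>' g)"
  using th by (subst (1 2) functional_sector_integral[OF A _ _ th(4) g f]) (auto simp: scalar_sector_integral_def)
qed

text \<open>By the resolvent identity, \<open>g(z) R(z) (\<mu> + A)^(-1)\<close> is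
  \<open>g(z) / (\<mu> + z)\<close> times \<open>R(z) - R(-\<mu>)\<close>. The constant operator
  contributes the contour integral of \<open>g(z) / (\<mu> + z)\<close>, which is zero since the
  pole -\<mu> is outside the sector.\<close>

lemma sector_integral_pres:
 assumes A: "sectorial_of_angle \<omega> A" and th: "\<omega> < \<xi>" "\<xi> < \<phi>" "\<phi> < pi" and g: "g \<in> H0_infty \<phi>" and \<mu>: "\<mu> > 0"
 shows "sector_integral A \<xi> g o\<^sub>L pres A \<mu> = sector_integral A \<xi> (%z. g z * (1 / (of_real \<mu> + z)))"
proof (rule functional_eqI)
 fix \<phi>' :: "('a \<Rightarrow>\<^sub>L 'a) \<Rightarrow>\<^sub>L complex" assume f: "\<phi>' \<in> clinear_ops"
 have sA: "sectorial A" using A by (auto simp: sectorial_def)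
 have lin: "linear_operator A" by (rule sectorial_linear[OF A])
 obtain q where q: "q \<in> clinear_ops" "!!B. q B = \<phi>' (B o\<^sub>L pres A \<mu>)"
  using compose_right_functional[OF f] by metis
 have th0: "\<xi> > 0" using sectorial_angle[OF A] th by simp
 have ph0: "\<phi> > 0" using th0 th by simp
 define k where "k = 1 / sqrt ((1 + cos \<phi>) / 2)"
 have k: "k > 0" unfolding k_def using sqrt_half_cos_pos[of \<phi>] th ph0 by simp
 have nz: "of_real \<mu> + z ~= 0" if "z \<in> sector \<phi>" for z
  using sector_nz[OF add_sector_nonzero[OF sector_le_pi[OF _ that], of \<mu>]] th \<mu> by simp
 have g': "(%z. g z * (1 / (of_real \<mu> + z))) \<in> H0_infty \<phi>"
 proof (rule H0_infty_mult[OF g, where K="k * (1 / \<mu>)"])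
  show "(%z. 1 / (of_real \<mu> + z)) holomorphic_on sector \<phi>" using nz by (intro holomorphic_intros) auto
  fix z assume z: "z \<in> sector \<phi>"
  have "cmod (1 / (of_real \<mu> + z)) <= k * (1 / (\<mu> + cmod z))"
   unfolding k_def using ph0 th(3) z \<mu> by (rule reciprocal_bound)
  also have "\<dots> <= k * (1 / \<mu>)" using k \<mu> by (intro mult_left_mono divide_left_mono mult_pos_pos add_pos_nonneg) auto
  finally show "cmod (1 / (of_real \<mu> + z)) <= k * (1 / \<mu>)" .
 qed
 obtain C s where *: "g holomorphic_on sector \<phi>" "C \<ge> 0" "s > 0"
  "!!z. z \<in> sector \<phi> ==> cmod (g z) <= C * (cmod z * mp s (cmod z))"
  using H0_inftyE[OF g] by metis
 let ?c = "\<phi>' (resolvent A (- of_real \<mu>))"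
 let ?h = "%z. g z * (1 / (of_real \<mu> + z))"
 have hb: "cmod (?h z) <= (C * k) * mp s (cmod z)" if z: "z \<in> sector \<phi>" for z
 proof -
  have z0: "cmod z > 0" using sector_nz[OF z] by simp
  have "cmod (1 / (of_real \<mu> + z)) <= k * (1 / (\<mu> + cmod z))"
   unfolding k_def using ph0 th(3) z \<mu> by (rule reciprocal_bound)
  also have "\<dots> <= k * (1 / cmod z)" using k \<mu> z0 by (intro mult_left_mono divide_left_mono mult_pos_pos add_pos_nonneg) auto
  finally have "cmod (?h z) <= (C * (cmod z * mp s (cmod z))) * (k * (1 / cmod z))"
   unfolding norm_mult using *(2,4) z z0 mp_nonneg[OF z0, of s] by (intro mult_mono) auto
  then show ?thesis using z0 by (simp add: mult_ac)
 qed
 have hh: "?h holomorphic_on sector \<phi>" using nz by (intro holomorphic_intros *(1)) auto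
 have zero: "scalar_sector_integral \<xi> ?h = 0"
  using th th0 by (intro scalar_sector_integral_zero[OF _ _ _ hh *(3) hb]) auto
 have adm: "ray_admissible \<xi> ?h"
 proof (rule ray_admissibleI)
  show "s > 0" by fact
  fix \<tau> assume t: "\<bar>\<tau>\<bar> = \<bar>\<xi>\<bar>"
  have mem: "rcis r \<tau> \<in> sector \<phi>" if "r > 0" for r using that th th0 t by (intro rcis_mem_sector) auto
  have rc: "continuous_on {0<..} (%r. rcis r \<tau>)" unfolding rcis_def by (intro continuous_intros)
  show "continuous_on {0<..} (%r. ?h (rcis r \<tau>))"
   using mem by (intro continuous_on_compose2[OF holomorphic_on_imp_continuous_on[OF hh] rc]) auto
  show "cmod (?h (rcis r \<tau>)) <= C * k * mp s r" if "r > 0" for r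
   using hb[OF mem[OF that]] that by simp
 qed
 have "\<phi>' (sector_integral A \<xi> g o\<^sub>L pres A \<mu>) = scalar_sector_integral \<xi> (%z. g z * q (resolvent A z))"
  unfolding q(2)[symmetric] using th g q(1) by (intro functional_sector_integral[OF A]) auto
 also have "\<dots> = scalar_sector_integral \<xi> (%z. ?h z * \<phi>' (resolvent A z) - ?c * ?h z)"
 proof -
  have "g z * q (resolvent A z) = ?h z * \<phi>' (resolvent A z) - ?c * ?h z"
   if z: "z \<in> resolvent_set A" "of_real \<mu> + z ~= 0" for z
  proof -
   have "resolvent A z - resolvent A (- of_real \<mu>) = (- of_real \<mu> - z) *\<^sub>C (resolvent A z o\<^sub>L resolvent A (- of_real \<mu>))"
    by (rule resolvent_identity[OF lin z(1) neg_real_resolvent_set[OF sA \<mu>]])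
   also have "\<dots> = (of_real \<mu> + z) *\<^sub>C (resolvent A z o\<^sub>L pres A \<mu>)"
    by (simp add: pres_def compose_minus_right scaleC_minus_right flip: scaleC_minus_left)
   finally have "\<phi>' (resolvent A z) - ?c = (of_real \<mu> + z) * q (resolvent A z)"
    by (metis q(2) blinfun.diff_right clinear_opsD[OF f] scaleC_complex_eq)
   then have "q (resolvent A z) = (\<phi>' (resolvent A z) - ?c) * (1 / (of_real \<mu> + z))"
    using z by (simp add: field_simps)
   then show ?thesis by (simp only:) (simp add: algebra_simps diff_divide_distrib)
  qed
  moreover have "rcis r \<tau> \<in> resolvent_set A \<and> of_real \<mu> + rcis r \<tau> ~= 0" if "r > 0" "\<bar>\<tau>\<bar> = \<xi>" for r \<tau>
   using that th by (intro conjI sectorial_resolvent_set[OF A] nz rcis_mem_sector) auto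
  ultimately show ?thesis
   unfolding scalar_sector_integral_def using th0
   by (intro arg_cong2[where f="(*)"] arg_cong2[where f="(-)"] integral_cong) auto
 qed
 also have "\<dots> = scalar_sector_integral \<xi> (%z. ?h z * \<phi>' (resolvent A z)) - ?c * scalar_sector_integral \<xi> ?h"
 proof -
  have 1: "ray_admissible \<xi> (%z. ?c * ?h z)" by (rule ray_admissible_cmul[OF adm])
  have 2: "ray_admissible \<xi> (%z. ?h z * \<phi>' (resolvent A z))"
   by (rule ray_admissible_functional[OF A th(1,2) _ g']) (use th in simp)
  show ?thesis
   unfolding scalar_sector_integral_diff[OF 2 1] by (simp only: scalar_sector_integral_cmul)
 qed
 also have "\<dots> = \<phi>' (sector_integral A \<xi> ?h)"
 proof -
  have "\<phi>' (sector_integral A \<xi> ?h) = scalar_sector_integral \<xi> (%z. ?h z * \<phi>' (resolvent A z))"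
   by (rule functional_sector_integral[OF A th(1,2) _ g' f]) (use th in simp)
  then show ?thesis unfolding zero by simp
 qed
 finally show "\<phi>' (sector_integral A \<xi> g o\<^sub>L pres A \<mu>) =
  \<phi>' (sector_integral A \<xi> (%z. g z * (1 / (of_real \<mu> + z))))" .
qed

lemma scalar_sector_integral_cong':
 assumes "0 <= \<xi>" "!!r \<tau>. r > 0 ==> \<bar>\<tau>\<bar> = \<xi> ==> h (rcis r \<tau>) = h' (rcis r \<tau>)"
 shows "scalar_sector_integral \<xi> h = scalar_sector_integral \<xi> h'"
proof -
 have "integral {0<..} (%r. h (rcis r \<tau>) * cis \<tau>) = integral {0<..} (%r. h' (rcis r \<tau>) * cis \<tau>)"
  if "\<bar>\<tau>\<bar> = \<xi>" for \<tau>
  using assms that by (intro integral_cong) auto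
 then show ?thesis using assms(1) by (simp add: scalar_sector_integral_def)
qed

lemma scalar_sector_integral_log_kernel:
 assumes "0 < \<xi>" "\<xi> < pi"
 shows "scalar_sector_integral \<xi> (%z. 2 / (z\<^sup>2 - 1)) = 1"
 using sector_log_kernel[of 1 \<xi>] assms by (simp add: scalar_sector_integral_def)

text \<open>The first explicit value of the calculus, which ties it to resolvents. The kernel has a
  double pole at -1, on the way when the contour is opened to angle pi. Expanding the resolvent
  twice at -1 separates a part G without pole there from rational functions that are integrated
  explicitly.\<close>

lemma sector_integral_kernel:
 assumes A: "sectorial_of_angle \<omega> A" and th: "\<omega> < \<xi>" "\<xi> < pi"
 shows "sector_integral A \<xi> (%z. z / (1 + z)\<^sup>2) = pres A 1 - (pres A 1 o\<^sub>L pres A 1)"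
proof (rule functional_eqI)
 fix \<phi>' :: "('a \<Rightarrow>\<^sub>L 'a) \<Rightarrow>\<^sub>L complex" assume f: "\<phi>' \<in> clinear_ops"
 have th0: "\<xi> > 0" using sectorial_angle[OF A] th by simp
 have sA: "sectorial A" using A by (auto simp: sectorial_def)
 have lin: "linear_operator A" by (rule sectorial_linear[OF A])
 define R1 where "R1 = resolvent A (-1)"
 define f1 where "f1 = \<phi>' R1"
 define f2 where "f2 = \<phi>' (R1 o\<^sub>L R1)"
 obtain q where q: "q \<in> clinear_ops" "!!B. q B = \<phi>' (B o\<^sub>L (R1 o\<^sub>L R1))"
  using compose_right_functional[OF f] by metis
 \<comment> \<open>The first summand is what the expansion leaves at second order. The summand with
   \<open>1 / (1 - z)\<close> gives G quadratic decay at infinity; its pole 1 is not met when the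
   rays open from \<xi> to pi.\<close>
 define G where "G z = z * q (resolvent A z) - f2 - (f1 + f2) * (1 / (1 - z))" for z
 define h where "h z = z / (1 + z)\<^sup>2 * \<phi>' (resolvent A z)" for z
 define c where "c z = - f1 * (1 / (1 + z)\<^sup>2) + - (f1 + f2) * (2 / (z\<^sup>2 - 1))" for z
 have m1: "-1 \<in> resolvent_set A" using neg_real_resolvent_set[OF sA, of 1] by simp
 have decomp: "h z = G z + c z" if z: "z \<in> resolvent_set A" "z ~= 1" "z ~= -1" for z
 proof -
  have 1: "resolvent A z = R1 - (1 + z) *\<^sub>C (resolvent A z o\<^sub>L R1)"
   using resolvent_identity[OF lin z(1) m1] unfolding R1_def
   by (simp add: algebra_simps scaleC_minus_left scaleC_diff_left scaleC_add_left)
  have 2: "resolvent A z o\<^sub>L R1 = (R1 o\<^sub>L R1) - (1 + z) *\<^sub>C (resolvent A z o\<^sub>L (R1 o\<^sub>L R1))"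
   using arg_cong[OF 1, of "%F. F o\<^sub>L R1"] by (simp only: compose_diff_left scaleC_compose_left compose_assoc)
  have e1: "\<phi>' (resolvent A z) = f1 - (1 + z) * \<phi>' (resolvent A z o\<^sub>L R1)"
   using arg_cong[OF 1, of "blinfun_apply \<phi>'"] by (simp only: blinfun.diff_right clinear_opsD[OF f] scaleC_complex_eq f1_def)
  have e2: "\<phi>' (resolvent A z o\<^sub>L R1) = f2 - (1 + z) * q (resolvent A z)"
   using arg_cong[OF 2, of "blinfun_apply \<phi>'"] by (simp only: blinfun.diff_right clinear_opsD[OF f] scaleC_complex_eq f2_def q(2))
  obtain u where u: "u = 1 + z" by simp
  have zz: "z = u - 1" "u ~= 0" "1 - z = 2 - u" "2 - u ~= 0" using z u by (auto simp: add_eq_0_iff)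
  have "z\<^sup>2 - 1 = - (u * (2 - u))" by (simp add: zz(1) power2_eq_square algebra_simps)
  then have k2: "2 / (z\<^sup>2 - 1) = - (1 / (2 - u) + 1 / u)"
   using zz(2,4) by (simp only:) (simp add: divide_simps)
  obtain p v w where pvw: "1 / (2 - u) = p" "1 / u = v" "1 / u\<^sup>2 = w" by simp
  have "G z + c z = z * q (resolvent A z) - f2 + (f1 + f2) * (1 / u) - f1 * (1 / u\<^sup>2)"
   unfolding G_def c_def k2 zz(3) u[symmetric] pvw by (simp add: algebra_simps)
  moreover have "h z = z / u\<^sup>2 * (f1 - u * (f2 - u * q (resolvent A z)))"
   unfolding h_def e1 e2 u[symmetric] ..
  moreover have "\<dots> = z * q (resolvent A z) - f2 + (f1 + f2) * (1 / u) - f1 * (1 / u\<^sup>2)"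
   unfolding zz(1) using zz(2) by (simp add: field_simps power2_eq_square)
  ultimately show ?thesis by simp
 qed
 obtain M where M: "M > 0" "!!r \<xi>'. r > 0 ==> \<xi> <= \<bar>\<xi>'\<bar> ==> \<bar>\<xi>'\<bar> <= pi ==> norm (resolvent A (rcis r \<xi>')) <= M / r"
  using sectorial_resolvent_bound[OF A th(1)] by metis
 define k where "k = sqrt ((1 - cos \<xi>) / 2)"
 have k: "k > 0" using cos_monotone_0_pi[of 0 \<xi>] th th0 by (simp add: k_def)
 have dif: "k * (1 + r) <= cmod (1 - rcis r \<tau>)" if "r > 0" "\<xi> <= \<bar>\<tau>\<bar>" "\<bar>\<tau>\<bar> <= pi" for r \<tau>
 proof -
  have "cos \<tau> <= cos \<xi>" using cos_monotone_0_pi_le[of \<xi> "\<bar>\<tau>\<bar>"] that th0 by auto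
  then have "k <= sqrt ((1 - cos \<tau>) / 2)" unfolding k_def by (intro real_sqrt_le_mono) auto
  then have "k * (1 + r) <= sqrt ((1 - cos \<tau>) / 2) * (1 + r)" using that by (intro mult_right_mono) auto
  also have "\<dots> <= cmod (rcis r \<tau> - of_real 1)" using that by (intro norm_diff_rcis_ge) auto
  finally show ?thesis by (simp add: norm_minus_commute)
 qed
 define K1 where "K1 = norm q * M + cmod f2 + cmod (f1 + f2) * (1 / k)"
 define K2 where "K2 = 9 * (norm \<phi>' * M) + 9 * cmod f1 + 18 * cmod (f1 + f2)"
 have memr: "rcis r \<tau> \<in> resolvent_set A" "rcis r \<tau> ~= 1" if "r > 0" "\<xi> <= \<bar>\<tau>\<bar>" "\<bar>\<tau>\<bar> <= pi" for r \<tau>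
 proof -
  show "rcis r \<tau> \<in> resolvent_set A" using that th by (intro sectorial_resolvent_set[OF A]) auto
  have "0 < k * (1 + r)" using k that by simp
  with dif[OF that] show "rcis r \<tau> ~= 1" by auto
 qed
 \<comment> \<open>Boundedness serves for r < 2. For larger r the quadratic decay is read off from h
   - c, because the summands of G do not decay separately.\<close>
 have Gb1: "cmod (G (rcis r \<tau>)) <= K1" if "r > 0" "\<xi> <= \<bar>\<tau>\<bar>" "\<bar>\<tau>\<bar> <= pi" for r \<tau>
 proof -
  have "cmod (q (resolvent A (rcis r \<tau>))) <= norm q * (M / r)"
   using M(2)[OF that] by (intro order_trans[OF norm_blinfun] mult_left_mono) auto
  then have a: "cmod (rcis r \<tau> * q (resolvent A (rcis r \<tau>))) <= norm q * M"
   using that by (simp add: norm_mult field_simps)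
  have "k * 1 <= k * (1 + r)" using k that by (intro mult_left_mono) auto
  then have "k <= cmod (1 - rcis r \<tau>)" using dif[OF that] by linarith
  from le_imp_inverse_le[OF this k] have "cmod (1 / (1 - rcis r \<tau>)) <= 1 / k"
   by (simp add: norm_divide inverse_eq_divide)
  then have b: "cmod ((f1 + f2) * (1 / (1 - rcis r \<tau>))) <= cmod (f1 + f2) * (1 / k)"
   unfolding norm_mult by (intro mult_left_mono) auto
  show ?thesis unfolding G_def K1_def
   by (intro order_trans[OF norm_triangle_ineq4] add_mono a b order_refl)
 qed
 have Gb2: "cmod (G (rcis r \<tau>)) <= K2 * (1 / (1 + r)\<^sup>2)" if "r \<ge> 2" "\<xi> <= \<bar>\<tau>\<bar>" "\<bar>\<tau>\<bar> <= pi" for r \<tau>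
 proof -
  let ?z = "rcis r \<tau>"
  have r0: "r > 0" using that by simp
  have n: "cmod ?z = r" using that by simp
  have lb: "r - 1 <= cmod (1 + ?z)" "r - 1 <= cmod (?z - 1)"
   using norm_triangle_ineq2[of ?z "-1"] norm_triangle_ineq2[of ?z 1] n by (simp_all add: add.commute)
  have r3: "(1 + r)\<^sup>2 / 9 <= (r - 1)\<^sup>2"
  proof -
   have "((1 + r) / 3)\<^sup>2 <= (r - 1)\<^sup>2" using that by (intro power_mono) auto
   then show ?thesis by (simp add: power_divide)
  qed
  have p1: "(1 + r)\<^sup>2 / 9 <= (cmod (1 + ?z))\<^sup>2"
   using that by (intro order_trans[OF r3] power_mono lb) auto
  have p2: "(1 + r)\<^sup>2 / 9 <= cmod (?z\<^sup>2 - 1)"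
  proof -
   have "(r - 1) * (r - 1) <= cmod (?z - 1) * cmod (1 + ?z)" using that lb by (intro mult_mono) auto
   also have "\<dots> = cmod (?z\<^sup>2 - 1)" by (simp add: norm_mult[symmetric] power2_eq_square algebra_simps)
   finally show ?thesis using r3 by (simp add: power2_eq_square)
  qed
  have pos: "(1 + r)\<^sup>2 / 9 > 0" using that by simp
  have i1: "1 / (cmod (1 + ?z))\<^sup>2 <= 9 * (1 / (1 + r)\<^sup>2)"
   using le_imp_inverse_le[OF p1 pos] by (simp add: inverse_eq_divide)
  have i2: "1 / cmod (?z\<^sup>2 - 1) <= 9 * (1 / (1 + r)\<^sup>2)"
   using le_imp_inverse_le[OF p2 pos] by (simp add: inverse_eq_divide)
  have ne: "?z ~= -1"
  proof
   assume "?z = -1"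
   then have "cmod ?z = 1" by simp
   with n that show False by linarith
  qed
  have "G ?z = h ?z - c ?z" using decomp[of ?z] memr[of r \<tau>] ne that r0 by auto
  moreover have "cmod (h ?z) <= 9 * (norm \<phi>' * M) * (1 / (1 + r)\<^sup>2)"
  proof -
   have "cmod (\<phi>' (resolvent A ?z)) <= norm \<phi>' * (M / r)"
    using M(2)[of r \<tau>] that r0 by (intro order_trans[OF norm_blinfun] mult_left_mono) auto
   then have "cmod (h ?z) <= (r * (9 * (1 / (1 + r)\<^sup>2))) * (norm \<phi>' * (M / r))"
    unfolding h_def norm_mult norm_divide norm_power n using i1 r0 M(1)
    by (intro mult_mono) (auto simp: divide_inverse intro!: mult_left_mono)
   then show ?thesis using r0 by (simp add: mult_ac)
  qed
  moreover have "cmod (c ?z) <= 9 * cmod f1 * (1 / (1 + r)\<^sup>2) + 18 * cmod (f1 + f2) * (1 / (1 + r)\<^sup>2)"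
  proof -
   have "cmod (- f1 * (1 / (1 + ?z)\<^sup>2)) <= cmod f1 * (9 * (1 / (1 + r)\<^sup>2))"
    unfolding norm_mult norm_divide norm_power norm_minus_cancel norm_one using i1 by (intro mult_left_mono) auto
   moreover have "cmod (- (f1 + f2) * (2 / (?z\<^sup>2 - 1))) <= cmod (f1 + f2) * (2 * (9 * (1 / (1 + r)\<^sup>2)))"
    unfolding norm_mult norm_divide norm_minus_cancel using i2 by (intro mult_left_mono) auto
   ultimately show ?thesis unfolding c_def
    using norm_triangle_ineq[of "- f1 * (1 / (1 + ?z)\<^sup>2)" "- (f1 + f2) * (2 / (?z\<^sup>2 - 1))"] by (simp add: mult_ac)
  qed
  ultimately show ?thesis using norm_triangle_ineq4[of "h ?z" "c ?z"] by (simp only: K2_def distrib_right)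
 qed
 define K where "K = 9 * K1 + K2"
 have K12: "K1 \<ge> 0" "K2 \<ge> 0" using M k by (auto simp: K1_def K2_def)
 have Gb: "cmod (G (rcis r \<tau>)) <= K * mp 1 r" if r: "r > 0" "\<xi> <= \<bar>\<tau>\<bar>" "\<bar>\<tau>\<bar> <= pi" for r \<tau>
 proof -
  have "cmod (G (rcis r \<tau>)) <= K * (1 / (1 + r)\<^sup>2)"
  proof (cases "r \<ge> 2")
   case True
   have "K2 * (1 / (1 + r)\<^sup>2) <= K * (1 / (1 + r)\<^sup>2)" using K12 by (intro mult_right_mono) (auto simp: K_def)
   then show ?thesis using Gb2[OF True r(2,3)] by linarith
  next
   case False
   have "(1 + r)\<^sup>2 <= 3\<^sup>2" using False r by (intro power_mono) auto
   then have "1 <= 9 * (1 / (1 + r)\<^sup>2)" using r by (simp add: field_simps)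
   then have "K1 * 1 <= K1 * (9 * (1 / (1 + r)\<^sup>2))" using K12 by (intro mult_left_mono)
   also have "\<dots> <= K * (1 / (1 + r)\<^sup>2)" using K12 by (simp add: K_def algebra_simps add_divide_distrib)
   finally show ?thesis using Gb1[OF r] by simp
  qed
  also have "\<dots> <= K * mp 1 r" using K12 r by (intro mult_left_mono inverse_square_le_mp) (auto simp: K_def)
  finally show ?thesis .
 qed
 let ?U = "resolvent_set A \<inter> - {1}"
 have hol: "G holomorphic_on ?U" unfolding G_def
  by (intro holomorphic_intros functional_resolvent_holomorphic[OF lin q(1)]) auto
 have op: "open ?U" by (intro open_Int open_resolvent_set[OF lin] open_Compl) auto
 have inU: "rcis r \<tau> \<in> ?U" if "r > 0" "\<xi> <= \<bar>\<tau>\<bar>" "\<bar>\<tau>\<bar> <= pi" for r \<tau> using memr[OF that] by simp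
 have "integral {0<..} (%r. G (rcis r \<xi>) * cis \<xi>) = integral {0<..} (%r. G (rcis r pi) * cis pi)"
  using th th0 by (intro ray_rotate[OF _ hol op inU Gb]) auto
 moreover have "integral {0<..} (%r. G (rcis r (-pi)) * cis (-pi)) = integral {0<..} (%r. G (rcis r (-\<xi>)) * cis (-\<xi>))"
  using th th0 by (intro ray_rotate[OF _ hol op inU Gb]) auto
 \<comment> \<open>At the angles pi and -pi the two rays coincide as sets, so the two integrals
   cancel.\<close>
 moreover have "G (rcis r (-pi)) * cis (-pi) = G (rcis r pi) * cis pi" for r
  by (simp add: rcis_pi_neg) (simp add: complex_eq_iff)
 ultimately have G0: "scalar_sector_integral \<xi> G = 0" by (simp add: scalar_sector_integral_def)
 define \<phi> where "\<phi> = (\<xi> + pi) / 2"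
 have ph: "0 < \<phi>" "\<xi> < \<phi>" "\<phi> < pi" using th th0 by (auto simp: \<phi>_def)
 have rc: "continuous_on {0<..} (%r. rcis r \<tau>)" for \<tau> unfolding rcis_def by (intro continuous_intros)
 have admG: "ray_admissible \<xi> G"
 proof (rule ray_admissibleI)
  show "continuous_on {0<..} (%r. G (rcis r \<tau>))" if "\<bar>\<tau>\<bar> = \<bar>\<xi>\<bar>" for \<tau>
   using inU that th th0 by (intro continuous_on_compose2[OF holomorphic_on_imp_continuous_on[OF hol] rc]) auto
  show "cmod (G (rcis r \<tau>)) <= K * mp 1 r" if "\<bar>\<tau>\<bar> = \<bar>\<xi>\<bar>" "r > 0" for r \<tau>
   using that th th0 by (intro Gb) auto
 qed simp
 let ?s = "%z. 1 / (1 + z)\<^sup>2 :: complex"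
 have k0: "0 < (1 + cos \<phi>) / 2" using sqrt_half_cos_pos[of \<phi>] ph by simp
 have nz: "1 + z ~= 0" if "z \<in> sector \<phi>" for z
  using sector_nz[OF add_sector_nonzero[OF sector_le_pi[OF _ that], of 1]] ph by simp
 have shol: "?s holomorphic_on sector \<phi>" using nz by (intro holomorphic_intros) auto
 have sb: "cmod (?s z) <= (1 / ((1 + cos \<phi>) / 2)) * mp 1 (cmod z)" if z: "z \<in> sector \<phi>" for z
 proof -
  have "cmod (1 / (1 + z)) <= (1 / sqrt ((1 + cos \<phi>) / 2)) * (1 / (1 + cmod z))"
   using reciprocal_bound[OF ph(1,3) z, of 1] by simp
  then have "(cmod (1 / (1 + z)))\<^sup>2 <= ((1 / sqrt ((1 + cos \<phi>) / 2)) * (1 / (1 + cmod z)))\<^sup>2"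
   by (intro power_mono) auto
  also have "\<dots> = (1 / ((1 + cos \<phi>) / 2)) * (1 / (1 + cmod z)\<^sup>2)"
   unfolding power_mult_distrib power_divide by (subst real_sqrt_pow2) (use k0 in auto)
  also have "\<dots> <= (1 / ((1 + cos \<phi>) / 2)) * mp 1 (cmod z)"
   using k0 sector_nz[OF z] by (intro mult_left_mono inverse_square_le_mp) auto
  finally show ?thesis by (simp add: norm_divide norm_power power_divide)
 qed
 have s0: "scalar_sector_integral \<xi> ?s = 0"
  using ph th0 by (intro scalar_sector_integral_zero[OF _ _ _ shol _ sb]) auto
 have adms: "ray_admissible \<xi> ?s"
 proof (rule ray_admissibleI)
  fix \<tau> assume t: "\<bar>\<tau>\<bar> = \<bar>\<xi>\<bar>"
  have mem: "rcis r \<tau> \<in> sector \<phi>" if "r > 0" for r using that ph th0 t by (intro rcis_mem_sector) auto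
  show "continuous_on {0<..} (%r. ?s (rcis r \<tau>))"
   using mem by (intro continuous_on_compose2[OF holomorphic_on_imp_continuous_on[OF shol] rc]) auto
  show "cmod (?s (rcis r \<tau>)) <= (1 / ((1 + cos \<phi>) / 2)) * mp 1 r" if "r > 0" for r
   using sb[OF mem[OF that]] that by simp
 qed simp
 let ?l = "%z. 2 / (z\<^sup>2 - 1) :: complex"
 have adml: "ray_admissible \<xi> ?l"
 proof (rule ray_admissibleI)
  fix \<tau> assume t: "\<bar>\<tau>\<bar> = \<bar>\<xi>\<bar>"
  let ?k = "min ((1 - cos \<xi>) / 2) ((1 + cos \<xi>) / 2)"
  have kp: "?k > 0" using cos_monotone_0_pi[of 0 \<xi>] cos_monotone_0_pi[of \<xi> pi] th th0 by simp
  have low: "?k * (1 + r)\<^sup>2 <= cmod ((rcis r \<tau>)\<^sup>2 - 1)" if "r > 0" for r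
   using norm_sq_diff_ge[of 1 r \<xi> \<tau> \<xi>] that t th th0 by simp
  have pos: "0 < ?k * (1 + r)\<^sup>2" if "r > 0" for r using kp that by simp
  show "continuous_on {0<..} (%r. ?l (rcis r \<tau>))"
  proof (intro continuous_intros rc ballI)
   fix r :: real assume "r \<in> {0<..}"
   then have "0 < cmod ((rcis r \<tau>)\<^sup>2 - 1)" by (intro less_le_trans[OF pos low]) auto
   then show "(rcis r \<tau>)\<^sup>2 - 1 ~= 0" by auto
  qed
  show "cmod (?l (rcis r \<tau>)) <= (2 / ?k) * mp 1 r" if r: "r > 0" for r
  proof -
   have "cmod (?l (rcis r \<tau>)) <= 2 / (?k * (1 + r)\<^sup>2)"
    unfolding norm_divide norm_numeral
    by (rule divide_left_mono[OF low[OF r] _ mult_pos_pos[OF less_le_trans[OF pos[OF r] low[OF r]] pos[OF r]]]) simp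
   also have "\<dots> = 2 / ?k * (1 / (1 + r)\<^sup>2)" by simp
   also have "\<dots> <= 2 / ?k * mp 1 r" using kp r by (intro mult_left_mono inverse_square_le_mp) auto
   finally show ?thesis .
  qed
 qed simp
 have admc: "ray_admissible \<xi> c"
  unfolding c_def
 proof -
  have a: "ray_admissible \<xi> (%z. - f1 * ?s z)" "ray_admissible \<xi> (%z. - (f1 + f2) * ?l z)"
   by (rule ray_admissible_cmul[OF adms], rule ray_admissible_cmul[OF adml])
  have mono: "mp u r <= mp u' r" if "r > 0" "u' <= u" "u' > 0" for u u' r
  proof (cases "r <= 1")
   case True
   then show ?thesis using that powr_mono'[of "u' - 1" "u - 1" r] by (simp add: mp_le_one)
  next
   case False
   then show ?thesis using that powr_mono[of "-u-1" "-u'-1" r] by (simp add: mp_ge_one)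
  qed
  obtain C1 u1 where 1: "u1 > 0" "!!\<tau>. \<tau> \<in> {\<xi>, -\<xi>} ==> continuous_on {0<..} (%r. - f1 * ?s (rcis r \<tau>))"
   "!!\<tau> r. \<tau> \<in> {\<xi>, -\<xi>} ==> r > 0 ==> cmod (- f1 * ?s (rcis r \<tau>)) <= C1 * mp u1 r"
   using a(1) unfolding ray_admissible_def by metis
  obtain C2 u2 where 2: "u2 > 0" "!!\<tau>. \<tau> \<in> {\<xi>, -\<xi>} ==> continuous_on {0<..} (%r. - (f1 + f2) * ?l (rcis r \<tau>))"
   "!!\<tau> r. \<tau> \<in> {\<xi>, -\<xi>} ==> r > 0 ==> cmod (- (f1 + f2) * ?l (rcis r \<tau>)) <= C2 * mp u2 r"
   using a(2) unfolding ray_admissible_def by metis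
  show "ray_admissible \<xi> (%z. - f1 * ?s z + - (f1 + f2) * ?l z)"
  proof (rule ray_admissibleI)
   show "min u1 u2 > 0" using 1 2 by simp
   fix \<tau> assume "\<bar>\<tau>\<bar> = \<bar>\<xi>\<bar>"
   then have t: "\<tau> \<in> {\<xi>, -\<xi>}" by auto
   show "continuous_on {0<..} (%r. - f1 * ?s (rcis r \<tau>) + - (f1 + f2) * ?l (rcis r \<tau>))"
    by (rule continuous_on_add[OF 1(2)[OF t] 2(2)[OF t]])
   fix r :: real assume r: "r > 0"
   have "C1 * mp u1 r <= max C1 0 * mp (min u1 u2) r"
    using mono[OF r, of "min u1 u2" u1] mp_nonneg[OF r, of u1] 1 2 by (intro mult_mono) auto
   moreover have "C2 * mp u2 r <= max C2 0 * mp (min u1 u2) r"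
    using mono[OF r, of "min u1 u2" u2] mp_nonneg[OF r, of u2] 1 2 by (intro mult_mono) auto
   ultimately show "cmod (- f1 * ?s (rcis r \<tau>) + - (f1 + f2) * ?l (rcis r \<tau>)) <= (max C1 0 + max C2 0) * mp (min u1 u2) r"
    using norm_triangle_ineq[of "- f1 * ?s (rcis r \<tau>)" "- (f1 + f2) * ?l (rcis r \<tau>)"] 1(3)[OF t r] 2(3)[OF t r]
    unfolding distrib_right by linarith
  qed
 qed
 have "\<phi>' (sector_integral A \<xi> (%z. z / (1 + z)\<^sup>2)) = scalar_sector_integral \<xi> h"
  unfolding h_def using ph th f kernel_H0_infty[OF ph(1,3)] by (intro functional_sector_integral[OF A]) auto
 also have "\<dots> = scalar_sector_integral \<xi> (%z. G z + c z)"
 proof (rule scalar_sector_integral_cong')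
  fix r \<tau> :: real assume a: "r > 0" "\<bar>\<tau>\<bar> = \<xi>"
  then have "rcis r \<tau> \<in> sector \<phi>" using ph by (intro rcis_mem_sector) auto
  then have "1 + rcis r \<tau> ~= 0" by (rule nz)
  then show "h (rcis r \<tau>) = G (rcis r \<tau>) + c (rcis r \<tau>)"
   using a memr[of r \<tau>] th by (intro decomp) (auto simp: add_eq_0_iff)
 qed (use th0 in simp)
 also have "\<dots> = scalar_sector_integral \<xi> c" using G0 by (simp add: scalar_sector_integral_add[OF admG admc])
 also have "\<dots> = - f1 * scalar_sector_integral \<xi> ?s + - (f1 + f2) * scalar_sector_integral \<xi> ?l"
  unfolding c_def scalar_sector_integral_cmul[symmetric]
  by (rule scalar_sector_integral_add[OF ray_admissible_cmul[OF adms] ray_admissible_cmul[OF adml]])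
 also have "\<dots> = - f1 - f2" using s0 scalar_sector_integral_log_kernel[OF th0 th(2)] by simp
 also have "\<dots> = \<phi>' (pres A 1 - (pres A 1 o\<^sub>L pres A 1))"
  by (simp add: pres_def f1_def f2_def R1_def blinfun.diff_right blinfun.minus_right compose_minus_left compose_minus_right)
 finally show "\<phi>' (sector_integral A \<xi> (%z. z / (1 + z)\<^sup>2)) =
  \<phi>' (pres A 1 - (pres A 1 o\<^sub>L pres A 1))" .
qed

text \<open>A self-contained substitute for ``\<open>f(A) = W\<close>'': it is multiplicative, determines \<open>W\<close>, and can be read off from scalar Stieltjes integrals.\<close>

definition represents :: "'a::complex_banach lop => (complex => complex) => ('a \<Rightarrow>\<^sub>L 'a) => bool" where
 "represents A f W \<longleftrightarrow> W \<in> clinear_ops \<and>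
  (\<forall>z\<in>resolvent_set A. W o\<^sub>L resolvent A z = resolvent A z o\<^sub>L W) \<and>
  f holomorphic_on sector pi \<and>
  (\<forall>\<phi>. 0 < \<phi> --> \<phi> < pi --> (\<exists>K. \<forall>z\<in>sector \<phi>. cmod (f z) <= K)) \<and>
  (\<forall>\<omega> \<xi> \<phi> g. sectorial_of_angle \<omega> A --> \<omega> < \<xi> --> \<xi> < \<phi> --> \<phi> < pi --> g \<in> H0_infty \<phi> -->
   sector_integral A \<xi> g o\<^sub>L W = sector_integral A \<xi> (%z. g z * f z))"

lemma representsD:
 assumes "represents A f W"
 shows "W \<in> clinear_ops" "z \<in> resolvent_set A ==> W o\<^sub>L resolvent A z = resolvent A z o\<^sub>L W"
  "f holomorphic_on sector pi"
  "sectorial_of_angle \<omega> A ==> \<omega> < \<xi> ==> \<xi> < \<phi> ==> \<phi> < pi ==> g \<in> H0_infty \<phi> ==>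
   sector_integral A \<xi> g o\<^sub>L W = sector_integral A \<xi> (%z. g z * f z)"
 using assms unfolding represents_def by auto

lemma represents_bounded:
 assumes "represents A f W" "0 < \<phi>" "\<phi> < pi"
 obtains K where "!!z. z \<in> sector \<phi> ==> cmod (f z) <= K"
 using assms unfolding represents_def by meson

lemma represents_H0:
 assumes "represents A f W" "0 < \<phi>" "\<phi> < pi" "g \<in> H0_infty \<phi>"
 shows "(%z. g z * f z) \<in> H0_infty \<phi>"
proof -
 obtain K where "!!z. z \<in> sector \<phi> ==> cmod (f z) <= K" using represents_bounded[OF assms(1-3)] by metis
 moreover have "f holomorphic_on sector \<phi>"
  using representsD(3)[OF assms(1)] sector_mono[of \<phi> pi] assms(3) by (auto intro: holomorphic_on_subset)
 ultimately show ?thesis using assms(4) by (intro H0_infty_mult) auto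
qed

lemma sector_integral_cong:
 assumes "0 <= \<xi>" "\<xi> < \<phi>" "\<phi> <= pi" "!!z. z \<in> sector \<phi> ==> g z = h z"
 shows "sector_integral A \<xi> g = sector_integral A \<xi> h"
proof -
 have "integral {0<..} (%r. (g (rcis r \<tau>) * cis \<tau>) *\<^sub>C resolvent A (rcis r \<tau>)) =
   integral {0<..} (%r. (h (rcis r \<tau>) * cis \<tau>) *\<^sub>C resolvent A (rcis r \<tau>))" if "\<bar>\<tau>\<bar> = \<xi>" for \<tau>
 proof (rule integral_cong)
  fix r :: real assume "r \<in> {0<..}"
  then have "rcis r \<tau> \<in> sector \<phi>" using assms that by (intro rcis_mem_sector) auto
  then show "(g (rcis r \<tau>) * cis \<tau>) *\<^sub>C resolvent A (rcis r \<tau>) = (h (rcis r \<tau>) * cis \<tau>) *\<^sub>C resolvent A (rcis r \<tau>)"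
   by (simp add: assms(4))
 qed
 then show ?thesis using assms by (simp add: sector_integral_def)
qed

text \<open>The identity for W turns g into \<open>g * f\<close>, which is again in
  \<open>H0_infty\<close>, so the identity for W' applies to it.\<close>

lemma represents_mult:
 assumes 1: "represents A f W" and 2: "represents A f' W'"
 shows "represents A (%z. f z * f' z) (W o\<^sub>L W')"
 unfolding represents_def
proof (intro conjI allI impI ballI)
 show "W o\<^sub>L W' \<in> clinear_ops" by (intro clinear_ops_compose representsD[OF 1] representsD[OF 2])
 show "(W o\<^sub>L W') o\<^sub>L resolvent A z = resolvent A z o\<^sub>L (W o\<^sub>L W')" if "z \<in> resolvent_set A" for z
  using representsD(2)[OF 1 that] representsD(2)[OF 2 that] by (metis compose_assoc)
 show "(%z. f z * f' z) holomorphic_on sector pi"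
  by (intro holomorphic_intros representsD(3)[OF 1] representsD(3)[OF 2])
 show "\<exists>K. \<forall>z\<in>sector \<phi>. cmod (f z * f' z) <= K" if p: "0 < \<phi>" "\<phi> < pi" for \<phi>
 proof -
  obtain K K' where "!!z. z \<in> sector \<phi> ==> cmod (f z) <= K" "!!z. z \<in> sector \<phi> ==> cmod (f' z) <= K'"
   using represents_bounded[OF 1 p] represents_bounded[OF 2 p] by metis
  then have "cmod (f z * f' z) <= \<bar>K\<bar> * \<bar>K'\<bar>" if "z \<in> sector \<phi>" for z
   unfolding norm_mult using that by (intro mult_mono) (auto intro: order_trans[OF _ abs_ge_self])
  then show ?thesis by blast
 qed
 fix \<omega> \<xi> \<phi> g assume a: "sectorial_of_angle \<omega> A" "\<omega> < \<xi>" "\<xi> < \<phi>" "\<phi> < pi" "g \<in> H0_infty \<phi>"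
 then have p: "0 < \<phi>" using sectorial_angle[OF a(1)] by simp
 have "sector_integral A \<xi> g o\<^sub>L (W o\<^sub>L W') = sector_integral A \<xi> (%z. g z * f z) o\<^sub>L W'"
  using representsD(4)[OF 1 a] by (simp flip: compose_assoc)
 also have "\<dots> = sector_integral A \<xi> (%z. g z * f z * f' z)"
  by (rule representsD(4)[OF 2 a(1-4) represents_H0[OF 1 p a(4,5)]])
 finally show "sector_integral A \<xi> g o\<^sub>L (W o\<^sub>L W') = sector_integral A \<xi> (%z. g z * (f z * f' z))"
  by (simp add: mult.assoc)
qed

lemma represents_cong:
 assumes "represents A f W" "!!z. z \<in> sector pi ==> f z = f' z"
 shows "represents A f' W"
 unfolding represents_def
proof (intro conjI allI impI ballI)
 show "f' holomorphic_on sector pi"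
  using representsD(3)[OF assms(1)] assms(2) holomorphic_cong by blast
 show "\<exists>K. \<forall>z\<in>sector \<phi>. cmod (f' z) <= K" if p: "0 < \<phi>" "\<phi> < pi" for \<phi>
  using represents_bounded[OF assms(1) p] assms(2) sector_le_pi p by (metis less_imp_le)
 fix \<omega> \<xi> \<phi> g assume a: "sectorial_of_angle \<omega> A" "\<omega> < \<xi>" "\<xi> < \<phi>" "\<phi> < pi" "g \<in> H0_infty \<phi>"
 have "sector_integral A \<xi> (%z. g z * f z) = sector_integral A \<xi> (%z. g z * f' z)"
 proof (rule sector_integral_cong[of _ \<phi>])
  fix z assume "z \<in> sector \<phi>"
  then have "z \<in> sector pi" using a by (intro sector_le_pi[of \<phi>]) auto
  then show "g z * f z = g z * f' z" by (simp add: assms(2))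
 qed (use a sectorial_angle[OF a(1)] in auto)
 then show "sector_integral A \<xi> g o\<^sub>L W = sector_integral A \<xi> (%z. g z * f' z)"
  using representsD(4)[OF assms(1) a] by simp
qed (use representsD(1,2)[OF assms(1)] in auto)

lemma sector_integral_diff:
 assumes A: "sectorial_of_angle \<omega> A" and th: "\<omega> < \<xi>" "\<xi> < \<phi>" "\<phi> <= pi"
  and g: "g \<in> H0_infty \<phi>" and h: "h \<in> H0_infty \<phi>"
 shows "sector_integral A \<xi> (%z. g z - h z) = sector_integral A \<xi> g - sector_integral A \<xi> h"
proof -
 have th0: "\<xi> > 0" using sectorial_angle[OF A] th by simp
 have int: "(%r. (g (rcis r \<tau>) * cis \<tau>) *\<^sub>C resolvent A (rcis r \<tau>)) integrable_on {0<..}"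
  if t: "\<bar>\<tau>\<bar> = \<xi>" and g: "g \<in> H0_infty \<phi>" for \<tau> g
 proof -
  obtain C u where *: "u > 0" "continuous_on {0<..} (%r. g (rcis r \<tau>))"
   "continuous_on {0<..} (%r. resolvent A (rcis r \<tau>))"
   "!!r. r > 0 ==> cmod (g (rcis r \<tau>)) * norm (resolvent A (rcis r \<tau>)) <= C * mp u r" "C \<ge> 0"
   using sector_integrand[OF A th g t] by metis
  show ?thesis
   by (rule integrable_mp[where C=C and u=u])
    (intro continuous_on_scaleC continuous_on_mult continuous_on_const *, use * in \<open>auto simp: norm_scaleC norm_mult\<close>)
 qed
 have "integral {0<..} (%r. ((g (rcis r \<tau>) - h (rcis r \<tau>)) * cis \<tau>) *\<^sub>C resolvent A (rcis r \<tau>)) =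
  integral {0<..} (%r. (g (rcis r \<tau>) * cis \<tau>) *\<^sub>C resolvent A (rcis r \<tau>)) -
  integral {0<..} (%r. (h (rcis r \<tau>) * cis \<tau>) *\<^sub>C resolvent A (rcis r \<tau>))" if t: "\<bar>\<tau>\<bar> = \<xi>" for \<tau>
  unfolding left_diff_distrib scaleC_diff_left by (rule integral_diff[OF int[OF t g] int[OF t h]])
 then show ?thesis unfolding sector_integral_def using th0
  by (simp add: scaleC_diff_right)
qed

lemma represents_diff:
 assumes 1: "represents A f W" and 2: "represents A f' W'"
 shows "represents A (%z. f z - f' z) (W - W')"
 unfolding represents_def
proof (intro conjI allI impI ballI)
 show "W - W' \<in> clinear_ops" by (intro clinear_ops_intros representsD[OF 1] representsD[OF 2])
 show "(W - W') o\<^sub>L resolvent A z = resolvent A z o\<^sub>L (W - W')" if "z \<in> resolvent_set A" for z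
  using representsD(2)[OF 1 that] representsD(2)[OF 2 that] by (simp add: compose_diff_left compose_diff_right)
 show "(%z. f z - f' z) holomorphic_on sector pi"
  by (intro holomorphic_intros representsD(3)[OF 1] representsD(3)[OF 2])
 show "\<exists>K. \<forall>z\<in>sector \<phi>. cmod (f z - f' z) <= K" if p: "0 < \<phi>" "\<phi> < pi" for \<phi>
 proof -
  obtain K K' where "!!z. z \<in> sector \<phi> ==> cmod (f z) <= K" "!!z. z \<in> sector \<phi> ==> cmod (f' z) <= K'"
   using represents_bounded[OF 1 p] represents_bounded[OF 2 p] by metis
  then have "cmod (f z - f' z) <= K + K'" if "z \<in> sector \<phi>" for z
   using that norm_triangle_ineq4[of "f z" "f' z"] by fastforce
  then show ?thesis by blast
 qed
 fix \<omega> \<xi> \<phi> g assume a: "sectorial_of_angle \<omega> A" "\<omega> < \<xi>" "\<xi> < \<phi>" "\<phi> < pi" "g \<in> H0_infty \<phi>"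
 then have p: "0 < \<phi>" using sectorial_angle[OF a(1)] by simp
 show "sector_integral A \<xi> g o\<^sub>L (W - W') = sector_integral A \<xi> (%z. g z * (f z - f' z))"
  unfolding compose_diff_right right_diff_distrib representsD(4)[OF 1 a] representsD(4)[OF 2 a]
  by (rule sector_integral_diff[symmetric, OF a(1-3)])
   (use a p in \<open>auto intro: represents_H0[OF 1] represents_H0[OF 2]\<close>)
qed

lemma represents_one: "represents A (%z. 1) id_blinfun"
 unfolding represents_def by (auto simp: clinear_ops_intros intro!: exI[of _ 1])

lemma represents_pres:
 assumes A: "sectorial A" and \<mu>: "\<mu> > 0"
 shows "represents A (%z. 1 / (of_real \<mu> + z)) (pres A \<mu>)"
 unfolding represents_def
proof (intro conjI allI impI ballI)
 show "pres A \<mu> \<in> clinear_ops" by (rule pres_clinear[OF A \<mu>])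
 show "pres A \<mu> o\<^sub>L resolvent A z = resolvent A z o\<^sub>L pres A \<mu>" if "z \<in> resolvent_set A" for z
  using resolvent_commute[OF sectorial_linear'[OF A] that neg_real_resolvent_set[OF A \<mu>]]
  by (simp add: pres_def compose_minus_left compose_minus_right)
 show "(%z. 1 / (of_real \<mu> + z)) holomorphic_on sector pi"
  using sector_nz[OF add_sector_nonzero] \<mu> by (intro holomorphic_intros) auto
 show "\<exists>K. \<forall>z\<in>sector \<phi>. cmod (1 / (of_real \<mu> + z)) <= K" if p: "0 < \<phi>" "\<phi> < pi" for \<phi>
 proof (intro exI ballI)
  fix z assume z: "z \<in> sector \<phi>"
  have "cmod (1 / (of_real \<mu> + z)) <= (1 / sqrt ((1 + cos \<phi>) / 2)) * (1 / (\<mu> + cmod z))"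
   by (rule reciprocal_bound[OF p z \<mu>])
  also have "\<dots> <= (1 / sqrt ((1 + cos \<phi>) / 2)) * (1 / \<mu>)"
   using sqrt_half_cos_pos[of \<phi>] p \<mu> by (intro mult_left_mono divide_left_mono mult_pos_pos add_pos_nonneg) auto
  finally show "cmod (1 / (of_real \<mu> + z)) <= (1 / sqrt ((1 + cos \<phi>) / 2)) * (1 / \<mu>)" .
 qed
 fix \<omega> \<xi> \<phi> g assume a: "sectorial_of_angle \<omega> A" "\<omega> < \<xi>" "\<xi> < \<phi>" "\<phi> < pi" "g \<in> H0_infty \<phi>"
 show "sector_integral A \<xi> g o\<^sub>L pres A \<mu> = sector_integral A \<xi> (%z. g z * (1 / (of_real \<mu> + z)))"
  by (rule sector_integral_pres[OF a \<mu>])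
qed

text \<open>This is \<open>A (1 + A)^(-2)\<close>, the value of the kernel
  \<open>z / (1 + z)^2\<close>. It is injective together with A, and the kernel brings functions
  that are bounded on smaller sectors into \<open>H0_infty\<close>: a universal regulariser.\<close>

definition kop :: "'a::complex_banach lop => 'a \<Rightarrow>\<^sub>L 'a" where
 "kop A = pres A 1 - (pres A 1 o\<^sub>L pres A 1)"

lemma represents_kop:
 assumes A: "sectorial A"
 shows "represents A (%z. z / (1 + z)\<^sup>2) (kop A)"
proof -
 have p: "represents A (%z. 1 / (of_real 1 + z)) (pres A 1)" by (rule represents_pres[OF A]) simp
 from represents_diff[OF p represents_mult[OF p p]]
 have "represents A (%z. 1 / (of_real 1 + z) - 1 / (of_real 1 + z) * (1 / (of_real 1 + z))) (kop A)"
  by (simp add: kop_def)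
 then show ?thesis
 proof (rule represents_cong)
  fix z assume "z \<in> sector pi"
  then have nz: "1 + z ~= 0" using sector_nz[OF add_sector_nonzero[of z 1]] by simp
  obtain u where u: "1 + z = u" by simp
  then have "z = u - 1" "u ~= 0" using nz by auto
  then have "1 / u - 1 / u * (1 / u) = z / u\<^sup>2" by (simp add: field_simps power2_eq_square)
  then show "1 / (of_real 1 + z) - 1 / (of_real 1 + z) * (1 / (of_real 1 + z)) = z / (1 + z)\<^sup>2"
   by (simp only: of_real_1 u)
 qed
qed

lemma pres_injective:
 assumes "sectorial A" "\<nu> > 0" "pres A \<nu> x = 0"
 shows "x = 0"
proof -
 have "(0, x) \<in> A" using pres_in[OF assms(1,2), of x] assms(3) by simp
 moreover have "(0, 0) \<in> A" using sectorial_linear'[OF assms(1)] by (simp add: linear_operator_def)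
 ultimately show ?thesis using linear_operatorD(4)[OF sectorial_linear'[OF assms(1)]] by blast
qed

lemma one_minus_pres_injective:
 assumes "sectorial A" "injective_operator A" "x - pres A 1 x = 0"
 shows "x = 0"
 using pres_in[OF assms(1), of 1 x] assms(2,3) by (auto simp: injective_operator_def)

lemma kop_injective:
 assumes "sectorial A" "injective_operator A" "kop A x = 0"
 shows "x = 0"
proof -
 have "pres A 1 x - pres A 1 (pres A 1 x) = 0"
  using assms(3) by (simp add: kop_def blinfun.diff_left)
 then have "pres A 1 x = 0" by (rule one_minus_pres_injective[OF assms(1,2)])
 then show ?thesis by (rule pres_injective[OF assms(1), rotated]) simp
qed

lemma commute_kop:
 assumes "sectorial A" "!!z. z \<in> resolvent_set A ==> W o\<^sub>L resolvent A z = resolvent A z o\<^sub>L W"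
 shows "W o\<^sub>L kop A = kop A o\<^sub>L W"
proof -
 have "W o\<^sub>L pres A 1 = pres A 1 o\<^sub>L W"
  using assms(2)[OF neg_real_resolvent_set[OF assms(1), of 1]] by (simp add: pres_def compose_minus_left compose_minus_right)
 then show ?thesis unfolding kop_def compose_diff_left compose_diff_right by (metis compose_assoc)
qed

lemma kop_cancel:
 assumes A: "sectorial A" "injective_operator A"
  and W: "!!z. z \<in> resolvent_set A ==> W o\<^sub>L resolvent A z = resolvent A z o\<^sub>L W"
  and W': "!!z. z \<in> resolvent_set A ==> W' o\<^sub>L resolvent A z = resolvent A z o\<^sub>L W'"
  and eq: "W o\<^sub>L kop A = W' o\<^sub>L kop A"
 shows "W = W'"
proof (rule blinfun_eqI)
 fix x
 have "kop A o\<^sub>L W = kop A o\<^sub>L W'" using eq commute_kop[OF A(1) W] commute_kop[OF A(1) W'] by simp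
 from arg_cong[OF this, of "%F. F x"]
 have "kop A (W x - W' x) = 0" by (simp add: blinfun.diff_right)
 from kop_injective[OF A this] show "W x = W' x" by simp
qed

lemma sectorial_angle_exists:
 assumes "sectorial A"
 obtains \<omega> \<xi> \<phi> where "sectorial_of_angle \<omega> A" "\<omega> < \<xi>" "\<xi> < \<phi>" "\<phi> < pi" "0 < \<xi>" "0 < \<phi>"
proof -
 obtain \<omega> where w: "sectorial_of_angle \<omega> A" using assms by (auto simp: sectorial_def)
 note sectorial_angle[OF w]
 then show thesis
  by (intro that[OF w, of "\<omega> + (pi - \<omega>) / 3" "\<omega> + 2 * (pi - \<omega>) / 3"]) (auto simp: field_simps)
qed

lemma kop_sector_integral:
 assumes "sectorial_of_angle \<omega> A" "\<omega> < \<xi>" "\<xi> < pi"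
 shows "sector_integral A \<xi> (%z. z / (1 + z)\<^sup>2) = kop A"
 unfolding kop_def by (rule sector_integral_kernel[OF assms])

text \<open>Both products with \<open>kop A\<close> equal the sector integral of
  \<open>f(z) * z / (1 + z)^2\<close>, and \<open>kop A\<close> is injective and commutes with both
  operators.\<close>

lemma represents_unique:
 assumes A: "sectorial A" "injective_operator A" and 1: "represents A f W" and 2: "represents A f W'"
 shows "W = W'"
proof -
 obtain \<omega> \<xi> \<phi> where a: "sectorial_of_angle \<omega> A" "\<omega> < \<xi>" "\<xi> < \<phi>" "\<phi> < pi" "0 < \<xi>" "0 < \<phi>"
  using sectorial_angle_exists[OF A(1)] .
 have k: "(%z. z / (1 + z)\<^sup>2) \<in> H0_infty \<phi>" by (rule kernel_H0_infty[OF a(6,4)])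
 have K: "sector_integral A \<xi> (%z. z / (1 + z)\<^sup>2) = kop A" using a by (intro kop_sector_integral) auto
 have "kop A o\<^sub>L W = kop A o\<^sub>L W'"
  using representsD(4)[OF 1 a(1-4) k] representsD(4)[OF 2 a(1-4) k] by (simp add: K)
 then have "W o\<^sub>L kop A = W' o\<^sub>L kop A"
  using commute_kop[OF A(1) representsD(2)[OF 1]] commute_kop[OF A(1) representsD(2)[OF 2]] by simp
 then show ?thesis
  by (rule kop_cancel[OF A, rotated 2]) (auto intro: representsD(2)[OF 1] representsD(2)[OF 2])
qed

lemma sector_integral_add:
 assumes A: "sectorial_of_angle \<omega> A" and th: "\<omega> < \<xi>" "\<xi> < \<phi>" "\<phi> <= pi"
  and g: "g \<in> H0_infty \<phi>" and h: "h \<in> H0_infty \<phi>" and gh: "(%z. g z + h z) \<in> H0_infty \<phi>"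
 shows "sector_integral A \<xi> (%z. g z + h z) = sector_integral A \<xi> g + sector_integral A \<xi> h"
 using sector_integral_diff[OF A th gh h] by simp

lemma H0_infty_add:
 assumes "g \<in> H0_infty \<phi>" "h \<in> H0_infty \<phi>"
 shows "(%z. g z + h z) \<in> H0_infty \<phi>"
proof -
 obtain C s where 1: "g holomorphic_on sector \<phi>" "C \<ge> 0" "s > 0"
  "!!z. z \<in> sector \<phi> ==> cmod (g z) <= C * (cmod z * mp s (cmod z))"
  using H0_inftyE[OF assms(1)] by metis
 obtain C' s' where 2: "h holomorphic_on sector \<phi>" "C' \<ge> 0" "s' > 0"
  "!!z. z \<in> sector \<phi> ==> cmod (h z) <= C' * (cmod z * mp s' (cmod z))"
  using H0_inftyE[OF assms(2)] by metis
 have mono: "mp u r <= mp u' r" if "r > 0" "u' <= u" "u' > 0" for u u' r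
 proof (cases "r <= 1")
  case True
  then show ?thesis using that powr_mono'[of "u' - 1" "u - 1" r] by (simp add: mp_le_one)
 next
  case False
  then show ?thesis using that powr_mono[of "-u-1" "-u'-1" r] by (simp add: mp_ge_one)
 qed
 show ?thesis
 proof (rule H0_inftyI[where C="C + C'" and s="min s s'"])
  fix z assume z: "z \<in> sector \<phi>"
  have z0: "cmod z > 0" using sector_nz[OF z] by simp
  have "cmod (g z + h z) <= C * (cmod z * mp s (cmod z)) + C' * (cmod z * mp s' (cmod z))"
   using norm_triangle_ineq[of "g z" "h z"] 1(4)[OF z] 2(4)[OF z] by linarith
  also have "\<dots> <= C * (cmod z * mp (min s s') (cmod z)) + C' * (cmod z * mp (min s s') (cmod z))"
   using 1 2 z0 by (intro add_mono mult_left_mono mono) auto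
  finally show "cmod (g z + h z) <= (C + C') * (cmod z * mp (min s s') (cmod z))" by (simp add: distrib_right)
 qed (use 1 2 in \<open>auto intro!: holomorphic_intros\<close>)
qed

lemma H0_infty_cmul:
 assumes "g \<in> H0_infty \<phi>" shows "(%z. g z * c) \<in> H0_infty \<phi>"
 using H0_infty_mult[OF assms, of "%z. c" "cmod c"] by auto

lemma sector_integral_cmul: "sector_integral A \<xi> (%z. g z * c) = c *\<^sub>C sector_integral A \<xi> g"
 if A: "sectorial_of_angle \<omega> A" and th: "\<omega> < \<xi>" "\<xi> < \<phi>" "\<phi> <= pi" and g: "g \<in> H0_infty \<phi>"
proof (rule functional_eqI)
 fix \<phi>' :: "('a \<Rightarrow>\<^sub>L 'a) \<Rightarrow>\<^sub>L complex" assume f: "\<phi>' \<in> clinear_ops"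
 show "\<phi>' (sector_integral A \<xi> (%z. g z * c)) = \<phi>' (c *\<^sub>C sector_integral A \<xi> g)"
  unfolding functional_sector_integral[OF A th H0_infty_cmul[OF g] f] clinear_opsD[OF f]
   functional_sector_integral[OF A th g f] scaleC_complex_eq scalar_sector_integral_cmul[symmetric]
  by (simp add: mult_ac)
qed

text \<open>What is kept of a witness of the primary calculus. After multiplication by the kernel
  the part \<open>c / (1 + z) + d\<close> also lies in \<open>H0_infty\<close>, and
  \<open>U o\<^sub>L kop A\<close> is a pure sector integral at all angles from \<xi> on; so two
  witnesses with different angles can be compared.\<close>

definition kop_representation where
 "kop_representation A \<phi> e U \<omega> \<xi> \<longleftrightarrow> sectorial_of_angle \<omega> A \<and> \<omega> < \<xi> \<and> \<xi> < \<phi> \<and> \<phi> <= pi \<and>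
  (\<forall>\<xi>' \<phi>'. \<xi> <= \<xi>' --> \<xi>' < \<phi>' --> \<phi>' < \<phi> --> (%z. e z * (z / (1 + z)\<^sup>2)) \<in> H0_infty \<phi>' \<and>
   U o\<^sub>L kop A = sector_integral A \<xi>' (%z. e z * (z / (1 + z)\<^sup>2))) \<and>
  U \<in> clinear_ops \<and> (\<forall>z\<in>resolvent_set A. U o\<^sub>L resolvent A z = resolvent A z o\<^sub>L U) \<and>
  (\<forall>W\<in>clinear_ops. (\<forall>z\<in>resolvent_set A. W o\<^sub>L resolvent A z = resolvent A z o\<^sub>L W) --> W o\<^sub>L U = U o\<^sub>L W)"

lemma kop_representationD:
 assumes "kop_representation A \<phi> e U \<omega> \<xi>"
 shows "sectorial_of_angle \<omega> A" "\<omega> < \<xi>" "\<xi> < \<phi>" "\<phi> <= pi"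
  "\<xi> <= \<xi>' ==> \<xi>' < \<phi>' ==> \<phi>' < \<phi> ==> (%z. e z * (z / (1 + z)\<^sup>2)) \<in> H0_infty \<phi>' \<and>
   U o\<^sub>L kop A = sector_integral A \<xi>' (%z. e z * (z / (1 + z)\<^sup>2))"
  "U \<in> clinear_ops" "z \<in> resolvent_set A ==> U o\<^sub>L resolvent A z = resolvent A z o\<^sub>L U"
  "W \<in> clinear_ops ==> (!!z. z \<in> resolvent_set A ==> W o\<^sub>L resolvent A z = resolvent A z o\<^sub>L W) ==> W o\<^sub>L U = U o\<^sub>L W"
 using assms unfolding kop_representation_def by auto

lemma primary_calculus_kop:
 assumes A: "sectorial A" and P: "primary_calculus A \<phi> e U"
 shows "\<exists>\<omega> \<xi>. kop_representation A \<phi> e U \<omega> \<xi>"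
proof -
 obtain \<omega> \<xi> g c d where *: "sectorial_of_angle \<omega> A" "\<omega> < \<xi>" "\<xi> < \<phi>" "\<phi> <= pi" "g \<in> H0_infty \<phi>"
  "!!z. z \<in> sector \<phi> ==> e z = g z + c / (1 + z) + d"
  "U = sector_integral A \<xi> g - c *\<^sub>C resolvent A (- 1) + d *\<^sub>C id_blinfun"
  using P unfolding primary_calculus_def by blast
 have m1: "-1 \<in> resolvent_set A" using neg_real_resolvent_set[OF A, of 1] by simp
 have lin: "linear_operator A" by (rule sectorial_linear'[OF A])
 let ?k = "%z::complex. z / (1 + z)\<^sup>2"
 have Uc: "U \<in> clinear_ops" unfolding *(7)
  using * by (intro clinear_ops_intros sector_integral_clinear[OF *(1,2)] resolvent_clinear m1) auto
 have comm: "W o\<^sub>L U = U o\<^sub>L W" if W: "W \<in> clinear_ops"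
  "!!z. z \<in> resolvent_set A ==> W o\<^sub>L resolvent A z = resolvent A z o\<^sub>L W" for W
  unfolding *(7) compose_diff_left compose_diff_right compose_add_left compose_add_right
   scaleC_compose_right[OF W(1)] scaleC_compose_left
  using sector_integral_commute[OF *(1-5) W] W(2)[OF m1] by simp
 have UR: "U o\<^sub>L resolvent A z = resolvent A z o\<^sub>L U" if "z \<in> resolvent_set A" for z
  using comm[OF resolvent_clinear[OF that] resolvent_commute[OF lin that]] by simp
 \<comment> \<open>A smaller \<phi>' is taken because \<phi> = pi is allowed, and there the kernel
   is unbounded near -1.\<close>
 have main: "(%z. e z * ?k z) \<in> H0_infty \<phi>' \<and> U o\<^sub>L kop A = sector_integral A \<xi>' (%z. e z * ?k z)"
  if th: "\<xi> <= \<xi>'" "\<xi>' < \<phi>'" "\<phi>' < \<phi>" for \<xi>' \<phi>'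
 proof -
  have p: "0 < \<phi>'" "\<phi>' < pi" "\<omega> < \<xi>'" "\<xi>' < pi" "0 < \<xi>'" using th * sectorial_angle[OF *(1)] by auto
  have g': "g \<in> H0_infty \<phi>'" by (rule H0_infty_mono[OF _ *(5)]) (use th in simp)
  have k: "?k \<in> H0_infty \<phi>'" by (rule kernel_H0_infty[OF p(1,2)])
  have rp: "represents A (%z. 1 / (of_real 1 + z)) (pres A 1)" by (rule represents_pres[OF A]) simp
  have h1: "(%z. g z * ?k z) \<in> H0_infty \<phi>'" by (rule represents_H0[OF represents_kop[OF A] p(1,2) g'])
  have h2: "(%z. ?k z * (1 / (of_real 1 + z))) \<in> H0_infty \<phi>'" by (rule represents_H0[OF rp p(1,2) k])
  have h2': "(%z. ?k z * (1 / (of_real 1 + z)) * c) \<in> H0_infty \<phi>'" by (rule H0_infty_cmul[OF h2])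
  have h3: "(%z. ?k z * d) \<in> H0_infty \<phi>'" by (rule H0_infty_cmul[OF k])
  have h12: "(%z. g z * ?k z + ?k z * (1 / (of_real 1 + z)) * c) \<in> H0_infty \<phi>'" by (rule H0_infty_add[OF h1 h2'])
  have h: "(%z. g z * ?k z + ?k z * (1 / (of_real 1 + z)) * c + ?k z * d) \<in> H0_infty \<phi>'" by (rule H0_infty_add[OF h12 h3])
  have eq: "g z * ?k z + ?k z * (1 / (of_real 1 + z)) * c + ?k z * d = e z * ?k z" if "z \<in> sector \<phi>'" for z
  proof -
   have "e z = g z + c / (1 + z) + d" using that sector_mono[of \<phi>' \<phi>] th by (intro *(6)) auto
   then show ?thesis by (simp only: distrib_right) (simp add: mult_ac)
  qed
  have le: "\<phi>' <= pi" using p by simp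
  have K: "sector_integral A \<xi>' ?k = kop A" by (rule kop_sector_integral[OF *(1) p(3,4)])
  have "sector_integral A \<xi> g = sector_integral A \<xi>' g"
   using th * by (intro sector_integral_angle_indep[OF *(1,2) _ _ _ g']) auto
  then have a1: "sector_integral A \<xi> g o\<^sub>L kop A = sector_integral A \<xi>' (%z. g z * ?k z)"
   using representsD(4)[OF represents_kop[OF A] *(1) p(3) th(2) p(2) g'] by simp
  have "- (resolvent A (-1) o\<^sub>L kop A) = pres A 1 o\<^sub>L kop A" by (simp add: pres_def compose_minus_left)
  also have "\<dots> = kop A o\<^sub>L pres A 1"
   by (rule commute_kop[OF A representsD(2)[OF rp]])
  also have "\<dots> = sector_integral A \<xi>' (%z. ?k z * (1 / (of_real 1 + z)))"
   using representsD(4)[OF rp *(1) p(3) th(2) p(2) k] K by simp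
  finally have a2: "- (c *\<^sub>C (resolvent A (-1) o\<^sub>L kop A)) = sector_integral A \<xi>' (%z. ?k z * (1 / (of_real 1 + z)) * c)"
   unfolding sector_integral_cmul[OF *(1) p(3) th(2) le h2] by (simp flip: scaleC_minus_right)
  have a3: "d *\<^sub>C kop A = sector_integral A \<xi>' (%z. ?k z * d)"
   unfolding sector_integral_cmul[OF *(1) p(3) th(2) le k] K ..
  have "U o\<^sub>L kop A = (sector_integral A \<xi> g o\<^sub>L kop A) + - (c *\<^sub>C (resolvent A (-1) o\<^sub>L kop A)) + d *\<^sub>C kop A"
   unfolding *(7) compose_diff_left compose_add_left scaleC_compose_left by simp
  also have "\<dots> = sector_integral A \<xi>' (%z. g z * ?k z + ?k z * (1 / (of_real 1 + z)) * c + ?k z * d)"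
   unfolding a1 a2 a3 sector_integral_add[OF *(1) p(3) th(2) le h12 h3 h] sector_integral_add[OF *(1) p(3) th(2) le h1 h2' h12] ..
  also have "\<dots> = sector_integral A \<xi>' (%z. e z * ?k z)"
   using eq p th by (intro sector_integral_cong[of _ \<phi>']) auto
  finally show ?thesis using H0_infty_cong[OF eq h] by simp
 qed
 have "kop_representation A \<phi> e U \<omega> \<xi>"
  unfolding kop_representation_def using *(1-4) Uc by (intro conjI allI impI ballI main UR comm) auto
 then show ?thesis by blast
qed

text \<open>Any regulariser yields the graph given by the pair f1, f * f1. For e, U, V as in the
  definition, multiplication by the kernel makes \<open>V W1\<close> and \<open>U W2\<close> sector
  integrals of the same function; cancelling the kernel and then the injective U gives the equation.
  Conversely, the kernel times f1 is itself a regulariser.\<close>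

lemma functional_calculus_characterization:
 assumes A: "sectorial A" "injective_operator A" and f: "f holomorphic_on sector pi"
  and 1: "represents A f1 W1" and 2: "represents A f2 W2"
  and eq: "!!z. z \<in> sector pi ==> f z * f1 z = f2 z" and inj: "!!x. blinfun_apply W1 x = 0 ==> x = 0"
 shows "(x, y) \<in> functional_calculus A f \<longleftrightarrow> blinfun_apply W1 y = blinfun_apply W2 x"
proof
 let ?k = "%z::complex. z / (1 + z)\<^sup>2"
 assume "(x, y) \<in> functional_calculus A f"
 then obtain \<phi> e U V where *: "primary_calculus A \<phi> e U" "inj (blinfun_apply U)"
  "primary_calculus A \<phi> (%z. e z * f z) V" "blinfun_apply U y = blinfun_apply V x"
  unfolding functional_calculus_def by blast
 obtain \<omega> \<xi> \<omega>' \<xi>V where UV: "kop_representation A \<phi> e U \<omega> \<xi>" "kop_representation A \<phi> (%z. e z * f z) V \<omega>' \<xi>V"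
  using primary_calculus_kop[OF A(1) *(1)] primary_calculus_kop[OF A(1) *(3)] by metis
 note U = kop_representationD[OF UV(1)] and V = kop_representationD[OF UV(2)]
 \<comment> \<open>The two witnesses bring their own angles, while the comparison needs a common ray
   and a common smaller sector.\<close>
 define m where "m = max \<xi> \<xi>V"
 have m: "\<xi> <= m" "\<xi>V <= m" "m < \<phi>" using U(3) V(3) by (auto simp: m_def)
 define \<xi>' where "\<xi>' = (m + \<phi>) / 2"
 define \<phi>' where "\<phi>' = (\<xi>' + \<phi>) / 2"
 have th: "\<xi> <= \<xi>'" "\<xi>V <= \<xi>'" "\<xi>' < \<phi>'" "\<phi>' < \<phi>" "\<omega> < \<xi>'" "\<phi>' < pi" "0 < \<xi>'"
 proof -
  have 1: "m < \<xi>'" "\<xi>' < \<phi>" using m by (simp_all add: \<xi>'_def)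
  have 2: "\<xi>' < \<phi>'" "\<phi>' < \<phi>" using 1 by (simp_all add: \<phi>'_def)
  show "\<xi> <= \<xi>'" "\<xi>V <= \<xi>'" "\<xi>' < \<phi>'" "\<phi>' < \<phi>" "\<omega> < \<xi>'" "\<phi>' < pi" "0 < \<xi>'"
   using 1 2 m U(2-4) sectorial_angle[OF U(1)] by linarith+
 qed
 note U' = U(5)[OF th(1,3,4)] and V' = V(5)[OF th(2,3,4)]
 have "(V o\<^sub>L W1) o\<^sub>L kop A = (V o\<^sub>L kop A) o\<^sub>L W1"
  using commute_kop[OF A(1) representsD(2)[OF 1]] by (simp add: compose_assoc)
 also have "\<dots> = sector_integral A \<xi>' (%z. (e z * f z) * ?k z * f1 z)"
  using representsD(4)[OF 1 U(1) th(5,3,6)] V' by simp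
 also have "\<dots> = sector_integral A \<xi>' (%z. e z * ?k z * f2 z)"
 proof (rule sector_integral_cong[of _ \<phi>'])
  fix z assume "z \<in> sector \<phi>'"
  then have "f z * f1 z = f2 z" using th by (intro eq sector_le_pi[of \<phi>']) auto
  then show "(e z * f z) * ?k z * f1 z = e z * ?k z * f2 z" by (metis mult.assoc mult.commute)
 qed (use th in auto)
 also have "\<dots> = (U o\<^sub>L kop A) o\<^sub>L W2"
  using representsD(4)[OF 2 U(1) th(5,3,6)] U' by simp
 also have "\<dots> = (U o\<^sub>L W2) o\<^sub>L kop A"
  using commute_kop[OF A(1) representsD(2)[OF 2]] by (simp add: compose_assoc)
 finally have VW: "V o\<^sub>L W1 = U o\<^sub>L W2"
 proof (rule kop_cancel[OF A, rotated 2])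
  fix z assume z: "z \<in> resolvent_set A"
  show "(V o\<^sub>L W1) o\<^sub>L resolvent A z = resolvent A z o\<^sub>L (V o\<^sub>L W1)"
   using V(7)[OF z] representsD(2)[OF 1 z] by (metis compose_assoc)
  show "(U o\<^sub>L W2) o\<^sub>L resolvent A z = resolvent A z o\<^sub>L (U o\<^sub>L W2)"
   using U(7)[OF z] representsD(2)[OF 2 z] by (metis compose_assoc)
 qed
 have c1: "W1 o\<^sub>L U = U o\<^sub>L W1" "W1 o\<^sub>L V = V o\<^sub>L W1"
  using U(8)[OF representsD(1,2)[OF 1]] V(8)[OF representsD(1,2)[OF 1]] by auto
 have "blinfun_apply U (blinfun_apply W1 y) = blinfun_apply W1 (blinfun_apply U y)"
  using arg_cong[OF c1(1), of "%F. blinfun_apply F y"] by simp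
 also have "\<dots> = blinfun_apply (W1 o\<^sub>L V) x" using *(4) by simp
 also have "\<dots> = blinfun_apply U (blinfun_apply W2 x)" using c1(2) VW by simp
 finally show "blinfun_apply W1 y = blinfun_apply W2 x" using *(2) by (rule injD[rotated])
next
 let ?k = "%z::complex. z / (1 + z)\<^sup>2"
 assume xy: "blinfun_apply W1 y = blinfun_apply W2 x"
 obtain \<omega> \<xi> \<phi> where a: "sectorial_of_angle \<omega> A" "\<omega> < \<xi>" "\<xi> < \<phi>" "\<phi> < pi" "0 < \<xi>" "0 < \<phi>"
  using sectorial_angle_exists[OF A(1)] .
 have k: "?k \<in> H0_infty \<phi>" by (rule kernel_H0_infty[OF a(6,4)])
 have K: "sector_integral A \<xi> ?k = kop A" using a by (intro kop_sector_integral) auto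
 let ?e = "%z. ?k z * f1 z" and ?e' = "%z. ?k z * f2 z"
 have H: "?e \<in> H0_infty \<phi>" "?e' \<in> H0_infty \<phi>"
  by (rule represents_H0[OF 1 a(6,4) k], rule represents_H0[OF 2 a(6,4) k])
 have ee: "?e' z = ?e z * f z" if "z \<in> sector \<phi>" for z
  using eq[OF sector_le_pi[OF less_imp_le[OF a(4)] that]] by (metis mult.assoc mult.commute)
 have H3: "(%z. ?e z * f z) \<in> H0_infty \<phi>" by (rule H0_infty_cong[OF ee H(2)])
 define U where "U = sector_integral A \<xi> ?e"
 define V where "V = sector_integral A \<xi> (%z. ?e z * f z)"
 have prim: "primary_calculus A \<phi> g (sector_integral A \<xi> g)" if "g \<in> H0_infty \<phi>" for g
  unfolding primary_calculus_def
  by (rule exI[of _ \<omega>], rule exI[of _ \<xi>], rule exI[of _ g], rule exI[of _ 0], rule exI[of _ 0])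
   (use a that in simp)
 have U: "U = kop A o\<^sub>L W1" unfolding U_def using representsD(4)[OF 1 a(1-4) k] K by simp
 have "V = sector_integral A \<xi> ?e'" unfolding V_def
 proof (rule sector_integral_cong[of _ \<phi>])
  show "?e z * f z = ?e' z" if "z \<in> sector \<phi>" for z by (rule ee[OF that, symmetric])
 qed (use a in auto)
 then have V: "V = kop A o\<^sub>L W2" using representsD(4)[OF 2 a(1-4) k] K by simp
 have "inj (blinfun_apply U)"
 proof (rule injI)
  fix u v assume "blinfun_apply U u = blinfun_apply U v"
  then have "blinfun_apply (kop A) (blinfun_apply W1 (u - v)) = 0" by (simp add: U blinfun.diff_right)
  from inj[OF kop_injective[OF A this]] show "u = v" by simp
 qed
 moreover have "blinfun_apply U y = blinfun_apply V x" by (simp add: U V xy)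
 moreover have "f holomorphic_on sector \<phi>" using f sector_mono[of \<phi> pi] a by (auto intro: holomorphic_on_subset)
 ultimately show "(x, y) \<in> functional_calculus A f"
  unfolding functional_calculus_def using prim[OF H(1)] prim[OF H3] U_def V_def by blast
qed

section \<open>Fractional powers\<close>

lemma scaleR_clinear: "B \<in> clinear_ops ==> r *\<^sub>R B \<in> clinear_ops"
 unfolding scaleC_of_real[symmetric] by (rule clinear_ops_intros)

lemma scalar_sector_integral_single:
 assumes "ray_admissible \<xi> h"
 shows "scalar_sector_integral \<xi> h = 1 / (2 * of_real pi * \<i>) *
  integral {0<..} (%r. h (rcis r (-\<xi>)) * cis (-\<xi>) - h (rcis r \<xi>) * cis \<xi>)"
 using ray_admissible_integrable[OF assms, of \<xi>] ray_admissible_integrable[OF assms, of "-\<xi>"]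
 by (simp add: scalar_sector_integral_def integral_diff)

text \<open>Superpositions of resolvents. The bound on m is weighted with \<nu> because the norm of
  \<open>pres A (\<nu> \<mu>)\<close> is at most a constant times \<open>1 / \<nu> \<mu>\<close>;
  the same weight bounds the scalar kernels on smaller sectors. The identity for sector integrals is
  Fubini's theorem between \<mu> and the contour.\<close>

lemma represents_stieltjes:
 fixes m \<nu> :: "real => real"
 assumes A: "sectorial A" and m: "continuous_on {0<..} m"
  and \<nu>: "continuous_on {0<..} \<nu>" "!!\<mu>. \<mu> > 0 ==> \<nu> \<mu> > 0"
  and le: "!!\<mu>. \<mu> > 0 ==> \<bar>m \<mu>\<bar> <= C * mp u \<mu> * \<nu> \<mu>" and u: "u > 0"
  and f: "f holomorphic_on sector pi"
  and feq: "!!z. z \<in> sector pi ==> f z = integral {0<..} (%\<mu>. of_real (m \<mu>) / (of_real (\<nu> \<mu>) + z))"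
 shows "represents A f (integral {0<..} (%\<mu>. m \<mu> *\<^sub>R pres A (\<nu> \<mu>)))"
  and "(%\<mu>. m \<mu> *\<^sub>R pres A (\<nu> \<mu>)) integrable_on {0<..}"
proof -
 let ?W = "integral {0<..} (%\<mu>. m \<mu> *\<^sub>R pres A (\<nu> \<mu>))"
 have C0: "C \<ge> 0"
 proof -
  have "0 <= C * (mp u 1 * \<nu> 1)" using le[of 1] by (simp add: mult.assoc)
  moreover have "mp u 1 * \<nu> 1 > 0" using \<nu>(2)[of 1] by (simp add: mp_def)
  ultimately show ?thesis by (simp add: zero_le_mult_iff)
 qed
 obtain M where M: "M > 0" "!!\<nu>. \<nu> > 0 ==> norm (pres A \<nu>) <= M / \<nu>" using pres_bound[OF A] by metis
 show int: "(%\<mu>. m \<mu> *\<^sub>R pres A (\<nu> \<mu>)) integrable_on {0<..}"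
 proof (rule integrable_mp[where C="C * M" and u=u, OF _ _ u])
  show "continuous_on {0<..} (%\<mu>. m \<mu> *\<^sub>R pres A (\<nu> \<mu>))"
   using \<nu> by (intro continuous_on_scaleR m continuous_on_pres[OF A]) auto
  fix \<mu> :: real assume mu: "\<mu> > 0"
  have "norm (m \<mu> *\<^sub>R pres A (\<nu> \<mu>)) <= (C * mp u \<mu> * \<nu> \<mu>) * (M / \<nu> \<mu>)"
   unfolding norm_scaleR using le[OF mu] M(2)[OF \<nu>(2)[OF mu]] by (intro mult_mono) auto
  then show "norm (m \<mu> *\<^sub>R pres A (\<nu> \<mu>)) <= C * M * mp u \<mu>" using \<nu>(2)[OF mu] by (simp add: mult_ac)
 qed
 have Wc: "?W \<in> clinear_ops" using \<nu> by (intro integral_clinear_ops scaleR_clinear pres_clinear[OF A]) auto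
 have kb: "cmod (of_real x / (of_real n + z)) <= \<bar>x\<bar> * ((1 / sqrt ((1 + cos \<phi>) / 2)) * (1 / n))"
  if "0 < \<phi>" "\<phi> < pi" "z \<in> sector \<phi>" "n > 0" for \<phi> z and n x :: real
 proof -
  have "cmod (1 / (of_real n + z)) <= (1 / sqrt ((1 + cos \<phi>) / 2)) * (1 / (n + cmod z))"
   by (rule reciprocal_bound[OF that])
  also have "\<dots> <= (1 / sqrt ((1 + cos \<phi>) / 2)) * (1 / n)"
   using sqrt_half_cos_pos[of \<phi>] that by (intro mult_left_mono divide_left_mono mult_pos_pos add_pos_nonneg) auto
  finally have "\<bar>x\<bar> * cmod (1 / (of_real n + z)) <= \<bar>x\<bar> * ((1 / sqrt ((1 + cos \<phi>) / 2)) * (1 / n))"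
   by (intro mult_left_mono) auto
  then show ?thesis by (simp add: norm_divide)
 qed
 have kc: "continuous_on {0<..} (%\<mu>. of_real (m \<mu>) / (of_real (\<nu> \<mu>) + z))" if "z \<in> sector pi" for z
  using sector_nz[OF add_sector_nonzero[OF that]] \<nu>(2)
  by (intro continuous_intros m \<nu>(1)) (auto simp: less_imp_le)
 have kmp: "cmod (of_real (m \<mu>) / (of_real (\<nu> \<mu>) + z)) <= (C * (1 / sqrt ((1 + cos \<phi>) / 2))) * mp u \<mu>"
  if p: "0 < \<phi>" "\<phi> < pi" "z \<in> sector \<phi>" and mu: "\<mu> > 0" for \<phi> z \<mu>
 proof -
  have "cmod (of_real (m \<mu>) / (of_real (\<nu> \<mu>) + z)) <= (C * mp u \<mu> * \<nu> \<mu>) * ((1 / sqrt ((1 + cos \<phi>) / 2)) * (1 / \<nu> \<mu>))"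
   using sqrt_half_cos_pos[of \<phi>] p \<nu>(2)[OF mu]
   by (intro order_trans[OF kb[OF p \<nu>(2)[OF mu]]] mult_right_mono le[OF mu]) auto
  then show ?thesis using \<nu>(2)[OF mu] by (simp add: mult_ac)
 qed
 show "represents A f ?W"
  unfolding represents_def
 proof (intro conjI allI impI ballI)
  show "?W \<in> clinear_ops" by (rule Wc)
  show "f holomorphic_on sector pi" by (rule f)
  show "?W o\<^sub>L resolvent A z = resolvent A z o\<^sub>L ?W" if z: "z \<in> resolvent_set A" for z
  proof -
   have "?W o\<^sub>L resolvent A z = integral {0<..} (%\<mu>. (m \<mu> *\<^sub>R pres A (\<nu> \<mu>)) o\<^sub>L resolvent A z)"
    by (rule integral_linear[OF int bounded_bilinear.bounded_linear_left[OF bounded_bilinear_blinfun_compose],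
       unfolded o_def, symmetric])
   also have "\<dots> = integral {0<..} (%\<mu>. resolvent A z o\<^sub>L (m \<mu> *\<^sub>R pres A (\<nu> \<mu>)))"
   proof (rule integral_cong)
    fix \<mu> :: real assume "\<mu> \<in> {0<..}"
    then have "pres A (\<nu> \<mu>) o\<^sub>L resolvent A z = resolvent A z o\<^sub>L pres A (\<nu> \<mu>)"
     using representsD(2)[OF represents_pres[OF A \<nu>(2)] z] by simp
    then show "(m \<mu> *\<^sub>R pres A (\<nu> \<mu>)) o\<^sub>L resolvent A z = resolvent A z o\<^sub>L (m \<mu> *\<^sub>R pres A (\<nu> \<mu>))"
     by (simp add: compose_scaleR_left compose_scaleR_right)
   qed
   also have "\<dots> = resolvent A z o\<^sub>L ?W"
    by (rule integral_linear[OF int bounded_bilinear.bounded_linear_right[OF bounded_bilinear_blinfun_compose],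
       unfolded o_def])
   finally show ?thesis .
  qed
  show "\<exists>K. \<forall>z\<in>sector \<phi>. cmod (f z) <= K" if p: "0 < \<phi>" "\<phi> < pi" for \<phi>
  proof (intro exI ballI)
   fix z assume z: "z \<in> sector \<phi>"
   then have z': "z \<in> sector pi" using p by (intro sector_le_pi[of \<phi>]) auto
   show "cmod (f z) <= (C * (1 / sqrt ((1 + cos \<phi>) / 2))) * integral {0<..} (mp u)"
    unfolding feq[OF z'] by (rule norm_integral_mp_le[OF kc[OF z'] kmp[OF p z] u])
  qed
  fix \<omega> \<xi> \<phi> g assume a: "sectorial_of_angle \<omega> A" "\<omega> < \<xi>" "\<xi> < \<phi>" "\<phi> < pi" and g: "g \<in> H0_infty \<phi>"
  then have p: "0 < \<phi>" "0 < \<xi>" "\<phi> <= pi" using sectorial_angle[OF a(1)] by auto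
  show "sector_integral A \<xi> g o\<^sub>L ?W = sector_integral A \<xi> (%z. g z * f z)"
  proof (rule functional_eqI)
   fix \<phi>' :: "('a \<Rightarrow>\<^sub>L 'a) \<Rightarrow>\<^sub>L complex" assume fc: "\<phi>' \<in> clinear_ops"
   let ?\<rho> = "%z. \<phi>' (resolvent A z)"
   have Pc: "sector_integral A \<xi> g \<in> clinear_ops" using a p by (intro sector_integral_clinear[OF a(1)]) auto
   obtain q where q: "q \<in> clinear_ops" "!!B. q B = \<phi>' (sector_integral A \<xi> g o\<^sub>L B)"
    using compose_left_functional[OF fc Pc] by metis
   obtain C' v where v1: "v > 0" and v23: "\<forall>\<tau>\<in>{\<xi>, -\<xi>}. continuous_on {0<..} (%r. g (rcis r \<tau>) * ?\<rho> (rcis r \<tau>)) \<and>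
    (\<forall>r>0. cmod (g (rcis r \<tau>) * ?\<rho> (rcis r \<tau>)) <= C' * mp v r)"
    using ray_admissible_functional[OF a(1-3) p(3) g, of \<phi>'] unfolding ray_admissible_def
    by (elim exE conjE) (rule that)
   have v: "v > 0" "!!\<tau>. \<tau> \<in> {\<xi>, -\<xi>} ==> continuous_on {0<..} (%r. g (rcis r \<tau>) * ?\<rho> (rcis r \<tau>))"
    "!!\<tau> r. \<tau> \<in> {\<xi>, -\<xi>} ==> r > 0 ==> cmod (g (rcis r \<tau>) * ?\<rho> (rcis r \<tau>)) <= C' * mp v r"
    using v1 v23 by blast+
   define w where "w \<tau> r = g (rcis r \<tau>) * ?\<rho> (rcis r \<tau>) * cis \<tau>" for \<tau> r
   have wc: "continuous_on {0<..} (w \<tau>)" if "\<tau> \<in> {\<xi>, -\<xi>}" for \<tau>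
    unfolding w_def by (intro continuous_on_mult v(2)[OF that] continuous_on_const)
   have wb: "cmod (w \<tau> r) <= C' * mp v r" if "\<tau> \<in> {\<xi>, -\<xi>}" "r > 0" for \<tau> r
    using v(3)[OF that] by (simp add: w_def norm_mult)
   have mem: "rcis r \<tau> \<in> sector \<phi>" if "\<tau> \<in> {\<xi>, -\<xi>}" "r > 0" for \<tau> r
    using that a p by (intro rcis_mem_sector) auto
   have mem': "rcis r \<tau> \<in> sector pi" if "\<tau> \<in> {\<xi>, -\<xi>}" "r > 0" for \<tau> r
    using mem[OF that] p by (rule_tac sector_le_pi[of \<phi>]) auto
   let ?c = "1 / (2 * of_real pi * \<i>) :: complex"
   let ?K = "%\<mu> r. of_real (m \<mu>) / (of_real (\<nu> \<mu>) + r) :: complex"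
   \<comment> \<open>Both rays enter one integrand, so that a single exchange of integrals
     suffices.\<close>
   define F where "F \<mu> r = w (-\<xi>) r * ?K \<mu> (rcis r (-\<xi>)) - w \<xi> r * ?K \<mu> (rcis r \<xi>)" for \<mu> r
   have qP: "q (m \<mu> *\<^sub>R pres A (\<nu> \<mu>)) = ?c * integral {0<..} (F \<mu>)" if mu: "\<mu> > 0" for \<mu>
   proof -
    note n = \<nu>(2)[OF mu]
    have H: "(%z. g z * (1 / (of_real (\<nu> \<mu>) + z))) \<in> H0_infty \<phi>"
     by (rule represents_H0[OF represents_pres[OF A n] p(1) a(4) g])
    let ?h = "%z. g z * (1 / (of_real (\<nu> \<mu>) + z)) * ?\<rho> z"
    have "q (m \<mu> *\<^sub>R pres A (\<nu> \<mu>)) = of_real (m \<mu>) * q (pres A (\<nu> \<mu>))"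
     by (simp add: blinfun.scaleR_right scaleR_conv_of_real)
    also have "q (pres A (\<nu> \<mu>)) = \<phi>' (sector_integral A \<xi> (%z. g z * (1 / (of_real (\<nu> \<mu>) + z))))"
     unfolding q(2) sector_integral_pres[OF a g n] ..
    also have "\<dots> = scalar_sector_integral \<xi> ?h"
     by (rule functional_sector_integral[OF a(1-3) p(3) H fc])
    also have "of_real (m \<mu>) * \<dots> = scalar_sector_integral \<xi> (%z. of_real (m \<mu>) * ?h z)"
     by (rule scalar_sector_integral_cmul[symmetric])
    also have "\<dots> = ?c * integral {0<..} (%r. of_real (m \<mu>) * ?h (rcis r (-\<xi>)) * cis (-\<xi>) - of_real (m \<mu>) * ?h (rcis r \<xi>) * cis \<xi>)"
     by (intro scalar_sector_integral_single ray_admissible_cmul ray_admissible_functional[OF a(1-3) p(3) H])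
    also have "(%r. of_real (m \<mu>) * ?h (rcis r (-\<xi>)) * cis (-\<xi>) - of_real (m \<mu>) * ?h (rcis r \<xi>) * cis \<xi>) = F \<mu>"
     by (rule ext) (simp add: F_def w_def mult_ac)
    finally show ?thesis .
   qed
   have Fc: "continuous_on ({0<..} \<times> {0<..}) (%(\<mu>, r). F \<mu> r)"
   proof -
    have c1: "continuous_on ({0<..} \<times> {0<..}) (%x. w \<tau> (snd x))" if "\<tau> \<in> {\<xi>, -\<xi>}" for \<tau>
     by (rule continuous_on_compose2[OF wc[OF that]]) (auto intro!: continuous_intros)
    have c2: "continuous_on ({0<..} \<times> {0<..}) (%x. m (fst x))" "continuous_on ({0<..} \<times> {0<..}) (%x. \<nu> (fst x))"
     by (rule continuous_on_compose2[OF m] continuous_on_compose2[OF \<nu>(1)]; auto intro!: continuous_intros)+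
    have c3: "continuous_on ({0<..} \<times> {0<..}) (%x. rcis (snd x) \<tau>)" for \<tau> :: real
     unfolding rcis_def by (intro continuous_intros)
    have nz: "of_real (\<nu> (fst x)) + rcis (snd x) \<tau> ~= 0" if "x \<in> {0<..} \<times> {0<..}" "\<tau> \<in> {\<xi>, -\<xi>}" for x \<tau>
     using that by (intro sector_nz[OF add_sector_nonzero[OF mem']] less_imp_le[OF \<nu>(2)]) auto
    show ?thesis unfolding F_def case_prod_beta
     by (intro continuous_on_diff continuous_on_mult c1 continuous_on_divide continuous_on_of_real c2 continuous_on_add c3 ballI nz) auto
   qed
   define k where "k = 1 / sqrt ((1 + cos \<phi>) / 2)"
   have k: "k > 0" unfolding k_def using sqrt_half_cos_pos[of \<phi>] p a by simp
   have Fb: "cmod (F \<mu> r) <= (2 * C * k * C') * mp u \<mu> * mp v r" if mu: "\<mu> > 0" and r: "r > 0" for \<mu> r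
   proof -
    have "cmod (w \<tau> r * ?K \<mu> (rcis r \<tau>)) <= (C' * mp v r) * ((C * k) * mp u \<mu>)" if t: "\<tau> \<in> {\<xi>, -\<xi>}" for \<tau>
     unfolding norm_mult k_def using kmp[OF p(1) a(4) mem[OF t r] mu] wb[OF t r]
     by (intro mult_mono) (auto intro: order_trans[OF norm_ge_zero])
    from this[of "-\<xi>"] this[of \<xi>] show ?thesis
     unfolding F_def using norm_triangle_ineq4[of "w (-\<xi>) r * ?K \<mu> (rcis r (-\<xi>))" "w \<xi> r * ?K \<mu> (rcis r \<xi>)"]
     by (simp add: mult_ac)
   qed
   have inner: "integral {0<..} (%\<mu>. F \<mu> r) = w (-\<xi>) r * f (rcis r (-\<xi>)) - w \<xi> r * f (rcis r \<xi>)" if r: "r > 0" for r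
   proof -
    have ki: "(%\<mu>. ?K \<mu> (rcis r \<tau>)) integrable_on {0<..}" if t: "\<tau> \<in> {\<xi>, -\<xi>}" for \<tau>
     by (rule integrable_mp[OF kc[OF mem'[OF t r]] kmp[OF p(1) a(4) mem[OF t r]] u])
    have i: "((%\<mu>. w \<tau> r * ?K \<mu> (rcis r \<tau>)) has_integral w \<tau> r * f (rcis r \<tau>)) {0<..}" if t: "\<tau> \<in> {\<xi>, -\<xi>}" for \<tau>
     unfolding feq[OF mem'[OF t r]] by (intro has_integral_mult_right integrable_integral ki[OF t])
    show ?thesis unfolding F_def by (intro integral_unique has_integral_diff i) auto
   qed
   have H: "(%z. g z * f z) \<in> H0_infty \<phi>"
   proof (rule H0_infty_mult[OF g])
    show "f holomorphic_on sector \<phi>" using f sector_mono[of \<phi> pi] p by (auto intro: holomorphic_on_subset)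
    fix z assume z: "z \<in> sector \<phi>"
    then have z': "z \<in> sector pi" using p by (intro sector_le_pi[of \<phi>]) auto
    show "cmod (f z) <= (C * (1 / sqrt ((1 + cos \<phi>) / 2))) * integral {0<..} (mp u)"
     unfolding feq[OF z'] by (rule norm_integral_mp_le[OF kc[OF z'] kmp[OF p(1) a(4) z] u])
   qed
   have "\<phi>' (sector_integral A \<xi> g o\<^sub>L ?W) = integral {0<..} (%\<mu>. q (m \<mu> *\<^sub>R pres A (\<nu> \<mu>)))"
    unfolding q(2)[symmetric] by (rule blinfun_apply_integral[OF int])
   also have "\<dots> = integral {0<..} (%\<mu>. ?c * integral {0<..} (F \<mu>))" by (rule integral_cong) (simp add: qP)
   also have "\<dots> = ?c * integral {0<..} (%r. integral {0<..} (%\<mu>. F \<mu> r))"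
   proof -
    have "integral {0<..} (%\<mu>. integral {0<..} (F \<mu>)) = integral {0<..} (%r. integral {0<..} (%\<mu>. F \<mu> r))"
     by (rule fubini_mp[OF Fc Fb u v(1)])
    then show ?thesis unfolding integral_mult_right by (rule arg_cong)
   qed
   also have "\<dots> = ?c * integral {0<..} (%r. (g (rcis r (-\<xi>)) * f (rcis r (-\<xi>)) * ?\<rho> (rcis r (-\<xi>))) * cis (-\<xi>)
     - (g (rcis r \<xi>) * f (rcis r \<xi>) * ?\<rho> (rcis r \<xi>)) * cis \<xi>)"
    by (intro arg_cong2[where f="(*)"] integral_cong refl) (simp add: inner w_def mult_ac)
   also have "\<dots> = scalar_sector_integral \<xi> (%z. g z * f z * ?\<rho> z)"
    by (rule scalar_sector_integral_single[symmetric, OF ray_admissible_functional[OF a(1-3) p(3) H]])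
   also have "\<dots> = \<phi>' (sector_integral A \<xi> (%z. g z * f z))"
    by (rule functional_sector_integral[symmetric, OF a(1-3) p(3) H fc])
   finally show "\<phi>' (sector_integral A \<xi> g o\<^sub>L ?W) = \<phi>' (sector_integral A \<xi> (%z. g z * f z))" .
  qed
 qed
qed

lemma stieltjes_complex_integrable:
 assumes s: "0 < s" "s < 1" and v: "v \<in> sector pi"
 shows "(%\<mu>. of_real (\<mu> powr (-s)) / (of_real \<mu> + v) :: complex) integrable_on {0<..}"
proof -
 obtain \<rho> \<xi> where v': "v = rcis \<rho> \<xi>" "\<rho> > 0" "\<bar>\<xi>\<bar> < pi" using sector_polar[OF v] by metis
 define \<phi> where "\<phi> = (\<bar>\<xi>\<bar> + pi) / 2"
 have p: "\<bar>\<xi>\<bar> < \<phi>" "\<phi> < pi" "0 < \<phi>" using v' by (auto simp: \<phi>_def)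
 have vp: "v \<in> sector \<phi>" unfolding v'(1) using v' p by (intro rcis_mem_sector) auto
 define k where "k = sqrt ((1 + cos \<phi>) / 2)"
 have k: "k > 0" unfolding k_def using sqrt_half_cos_pos[of \<phi>] p by simp
 show ?thesis
 proof (rule integrable_mp[where C="1 / (k * min \<rho> 1)" and u="min s (1 - s)"])
  show "continuous_on {0<..} (%\<mu>. of_real (\<mu> powr (-s)) / (of_real \<mu> + v) :: complex)"
   using sector_nz[OF add_sector_nonzero[OF v]] by (intro continuous_intros) (auto simp: less_imp_le)
  fix r :: real assume r: "r > 0"
  have "k * (r + cmod v) <= cmod (of_real r + v)"
   unfolding k_def using p vp r by (intro norm_add_sector_ge) auto
  moreover have "min \<rho> 1 * (r + 1) <= r + cmod v" using r v' by (auto simp: min_def algebra_simps)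
  then have "k * (min \<rho> 1 * (r + 1)) <= k * (r + cmod v)" using k by (intro mult_left_mono) auto
  ultimately have low: "(k * min \<rho> 1) * (r + 1) <= cmod (of_real r + v)" by (simp add: mult.assoc)
  have pos: "0 < (k * min \<rho> 1) * (r + 1)" using k v' r by simp
  have "norm (of_real (r powr (-s)) / (of_real r + v)) <= r powr (-s) / ((k * min \<rho> 1) * (r + 1))"
   unfolding norm_divide using divide_left_mono[OF low _ mult_pos_pos[OF less_le_trans[OF pos low] pos], of "r powr (-s)"] by simp
  also have "\<dots> = (1 / (k * min \<rho> 1)) * (r powr (-s) / (r + 1))" by simp
  also have "\<dots> <= (1 / (k * min \<rho> 1)) * mp (min s (1 - s)) r"
   using r s k v' by (intro mult_left_mono powr_shift_le_mp) auto
  finally show "norm (of_real (r powr (-s)) / (of_real r + v)) <= 1 / (k * min \<rho> 1) * mp (min s (1 - s)) r" .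
 qed (use s in auto)
qed

text \<open>This is \<open>(b + 1 + A)^(-s)\<close>, by the Stieltjes formula at
  \<open>v = b + 1 + z\<close>.\<close>

definition ifrac :: "'a::complex_banach lop => real => real => 'a \<Rightarrow>\<^sub>L 'a" where
 "ifrac A b s = integral {0<..} (%\<mu>. (\<mu> powr (-s) / st s) *\<^sub>R pres A (b + 1 + \<mu>))"

text \<open>One minus \<open>w^s\<close> for \<open>w = (b + z) / (b + 1 + z)\<close>, written with
  resolvents. It comes from \<open>w^s = w * w^(-(1 - s))\<close> and the Stieltjes formula for 1 -
  s: \<open>w / (\<mu> + w)\<close> has its only pole at
  \<open>z = - (b + \<mu> / (1 + \<mu>))\<close>, and the difference from 1 removes its value at
  infinity.\<close>

definition dfrac_integral :: "'a::complex_banach lop => real => real => 'a \<Rightarrow>\<^sub>L 'a" where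
 "dfrac_integral A b s = integral {0<..} (%\<mu>. (\<mu> powr s / (1 + \<mu>)\<^sup>2 / st (1 - s)) *\<^sub>R pres A (b + \<mu> / (1 + \<mu>)))"

lemma represents_ifrac:
 assumes A: "sectorial A" and b: "b \<ge> 0" and s: "0 < s" "s < 1"
 shows "represents A (%z. (of_real (b + 1) + z) powr of_real (-s)) (ifrac A b s)"
 unfolding ifrac_def
proof (rule represents_stieltjes(1)[OF A, where u="min s (1 - s)" and C="1 / st s"])
 have v: "of_real (b + 1) + z \<in> sector pi" if "z \<in> sector pi" for z
  using add_sector_nonzero[OF that, of "b + 1"] b by simp
 show "continuous_on {0<..} (%\<mu>. \<mu> powr (-s) / st s)" using st_pos[OF s] by (intro continuous_intros) auto
 show "continuous_on {0<..} (%\<mu>. b + 1 + \<mu>)" by (intro continuous_intros)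
 show "b + 1 + \<mu> > 0" if "\<mu> > 0" for \<mu> using that b by simp
 show "min s (1 - s) > 0" using s by simp
 show "\<bar>\<mu> powr (-s) / st s\<bar> <= 1 / st s * mp (min s (1 - s)) \<mu> * (b + 1 + \<mu>)" if mu: "\<mu> > 0" for \<mu>
 proof -
  have "\<mu> powr (-s) = \<mu> powr (-s) / (\<mu> + 1) * (\<mu> + 1)" using mu by simp
  also have "\<dots> <= mp (min s (1 - s)) \<mu> * (b + 1 + \<mu>)"
   using mu b s by (intro mult_mono powr_shift_le_mp mp_nonneg) auto
  finally show ?thesis using st_pos[OF s] by (simp add: divide_right_mono)
 qed
 show "(%z. (of_real (b + 1) + z) powr of_real (-s)) holomorphic_on sector pi"
  using v by (intro holomorphic_intros) (auto simp: sector_pi simp del: of_real_add)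
 fix z assume z: "z \<in> sector pi"
 have "integral {0<..} (%\<mu>. of_real (\<mu> powr (-s) / st s) / (of_real (b + 1 + \<mu>) + z)) =
  integral {0<..} (%\<mu>. of_real (1 / st s) * (of_real (\<mu> powr (-s)) / (of_real \<mu> + (of_real (b + 1) + z))))"
  by (rule integral_cong) (simp add: add_ac)
 also have "\<dots> = of_real (1 / st s) * (of_real (st s) * (of_real (b + 1) + z) powr of_real (-s))"
  unfolding integral_mult_right stieltjes_complex[OF s v[OF z]] ..
 also have "\<dots> = (of_real (b + 1) + z) powr of_real (-s)" using st_pos[OF s] by simp
 finally show "(of_real (b + 1) + z) powr of_real (-s) =
  integral {0<..} (%\<mu>. of_real (\<mu> powr (-s) / st s) / (of_real (b + 1 + \<mu>) + z))" ..
qed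

text \<open>The arguments of z and 1 + z have the same sign and are less than pi in size, so
  \<open>Ln z - Ln (1 + z)\<close> is the principal logarithm of the quotient.\<close>

lemma sector_quotient:
 assumes "z \<in> sector pi"
 shows "z / (1 + z) \<in> sector pi" "(z / (1 + z)) powr of_real a = z powr of_real a * (1 + z) powr of_real (-a)"
proof -
 have z1: "1 + z \<in> sector pi" using add_sector_nonzero[OF assms, of 1] by simp
 note nz = sector_nz[OF assms] sector_nz[OF z1]
 have "Im (Ln z) < pi" "Im (Ln (1 + z)) < pi"
  using assms z1 Im_Ln_le_pi[OF nz(1)] Im_Ln_le_pi[OF nz(2)] Im_Ln_eq_pi[OF nz(1)] Im_Ln_eq_pi[OF nz(2)]
  by (auto simp: sector_pi complex_nonpos_Reals_iff less_le)
 moreover have "- pi < Im (Ln z)" "- pi < Im (Ln (1 + z))" using mpi_less_Im_Ln nz by auto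
 moreover have "0 <= Im (Ln z) \<longleftrightarrow> 0 <= Im z" "0 <= Im (Ln (1 + z)) \<longleftrightarrow> 0 <= Im (1 + z)"
  using Im_Ln_pos_le[OF nz(1)] Im_Ln_pos_le[OF nz(2)] calculation by auto
 ultimately have bd: "- pi < Im (Ln z - Ln (1 + z))" "Im (Ln z - Ln (1 + z)) < pi" by auto
 have ex: "exp (Ln z - Ln (1 + z)) = z / (1 + z)" using nz by (simp add: exp_diff)
 then have Ln: "Ln (z / (1 + z)) = Ln z - Ln (1 + z)" using bd by (intro Ln_unique) auto
 have "z / (1 + z) ~= 0" using nz by simp
 then have "Arg (z / (1 + z)) < pi \<and> - pi < Arg (z / (1 + z))" using bd Ln by (simp add: Arg_eq_Im_Ln)
 then show "z / (1 + z) \<in> sector pi" using \<open>z / (1 + z) ~= 0\<close> by (auto simp: sector_def)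
 show "(z / (1 + z)) powr of_real a = z powr of_real a * (1 + z) powr of_real (-a)"
 proof -
  have "(z / (1 + z)) powr of_real a = exp (of_real a * (Ln z - Ln (1 + z)))"
   using \<open>z / (1 + z) ~= 0\<close> by (simp only: powr_def Ln if_False)
  also have "\<dots> = exp (of_real a * Ln z) * exp (of_real (-a) * Ln (1 + z))"
   by (simp add: right_diff_distrib exp_diff exp_minus divide_inverse)
  finally show ?thesis using nz by (simp add: powr_def)
 qed
qed

lemma mult_powr_self: "x * x powr of_real (-(1 - s)) = x powr of_real s" for x :: complex
proof -
 have "x powr of_real s = x powr (1 + of_real (-(1 - s)))" by simp
 then show ?thesis by (simp only: powr_add powr_to_1)
qed

lemma represents_dfrac:
 assumes A: "sectorial A" and b: "b \<ge> 0" and s: "0 < s" "s < 1"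
 shows "represents A (%z. ((of_real b + z) / (of_real (b + 1) + z)) powr of_real s) (id_blinfun - dfrac_integral A b s)"
  and "(%\<mu>. (\<mu> powr s / (1 + \<mu>)\<^sup>2 / st (1 - s)) *\<^sub>R pres A (b + \<mu> / (1 + \<mu>))) integrable_on {0<..}"
proof -
 have s': "0 < 1 - s" "1 - s < 1" using s by auto
 let ?w = "%z. (of_real b + z) / (of_real (b + 1) + z)"
 have w: "?w z \<in> sector pi" if "z \<in> sector pi" for z
  using sector_quotient(1)[OF add_sector_nonzero[OF that b]] by (simp add: add_ac)
 have hw: "(%z. 1 - ?w z powr of_real s) holomorphic_on sector pi"
 proof (intro holomorphic_intros)
  show "of_real (b + 1) + z ~= 0" if "z \<in> sector pi" for z
   using sector_nz[OF add_sector_nonzero[OF that, of "b + 1"]] b by simp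
  show "?w z \<notin> \<real>\<^sub>\<le>\<^sub>0" if "z \<in> sector pi" for z using w[OF that] by (simp add: sector_pi)
 qed
 have feq: "1 - ?w z powr of_real s =
  integral {0<..} (%\<mu>. of_real (\<mu> powr s / (1 + \<mu>)\<^sup>2 / st (1 - s)) / (of_real (b + \<mu> / (1 + \<mu>)) + z))" if z: "z \<in> sector pi" for z
 proof -
  let ?z = "of_real b + z"
  have z': "?z \<in> sector pi" "1 + ?z ~= 0" "?w z = ?z / (1 + ?z)"
   using add_sector_nonzero[OF z b] sector_nz[OF add_sector_nonzero[OF z, of "1 + b"]] b by (auto simp: add_ac)
  have pt: "of_real (\<mu> powr s / (1 + \<mu>)\<^sup>2 / st (1 - s)) / (of_real (b + \<mu> / (1 + \<mu>)) + z) =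
   of_real (1 / st (1 - s)) * (of_real (\<mu> powr (-(1 - s)) / (\<mu> + 1)) - ?w z * (of_real (\<mu> powr (-(1 - s))) / (of_real \<mu> + ?w z)))"
   if mu: "\<mu> > 0" for \<mu>
  proof -
   obtain Z m1 :: complex where Z: "?z = Z" "1 + of_real \<mu> = m1" by simp
   have ps: "complex_of_real (\<mu> powr s) = of_real \<mu> * of_real (\<mu> powr (-(1 - s)))"
    using mu by (simp add: powr_diff powr_minus divide_simps flip: of_real_mult)
   have m1: "m1 ~= 0" using mu Z(2) by (metis add.commute of_real_1 of_real_add of_real_eq_0_iff add_pos_pos zero_less_one less_irrefl)
   have nz1: "1 + Z ~= 0" using z'(2) Z by simp
   have "of_real \<mu> + ?w z \<in> sector pi" by (rule add_sector_nonzero[OF w[OF z]]) (use mu in simp)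
   then have nz2: "of_real \<mu> + Z / (1 + Z) ~= 0" using sector_nz z'(3) Z(1) by metis
   have "of_real (\<mu> / (1 + \<mu>)) + ?z \<in> sector pi" by (rule add_sector_nonzero[OF z'(1)]) (use mu in simp)
   then have nz3: "of_real \<mu> / m1 + Z ~= 0" using sector_nz Z by fastforce
   \<comment> \<open>Partial fractions in Z with pole \<open>- \<mu> / (1 + \<mu>)\<close>, after
     \<open>\<mu>^s = \<mu> * \<mu>^(-(1 - s))\<close>.\<close>
   have core: "of_real \<mu> / m1\<^sup>2 / (of_real \<mu> / m1 + Z) = 1 / m1 - Z / (1 + Z) * (1 / (of_real \<mu> + Z / (1 + Z)))"
   proof -
    have e1: "of_real \<mu> / m1 + Z = (of_real \<mu> + Z * m1) / m1" using m1 by (simp add: field_simps)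
    have e2: "of_real \<mu> + Z / (1 + Z) = (of_real \<mu> + Z * m1) / (1 + Z)" using nz1 Z(2)[symmetric] by (simp add: field_simps)
    have nz4: "of_real \<mu> + Z * m1 ~= 0" using nz3 unfolding e1 by auto
    obtain N where N: "of_real \<mu> + Z * m1 = N" by simp
    have Ne: "of_real \<mu> = N - Z * m1" using N by (simp add: algebra_simps)
    have N0: "N ~= 0" using nz4 N by simp
    have "of_real \<mu> / m1\<^sup>2 / (N / m1) = 1 / m1 - Z / N"
     unfolding Ne using m1 N0 by (simp add: field_simps power2_eq_square)
    also have "Z / N = Z / (1 + Z) * (1 / (N / (1 + Z)))" using nz1 by simp
    finally have "of_real \<mu> / m1\<^sup>2 / (N / m1) = 1 / m1 - Z / (1 + Z) * (1 / (N / (1 + Z)))" .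
    then show ?thesis unfolding e1 e2 N .
   qed
   have "of_real (\<mu> powr s / (1 + \<mu>)\<^sup>2 / st (1 - s)) / (of_real (b + \<mu> / (1 + \<mu>)) + z) =
    of_real (1 / st (1 - s)) * (of_real (\<mu> powr (-(1 - s))) * (of_real \<mu> / m1\<^sup>2 / (of_real \<mu> / m1 + Z)))"
    unfolding of_real_divide ps of_real_mult of_real_power of_real_add of_real_1 Z(2) Z(1)[symmetric]
    by (simp add: add_ac mult_ac)
   also have "\<dots> = of_real (1 / st (1 - s)) * (of_real (\<mu> powr (-(1 - s)) / (\<mu> + 1)) - ?w z * (of_real (\<mu> powr (-(1 - s))) / (of_real \<mu> + ?w z)))"
    unfolding core
    unfolding z'(3)
    unfolding Z(1)
    unfolding of_real_divide[of "\<mu> powr (-(1 - s))"] of_real_add of_real_1 add.commute[of "of_real \<mu>" 1] Z(2)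
    by (simp add: right_diff_distrib mult_ac)
   finally show ?thesis .
  qed
  have i1: "((%\<mu>. complex_of_real (\<mu> powr (-(1 - s)) / (\<mu> + 1))) has_integral of_real (st (1 - s))) {0<..}"
   using st_integrable[OF s'] by (intro has_integral_of_real) (simp add: st_def has_integral_integral)
  have i2: "((%\<mu>. ?w z * (of_real (\<mu> powr (-(1 - s))) / (of_real \<mu> + ?w z))) has_integral ?w z * (of_real (st (1 - s)) * ?w z powr of_real (-(1 - s)))) {0<..}"
   unfolding stieltjes_complex[OF s' w[OF z], symmetric]
   by (intro has_integral_mult_right integrable_integral stieltjes_complex_integrable[OF s' w[OF z]])
  have "?w z * ?w z powr of_real (-(1 - s)) = ?w z powr of_real s"
   by (rule mult_powr_self)
  then have e: "?w z * (of_real (st (1 - s)) * ?w z powr of_real (-(1 - s))) = of_real (st (1 - s)) * ?w z powr of_real s"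
   by (metis mult.left_commute)
  have "integral {0<..} (%\<mu>. of_real (\<mu> powr s / (1 + \<mu>)\<^sup>2 / st (1 - s)) / (of_real (b + \<mu> / (1 + \<mu>)) + z)) =
   integral {0<..} (%\<mu>. of_real (1 / st (1 - s)) * (of_real (\<mu> powr (-(1 - s)) / (\<mu> + 1)) - ?w z * (of_real (\<mu> powr (-(1 - s))) / (of_real \<mu> + ?w z))))"
   by (rule integral_cong) (use pt in simp)
  also have "\<dots> = of_real (1 / st (1 - s)) * (of_real (st (1 - s)) - of_real (st (1 - s)) * ?w z powr of_real s)"
   by (rule integral_unique) (intro has_integral_mult_right has_integral_diff i1 i2[unfolded e])
  also have "\<dots> = 1 - ?w z powr of_real s" using st_pos[OF s'] by (simp add: right_diff_distrib)
  finally show ?thesis ..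
 qed
 have cm: "continuous_on {0<..} (%\<mu>. \<mu> powr s / (1 + \<mu>)\<^sup>2 / st (1 - s))"
  using st_pos[OF s'] by (intro continuous_intros) auto
 have cn: "continuous_on {0<..} (%\<mu>::real. b + \<mu> / (1 + \<mu>))" by (intro continuous_intros) auto
 have np: "b + \<mu> / (1 + \<mu>) > 0" if "\<mu> > 0" for \<mu>
  using b that by (intro add_nonneg_pos) auto
 have le: "\<bar>\<mu> powr s / (1 + \<mu>)\<^sup>2 / st (1 - s)\<bar> <= 1 / st (1 - s) * mp (min (1 - s) (1 - (1 - s))) \<mu> * (b + \<mu> / (1 + \<mu>))"
  if mu: "\<mu> > 0" for \<mu>
 proof -
  have "\<mu> powr s / (1 + \<mu>)\<^sup>2 = \<mu> powr (-(1 - s)) / (\<mu> + 1) * (\<mu> / (1 + \<mu>))"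
  proof -
   have "\<mu> powr s = \<mu> powr (-(1 - s)) * \<mu>" using mu by (simp add: powr_diff)
   then show ?thesis by (simp add: power2_eq_square add.commute)
  qed
  also have "\<dots> <= mp (min (1 - s) (1 - (1 - s))) \<mu> * (b + \<mu> / (1 + \<mu>))"
   using mu b s' by (intro mult_mono powr_shift_le_mp mp_nonneg) auto
  finally have "\<mu> powr s / (1 + \<mu>)\<^sup>2 / st (1 - s) <=
    mp (min (1 - s) (1 - (1 - s))) \<mu> * (b + \<mu> / (1 + \<mu>)) / st (1 - s)"
   by (rule divide_right_mono) (use st_pos[OF s'] in simp)
  moreover have "0 <= \<mu> powr s / (1 + \<mu>)\<^sup>2 / st (1 - s)" using st_pos[OF s'] by simp
  ultimately show ?thesis by (simp only: abs_of_nonneg) (simp only: times_divide_eq_left mult_1 mult.assoc)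
 qed
 have u: "min (1 - s) (1 - (1 - s)) > 0" using s by simp
 note st = represents_stieltjes[OF A cm cn np le u hw feq]
 show "(%\<mu>. (\<mu> powr s / (1 + \<mu>)\<^sup>2 / st (1 - s)) *\<^sub>R pres A (b + \<mu> / (1 + \<mu>))) integrable_on {0<..}" by (rule st(2))
 show "represents A (%z. ?w z powr of_real s) (id_blinfun - dfrac_integral A b s)"
  using represents_diff[OF represents_one st(1)] unfolding dfrac_integral_def by simp
qed


section \<open>Powers with an arbitrary nonnegative exponent\<close>

definition bpow :: "('a::real_normed_vector \<Rightarrow>\<^sub>L 'a) => nat => 'a \<Rightarrow>\<^sub>L 'a" where
 "bpow W n = ((%X. W o\<^sub>L X) ^^ n) id_blinfun"

lemma bpow_0 [simp]: "bpow W 0 = id_blinfun" and bpow_Suc [simp]: "bpow W (Suc n) = W o\<^sub>L bpow W n"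
 by (simp_all add: bpow_def)

lemma represents_bpow: "represents A f W ==> represents A (%z. f z ^ n) (bpow W n)"
proof (induction n)
 case 0 then show ?case using represents_one by simp
next
 case (Suc n) then show ?case using represents_mult[of A f W "%z. f z ^ n" "bpow W n"] by simp
qed

text \<open>This is \<open>(b + 1 + A)^(-\<sigma>)\<close>. The Stieltjes formula covers exponents
  strictly between 0 and 1, so the integer part is split off and a vanishing fraction gives the
  identity.\<close>

definition iop :: "'a::complex_banach lop => real => real => 'a \<Rightarrow>\<^sub>L 'a" where
 "iop A b \<sigma> = bpow (pres A (b + 1)) (nat \<lfloor>\<sigma>\<rfloor>) o\<^sub>L (if frac \<sigma> = 0 then id_blinfun else ifrac A b (frac \<sigma>))"

text \<open>The operator \<open>((b + A) (b + 1 + A)\<^sup>-\<^sup>1)\<^sup>\<sigma>\<close>; for \<open>b = 0\<close> it is \<open>A\<^sup>\<sigma> (1 + A)\<^sup>-\<^sup>\<sigma>\<close>.\<close>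

definition dop :: "'a::complex_banach lop => real => real => 'a \<Rightarrow>\<^sub>L 'a" where
 "dop A b \<sigma> = bpow (id_blinfun - pres A (b + 1)) (nat \<lfloor>\<sigma>\<rfloor>) o\<^sub>L
  (if frac \<sigma> = 0 then id_blinfun else id_blinfun - dfrac_integral A b (frac \<sigma>))"

lemma frac_split: "\<sigma> \<ge> 0 ==> \<sigma> = real (nat \<lfloor>\<sigma>\<rfloor>) + frac \<sigma>"
 by (simp add: frac_def)

lemma represents_frac_part:
 assumes "!!s. 0 < s ==> s < 1 ==> represents A (F s) (W s)"
  and "!!z. z \<in> sector pi ==> F 0 z = 1"
 shows "represents A (F (frac \<sigma>)) (if frac \<sigma> = 0 then id_blinfun else W (frac \<sigma>))"
proof (cases "frac \<sigma> = 0")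
 case True
 show ?thesis unfolding True using represents_cong[OF represents_one, of "F 0"] assms(2) by simp
next
 case False
 then have "0 < frac \<sigma>" using frac_ge_0[of \<sigma>] by linarith
 then show ?thesis using assms(1)[of "frac \<sigma>"] frac_lt_1[of \<sigma>] False by simp
qed

lemma powr_of_nat_frac:
 fixes z :: complex
 assumes "z ~= 0" "\<sigma> \<ge> 0"
 shows "z ^ nat \<lfloor>\<sigma>\<rfloor> * z powr of_real (frac \<sigma>) = z powr of_real \<sigma>"
proof -
 define n where "n = nat \<lfloor>\<sigma>\<rfloor>"
 have "\<sigma> = real n + frac \<sigma>" unfolding n_def by (rule frac_split[OF assms(2)])
 then have "z powr of_real \<sigma> = z powr (of_nat n + of_real (frac \<sigma>))"
  by (metis of_real_add of_real_of_nat_eq)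
 then show ?thesis using assms unfolding n_def[symmetric] by (simp add: powr_add powr_nat)
qed

lemma represents_iop:
 assumes A: "sectorial A" and b: "b \<ge> 0" and \<sigma>: "\<sigma> \<ge> 0"
 shows "represents A (%z. (of_real (b + 1) + z) powr of_real (-\<sigma>)) (iop A b \<sigma>)"
proof -
 have nz: "of_real (b + 1) + z ~= 0" if "z \<in> sector pi" for z
  using sector_nz[OF add_sector_nonzero[OF that, of "b + 1"]] b by simp
 have 1: "represents A (%z. (1 / (of_real (b + 1) + z)) ^ nat \<lfloor>\<sigma>\<rfloor>) (bpow (pres A (b + 1)) (nat \<lfloor>\<sigma>\<rfloor>))"
  using b by (intro represents_bpow represents_pres[OF A]) auto
 have 2: "represents A (%z. (of_real (b + 1) + z) powr of_real (- frac \<sigma>)) (if frac \<sigma> = 0 then id_blinfun else ifrac A b (frac \<sigma>))"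
  by (rule represents_frac_part[where F="%s z. (of_real (b + 1) + z) powr of_real (-s)" and W="ifrac A b"])
   (use represents_ifrac[OF A b] nz in auto)
 show ?thesis unfolding iop_def
 proof (rule represents_cong[OF represents_mult[OF 1 2]])
  fix z assume "z \<in> sector pi"
  note n = nz[OF this]
  obtain Z where Z: "of_real (b + 1) + z = Z" by simp
  have "(1 / Z) ^ nat \<lfloor>\<sigma>\<rfloor> * Z powr of_real (- frac \<sigma>) = 1 / (Z ^ nat \<lfloor>\<sigma>\<rfloor> * Z powr of_real (frac \<sigma>))"
   by (simp add: power_one_over powr_minus divide_inverse power_inverse)
  also have "\<dots> = Z powr of_real (-\<sigma>)" using n Z \<sigma> by (subst powr_of_nat_frac) (auto simp: powr_minus divide_inverse)
  finally show "(1 / (of_real (b + 1) + z)) ^ nat \<lfloor>\<sigma>\<rfloor> * (of_real (b + 1) + z) powr of_real (- frac \<sigma>) =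
   (of_real (b + 1) + z) powr of_real (-\<sigma>)" unfolding Z .
 qed
qed

lemma represents_dop_step:
 assumes A: "sectorial A" and b: "b \<ge> 0"
 shows "represents A (%z. (of_real b + z) / (of_real (b + 1) + z)) (id_blinfun - pres A (b + 1))"
proof (rule represents_cong[OF represents_diff[OF represents_one represents_pres[OF A, of "b + 1"]]])
 fix z assume "z \<in> sector pi"
 then have "of_real (b + 1) + z ~= 0"
  using sector_nz[OF add_sector_nonzero[of z "b + 1"]] b by simp
 then show "1 - 1 / (of_real (b + 1) + z) = (of_real b + z) / (of_real (b + 1) + z)"
  by (simp add: field_simps)
qed (use b in simp)

lemma represents_dop:
 assumes A: "sectorial A" and b: "b \<ge> 0" and \<sigma>: "\<sigma> \<ge> 0"
 shows "represents A (%z. ((of_real b + z) / (of_real (b + 1) + z)) powr of_real \<sigma>) (dop A b \<sigma>)"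
proof -
 let ?w = "%z. (of_real b + z) / (of_real (b + 1) + z)"
 have w: "?w z ~= 0" if "z \<in> sector pi" for z
  using sector_nz[OF add_sector_nonzero[OF that, of "b + 1"]] sector_nz[OF add_sector_nonzero[OF that, of b]] b by simp
 have 1: "represents A (%z. ?w z ^ nat \<lfloor>\<sigma>\<rfloor>) (bpow (id_blinfun - pres A (b + 1)) (nat \<lfloor>\<sigma>\<rfloor>))"
  by (intro represents_bpow represents_dop_step[OF A b])
 have 2: "represents A (%z. ?w z powr of_real (frac \<sigma>))
   (if frac \<sigma> = 0 then id_blinfun else id_blinfun - dfrac_integral A b (frac \<sigma>))"
  by (rule represents_frac_part[where F="%s z. ?w z powr of_real s" and W="%s. id_blinfun - dfrac_integral A b s"])
   (use represents_dfrac(1)[OF A b] w in auto)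
 show ?thesis unfolding dop_def
 proof (rule represents_cong[OF represents_mult[OF 1 2]])
  fix z assume "z \<in> sector pi"
  from powr_of_nat_frac[OF w[OF this] \<sigma>]
  show "?w z ^ nat \<lfloor>\<sigma>\<rfloor> * ?w z powr of_real (frac \<sigma>) = ?w z powr of_real \<sigma>" .
 qed
qed

lemma bpow_injective:
 assumes W: "!!x. blinfun_apply W x = 0 ==> x = 0" and "blinfun_apply (bpow W n) x = 0"
 shows "x = 0"
 using assms(2)
proof (induction n arbitrary: x)
 case (Suc n)
 have "blinfun_apply W (blinfun_apply (bpow W n) x) = 0" using Suc.prems by simp
 from Suc.IH[OF W[OF this]] show ?case .
qed simp

text \<open>W is a factor of the injective V, with cofactor W'; \<open>represents_unique\<close>
  identifies the product with V.\<close>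

lemma represented_root_injective:
 assumes A: "sectorial A" "injective_operator A"
  and 1: "represents A f W" and 2: "represents A f' W'" and 3: "represents A h V"
  and eq: "!!z. z \<in> sector pi ==> f' z * f z = h z" and V: "!!x. V x = 0 ==> x = 0"
  and x: "W x = 0"
 shows "x = 0"
proof -
 have "W' o\<^sub>L W = V"
  by (rule represents_unique[OF A represents_cong[OF represents_mult[OF 2 1] eq] 3])
 then have "V x = 0" using x by auto
 then show ?thesis by (rule V)
qed

lemma iop_injective:
 assumes A: "sectorial A" "injective_operator A" and \<sigma>: "\<sigma> \<ge> 0" and x: "iop A 0 \<sigma> x = 0"
 shows "x = 0"
proof -
 \<comment> \<open>The cofactor \<open>(1 + A)^(-(N - \<sigma>))\<close> completes the exponent to
   an integer, where injectivity is that of a resolvent.\<close>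
 define N where "N = nat \<lceil>\<sigma>\<rceil>"
 have N: "real N - \<sigma> \<ge> 0" using \<sigma> by (simp add: N_def)
 have p: "represents A (%z. (1 / (of_real 1 + z)) ^ N) (bpow (pres A 1) N)"
  by (intro represents_bpow represents_pres[OF A(1)]) auto
 show ?thesis
 proof (rule represented_root_injective[OF A represents_iop[OF A(1) order_refl \<sigma>] represents_iop[OF A(1) order_refl N] p _ _ x])
  fix z assume "z \<in> sector pi"
  then have nz: "1 + z ~= 0" using sector_nz[OF add_sector_nonzero[of z 1]] by simp
  have "(1 + z) powr of_real (-(real N - \<sigma>)) * (1 + z) powr of_real (-\<sigma>) = (1 + z) powr - of_nat N"
   by (simp flip: powr_add)
  also have "\<dots> = (1 / (1 + z)) ^ N" using nz by (simp add: powr_minus powr_nat power_one_over divide_inverse power_inverse)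
  finally show "(of_real (0 + 1) + z) powr of_real (-(real N - \<sigma>)) * (of_real (0 + 1) + z) powr of_real (-\<sigma>) = (1 / (of_real 1 + z)) ^ N"
   by simp
 qed (rule bpow_injective[OF pres_injective[OF A(1) zero_less_one]])
qed

lemma dop_injective:
 assumes A: "sectorial A" "injective_operator A" and \<sigma>: "\<sigma> \<ge> 0" and x: "dop A 0 \<sigma> x = 0"
 shows "x = 0"
proof -
 define N where "N = nat \<lceil>\<sigma>\<rceil>"
 have N: "real N - \<sigma> \<ge> 0" using \<sigma> by (simp add: N_def)
 have p: "represents A (%z. ((of_real 0 + z) / (of_real (0 + 1) + z)) ^ N) (bpow (id_blinfun - pres A (0 + 1)) N)"
  by (intro represents_bpow represents_dop_step[OF A(1)]) auto
 show ?thesis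
 proof (rule represented_root_injective[OF A represents_dop[OF A(1) order_refl \<sigma>] represents_dop[OF A(1) order_refl N] p _ _ x])
  fix z assume z: "z \<in> sector pi"
  let ?w = "(of_real 0 + z) / (of_real (0 + 1) + z)"
  have nz: "?w ~= 0" using sector_nz[OF add_sector_nonzero[OF z, of 1]] sector_nz[OF z] by simp
  have "?w powr of_real (real N - \<sigma>) * ?w powr of_real \<sigma> = ?w powr of_nat N"
   by (simp flip: powr_add)
  also have "\<dots> = ?w ^ N" using nz by (simp add: powr_nat)
  finally show "?w powr of_real (real N - \<sigma>) * ?w powr of_real \<sigma> = ?w ^ N" .
 next
  fix x assume "bpow (id_blinfun - pres A (0 + 1)) N x = 0"
  then show "x = 0"
   by (rule bpow_injective[rotated]) (rule one_minus_pres_injective[OF A], simp add: blinfun.diff_left)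
 qed
qed

section \<open>The shifted operator 1 + A\<close>

lemma mem_shift_op: "(u, w) \<in> shift_op c A \<longleftrightarrow> (u, w - c *\<^sub>C u) \<in> A"
 unfolding shift_op_def by force

lemma linear_shift_op:
 assumes A: "linear_operator A" shows "linear_operator (shift_op c A)"
 unfolding linear_operator_def single_valued_def mem_shift_op
proof (intro conjI allI impI; (elim conjE)?)
 show "(0, 0 - c *\<^sub>C 0) \<in> A" using A by (simp add: linear_operator_def)
 fix x y x' y' assume "(x, y - c *\<^sub>C x) \<in> A" "(x', y' - c *\<^sub>C x') \<in> A"
 from linear_operatorD(1)[OF A this] show "(x + x', y + y' - c *\<^sub>C (x + x')) \<in> A"
  by (simp add: scaleC_add_right algebra_simps)
next
 fix k x y assume "(x, y - c *\<^sub>C x) \<in> A"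
 from linear_operatorD(2)[OF A this, of k] show "(k *\<^sub>C x, k *\<^sub>C y - c *\<^sub>C k *\<^sub>C x) \<in> A"
  by (simp add: scaleC_diff_right scaleC_scaleC mult.commute)
next
 fix x y z assume "(x, y - c *\<^sub>C x) \<in> A" "(x, z - c *\<^sub>C x) \<in> A"
 from linear_operatorD(4)[OF A this] show "y = z" by simp
qed

lemma resolvent_shift_op:
 assumes A: "linear_operator A" and z: "z - c \<in> resolvent_set A"
 shows "z \<in> resolvent_set (shift_op c A)" "resolvent (shift_op c A) z = resolvent A (z - c)"
proof -
 let ?R = "resolvent A (z - c)"
 have 1: "(?R x, z *\<^sub>C ?R x - x) \<in> shift_op c A" for x
  using resolvent_in[OF z, of x] by (simp add: mem_shift_op scaleC_diff_left algebra_simps)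
 have 2: "?R (z *\<^sub>C u - v) = u" if "(u, v) \<in> shift_op c A" for u v
  using resolvent_left[OF z that[unfolded mem_shift_op]] by (simp add: scaleC_diff_left algebra_simps)
 show "z \<in> resolvent_set (shift_op c A)" "resolvent (shift_op c A) z = ?R"
  by (rule resolvent_setI[OF resolvent_clinear[OF z] linear_shift_op[OF A] 1 2], assumption)+
qed

lemma closure_sector: "0 < \<phi> ==> \<phi> < pi ==> closure (sector \<phi>) = {z. cos \<phi> * cmod z <= Re z}"
 using closure_sector_subset[of \<phi>] mem_closure_sector[of \<phi>] by auto

text \<open>The two signs of c call for the upper and the lower triangle inequality.\<close>

lemma cone_add_one:
 assumes "- 1 <= c" "c <= 1" "c * cmod u <= Re u"
 shows "c * cmod (u + 1) <= Re u + 1"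
proof (cases "c \<ge> 0")
 case True
 have "c * cmod (u + 1) <= c * (cmod u + 1)"
  using norm_triangle_ineq[of u 1] True by (intro mult_left_mono) auto
 then show ?thesis using assms by (simp add: distrib_left)
next
 case False
 have "cmod u - 1 <= cmod (u + 1)" using norm_diff_ineq[of u 1] by simp
 then have "c * cmod (u + 1) <= c * (cmod u - 1)" using False by (intro mult_left_mono_neg) auto
 then show ?thesis using assms by (simp add: right_diff_distrib)
qed

lemma closure_sector_add_one:
 assumes "0 < \<phi>" "\<phi> < pi" "u \<in> closure (sector \<phi>)"
 shows "u + 1 \<in> closure (sector \<phi>)"
 using assms cone_add_one[of "cos \<phi>" u] by (simp add: closure_sector)

lemma sectorial_shift_op:
 assumes "sectorial A" shows "sectorial (shift_op 1 A)"
proof -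
 obtain \<omega> where w: "sectorial_of_angle \<omega> A" using assms by (auto simp: sectorial_def)
 note ang = sectorial_angle[OF w]
 have lin: "linear_operator A" by (rule sectorial_linear[OF w])
 have out: "z - 1 \<notin> closure (sector \<phi>)" if "0 < \<phi>" "\<phi> < pi" "z \<notin> closure (sector \<phi>)" for z \<phi>
  using closure_sector_add_one[OF that(1,2), of "z - 1"] that(3) by auto
 have rs: "z - 1 \<in> resolvent_set A" if "z \<notin> closure (sector \<omega>)" for z
  using out[of \<omega> z] that ang w by (auto simp: sectorial_of_angle_def op_spectrum_def)
 have bd: "bounded ((%l. l *\<^sub>C resolvent (shift_op 1 A) l) ` (- closure (sector \<omega>')))" if w': "\<omega> < \<omega>'" "\<omega>' < pi" for \<omega>'
 proof -
  have p: "0 < \<omega>'" using w' ang by simp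
  have "bounded ((%l. l *\<^sub>C resolvent A l) ` (- closure (sector \<omega>')))"
   using w w' by (simp add: sectorial_of_angle_def)
  then obtain M where M: "M > 0" "!!l. l \<notin> closure (sector \<omega>') ==> norm (l *\<^sub>C resolvent A l) <= M"
   unfolding bounded_pos by (metis (no_types, lifting) ComplI imageI)
  have "(1::complex) \<in> sector \<omega>'" using p by (simp add: sector_def)
  moreover have "open (sector \<omega>')" using p w' by (intro open_sector) auto
  \<comment> \<open>Outside the sector z keeps distance \<rho> from 1, which makes
    \<open>cmod z\<close> comparable with \<open>cmod (z - 1)\<close>.\<close>
  ultimately obtain \<rho> where \<rho>: "\<rho> > 0" "ball 1 \<rho> \<subseteq> sector \<omega>'" by (meson open_contains_ball)
  have "norm (z *\<^sub>C resolvent (shift_op 1 A) z) <= M * (1 + 1 / \<rho>)" if z: "z \<notin> closure (sector \<omega>')" for z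
  proof -
   have zo: "z \<notin> closure (sector \<omega>)" using z closure_mono[OF sector_mono[of \<omega> \<omega>']] w' by auto
   have "z \<notin> ball 1 \<rho>" using z \<rho>(2) closure_subset by blast
   then have d: "\<rho> <= cmod (z - 1)" by (simp add: dist_norm norm_minus_commute)
   have "cmod z <= cmod (z - 1) + 1" using norm_triangle_ineq[of "z - 1" 1] by simp
   also have "\<dots> <= cmod (z - 1) * (1 + 1 / \<rho>)" using d \<rho>(1) by (simp add: field_simps)
   finally have le: "cmod z <= cmod (z - 1) * (1 + 1 / \<rho>)" .
   have "norm (z *\<^sub>C resolvent (shift_op 1 A) z) = cmod z * norm (resolvent A (z - 1))"
    by (simp add: resolvent_shift_op(2)[OF lin rs[OF zo]] norm_scaleC)
   also have "\<dots> <= cmod (z - 1) * (1 + 1 / \<rho>) * norm (resolvent A (z - 1))" by (intro mult_right_mono le) auto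
   also have "\<dots> = norm ((z - 1) *\<^sub>C resolvent A (z - 1)) * (1 + 1 / \<rho>)" by (simp add: norm_scaleC mult_ac)
   also have "\<dots> <= M * (1 + 1 / \<rho>)" using \<rho>(1) by (intro mult_right_mono M(2) out p w' z) auto
   finally show ?thesis .
  qed
  then show ?thesis by (intro boundedI[where B="M * (1 + 1 / \<rho>)"]) auto
 qed
 have "sectorial_of_angle \<omega> (shift_op 1 A)"
  unfolding sectorial_of_angle_def
 proof (intro conjI)
  show "op_spectrum (shift_op 1 A) \<subseteq> closure (sector \<omega>)"
   using resolvent_shift_op(1)[OF lin rs] by (auto simp: op_spectrum_def)
 qed (use ang bd linear_shift_op[OF lin] in auto)
 then show ?thesis by (auto simp: sectorial_def)
qed

lemma injective_shift_op:
 assumes "sectorial A" shows "injective_operator (shift_op 1 A)"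
 unfolding injective_operator_def mem_shift_op
proof (intro allI impI)
 fix x assume "(x, 0 - 1 *\<^sub>C x) \<in> A"
 then show "x = 0" using pres_left[OF assms, of 1 x "-x"] by simp
qed

lemma pres_shift_op:
 assumes "sectorial A" "\<nu> > 0" shows "pres (shift_op 1 A) \<nu> = pres A (1 + \<nu>)"
proof -
 have "- of_real \<nu> - 1 = - (of_real (1 + \<nu>) :: complex)" by simp
 moreover have "- (of_real (1 + \<nu>) :: complex) \<in> resolvent_set A"
  using assms by (intro neg_real_resolvent_set) auto
 ultimately show ?thesis
  unfolding pres_def by (simp only: resolvent_shift_op(2)[OF sectorial_linear'[OF assms(1)]])
qed

text \<open>The parameter b = 0 for 1 + A is b = 1 for A, which is the purpose of b.\<close>

lemma iop_shift_op: "sectorial A ==> iop (shift_op 1 A) 0 \<sigma> = iop A 1 \<sigma>"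
proof -
 assume A: "sectorial A"
 have "ifrac (shift_op 1 A) 0 s = ifrac A 1 s" for s
  unfolding ifrac_def by (rule integral_cong) (simp add: pres_shift_op[OF A] add_ac)
 then show ?thesis by (simp add: iop_def pres_shift_op[OF A])
qed

lemma dop_shift_op: "sectorial A ==> dop (shift_op 1 A) 0 \<sigma> = dop A 1 \<sigma>"
proof -
 assume A: "sectorial A"
 have "dfrac_integral (shift_op 1 A) 0 s = dfrac_integral A 1 s" for s
  unfolding dfrac_integral_def by (rule integral_cong) (simp add: pres_shift_op[OF A])
 then show ?thesis by (simp add: dop_def pres_shift_op[OF A])
qed

lemma holomorphic_powr_sector: "(%z. z powr of_real s) holomorphic_on sector pi"
 by (intro holomorphic_intros) (simp add: sector_pi)

text \<open>The pair \<open>(1 + z)^(-\<sigma>)\<close> and \<open>(z / (1 + z))^\<sigma>\<close>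
  regularises both signs: multiplication by \<open>z^\<sigma>\<close> takes the first to the second,
  multiplication by \<open>z^(-\<sigma>)\<close> the second to the first.\<close>

lemma frac_power_iff:
 assumes A: "sectorial A" "injective_operator A" and \<sigma>: "\<sigma> \<ge> 0"
 shows "(x, y) \<in> frac_power A \<sigma> \<longleftrightarrow> iop A 0 \<sigma> y = dop A 0 \<sigma> x"
  and "(x, y) \<in> frac_power A (-\<sigma>) \<longleftrightarrow> dop A 0 \<sigma> y = iop A 0 \<sigma> x"
proof -
 have q: "((of_real 0 + z) / (of_real (0 + 1) + z)) powr of_real \<sigma> = z powr of_real \<sigma> * (1 + z) powr of_real (-\<sigma>)"
  if "z \<in> sector pi" for z using sector_quotient(2)[OF that, of \<sigma>] by simp
 show "(x, y) \<in> frac_power A \<sigma> \<longleftrightarrow> iop A 0 \<sigma> y = dop A 0 \<sigma> x"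
  unfolding frac_power_def
 proof (rule functional_calculus_characterization[OF A holomorphic_powr_sector represents_iop[OF A(1) order_refl \<sigma>]
    represents_dop[OF A(1) order_refl \<sigma>]])
  show "z powr of_real \<sigma> * (of_real (0 + 1) + z) powr of_real (-\<sigma>) = ((of_real 0 + z) / (of_real (0 + 1) + z)) powr of_real \<sigma>"
   if "z \<in> sector pi" for z using q[OF that] by simp
 qed (rule iop_injective[OF A \<sigma>])
 show "(x, y) \<in> frac_power A (-\<sigma>) \<longleftrightarrow> dop A 0 \<sigma> y = iop A 0 \<sigma> x"
  unfolding frac_power_def
 proof (rule functional_calculus_characterization[OF A holomorphic_powr_sector represents_dop[OF A(1) order_refl \<sigma>]
    represents_iop[OF A(1) order_refl \<sigma>]])
  fix z assume z: "z \<in> sector pi"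
  have "z powr of_real (-\<sigma>) * z powr of_real \<sigma> = 1"
   using sector_nz[OF z] by (simp add: powr_minus)
  then show "z powr of_real (-\<sigma>) * ((of_real 0 + z) / (of_real (0 + 1) + z)) powr of_real \<sigma> = (of_real (0 + 1) + z) powr of_real (-\<sigma>)"
   unfolding q[OF z] by (simp flip: mult.assoc)
 qed (rule dop_injective[OF A \<sigma>])
qed

text \<open>Applied to 1 + A, \<open>frac_power_iff\<close> describes the power by
  \<open>(2 + A)^(-\<sigma>)\<close> and \<open>((1 + A) / (2 + A))^\<sigma>\<close>. The former is
  the latter times \<open>(1 + A)^(-\<sigma>)\<close>, so the injective latter cancels and the power
  is the bounded operator \<open>iop A 0 \<sigma>\<close>.\<close>

lemma frac_power_composition:
 assumes A: "sectorial A" "injective_operator A" and \<sigma>: "\<sigma> \<ge> 0"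
 shows "frac_power (shift_op 1 A) (- \<sigma>) O frac_power A \<sigma> = graph_of (dop A 0 \<sigma>)"
proof -
 let ?A1 = "shift_op 1 A"
 let ?W1 = "iop A 0 \<sigma>" and ?W2 = "dop A 0 \<sigma>" and ?W3 = "dop A 1 \<sigma>" and ?W4 = "iop A 1 \<sigma>"
 have A1: "sectorial ?A1" "injective_operator ?A1"
  using sectorial_shift_op[OF A(1)] injective_shift_op[OF A(1)] by auto
 have r1: "represents A (%z. (of_real (0 + 1) + z) powr of_real (-\<sigma>)) ?W1" by (rule represents_iop[OF A(1) order_refl \<sigma>])
 have r2: "represents A (%z. ((of_real 0 + z) / (of_real (0 + 1) + z)) powr of_real \<sigma>) ?W2" by (rule represents_dop[OF A(1) order_refl \<sigma>])
 have r3: "represents A (%z. ((of_real 1 + z) / (of_real (1 + 1) + z)) powr of_real \<sigma>) ?W3" by (rule represents_dop[OF A(1) zero_le_one \<sigma>])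
 have r4: "represents A (%z. (of_real (1 + 1) + z) powr of_real (-\<sigma>)) ?W4" by (rule represents_iop[OF A(1) zero_le_one \<sigma>])
 have "?W4 = ?W3 o\<^sub>L ?W1"
 proof (rule represents_unique[OF A r4])
  show "represents A (%z. (of_real (1 + 1) + z) powr of_real (-\<sigma>)) (?W3 o\<^sub>L ?W1)"
  proof (rule represents_cong[OF represents_mult[OF r3 r1]])
   fix z assume "z \<in> sector pi"
   then have z1: "1 + z \<in> sector pi" using add_sector_nonzero[of z 1] by simp
   have e: "((1 + z) / (1 + (1 + z))) powr of_real \<sigma> = (1 + z) powr of_real \<sigma> * (1 + (1 + z)) powr of_real (-\<sigma>)"
    by (rule sector_quotient(2)[OF z1])
   have "(1 + z) powr of_real \<sigma> * (1 + z) powr of_real (-\<sigma>) = 1"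
    using sector_nz[OF z1] by (simp add: powr_minus)
   then show "((of_real 1 + z) / (of_real (1 + 1) + z)) powr of_real \<sigma> * (of_real (0 + 1) + z) powr of_real (-\<sigma>) =
    (of_real (1 + 1) + z) powr of_real (-\<sigma>)"
    using e by (simp add: add.assoc[symmetric])
  qed
 qed
 moreover have "?W1 o\<^sub>L ?W2 = ?W2 o\<^sub>L ?W1"
  by (rule represents_unique[OF A represents_mult[OF r1 r2] represents_cong[OF represents_mult[OF r2 r1]]]) simp
 ultimately have W4: "blinfun_apply ?W4 x = blinfun_apply ?W3 (blinfun_apply ?W1 x)"
  and W12: "blinfun_apply ?W2 (blinfun_apply ?W1 x) = blinfun_apply ?W1 (blinfun_apply ?W2 x)" for x
  by (metis blinfun_apply_blinfun_compose)+
 have inj3: "u = v" if "blinfun_apply ?W3 u = blinfun_apply ?W3 v" for u v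
  using dop_injective[OF A1 \<sigma>, of "u - v"] that by (simp add: dop_shift_op[OF A(1)] blinfun.diff_right)
 have inj1: "u = v" if "blinfun_apply ?W1 u = blinfun_apply ?W1 v" for u v
  using iop_injective[OF A \<sigma>, of "u - v"] that by (simp add: blinfun.diff_right)
 have s: "(x, u) \<in> frac_power ?A1 (-\<sigma>) \<longleftrightarrow> u = blinfun_apply ?W1 x" for x u
  unfolding frac_power_iff(2)[OF A1 \<sigma>] dop_shift_op[OF A(1)] iop_shift_op[OF A(1)] W4 using inj3 by auto
 have "(x, y) \<in> frac_power ?A1 (-\<sigma>) O frac_power A \<sigma> \<longleftrightarrow> y = blinfun_apply ?W2 x" for x y
  unfolding relcomp_unfold mem_Collect_eq case_prod_conv s frac_power_iff(1)[OF A \<sigma>] using W12 inj1 by auto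
 then show ?thesis by (auto simp: graph_of_def)
qed

text \<open>Signs are chosen so that \<open>lres A l\<close> is \<open>(l + A)\<^sup>-\<^sup>1\<close>, the Laplace transform at \<open>l\<close> of the semigroup generated by \<open>- A\<close>.\<close>

definition lres :: "'a::complex_banach lop => complex => 'a \<Rightarrow>\<^sub>L 'a" where
 "lres A l = - resolvent A (- l)"

lemma pres_lres: "pres A \<nu> = lres A (of_real \<nu>)"
 by (simp add: pres_def lres_def)

lemma lres_identity:
 assumes "linear_operator A" "- l \<in> resolvent_set A" "- m \<in> resolvent_set A"
 shows "lres A l - lres A m = (m - l) *\<^sub>C (lres A l o\<^sub>L lres A m)"
proof -
 have "lres A l - lres A m = - (resolvent A (- l) - resolvent A (- m))" by (simp add: lres_def)
 also have "\<dots> = (m - l) *\<^sub>C (resolvent A (- l) o\<^sub>L resolvent A (- m))"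
  unfolding resolvent_identity[OF assms] by (simp flip: scaleC_minus_left)
 finally show ?thesis by (simp add: lres_def compose_minus_left compose_minus_right)
qed

lemma functional_lres_holomorphic:
 fixes \<phi> :: "'a::complex_banach \<Rightarrow>\<^sub>L complex"
 assumes A: "linear_operator A" and f: "\<phi> \<in> clinear_ops" and S: "uminus ` S \<subseteq> resolvent_set A"
 shows "(%l. \<phi> (lres A l x)) holomorphic_on S"
proof -
 have bl: "bounded_linear (%B :: 'a \<Rightarrow>\<^sub>L 'a. \<phi> (B x))"
  by (intro bounded_linear_compose[OF blinfun.bounded_linear_right] blinfun.bounded_linear_left)
 define \<psi> where "\<psi> = Blinfun (%B :: 'a \<Rightarrow>\<^sub>L 'a. \<phi> (B x))"
 have p: "\<psi> B = \<phi> (B x)" for B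
  unfolding \<psi>_def by (simp add: bounded_linear_Blinfun_apply[OF bl])
 have pc: "\<psi> \<in> clinear_ops" unfolding clinear_ops_def
  by (simp add: p scaleC_blinfun.rep_eq clinear_opsD[OF f, simplified])
 have "(%l. - \<psi> (resolvent A (- l))) holomorphic_on S"
  using S by (intro holomorphic_intros functional_resolvent_holomorphic[OF A pc]) (auto simp: image_subset_iff)
 then show ?thesis by (simp add: p lres_def blinfun.minus_left blinfun.minus_right)
qed

lemma norm_lres_le:
 assumes A: "linear_operator A" and a: "- a \<in> resolvent_set A" and le: "cmod (l - a) * norm (lres A a) <= 1/2"
 shows "- l \<in> resolvent_set A" "norm (lres A l o\<^sub>L W) <= 2 * norm (lres A a o\<^sub>L W)"
proof -
 have n: "cmod (- l - - a) = cmod (l - a)" using norm_minus_cancel[of "l - a"] by simp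
 show z: "- l \<in> resolvent_set A"
  by (rule resolvent_set_neumann[OF A a]) (use le n in \<open>simp add: lres_def\<close>)
 show "norm (lres A l o\<^sub>L W) <= 2 * norm (lres A a o\<^sub>L W)"
  using resolvent_tail_bound[OF A a z, of W] le n by (simp add: lres_def compose_minus_left)
qed

text \<open>The fractional power gains the factor \<open>cmod l powr s\<close>. It is an average of
  \<open>1 - \<nu> (\<nu> + A)^(-1)\<close>, and the product of this with
  \<open>(l + A)^(-1)\<close> is estimated in two ways: trivially when \<mu> is at most
  \<open>cmod l\<close>, and through the resolvent identity, with a factor
  \<open>cmod l / \<mu>\<close>, when it is larger. Both are covered by
  \<open>2 * \<kappa> / (\<mu> + \<kappa>)\<close>, so the average is again a Stieltjes integral.
  The hypothesis with c absorbs a term that does not carry B.\<close>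

lemma lres_dfrac_bound:
 assumes A: "sectorial A" and M: "M > 0" "!!\<nu>. \<nu> > 0 ==> norm (pres A \<nu>) <= M / \<nu>"
  and s: "0 < s" "s < 1" and l: "- l \<in> resolvent_set A" "l ~= 0"
  and B: "norm (lres A l) <= B" and c: "1 <= c * (cmod l * B)" "c > 0"
 shows "norm (lres A l o\<^sub>L (id_blinfun - dfrac_integral A 0 s)) <= 2 * max (1 + M) (M * (1 + c)) * B * cmod l powr s"
proof -
 have s': "0 < 1 - s" "1 - s < 1" using s by auto
 note stp = st_pos[OF s']
 have lin: "linear_operator A" by (rule sectorial_linear'[OF A])
 define \<kappa> where "\<kappa> = cmod l"
 define K where "K = max (1 + M) (M * (1 + c))"
 have k: "\<kappa> > 0" using l by (simp add: \<kappa>_def)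
 have B0: "B > 0" using c k norm_ge_zero[of "lres A l"] B unfolding \<kappa>_def[symmetric]
  by (metis less_eq_real_def mult_zero_right not_one_le_zero order_trans)
 let ?\<nu> = "%\<mu>::real. \<mu> / (1 + \<mu>)"
 \<comment> \<open>This density has integral 1, which lets the identity be moved under the integral
   sign.\<close>
 let ?m = "%\<mu>::real. \<mu> powr (-(1 - s)) / (\<mu> + 1) / st (1 - s)"
 let ?g = "%\<mu>. ?m \<mu> *\<^sub>R (id_blinfun - ?\<nu> \<mu> *\<^sub>R pres A (?\<nu> \<mu>))"
 have i1: "((%\<mu>. ?m \<mu> *\<^sub>R (id_blinfun :: 'a \<Rightarrow>\<^sub>L 'a)) has_integral (st (1 - s) / st (1 - s)) *\<^sub>R id_blinfun) {0<..}"
  using st_integrable[OF s'] by (intro has_integral_scaleR_left has_integral_divide) (simp add: st_def has_integral_integral)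
 have i2: "((%\<mu>. (\<mu> powr s / (1 + \<mu>)\<^sup>2 / st (1 - s)) *\<^sub>R pres A (0 + ?\<nu> \<mu>)) has_integral dfrac_integral A 0 s) {0<..}"
  unfolding dfrac_integral_def by (rule integrable_integral[OF represents_dfrac(2)[OF A order_refl s]])
 have gi: "(?g has_integral id_blinfun - dfrac_integral A 0 s) {0<..}"
 proof (rule has_integral_eq[rotated])
  show "((%\<mu>. ?m \<mu> *\<^sub>R id_blinfun - (\<mu> powr s / (1 + \<mu>)\<^sup>2 / st (1 - s)) *\<^sub>R pres A (0 + ?\<nu> \<mu>)) has_integral
    id_blinfun - dfrac_integral A 0 s) {0<..}"
   using has_integral_diff[OF i1 i2] stp by simp
  fix \<mu> :: real assume "\<mu> \<in> {0<..}"
  then have "\<mu> powr s = \<mu> powr (-(1 - s)) * \<mu>" by (simp add: powr_diff)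
  then have "\<mu> powr s / (1 + \<mu>)\<^sup>2 / st (1 - s) = ?m \<mu> * ?\<nu> \<mu>" by (simp add: power2_eq_square add.commute)
  then show "?m \<mu> *\<^sub>R id_blinfun - (\<mu> powr s / (1 + \<mu>)\<^sup>2 / st (1 - s)) *\<^sub>R pres A (0 + ?\<nu> \<mu>) = ?g \<mu>"
   by (simp add: scaleR_diff_right)
 qed
 have li: "((%\<mu>. lres A l o\<^sub>L ?g \<mu>) has_integral (lres A l o\<^sub>L (id_blinfun - dfrac_integral A 0 s))) {0<..}"
  using has_integral_linear[OF gi bounded_bilinear.bounded_linear_right[OF bounded_bilinear_blinfun_compose], of "lres A l"]
  by (simp only: o_def)
 have K0: "K \<ge> 0" using M by (simp add: K_def)
 have pt: "norm (lres A l o\<^sub>L ?g \<mu>) <= (K * B / st (1 - s) * (2 * \<kappa>)) * (\<mu> powr (-(1 - s)) / (\<mu> + \<kappa>))" if mu: "\<mu> > 0" for \<mu>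
 proof -
  have nu: "?\<nu> \<mu> > 0" "?\<nu> \<mu> < 1" using mu by auto
  let ?P = "pres A (?\<nu> \<mu>)"
  let ?N = "lres A l o\<^sub>L (id_blinfun - ?\<nu> \<mu> *\<^sub>R ?P)"
  have nP: "norm (?\<nu> \<mu> *\<^sub>R ?P) <= M"
  proof -
   have "?\<nu> \<mu> * norm ?P <= ?\<nu> \<mu> * (M / ?\<nu> \<mu>)" using M(2)[OF nu(1)] nu by (intro mult_left_mono) auto
   also have "\<dots> = M" using mu by simp
   finally show ?thesis using nu by (simp only: norm_scaleR abs_of_pos)
  qed
  have a: "norm ?N <= B * (1 + M)"
  proof -
   have "norm (id_blinfun - ?\<nu> \<mu> *\<^sub>R ?P) <= norm (id_blinfun :: 'a \<Rightarrow>\<^sub>L 'a) + norm (?\<nu> \<mu> *\<^sub>R ?P)"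
    by (rule norm_triangle_ineq4)
   also have "\<dots> <= 1 + M" by (intro add_mono nP norm_blinfun_id_le)
   finally show ?thesis using B B0 by (intro order_trans[OF norm_blinfun_compose] mult_mono) auto
  qed
  have "lres A l - ?P = (of_real (?\<nu> \<mu>) - l) *\<^sub>C (lres A l o\<^sub>L ?P)"
   unfolding pres_lres by (intro lres_identity[OF lin l(1)] neg_real_resolvent_set[OF A nu(1)])
  then have "?N = ?P - l *\<^sub>C (lres A l o\<^sub>L ?P)"
   by (simp add: compose_diff_right compose_scaleR_right scaleC_diff_left scaleC_of_real algebra_simps del: of_real_divide)
  then have "norm ?N <= norm ?P + \<kappa> * (B * norm ?P)"
   using norm_triangle_ineq4[of ?P "l *\<^sub>C (lres A l o\<^sub>L ?P)"] B
    mult_left_mono[OF order_trans[OF norm_blinfun_compose mult_right_mono[OF B norm_ge_zero]], of "cmod l" ?P]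
   by (simp add: norm_scaleC \<kappa>_def)
  also have "\<dots> = (1 + \<kappa> * B) * norm ?P" by (simp add: algebra_simps)
  also have "\<dots> <= ((1 + c) * (\<kappa> * B)) * (M * ((1 + \<mu>) / \<mu>))"
   using c M(2)[OF nu(1)] k B0 unfolding \<kappa>_def[symmetric] by (intro mult_mono) (auto simp: distrib_right)
  finally have b: "norm ?N <= M * (1 + c) * B * ((1 + \<mu>) * (\<kappa> / \<mu>))" by (simp add: mult_ac)
  have N: "norm ?N <= K * B * ((1 + \<mu>) * (2 * \<kappa> / (\<mu> + \<kappa>)))"
  proof (cases "\<mu> <= \<kappa>")
   case True
   have "1 <= 2 * \<kappa> / (\<mu> + \<kappa>)" using True mu k by simp
   then have p1: "1 * 1 <= (1 + \<mu>) * (2 * \<kappa> / (\<mu> + \<kappa>))" using mu by (intro mult_mono) auto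
   have p2: "B * (1 + M) <= K * B" using B0 by (simp add: K_def mult.commute mult_left_mono)
   have "(B * (1 + M)) * (1 * 1) <= K * B * ((1 + \<mu>) * (2 * \<kappa> / (\<mu> + \<kappa>)))"
    by (rule mult_mono[OF p2 p1]) (use K0 B0 in auto)
   then show ?thesis using a by simp
  next
   case False
   have "\<kappa> / \<mu> <= 2 * \<kappa> / (\<mu> + \<kappa>)" using False mu k by (simp add: field_simps)
   then have p1: "(1 + \<mu>) * (\<kappa> / \<mu>) <= (1 + \<mu>) * (2 * \<kappa> / (\<mu> + \<kappa>))" using mu by (intro mult_left_mono) auto
   have p2: "M * (1 + c) * B <= K * B" using B0 by (intro mult_right_mono) (auto simp: K_def)
   have "M * (1 + c) * B * ((1 + \<mu>) * (\<kappa> / \<mu>)) <= K * B * ((1 + \<mu>) * (2 * \<kappa> / (\<mu> + \<kappa>)))"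
    by (rule mult_mono[OF p2 p1]) (use K0 B0 mu k in auto)
   then show ?thesis using b by linarith
  qed
  have "norm (lres A l o\<^sub>L ?g \<mu>) = ?m \<mu> * norm ?N" using mu stp by (simp add: compose_scaleR_right)
  also have "\<dots> <= ?m \<mu> * (K * B * ((1 + \<mu>) * (2 * \<kappa> / (\<mu> + \<kappa>))))" using mu stp by (intro mult_left_mono N) auto
  also have "\<dots> = (K * B / st (1 - s) * (2 * \<kappa>)) * (\<mu> powr (-(1 - s)) / (\<mu> + \<kappa>))"
  proof -
   have "?m \<mu> * (1 + \<mu>) = \<mu> powr (-(1 - s)) / st (1 - s)" using mu by (simp add: add.commute)
   moreover have "?m \<mu> * (K * B * ((1 + \<mu>) * (2 * \<kappa> / (\<mu> + \<kappa>)))) = (?m \<mu> * (1 + \<mu>)) * (K * B * (2 * \<kappa> / (\<mu> + \<kappa>)))"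
    by (simp only: mult_ac)
   ultimately show ?thesis by simp
  qed
  finally show ?thesis .
 qed
 have "norm (integral {0<..} (%\<mu>. lres A l o\<^sub>L ?g \<mu>)) <=
   integral {0<..} (%\<mu>. (K * B / st (1 - s) * (2 * \<kappa>)) * (\<mu> powr (-(1 - s)) / (\<mu> + \<kappa>)))"
  using pt by (intro Henstock_Kurzweil_Integration.integral_norm_bound_integral has_integral_integrable[OF li]
    integrable_on_mult_right stieltjes_real(1)[OF s' k]) auto
 also have "\<dots> = (K * B / st (1 - s) * (2 * \<kappa>)) * (st (1 - s) * \<kappa> powr (-(1 - s)))"
  unfolding integral_mult_right stieltjes_real(2)[OF s' k] ..
 also have "\<dots> = 2 * K * B * \<kappa> powr s"
  using stp k by (simp add: powr_diff)
 finally show ?thesis unfolding integral_unique[OF li] by (simp add: K_def \<kappa>_def)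
qed

section \<open>The semigroup and its Laplace transform\<close>

lemma exp_le_mp:
 assumes "\<eta> > 0"
 obtains C where "C > 0" "!!r. r > 0 ==> exp (- \<eta> * r) <= C * mp 1 r"
proof -
 obtain C where C: "C > 0" "!!r. r > 0 ==> (1 + 0 + r)\<^sup>2 * exp (- \<eta> * r) <= C * mp 1 r"
  using exp_decay_mp[OF assms order_refl] by blast
 have "exp (- \<eta> * r) <= C * mp 1 r" if r: "r > 0" for r
 proof -
  have "1 <= (1 + 0 + r)\<^sup>2" using r by (simp add: one_le_power)
  then have "1 * exp (- \<eta> * r) <= (1 + 0 + r)\<^sup>2 * exp (- \<eta> * r)" by (intro mult_right_mono) auto
  from order_trans[OF this C(2)[OF r]] show ?thesis by simp
 qed
 then show thesis using that C(1) by blast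
qed

lemma lres_in:
 assumes A: "linear_operator A" and l: "- l \<in> resolvent_set A"
 shows "(lres A l x, x - l *\<^sub>C lres A l x) \<in> A"
proof -
 have "(resolvent A (- l) x, (- l) *\<^sub>C resolvent A (- l) x - x) \<in> A"
  by (rule resolvent_in[OF l])
 from linear_operatorD(2)[OF A this, of "-1"] show ?thesis
  by (simp add: lres_def blinfun.minus_left scaleC_minus_left scaleC_diff_right scaleC_scaleC scaleC_minus_right add.commute)
qed

lemma semigroup_right_continuous:
 assumes T: "C0_semigroup T"
 shows "((%h. T h x) \<longlongrightarrow> x) (at_right 0)"
 using T by (simp add: C0_semigroup_def)

text \<open>Continuity from the left uses \<open>T t = T (t - h) o\<^sub>L T h\<close> and the bound
  K for T between 0 and t.\<close>

lemma semigroup_continuous_at: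
 assumes T: "C0_semigroup T" and bd: "!!t. t \<ge> 0 ==> norm (T t) <= M * exp (w * t)" and t: "t > 0"
 shows "((%h. T (t + h) x) \<longlongrightarrow> T t x) (at 0)"
 unfolding filterlim_at_split
proof (intro conjI)
 have sg: "T (r + s) = T r o\<^sub>L T s" if "r \<ge> 0" "s \<ge> 0" for r s using T that by (simp add: C0_semigroup_def)
 note rc = semigroup_right_continuous[OF T]
 show "((%h. T (t + h) x) \<longlongrightarrow> T t x) (at_right 0)"
 proof (rule Lim_transform_eventually)
  show "((%h. T t (T h x)) \<longlongrightarrow> T t x) (at_right 0)"
   by (intro blinfun.tendsto tendsto_const rc)
  show "\<forall>\<^sub>F h in at_right 0. T t (T h x) = T (t + h) x"
   using eventually_at_right_less[of 0] by eventually_elim (use sg t in simp)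
 qed
 define K where "K = \<bar>M\<bar> * exp (\<bar>w\<bar> * t)"
 have K: "norm (T s) <= K" if "0 <= s" "s <= t" for s
 proof -
  have "w * s <= \<bar>w\<bar> * t" using that by (metis abs_ge_self abs_ge_zero mult_mono order_trans mult_right_mono)
  then have "M * exp (w * s) <= K" unfolding K_def by (intro mult_mono) auto
  then show ?thesis using bd[OF that(1)] by linarith
 qed
 show "((%h. T (t + h) x) \<longlongrightarrow> T t x) (at_left 0)"
  unfolding filterlim_at_left_to_right[of _ _ 0] minus_zero
 proof (rule Lim_transform[where g="%h. T t x"])
  have "((%h. K * norm (x - T h x)) \<longlongrightarrow> K * norm (x - x)) (at_right 0)"
   by (intro tendsto_intros rc)
  then have z: "((%h. K * norm (x - T h x)) \<longlongrightarrow> 0) (at_right 0)" by simp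
  have ev: "\<forall>\<^sub>F h in at_right 0. 0 < h \<and> h < t"
   using eventually_at_right_less[of 0] eventually_at_right_real[OF t] by eventually_elim auto
  have "\<forall>\<^sub>F h in at_right 0. norm (T (t + - h) x - T t x) <= K * norm (x - T h x)"
   using ev
  proof eventually_elim
   case (elim h)
   have "T t = T (t - h) o\<^sub>L T h" using sg[of "t - h" h] elim by simp
   then have "T (t + - h) x - T t x = T (t - h) (x - T h x)"
    by (simp add: blinfun.diff_right)
   then show ?case using elim K[of "t - h"]
    by (simp only:) (intro order_trans[OF norm_blinfun] mult_right_mono; simp)
  qed
  from Lim_null_comparison[OF this z]
  show "((%h. T (t + - h) x - T t x) \<longlongrightarrow> 0) (at_right 0)" .
 qed simp
qed

lemma semigroup_continuous_on:
 assumes T: "C0_semigroup T" and bd: "!!t. t \<ge> 0 ==> norm (T t) <= M * exp (w * t)"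
 shows "continuous_on {0<..} (%t. T t x)"
proof (intro continuous_at_imp_continuous_on ballI)
 fix t :: real assume "t \<in> {0<..}"
 then show "isCont (%t. T t x) t"
  using semigroup_continuous_at[OF T bd, of t x] by (simp add: isCont_iff)
qed

text \<open>From the right the generator is applied directly. From the left, the quotient is
  \<open>T (t - h)\<close> applied to the quotient at 0, whose error is controlled by the local
  bound K.\<close>

lemma semigroup_derivative:
 assumes T: "C0_semigroup T" and bd: "!!t. t \<ge> 0 ==> norm (T t) <= M * exp (w * t)" and t: "t > 0"
  and g: "((%h. (1 / h) *\<^sub>R (T h u - u)) \<longlongrightarrow> v) (at_right 0)"
 shows "((%t. T t u) has_vector_derivative T t v) (at t)"
proof -
 have sg: "T (r + s) = T r o\<^sub>L T s" if "r \<ge> 0" "s \<ge> 0" for r s using T that by (simp add: C0_semigroup_def)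
 let ?d = "%h. (1 / h) *\<^sub>R (T h u - u)"
 have r: "((%h. (1 / h) *\<^sub>R (T (t + h) u - T t u)) \<longlongrightarrow> T t v) (at_right 0)"
 proof (rule Lim_transform_eventually)
  show "((%h. T t (?d h)) \<longlongrightarrow> T t v) (at_right 0)"
   by (intro blinfun.tendsto tendsto_const g)
  show "\<forall>\<^sub>F h in at_right 0. T t (?d h) = (1 / h) *\<^sub>R (T (t + h) u - T t u)"
   using eventually_at_right_less[of 0] by eventually_elim (use sg t in \<open>simp add: blinfun.scaleR_right blinfun.diff_right\<close>)
 qed
 define K where "K = \<bar>M\<bar> * exp (\<bar>w\<bar> * t)"
 have K: "norm (T s) <= K" if "0 <= s" "s <= t" for s
 proof -
  have "w * s <= \<bar>w\<bar> * t" using that by (metis abs_ge_self abs_ge_zero mult_mono order_trans mult_right_mono)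
  then have "M * exp (w * s) <= K" unfolding K_def by (intro mult_mono) auto
  then show ?thesis using bd[OF that(1)] by linarith
 qed
 have ev: "\<forall>\<^sub>F h in at_right 0. 0 < h \<and> h < t"
  using eventually_at_right_less[of 0] eventually_at_right_real[OF t] by eventually_elim auto
 have l: "((%h. (1 / h) *\<^sub>R (T (t + h) u - T t u)) \<longlongrightarrow> T t v) (at_left 0)"
  unfolding filterlim_at_left_to_right[of _ _ 0] minus_zero
 proof (rule Lim_transform[where g="%h. T (t - h) v"])
  have "((%h. T (t + h) v) \<longlongrightarrow> T t v) (at_left 0)"
   using semigroup_continuous_at[OF T bd t, of v] by (simp add: filterlim_at_split)
  then show "((%h. T (t - h) v) \<longlongrightarrow> T t v) (at_right 0)"
   unfolding filterlim_at_left_to_right[of _ _ 0] by simp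
  have "((%h. K * norm (?d h - v)) \<longlongrightarrow> K * norm (v - v)) (at_right 0)"
   by (intro tendsto_intros g)
  then have z: "((%h. K * norm (?d h - v)) \<longlongrightarrow> 0) (at_right 0)" by simp
  have "\<forall>\<^sub>F h in at_right 0. norm ((1 / - h) *\<^sub>R (T (t + - h) u - T t u) - T (t - h) v)
   <= K * norm (?d h - v)"
   using ev
  proof eventually_elim
   case (elim h)
   have "T t = T (t - h) o\<^sub>L T h" using sg[of "t - h" h] elim by simp
   then have "(1 / - h) *\<^sub>R (T (t + - h) u - T t u) - T (t - h) v
    = T (t - h) (?d h - v)"
    by (simp add: blinfun.diff_right blinfun.scaleR_right scaleR_diff_right)
   then show ?case using elim K[of "t - h"]
    by (simp only:) (intro order_trans[OF norm_blinfun] mult_right_mono; simp)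
  qed
  from Lim_null_comparison[OF this z]
  show "((%h. (1 / - h) *\<^sub>R (T (t + - h) u - T t u) - T (t - h) v) \<longlongrightarrow> 0) (at_right 0)" .
 qed
 have "((%h. (1 / h) *\<^sub>R (T (t + h) u - T t u)) \<longlongrightarrow> T t v) (at 0)"
  using l r by (simp add: filterlim_at_split)
 then have "((%h. norm ((1 / h) *\<^sub>R (T (t + h) u - T t u) - T t v)) \<longlongrightarrow> 0) (at 0)"
  by (intro tendsto_norm_zero LIM_zero)
 then have lim: "((%h. norm (T (t + h) u - T t u - h *\<^sub>R T t v) / norm h) \<longlongrightarrow> 0) (at 0)"
 proof (rule Lim_transform_eventually)
  have "norm ((1 / h) *\<^sub>R (a - b) - c) = norm (a - b - h *\<^sub>R c) / norm h" if "h ~= 0" for h :: real and a b c :: 'a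
  proof -
   have "(1 / h) *\<^sub>R (a - b) - c = (1 / h) *\<^sub>R (a - b - h *\<^sub>R c)" using that by (simp add: scaleR_diff_right)
   then show ?thesis by simp
  qed
  then show "\<forall>\<^sub>F h in at 0. norm ((1 / h) *\<^sub>R (T (t + h) u - T t u) - T t v) =
   norm (T (t + h) u - T t u - h *\<^sub>R T t v) / norm h"
   by (auto simp: eventually_at intro!: exI[of _ 1])
 qed
 then show ?thesis
  unfolding has_vector_derivative_def has_derivative_at by (simp add: bounded_linear_scaleR_left)
qed

text \<open>With \<open>u = (l + A)^(-1) x\<close>, the derivative of
  \<open>exp (- l * t) * \<phi> (T t u)\<close> is \<open>- exp (- l * t) * \<phi> (T t x)\<close>.
  The fundamental theorem on truncated intervals leaves the boundary value at 0, as the other one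
  tends to 0.\<close>

lemma laplace_semigroup:
 fixes \<phi> :: "'a::complex_banach \<Rightarrow>\<^sub>L complex"
 assumes A: "linear_operator A" and T: "C0_semigroup T" and gen: "generator T = neg_op A"
  and bd: "!!t. t \<ge> 0 ==> norm (T t) <= M * exp (w * t)"
  and l: "- l \<in> resolvent_set A" and re: "Re l > w" and f: "\<phi> \<in> clinear_ops"
 shows "integral {0<..} (%t. exp (- l * of_real t) * \<phi> (T t x)) =
  \<phi> (lres A l x)"
proof -
 define u where "u = lres A l x"
 define v where "v = l *\<^sub>C u - x"
 have "(u, x - l *\<^sub>C u) \<in> A" unfolding u_def by (rule lres_in[OF A l])
 then have "(u, v) \<in> generator T" unfolding gen neg_op_def v_def by force
 then have g: "((%h. (1 / h) *\<^sub>R (T h u - u)) \<longlongrightarrow> v) (at_right 0)" by (simp add: generator_def)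
 let ?f = "%t. exp (- l * of_real t) * \<phi> (T t x)"
 let ?h = "%t. exp (- l * of_real t) * \<phi> (T t u)"
 define \<eta> where "\<eta> = Re l - w"
 have eta: "\<eta> > 0" using re by (simp add: \<eta>_def)
 have nb: "cmod (exp (- l * of_real t) * \<phi> (T t y)) <= norm \<phi> * \<bar>M\<bar> * norm y * exp (- \<eta> * t)"
  if "t > 0" for t y
 proof -
  have "M * exp (w * t) <= \<bar>M\<bar> * exp (w * t)" by (intro mult_right_mono) auto
  then have "norm (T t) <= \<bar>M\<bar> * exp (w * t)" using bd[of t] that by linarith
  from order_trans[OF norm_blinfun mult_right_mono[OF this norm_ge_zero]]
  have "norm (T t y) <= \<bar>M\<bar> * exp (w * t) * norm y" .
  then have "cmod (\<phi> (T t y)) <= norm \<phi> * (\<bar>M\<bar> * exp (w * t) * norm y)"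
   by (rule order_trans[OF norm_blinfun mult_left_mono]) simp
  then have "cmod (exp (- l * of_real t) * \<phi> (T t y)) <=
   exp (- Re l * t) * (norm \<phi> * (\<bar>M\<bar> * exp (w * t) * norm y))"
   by (simp add: norm_mult norm_exp_eq_Re mult_left_mono)
  also have "\<dots> = norm \<phi> * \<bar>M\<bar> * norm y * (exp (- Re l * t) * exp (w * t))" by (simp add: mult_ac)
  also have "exp (- Re l * t) * exp (w * t) = exp (- \<eta> * t)" by (simp add: \<eta>_def flip: exp_add) (simp add: algebra_simps)
  finally show ?thesis .
 qed
 obtain C where C: "C > 0" "!!r. r > 0 ==> exp (- \<eta> * r) <= C * mp 1 r" using exp_le_mp[OF eta] by blast
 have cont: "continuous_on {0<..} (%t. T t x)" by (rule semigroup_continuous_on[OF T bd])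
 have fc: "continuous_on {0<..} ?f"
  by (intro continuous_intros bounded_linear.continuous_on[OF blinfun.bounded_linear_right] cont)
 have l1: "(%n. integral {exp (- real n)..exp (real n)} ?f) \<longlonglongrightarrow> integral {0<..} ?f"
 proof (rule truncated_integral_LIMSEQ[OF fc, where u=1 and C="norm \<phi> * \<bar>M\<bar> * norm x * C"])
  fix r :: real assume r: "r > 0"
  have "norm (?f r) <= norm \<phi> * \<bar>M\<bar> * norm x * exp (- \<eta> * r)" by (rule nb[OF r])
  also have "\<dots> <= norm \<phi> * \<bar>M\<bar> * norm x * (C * mp 1 r)" by (intro mult_left_mono C r) auto
  finally show "norm (?f r) <= norm \<phi> * \<bar>M\<bar> * norm x * C * mp 1 r" by (simp add: mult.assoc)
 qed simp
 have l2: "integral {exp (- real n)..exp (real n)} ?f = ?h (exp (- real n)) - ?h (exp (real n))" for n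
 proof -
  let ?I = "{exp (- real n)..exp (real n)}"
  have "((%t. - ?f t) has_integral (?h (exp (real n)) - ?h (exp (- real n)))) ?I"
  proof (rule fundamental_theorem_of_calculus)
   fix t assume "t \<in> ?I"
   then have t: "t > 0" by (auto intro: less_le_trans[OF exp_gt_zero])
   have Tc: "T t \<in> clinear_ops" using T t by (simp add: C0_semigroup_def)
   have d1: "((%t. \<phi> (T t u)) has_vector_derivative \<phi> (T t v)) (at t within ?I)"
    by (rule bounded_linear.has_vector_derivative[OF blinfun.bounded_linear_right
       has_vector_derivative_at_within[OF semigroup_derivative[OF T bd t g]]])
   have d2: "((%t. exp (- l * of_real t)) has_vector_derivative (- l * exp (- l * of_real t))) (at t within ?I)"
    by (rule has_vector_derivative_at_within, rule has_vector_derivative_real_field)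
     (auto intro!: derivative_eq_intros)
   have eq: "- ?f t = exp (- l * of_real t) * \<phi> (T t v) + (- l * exp (- l * of_real t)) * \<phi> (T t u)"
    by (simp add: v_def blinfun.diff_right clinear_opsD[OF Tc] clinear_opsD[OF f] algebra_simps)
   show "(?h has_vector_derivative - ?f t) (at t within ?I)"
    unfolding eq by (rule has_vector_derivative_mult[OF d2 d1])
  qed auto
  from has_integral_neg[OF this]
  have "(?f has_integral - (?h (exp (real n)) - ?h (exp (- real n)))) ?I" by (simp only: minus_minus)
  from integral_unique[OF this] show ?thesis by (simp only: minus_diff_eq)
 qed
 have n1: "filterlim (%n. exp (real n)) at_top sequentially"
  by (rule filterlim_compose[OF exp_at_top filterlim_real_sequentially])
 have "(%n. ?h (exp (real n))) \<longlonglongrightarrow> 0"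
 proof (rule Lim_null_comparison[OF always_eventually[OF allI[OF nb]]])
  have "- \<eta> < 0" using eta by simp
  from tendsto_mult_left[OF filterlim_compose[OF exp_at_bot filterlim_tendsto_neg_mult_at_bot[OF tendsto_const this n1]]]
  have "(%n. norm \<phi> * \<bar>M\<bar> * norm u * exp (- \<eta> * exp (real n))) \<longlonglongrightarrow> norm \<phi> * \<bar>M\<bar> * norm u * 0" .
  then show "(%n. norm \<phi> * \<bar>M\<bar> * norm u * exp (- \<eta> * exp (real n))) \<longlonglongrightarrow> 0" by simp
 qed simp
 moreover have "(%n. ?h (exp (- real n))) \<longlonglongrightarrow> exp (- l * of_real 0) * \<phi> u"
 proof -
  have e0: "filterlim (%n. exp (- real n)) (at_right 0) sequentially"
  proof -
   have "(%n. exp (- 1 :: real) ^ n) \<longlonglongrightarrow> 0" by (rule LIMSEQ_realpow_zero) auto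
   then have "(%n. exp (- real n)) \<longlonglongrightarrow> 0" by (simp flip: exp_of_nat_mult)
   then show ?thesis by (simp add: filterlim_at)
  qed
  have "((%t. ?h t) \<longlongrightarrow> exp (- l * of_real 0) * \<phi> u) (at_right 0)"
   by (intro tendsto_intros blinfun.tendsto semigroup_right_continuous[OF T])
  from filterlim_compose[OF this e0] show ?thesis .
 qed
 ultimately have "(%n. ?h (exp (- real n)) - ?h (exp (real n))) \<longlonglongrightarrow> exp (- l * of_real 0) * \<phi> u - 0"
  by (intro tendsto_diff)
 from LIMSEQ_unique[OF l1[unfolded l2] this] show ?thesis by (simp add: u_def)
qed

section \<open>Contour representation\<close>

lemma exp_bounded_on_ray:
 assumes z: "Re z \<ge> cos \<psi> * cmod z" and p: "p \<ge> 0" and f: "cmod f <= M * exp (w * cmod z)"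
 shows "cmod (f * exp (of_real p * (of_real t - z))) <= M * exp (p * t) * exp (- (p * cos \<psi> - w) * cmod z)"
proof -
 have "cmod (f * exp (of_real p * (of_real t - z))) = cmod f * exp (p * (t - Re z))"
  by (simp add: norm_mult norm_exp_eq_Re)
 also have "\<dots> <= (M * exp (w * cmod z)) * exp (p * (t - cos \<psi> * cmod z))"
 proof (rule mult_mono[OF f])
  have "p * (t - Re z) <= p * (t - cos \<psi> * cmod z)" using p z by (intro mult_left_mono) auto
  then show "exp (p * (t - Re z)) <= exp (p * (t - cos \<psi> * cmod z))" by simp
  show "0 <= M * exp (w * cmod z)" using order_trans[OF norm_ge_zero f] .
 qed simp
 also have "\<dots> = M * (exp (w * cmod z) * exp (p * (t - cos \<psi> * cmod z)))" by simp
 also have "exp (w * cmod z) * exp (p * (t - cos \<psi> * cmod z)) = exp (p * t) * exp (- (p * cos \<psi> - w) * cmod z)"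
  by (simp add: algebra_simps flip: exp_add)
 finally show ?thesis by (simp add: mult.assoc)
qed

text \<open>The factor \<open>exp (p (t - z))\<close> makes the integrals over the two rays converge; as functions of \<open>p\<close> they continue to the left half-plane, one upwards and one downwards.\<close>

lemma sector_cauchy:
 assumes hol: "f holomorphic_on sector \<xi>" and \<xi>: "\<xi> <= pi"
  and bd: "!!z. z \<in> sector \<xi> ==> cmod (f z) <= M * exp (w * cmod z)" and w: "w \<ge> 0"
  and \<psi>: "0 < \<psi>" "\<psi> < \<xi>" "\<psi> < pi / 2" and p: "w < p * cos \<psi>" and t: "t > 0"
 shows "integral {0<..} (%r. f (rcis r (-\<psi>)) / (rcis r (-\<psi>) - of_real t) * exp (of_real p * (of_real t - rcis r (-\<psi>))) * cis (-\<psi>))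
  - integral {0<..} (%r. f (rcis r \<psi>) / (rcis r \<psi> - of_real t) * exp (of_real p * (of_real t - rcis r \<psi>)) * cis \<psi>)
  = 2 * of_real pi * \<i> * f (of_real t)"
proof -
 have cp: "cos \<psi> > 0" using \<psi> by (intro cos_gt_zero) auto
 have p0: "p > 0"
 proof (rule ccontr)
  assume "\<not> p > 0"
  then have "p * cos \<psi> <= 0" using cp by (simp add: mult_le_0_iff)
  then show False using p w by linarith
 qed
 define \<eta> where "\<eta> = p * cos \<psi> - w"
 have eta: "\<eta> > 0" using p by (simp add: \<eta>_def)
 obtain C where C: "C > 0" "!!r. r > 0 ==> exp (- \<eta> * r) <= C * mp 1 r" using exp_le_mp[OF eta] by blast
 define U where "U = sector \<xi> \<inter> {z. Re z > 0}"
 have openU: "open U" unfolding U_def using \<psi> \<xi> by (intro open_Int open_sector open_halfspace_Re_gt) auto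
 have tS: "of_real t \<in> U" using t \<psi> by (auto simp: U_def sector_def Arg_eq_0)
 have M0: "M \<ge> 0"
 proof -
  have "of_real t \<in> sector \<xi>" using tS by (simp add: U_def)
  from order_trans[OF norm_ge_zero bd[OF this]] show ?thesis by (simp add: zero_le_mult_iff)
 qed
 let ?e = "%z. f z * exp (of_real p * (of_real t - z))"
 \<comment> \<open>At t the subtracted term equals f(t), so \<open>?N\<close> has a zero there and
   its quotient by z - t is holomorphic. Divided by z - t, the subtracted term is f(t) times the
   kernel of \<open>sector_log_kernel\<close>, whose contour integral is known.\<close>
 let ?N = "%z. ?e z - f (of_real t) * (2 * of_real t / (z + of_real t))"
 have N0: "?N (of_real t) = 0" using t by simp
 define G where "G = (%z. if z = of_real t then deriv ?N (of_real t) else (?N z - ?N (of_real t)) / (z - of_real t))"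
 have ray: "rcis r \<xi>' \<in> U \<and> Re (rcis r \<xi>') \<ge> cos \<psi> * r" if "r > 0" "- \<psi> <= \<xi>'" "\<xi>' <= \<psi>" for r \<xi>'
 proof -
  have "cos \<psi> <= cos \<bar>\<xi>'\<bar>" using that \<psi> by (intro cos_monotone_0_pi_le) auto
  then have c: "cos \<psi> <= cos \<xi>'" by simp
  then have "cos \<psi> * r <= Re (rcis r \<xi>')" using that by (simp add: rcis_def mult.commute mult_left_mono)
  moreover have "0 < Re (rcis r \<xi>')" using c cp that by (simp add: rcis_def)
  moreover have "rcis r \<xi>' \<in> sector \<xi>" using that \<psi> \<xi> by (intro rcis_mem_sector) auto
  ultimately show ?thesis by (simp add: U_def)
 qed
 have zt: "z + of_real t ~= 0" if "z \<in> U" for z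
 proof
  assume "z + of_real t = 0"
  then have "Re (z + of_real t) = 0" by simp
  then show False using that t by (simp add: U_def)
 qed
 have holN: "?N holomorphic_on U"
  by (intro holomorphic_intros holomorphic_on_subset[OF hol]) (use zt in \<open>auto simp: U_def\<close>)
 have holG: "G holomorphic_on U"
  unfolding G_def by (rule pole_lemma_open[OF holN openU])
 obtain e where e: "e > 0" "cball (of_real t) e \<subseteq> U" using openU tS open_contains_cball by blast
 have "compact (G ` cball (of_real t) e)"
  by (intro compact_continuous_image holomorphic_on_imp_continuous_on holomorphic_on_subset[OF holG e(2)]) simp
 then obtain B where B: "!!z. z \<in> cball (of_real t) e ==> cmod (G z) <= B"
  by (meson bounded_iff compact_imp_bounded image_eqI)
 \<comment> \<open>Outside the ball,
   \<open>t + |z| <= |z - t| + 2 t <= |z - t| (1 + 2 t / e)\<close>, and the last bracket is 1 /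
   c.\<close>
 define c where "c = e / (e + 2 * t)"
 have c0: "c > 0" using e t by (simp add: c_def)
 have eb: "cmod (?e z) <= M * exp (p * t) * (C * mp 1 (cmod z))" if "z \<in> U" "Re z \<ge> cos \<psi> * cmod z" for z
 proof -
  have "cmod (?e z) <= M * exp (p * t) * exp (- \<eta> * cmod z)"
   unfolding \<eta>_def by (rule exp_bounded_on_ray[OF that(2) less_imp_le[OF p0] bd]) (use that in \<open>simp add: U_def\<close>)
  also have "\<dots> <= M * exp (p * t) * (C * mp 1 (cmod z))"
   using M0 that by (intro mult_left_mono C) (auto simp: U_def sector_def)
  finally show ?thesis .
 qed
 \<comment> \<open>K1 serves outside the ball around t, where numerator and denominator are
   estimated separately; K2 serves in the ball, where G is bounded by compactness.\<close>
 define K1 where "K1 = M * exp (p * t) * C / (c * t) + cmod (f (of_real t)) * 4 * t / (c * (min t 1)\<^sup>2)"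
 define K2 where "K2 = \<bar>B\<bar> * (1 + t + e)\<^sup>2"
 have Gb: "cmod (G z) <= (K1 + K2) * mp 1 (cmod z)" if z: "z \<in> U" "Re z \<ge> cos \<psi> * cmod z" for z
 proof -
  let ?r = "cmod z"
  have r: "?r > 0" using z by (auto simp: U_def sector_def)
  have K10: "K1 \<ge> 0" unfolding K1_def using M0 C c0 t by (intro add_nonneg_nonneg divide_nonneg_nonneg mult_nonneg_nonneg) auto
  have K20: "K2 \<ge> 0" by (simp add: K2_def)
  show ?thesis
  proof (cases "dist (of_real t) z <= e")
   case True
   have "?r <= t + e" using norm_triangle_ineq2[of z "of_real t"] True t by (simp add: dist_norm norm_minus_commute)
   then have "(1 + ?r)\<^sup>2 <= (1 + t + e)\<^sup>2" by (intro power_mono) auto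
   moreover have "0 < (1 + ?r)\<^sup>2" using norm_ge_zero[of z] by (intro zero_less_power) linarith
   ultimately have "1 <= (1 + t + e)\<^sup>2 / (1 + ?r)\<^sup>2" by (subst le_divide_eq_1_pos)
   then have "\<bar>B\<bar> * 1 <= \<bar>B\<bar> * ((1 + t + e)\<^sup>2 * (1 / (1 + ?r)\<^sup>2))"
    by (intro mult_left_mono) (simp_all only: times_divide_eq_right mult_1_right abs_ge_zero)
   also have "\<dots> <= \<bar>B\<bar> * ((1 + t + e)\<^sup>2 * mp 1 ?r)"
    by (intro mult_left_mono inverse_square_le_mp r) auto
   also have "\<dots> = K2 * mp 1 ?r" by (simp add: K2_def)
   also have "\<dots> <= (K1 + K2) * mp 1 ?r" using K10 mp_nonneg[OF r, of 1] by (intro mult_right_mono) auto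
   finally show ?thesis using B[of z] True by simp
  next
   case False
   then have d: "cmod (z - of_real t) \<ge> e" by (simp add: dist_norm norm_minus_commute)
   then have zne: "z ~= of_real t" using e by auto
   have "t + ?r <= cmod (z - of_real t) + 2 * t" using norm_triangle_ineq2[of z "of_real t"] t by simp
   also have "\<dots> <= cmod (z - of_real t) + cmod (z - of_real t) / e * (2 * t)"
    using d e t by (intro add_left_mono) (simp add: field_simps mult_right_mono)
   also have "\<dots> = cmod (z - of_real t) / c" using e t by (simp add: c_def field_simps)
   finally have d1: "c * (t + ?r) <= cmod (z - of_real t)" using c0 by (simp add: field_simps)
   have d2: "(t + ?r) / 2 <= cmod (z + of_real t)"
   proof -
    have "t <= Re (z + of_real t)" using z by (simp add: U_def)
    then have "t <= cmod (z + of_real t)" using complex_Re_le_cmod order_trans by blast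
    moreover have "?r\<^sup>2 <= (cmod (z + of_real t))\<^sup>2"
    proof -
     have "Re z * Re z <= (Re z + t) * (Re z + t)" using z t by (intro mult_mono) (auto simp: U_def)
     then show ?thesis unfolding cmod_power2 by (simp add: power2_eq_square)
    qed
    then have "?r <= cmod (z + of_real t)" by (rule power2_le_imp_le) simp
    ultimately show ?thesis by simp
   qed
   have "cmod (G z) = cmod (?N z) / cmod (z - of_real t)" using zne by (simp only: G_def N0 diff_0_right if_False norm_divide)
   also have "\<dots> <= (cmod (?e z) + cmod (f (of_real t) * (2 * of_real t / (z + of_real t)))) / cmod (z - of_real t)"
    by (intro divide_right_mono norm_triangle_ineq4) auto
   also have "\<dots> = cmod (?e z) / cmod (z - of_real t) + cmod (f (of_real t)) * (2 * t) / (cmod (z + of_real t) * cmod (z - of_real t))"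
    using t by (simp add: add_divide_distrib norm_mult norm_divide)
   also have "\<dots> <= (M * exp (p * t) * (C * mp 1 ?r)) / (c * t) + cmod (f (of_real t)) * (2 * t) / ((t + ?r) / 2 * (c * (t + ?r)))"
   proof (intro add_mono frac_le mult_mono d1 d2 eb z)
    have "c * t <= c * (t + ?r)" using c0 by (intro mult_left_mono) auto
    then show "c * t <= cmod (z - of_real t)" using d1 by linarith
   qed (use t c0 r M0 C mp_nonneg[OF r, of 1] in \<open>auto intro!: mult_pos_pos add_pos_nonneg\<close>)
   also have "\<dots> = (M * exp (p * t) * C / (c * t)) * mp 1 ?r + cmod (f (of_real t)) * 4 * t / c * (1 / (t + ?r)\<^sup>2)"
    by (simp add: power2_eq_square mult_ac)
   also have "\<dots> <= (M * exp (p * t) * C / (c * t)) * mp 1 ?r + cmod (f (of_real t)) * 4 * t / c * (1 / (min t 1)\<^sup>2 * mp 1 ?r)"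
    using c0 t by (intro add_left_mono mult_left_mono inverse_sum_square_le_mp r) auto
   also have "\<dots> = K1 * mp 1 ?r" by (simp add: K1_def algebra_simps)
   also have "\<dots> <= (K1 + K2) * mp 1 ?r" using K20 mp_nonneg[OF r, of 1] by (intro mult_right_mono) auto
   finally show ?thesis .
  qed
 qed
 have Gray: "cmod (G (rcis r \<xi>')) <= (K1 + K2) * mp 1 r" if "r > 0" "- \<psi> <= \<xi>'" "\<xi>' <= \<psi>" for r \<xi>'
  using Gb[of "rcis r \<xi>'"] ray[OF that] that by (simp add: mult.commute)
 have rot: "integral {0<..} (%r. G (rcis r (-\<psi>)) * cis (-\<psi>)) = integral {0<..} (%r. G (rcis r \<psi>) * cis \<psi>)"
  by (rule ray_rotate[OF _ holG openU, where u=1]) (use ray Gray \<psi> in auto)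
 define k where "k = (%\<xi>' r. 2 * complex_of_real t / ((rcis r \<xi>')\<^sup>2 - (of_real t)\<^sup>2) * cis \<xi>')"
 have split: "integral {0<..} (%r. G (rcis r \<xi>') * cis \<xi>') =
   integral {0<..} (%r. f (rcis r \<xi>') / (rcis r \<xi>' - of_real t) * exp (of_real p * (of_real t - rcis r \<xi>')) * cis \<xi>')
   - f (of_real t) * integral {0<..} (k \<xi>')"
  (is "_ = integral _ ?g - _")
  if th: "\<xi>' = \<psi> \<or> \<xi>' = - \<psi>" for \<xi>'
 proof -
  have th': "- \<psi> <= \<xi>'" "\<xi>' <= \<psi>" using th \<psi> by auto
  define s where "s = sqrt ((1 - cos \<xi>') / 2)"
  have "cos \<xi>' < 1" using cos_monotone_0_pi[of 0 \<psi>] \<psi> th by auto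
  then have s: "s > 0" by (simp add: s_def)
  have dz: "s * t <= cmod (rcis r \<xi>' - of_real t)" if "r > 0" for r
  proof -
   have "s * t <= s * (t + r)" using s that by (intro mult_left_mono) auto
   then show ?thesis using norm_diff_rcis_ge[of t r \<xi>'] t that by (simp add: s_def)
  qed
  have ne: "rcis r \<xi>' ~= of_real t" if "r > 0" for r
  proof
   assume "rcis r \<xi>' = of_real t"
   then have "s * t <= 0" using dz[OF that] by simp
   then show False using s t by (simp add: mult_le_0_iff)
  qed
  have Geq: "G (rcis r \<xi>') * cis \<xi>' = ?g r - f (of_real t) * k \<xi>' r" if r: "r > 0" for r
  proof -
   have k: "k \<xi>' r = 2 * of_real t / (rcis r \<xi>' + of_real t) / (rcis r \<xi>' - of_real t) * cis \<xi>'"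
    by (simp add: k_def power2_eq_square algebra_simps)
   have G: "G (rcis r \<xi>') = ?N (rcis r \<xi>') / (rcis r \<xi>' - of_real t)"
    using ne[OF r] by (simp only: G_def N0 diff_0_right if_False)
   have alg: "(x * ex - ft * q) / u * d = x / u * ex * d - ft * (q / u * d)" for x ex ft q u d :: complex
    by (simp add: diff_divide_distrib left_diff_distrib)
   show ?thesis unfolding G k by (rule alg)
  qed
  have cr: "continuous_on {0<..} (%r. rcis r \<xi>')" by (simp add: rcis_def continuous_intros)
  have im: "(%r. rcis r \<xi>') ` {0<..} \<subseteq> U" using ray th' by auto
  have cf: "continuous_on {0<..} (%r. f (rcis r \<xi>'))"
   by (rule continuous_on_compose2[OF holomorphic_on_imp_continuous_on[OF hol] cr]) (use im in \<open>auto simp: U_def\<close>)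
  have gi: "?g integrable_on {0<..}"
  proof (rule integrable_mp[where u=1 and C="M * exp (p * t) * C / (s * t)"])
   show "continuous_on {0<..} ?g" by (intro continuous_intros cf cr) (use ne in auto)
   fix r :: real assume r: "r > 0"
   have "norm (?g r) = cmod (?e (rcis r \<xi>')) / cmod (rcis r \<xi>' - of_real t)"
    by (simp add: norm_mult norm_divide)
   also have "\<dots> <= (M * exp (p * t) * (C * mp 1 r)) / (s * t)"
    using eb[of "rcis r \<xi>'"] ray[OF r th'] r dz[OF r] s t M0 C mp_nonneg[OF r, of 1]
    by (intro frac_le) (auto simp: mult.commute)
   finally show "norm (?g r) <= M * exp (p * t) * C / (s * t) * mp 1 r" by simp
  qed simp
  have Gi: "(%r. G (rcis r \<xi>') * cis \<xi>') integrable_on {0<..}"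
  proof (rule integrable_mp[where u=1 and C="K1 + K2"])
   show "continuous_on {0<..} (%r. G (rcis r \<xi>') * cis \<xi>')"
    by (intro continuous_intros continuous_on_compose2[OF holomorphic_on_imp_continuous_on[OF holG] cr im])
  qed (use Gray th' in \<open>auto simp: norm_mult\<close>)
  have "integral {0<..} (%r. f (of_real t) * k \<xi>' r) = integral {0<..} (%r. ?g r - G (rcis r \<xi>') * cis \<xi>')"
   by (rule integral_cong) (use Geq in auto)
  also have "\<dots> = integral {0<..} ?g - integral {0<..} (%r. G (rcis r \<xi>') * cis \<xi>')"
   by (rule integral_diff[OF gi Gi])
  finally show ?thesis by (simp add: algebra_simps)
 qed
 have "integral {0<..} (k (-\<psi>)) - integral {0<..} (k \<psi>) = 2 * of_real pi * \<i>"
  unfolding k_def by (rule sector_log_kernel[OF t]) (use \<psi> in auto)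
 moreover have "x1 - x2 = q * c" if "I1 = x1 - c * k1" "I2 = x2 - c * k2" "I1 = I2" "k1 - k2 = q" for x1 x2 I1 I2 c k1 k2 q :: complex
  using that by (metis add_diff_cancel_left' diff_add_cancel diff_diff_eq2 mult.commute right_diff_distrib')
 ultimately show ?thesis using split[of "-\<psi>", OF disjI2[OF refl]] split[of \<psi>, OF disjI1[OF refl]] rot by blast
qed

text \<open>Differentiation in p brings down t - z and cancels Cauchy's denominator, leaving a
  Laplace transform of f along the ray. It is defined on a half-plane tilted by the angle of the
  ray; for large real p the ray is rotated back to the positive axis.\<close>

lemma ray_laplace:
 assumes hol: "f holomorphic_on sector \<xi>" and \<xi>: "\<xi> <= pi"
  and bd: "!!z. z \<in> sector \<xi> ==> cmod (f z) <= M * exp (w * cmod z)" and w: "w \<ge> 0"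
  and \<psi>: "0 < \<psi>" "\<psi> < \<xi>" "\<psi> < pi / 2" and th: "\<xi>' = \<psi> \<or> \<xi>' = - \<psi>"
 shows "!!p t. w < Re (p * cis \<xi>') ==> t > 0 ==>
   ((%p. integral {0<..} (%r. f (rcis r \<xi>') / (rcis r \<xi>' - of_real t) * exp (p * (of_real t - rcis r \<xi>')) * cis \<xi>'))
   has_field_derivative - (exp (p * of_real t) * integral {0<..} (%r. f (rcis r \<xi>') * exp (- p * rcis r \<xi>') * cis \<xi>'))) (at p)"
  and "(%p. integral {0<..} (%r. f (rcis r \<xi>') * exp (- p * rcis r \<xi>') * cis \<xi>')) holomorphic_on {p. w < Re (p * cis \<xi>')}"
  and "!!p t. w + 1 <= Re (p * cis \<xi>') ==> t > 0 ==> (!!r. r > 0 ==> exp (- r) <= C * mp 1 r) ==>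
   cmod (integral {0<..} (%r. f (rcis r \<xi>') / (rcis r \<xi>' - of_real t) * exp (p * (of_real t - rcis r \<xi>')) * cis \<xi>'))
   <= M / (sqrt ((1 - cos \<psi>) / 2) * t) * exp (Re p * t) * C * integral {0<..} (mp 1)"
  and "!!p. w < p * cos \<psi> ==> integral {0<..} (%r. f (rcis r \<xi>') * exp (- of_real p * rcis r \<xi>') * cis \<xi>')
   = integral {0<..} (%r. exp (- of_real p * of_real r) * f (of_real r))"
proof -
 define d where "d = cis \<xi>'"
 have rd: "rcis r \<xi>' = of_real r * d" for r by (simp add: rcis_def d_def)
 have nd: "cmod d = 1" by (simp add: d_def)
 have sec: "rcis r \<xi>' \<in> sector \<xi>" if "r > 0" for r using that \<psi> th \<xi> by (intro rcis_mem_sector) auto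
 have b: "cmod (f (rcis r \<xi>')) <= M * exp (w * r)" if "r > 0" for r using bd[OF sec[OF that]] that by simp
 have M0: "M \<ge> 0" using order_trans[OF norm_ge_zero b[of 1]] by (simp add: zero_le_mult_iff)
 have cr: "continuous_on {0<..} (%r. rcis r \<xi>')" by (simp add: rcis_def continuous_intros)
 have cf: "continuous_on {0<..} (%r. f (rcis r \<xi>'))"
  by (rule continuous_on_compose2[OF holomorphic_on_imp_continuous_on[OF hol] cr]) (use sec in auto)
 define s where "s = sqrt ((1 - cos \<psi>) / 2)"
 have "cos \<psi> < 1" using cos_monotone_0_pi[of 0 \<psi>] \<psi> by auto
 then have s: "s > 0" by (simp add: s_def)
 have cth: "cos \<xi>' = cos \<psi>" using th by auto
 have dz: "s * t <= cmod (rcis r \<xi>' - of_real t)" if "r > 0" "t > 0" for r t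
 proof -
  have "s * t <= s * (t + r)" using s that by (intro mult_left_mono) auto
  then show ?thesis using norm_diff_rcis_ge[of t r \<xi>'] that by (simp add: s_def cth)
 qed
 have ne: "rcis r \<xi>' ~= of_real t" if "r > 0" "t > 0" for r t
 proof
  assume "rcis r \<xi>' = of_real t"
  then have "s * t <= 0" using dz[OF that] by simp
  then show False using s that by (simp add: mult_le_0_iff)
 qed
 let ?a = "%t r. f (rcis r \<xi>') / (rcis r \<xi>' - of_real t) * cis \<xi>'"
 have ca: "continuous_on {0<..} (?a t)" if "t > 0" for t by (intro continuous_intros cf cr) (use ne that in auto)
 have ab: "cmod (?a t r) <= M / (s * t) * exp (w * r)" if "r > 0" "t > 0" for r t
 proof -
  have "cmod (?a t r) <= (M * exp (w * r)) / (s * t)"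
   unfolding norm_mult norm_divide norm_cis mult_1_right
   by (rule frac_le[OF _ b _ dz]) (use that s M0 in auto)
  then show ?thesis by simp
 qed
 show "((%p. integral {0<..} (%r. f (rcis r \<xi>') / (rcis r \<xi>' - of_real t) * exp (p * (of_real t - rcis r \<xi>')) * cis \<xi>'))
   has_field_derivative - (exp (p * of_real t) * integral {0<..} (%r. f (rcis r \<xi>') * exp (- p * rcis r \<xi>') * cis \<xi>'))) (at p)"
  if p: "w < Re (p * cis \<xi>')" and t: "t > 0" for p t
 proof -
  have "((%p. integral {0<..} (%r. ?a t r * exp (p * (of_real t - of_real r * d)))) has_field_derivative
   integral {0<..} (%r. ?a t r * (of_real t - of_real r * d) * exp (p * (of_real t - of_real r * d)))) (at p)"
   by (rule laplace_deriv[OF ca[OF t] ab[OF _ t] nd less_imp_le[OF t] p[folded d_def]])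
  moreover have "(%p. integral {0<..} (%r. ?a t r * exp (p * (of_real t - of_real r * d)))) =
   (%p. integral {0<..} (%r. f (rcis r \<xi>') / (rcis r \<xi>' - of_real t) * exp (p * (of_real t - rcis r \<xi>')) * cis \<xi>'))"
   by (simp add: rd mult_ac)
  moreover have "integral {0<..} (%r. ?a t r * (of_real t - of_real r * d) * exp (p * (of_real t - of_real r * d))) =
   integral {0<..} (%r. - exp (p * of_real t) * (f (rcis r \<xi>') * exp (- p * rcis r \<xi>') * cis \<xi>'))"
  proof (rule integral_cong)
   fix r :: real assume "r \<in> {0<..}"
   then have "?a t r * (of_real t - rcis r \<xi>') = - (f (rcis r \<xi>') * cis \<xi>')"
    using ne[of r t] t by (simp add: field_simps)
   moreover have "exp (p * (of_real t - rcis r \<xi>')) = exp (p * of_real t) * exp (- p * rcis r \<xi>')"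
    by (simp add: algebra_simps flip: exp_add)
   ultimately show "?a t r * (of_real t - of_real r * d) * exp (p * (of_real t - of_real r * d)) =
    - exp (p * of_real t) * (f (rcis r \<xi>') * exp (- p * rcis r \<xi>') * cis \<xi>')"
    by (simp only: rd[symmetric]) (simp only: mult_minus_left mult_minus_right mult_ac)
  qed
  ultimately show ?thesis by (simp only: integral_mult_right mult_minus_left integral_neg)
 qed
 show "(%p. integral {0<..} (%r. f (rcis r \<xi>') * exp (- p * rcis r \<xi>') * cis \<xi>')) holomorphic_on {p. w < Re (p * cis \<xi>')}"
 proof (rule holomorphic_onI)
  fix p assume p: "p \<in> {p. w < Re (p * cis \<xi>')}"
  have c: "continuous_on {0<..} (%r. f (rcis r \<xi>') * cis \<xi>')" by (intro continuous_intros cf)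
  have p': "w < Re (p * d)" using p by (simp add: d_def)
  have "((%p. integral {0<..} (%r. f (rcis r \<xi>') * cis \<xi>' * exp (p * (of_real 0 - of_real r * d)))) has_field_derivative
   integral {0<..} (%r. f (rcis r \<xi>') * cis \<xi>' * (of_real 0 - of_real r * d) * exp (p * (of_real 0 - of_real r * d)))) (at p)"
   by (rule laplace_deriv[where t=0, OF c _ nd order_refl p']) (use b in \<open>simp add: norm_mult\<close>)
  moreover have "(%p. integral {0<..} (%r. f (rcis r \<xi>') * cis \<xi>' * exp (p * (of_real 0 - of_real r * d)))) =
   (%p. integral {0<..} (%r. f (rcis r \<xi>') * exp (- p * rcis r \<xi>') * cis \<xi>'))"
   by (simp add: rd mult_ac)
  ultimately have "(%p. integral {0<..} (%r. f (rcis r \<xi>') * exp (- p * rcis r \<xi>') * cis \<xi>')) field_differentiable at p"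
   unfolding field_differentiable_def by (intro exI) (simp only:)
  then show "(%p. integral {0<..} (%r. f (rcis r \<xi>') * exp (- p * rcis r \<xi>') * cis \<xi>')) field_differentiable at p within {p. w < Re (p * cis \<xi>')}"
   by (rule field_differentiable_at_within)
 qed
 show "cmod (integral {0<..} (%r. f (rcis r \<xi>') / (rcis r \<xi>' - of_real t) * exp (p * (of_real t - rcis r \<xi>')) * cis \<xi>'))
   <= M / (sqrt ((1 - cos \<psi>) / 2) * t) * exp (Re p * t) * C * integral {0<..} (mp 1)"
  if p: "w + 1 <= Re (p * cis \<xi>')" and t: "t > 0" and C: "!!r. r > 0 ==> exp (- r) <= C * mp 1 r" for p t
  unfolding s_def[symmetric]
 proof (rule norm_integral_mp_le)
  show "continuous_on {0<..} (%r. f (rcis r \<xi>') / (rcis r \<xi>' - of_real t) * exp (p * (of_real t - rcis r \<xi>')) * cis \<xi>')"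
   by (intro continuous_intros cf cr) (use ne t in auto)
  fix r :: real assume r: "r > 0"
  have "cmod (f (rcis r \<xi>') / (rcis r \<xi>' - of_real t) * exp (p * (of_real t - rcis r \<xi>')) * cis \<xi>') = cmod (?a t r) * exp (Re (p * (of_real t - rcis r \<xi>')))"
   by (simp add: norm_mult norm_divide norm_exp_eq_Re del: Re_complex_of_real times_complex.simps minus_complex.simps)
  also have "Re (p * (of_real t - rcis r \<xi>')) = Re p * t - r * Re (p * cis \<xi>')"
   by (simp add: rcis_def algebra_simps)
  also have "cmod (?a t r) * exp (Re p * t - r * Re (p * cis \<xi>')) <= (M / (s * t) * exp (w * r)) * exp (Re p * t - r * (w + 1))"
   using ab[OF r t] p r M0 s t by (intro mult_mono) (auto simp del: times_complex.simps)
  also have "\<dots> = M / (s * t) * (exp (w * r) * exp (Re p * t - r * (w + 1)))" by simp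
  also have "exp (w * r) * exp (Re p * t - r * (w + 1)) = exp (Re p * t) * exp (- r)" by (simp add: algebra_simps flip: exp_add)
  also have "M / (s * t) * (exp (Re p * t) * exp (- r)) <= M / (s * t) * (exp (Re p * t) * (C * mp 1 r))"
   using M0 s t by (intro mult_left_mono C r) auto
  finally show "cmod (f (rcis r \<xi>') / (rcis r \<xi>' - of_real t) * exp (p * (of_real t - rcis r \<xi>')) * cis \<xi>') <= M / (s * t) * exp (Re p * t) * C * mp 1 r"
   by (simp only: mult_ac)
 qed simp
 show "integral {0<..} (%r. f (rcis r \<xi>') * exp (- of_real p * rcis r \<xi>') * cis \<xi>')
   = integral {0<..} (%r. exp (- of_real p * of_real r) * f (of_real r))" if p: "w < p * cos \<psi>" for p
 proof -
  have cp: "cos \<psi> > 0" using \<psi> by (intro cos_gt_zero) auto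
  have p0: "p > 0"
  proof (rule ccontr)
   assume "\<not> p > 0"
   then have "p * cos \<psi> <= 0" using cp by (simp add: mult_le_0_iff)
   then show False using p w by linarith
  qed
  define \<eta> where "\<eta> = p * cos \<psi> - w"
  have eta: "\<eta> > 0" using p by (simp add: \<eta>_def)
  obtain C where C: "C > 0" "!!r. r > 0 ==> exp (- \<eta> * r) <= C * mp 1 r" using exp_le_mp[OF eta] by blast
  let ?F = "%z. f z * exp (of_real p * (of_real 0 - z))"
  have F: "?F holomorphic_on sector \<xi>" by (intro holomorphic_intros hol)
  have sec': "rcis r \<phi> \<in> sector \<xi>" if "r > 0" "-\<psi> <= \<phi>" "\<phi> <= \<psi>" for r \<phi> using that \<psi> \<xi> by (intro rcis_mem_sector) auto
  have Fb: "cmod (?F (rcis r \<phi>)) <= M * C * mp 1 r" if r: "r > 0" "-\<psi> <= \<phi>" "\<phi> <= \<psi>" for r \<phi>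
  proof -
   have "cos \<psi> <= cos \<bar>\<phi>\<bar>" using that \<psi> by (intro cos_monotone_0_pi_le) auto
   then have c: "cos \<psi> <= cos \<phi>" by simp
   have re: "cos \<psi> * cmod (rcis r \<phi>) <= Re (rcis r \<phi>)" using mult_right_mono[OF c, of r] r by (simp add: mult.commute)
   have "cmod (?F (rcis r \<phi>)) <= M * exp (p * 0) * exp (- \<eta> * cmod (rcis r \<phi>))"
    unfolding \<eta>_def by (rule exp_bounded_on_ray[OF re less_imp_le[OF p0] bd]) (use sec' that in auto)
   also have "\<dots> = M * exp (- \<eta> * r)" using r by simp
   also have "\<dots> <= M * (C * mp 1 r)" by (intro mult_left_mono C r M0)
   finally show ?thesis by (simp add: mult.assoc)
  qed
  have os: "open (sector \<xi>)" using \<psi> \<xi> by (intro open_sector) auto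
  have *: "integral {0<..} (%r. ?F (rcis r \<xi>1) * cis \<xi>1) = integral {0<..} (%r. ?F (rcis r \<xi>2) * cis \<xi>2)"
   if "- \<psi> <= \<xi>1" "\<xi>1 <= \<xi>2" "\<xi>2 <= \<psi>" for \<xi>1 \<xi>2
   by (rule ray_rotate[OF that(2) F os, where u=1 and C="M * C"]) (use sec' Fb that in auto)
  have "integral {0<..} (%r. ?F (rcis r \<xi>') * cis \<xi>') = integral {0<..} (%r. ?F (rcis r 0) * cis 0)"
   using th *[of 0 \<psi>] *[of "-\<psi>" 0] \<psi> by auto
  then show ?thesis by (simp add: rcis_def mult.commute)
 qed
qed

lemma convex_open_halfplane: "convex {z. b < Re (c * z)}" "open {z. b < Re (c * z)}"
proof -
 have "{z. b < Re (c * z)} = {z. cnj c \<bullet> z > b}" by (auto simp: inner_complex_def)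
 then show "convex {z. b < Re (c * z)}" "open {z. b < Re (c * z)}"
  by (auto simp: convex_halfspace_gt open_halfspace_gt)
qed

text \<open>\<open>E + Q - R\<close> is constant on a convex region that joins the real point l to
  the point at height \<open>sg * Y\<close>: its derivative is \<open>exp (p * t)\<close> times the
  defect between \<open>\<rho> - \<upsilon>\<close> and the ray transform, which vanishes by
  analytic continuation from large real p. For sg = 1 the ray below the axis is taken, since its
  half-plane reaches to the left at large positive heights.\<close>

lemma half_contour:
 assumes hol: "f holomorphic_on sector \<xi>" and \<xi>: "\<xi> <= pi"
  and bd: "!!z. z \<in> sector \<xi> ==> cmod (f z) <= M * exp (w * cmod z)" and w: "w \<ge> 0"
  and \<psi>: "0 < \<psi>" "\<psi> < \<xi>" "\<psi> < pi / 2" and sg: "sg = 1 \<or> sg = (-1::real)" and t: "t > 0"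
  and \<kappa>: "0 < \<kappa>" "\<kappa> <= 1/4" and Y: "w + 2 <= Y * sin \<psi>"
  and \<Omega>: "!!z. \<bar>Im z\<bar> < Y + 1 ==> Re z > 0 \<or> \<bar>Im z\<bar> > 1/2 \<and> Re z > - 2 * \<kappa> ==> z \<in> \<Omega>"
  and \<rho>: "\<rho> holomorphic_on \<Omega>" and \<upsilon>: "\<upsilon> holomorphic_on {z. Re z > - 2 * \<kappa>}"
  and Q: "!!z. z \<in> \<Omega> ==> (Q has_field_derivative exp (z * of_real t) * \<rho> z) (at z)"
  and R: "!!z. Re z > - 2 * \<kappa> ==> (R has_field_derivative exp (z * of_real t) * \<upsilon> z) (at z)"
  and eq: "!!p. p > l0 ==> integral {0<..} (%r. exp (- of_real p * of_real r) * f (of_real r)) = \<rho> (of_real p) - \<upsilon> (of_real p)"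
  and E: "!!p. E p = integral {0<..} (%r. f (rcis r (- sg * \<psi>)) / (rcis r (- sg * \<psi>) - of_real t) *
   exp (p * (of_real t - rcis r (- sg * \<psi>))) * cis (- sg * \<psi>))"
  and l: "l > l0" "w < l * cos \<psi>" "l > 1/2"
 shows "E (of_real l) + Q (of_real l) - R (of_real l) =
  E (Complex (-\<kappa>) (sg * Y)) + Q (Complex (-\<kappa>) (sg * Y)) - R (Complex (-\<kappa>) (sg * Y))"
proof -
 define \<xi>' where "\<xi>' = - sg * \<psi>"
 have th: "\<xi>' = \<psi> \<or> \<xi>' = - \<psi>" using sg by (auto simp: \<xi>'_def)
 note RL = ray_laplace[OF hol \<xi> bd w \<psi> th]
 have cp: "cos \<psi> > 0" "cos \<psi> <= 1" using \<psi> by (auto intro: cos_gt_zero)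
 have sp: "sin \<psi> > 0" "sin \<psi> <= 1" using \<psi> by (auto intro: sin_gt_zero)
 have Y2: "Y \<ge> 2"
 proof -
  have "0 < Y * sin \<psi>" using Y w by linarith
  then have "Y > 0" using sp by (simp add: zero_less_mult_iff)
  then have "Y * sin \<psi> <= Y * 1" using sp by (intro mult_left_mono) auto
  then show ?thesis using Y w by linarith
 qed
 have ct: "Re (p * cis \<xi>') = Re p * cos \<psi> + sg * Im p * sin \<psi>" for p
  using sg by (auto simp: \<xi>'_def)
 \<comment> \<open>An intersection of half-planes, hence convex. The second one,
   \<open>Re z + sg * Im z > 1/2\<close>, keeps D away from the origin and forces
   \<open>\<bar>Im z\<bar> > 1/2\<close> where \<open>Re z <= 0\<close>, so that D lies in
   \<Omega>.\<close>
 define D where "D = {z. w < Re (cis \<xi>' * z)} \<inter> {z. 1/2 < Re (Complex 1 (- sg) * z)} \<inter> {z. - 2 * \<kappa> < Re (1 * z)}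
  \<inter> {z. - (Y + 1) < Re (\<i> * z)} \<inter> {z. - (Y + 1) < Re (- \<i> * z)}"
 have oD: "open D" and cD: "convex D" unfolding D_def by (intro open_Int convex_Int convex_open_halfplane)+
 have memD: "z \<in> D \<longleftrightarrow> w < Re (z * cis \<xi>') \<and> 1/2 < Re z + sg * Im z \<and> - 2 * \<kappa> < Re z \<and> \<bar>Im z\<bar> < Y + 1" for z
  by (auto simp: D_def mult.commute)
 have D\<Omega>: "z \<in> \<Omega>" if "z \<in> D" for z
 proof (rule \<Omega>)
  show "\<bar>Im z\<bar> < Y + 1" using that memD by simp
  have "sg * Im z <= \<bar>Im z\<bar>" using sg by auto
  then show "Re z > 0 \<or> \<bar>Im z\<bar> > 1/2 \<and> Re z > - 2 * \<kappa>" using that memD[of z] by auto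
 qed
 have lD: "complex_of_real x \<in> D" if "x \<ge> l" for x
 proof -
  have "l * cos \<psi> <= x * cos \<psi>" using that cp by (intro mult_right_mono) auto
  then show ?thesis using l that \<kappa> Y2 unfolding memD ct by simp
 qed
 let ?p = "Complex (-\<kappa>) (sg * Y)"
 have pD: "?p \<in> D"
 proof -
  have "\<kappa> * cos \<psi> <= 1/4 * 1" using \<kappa> cp by (intro mult_mono) auto
  moreover have "sg * (sg * Y) = Y" "\<bar>sg * Y\<bar> = Y" using sg Y2 by auto
  ultimately show ?thesis unfolding memD ct using \<kappa> Y2 Y by (simp flip: mult.assoc)
 qed
 define S where "S = (%p. integral {0<..} (%r. f (rcis r \<xi>') * exp (- p * rcis r \<xi>') * cis \<xi>'))"
 \<comment> \<open>Identity theorem: at the real points beyond l the equality is known, as the ray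
   can be rotated to the positive axis there.\<close>
 have z: "S p - (\<rho> p - \<upsilon> p) = 0" if p: "p \<in> D" for p
 proof (rule analytic_continuation[where S=D and U="complex_of_real ` {l<..}" and \<xi>="of_real (l + 1)" and f="%p. S p - (\<rho> p - \<upsilon> p)"])
  show "(%p. S p - (\<rho> p - \<upsilon> p)) holomorphic_on D"
   unfolding S_def
   by (intro holomorphic_intros holomorphic_on_subset[OF RL(2)] holomorphic_on_subset[OF \<rho>] holomorphic_on_subset[OF \<upsilon>])
    (use memD D\<Omega> in auto)
  show "complex_of_real ` {l<..} \<subseteq> D" using lD by auto
  show "complex_of_real (l + 1) \<in> D" using lD[of "l+1"] by simp
  show "complex_of_real (l + 1) islimpt complex_of_real ` {l<..}"
   unfolding islimpt_approachable
  proof (intro allI impI)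
   fix e :: real assume "e > 0"
   then show "\<exists>x'\<in>complex_of_real ` {l<..}. x' ~= complex_of_real (l + 1) \<and> dist x' (complex_of_real (l + 1)) < e"
    by (intro bexI[of _ "complex_of_real (l + 1 + e / 2)"]) (auto simp: dist_norm simp flip: of_real_add of_real_diff)
  qed
  fix x assume "x \<in> complex_of_real ` {l<..}"
  then obtain y where y: "x = of_real y" "y > l" by auto
  have "l * cos \<psi> <= y * cos \<psi>" using y cp by (intro mult_right_mono) auto
  then have yw: "w < y * cos \<psi>" using l by linarith
  have "integral {0<..} (%r. f (rcis r \<xi>') * exp (- of_real y * rcis r \<xi>') * cis \<xi>')
   = integral {0<..} (%r. exp (- of_real y * of_real r) * f (of_real r))"
   by (rule RL(4)[OF _ yw])
  with eq[of y] y l show "S x - (\<rho> x - \<upsilon> x) = 0" by (simp add: S_def)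
 qed (use oD cD p convex_connected in auto)
 have "\<exists>c. \<forall>x\<in>D. E x + Q x - R x = c"
 proof (rule has_field_derivative_zero_constant[OF cD])
  fix p assume p: "p \<in> D"
  have "(E has_field_derivative - (exp (p * of_real t) * S p)) (at p)"
   unfolding E S_def \<xi>'_def[symmetric] using RL(1)[OF _ _ t, of p] memD p by blast
  moreover have "(Q has_field_derivative exp (p * of_real t) * \<rho> p) (at p)" using Q D\<Omega> p by blast
  moreover have "(R has_field_derivative exp (p * of_real t) * \<upsilon> p) (at p)" using R memD p by blast
  ultimately have "((%x. E x + Q x - R x) has_field_derivative
   - (exp (p * of_real t) * S p) + exp (p * of_real t) * \<rho> p - exp (p * of_real t) * \<upsilon> p) (at p)"
   by (intro derivative_intros)
  moreover have "- (exp (p * of_real t) * S p) + exp (p * of_real t) * \<rho> p - exp (p * of_real t) * \<upsilon> p = 0"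
  proof -
   have "\<rho> p = S p + \<upsilon> p" using z[OF p] by (simp add: algebra_simps)
   then show ?thesis by (simp add: distrib_left)
  qed
  ultimately show "((%x. E x + Q x - R x) has_field_derivative 0) (at p within D)"
   using DERIV_subset by fastforce
 qed
 then obtain c where "\<forall>x\<in>D. E x + Q x - R x = c" by blast
 then show ?thesis using pD lD[OF order_refl] by simp
qed

section \<open>The path near the imaginary axis\<close>

definition Lg :: "real => real" where "Lg y = ln (2 + 1 / y)"

text \<open>The curve of the contour is \<open>Re z = - hc c \<alpha> a \<bar>Im z\<bar>\<close>.
  Above height 1/2 the minimum makes it vertical; there a bound on a compact part of the imaginary
  axis replaces the estimate near the origin.\<close>

definition hc :: "real => real => real => real => real" where
 "hc c \<alpha> a y = c * min y (1/2) powr \<alpha> * Lg (min y (1/2)) powr (- a)"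

text \<open>The factor 2 leaves the curve, apart from its end 0, in the interior of the
  region.\<close>

definition Om :: "real => real => real => real => complex set" where
 "Om c \<alpha> a Z = {z. \<bar>Im z\<bar> < Z \<and> - 2 * hc c \<alpha> a \<bar>Im z\<bar> < Re z}"

lemma Lg_ge_one: "0 < y ==> y <= 1 ==> 1 <= Lg y"
proof -
 assume y: "0 < y" "y <= 1"
 have "exp 1 <= (3::real)" by (rule exp_le)
 also have "3 <= 2 + 1 / y" using y by (simp add: field_simps)
 finally show ?thesis using y unfolding Lg_def by (subst ln_ge_iff) (auto intro: add_pos_pos)
qed

lemma Lg_pos: assumes "0 < y" shows "0 < Lg y"
proof -
 have "0 < 1 / y" using assms by simp
 then show ?thesis unfolding Lg_def by (intro ln_gt_zero) linarith
qed

lemma Lg_antimono: "0 < x ==> x <= y ==> Lg y <= Lg x"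
 unfolding Lg_def by (subst ln_le_cancel_iff) (auto intro!: add_pos_pos divide_left_mono)

lemma Lg_scale:
 assumes "0 < v" "v <= 1" "0 < y" shows "Lg (v * y) <= Lg y - ln v"
proof -
 have "2 + 1 / (v * y) <= (2 + 1 / y) / v" using assms by (simp add: field_simps)
 then have "Lg (v * y) <= ln ((2 + 1 / y) / v)"
  unfolding Lg_def using assms by (subst ln_le_cancel_iff) (auto intro!: add_pos_pos divide_pos_pos)
 also have "\<dots> = Lg y - ln v"
 proof -
  have "2 + 1 / y > 0" using assms by (intro add_pos_pos) auto
  then show ?thesis unfolding Lg_def using assms by (subst ln_div) auto
 qed
 finally show ?thesis .
qed

lemma Lg_half: "0 < y ==> y <= 1 ==> Lg (y / 2) <= 2 * Lg y"
 using Lg_scale[of "1/2" y] Lg_ge_one[of y] ln_le_minus_one[of "2::real"] by (simp add: ln_div)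

lemma powr_le_doubling:
 fixes y u b :: real
 assumes "0 < y" "y / 2 <= u" "u <= 2 * y"
 shows "u powr b <= 2 powr \<bar>b\<bar> * y powr b"
proof (cases "b \<ge> 0")
 case True
 have "u powr b <= (2 * y) powr b" using assms True by (intro powr_mono2) auto
 then show ?thesis using True assms by (simp add: powr_mult)
next
 case False
 have "u powr b <= (y / 2) powr b" using assms False by (intro powr_mono2') auto
 then show ?thesis using False assms by (simp add: powr_divide powr_minus_divide)
qed

context
 fixes c \<alpha> a :: real
 assumes c: "c > 0" and \<alpha>: "\<alpha> \<ge> 1" and a: "a > 0"
begin

lemma hc_pos: "y > 0 ==> hc c \<alpha> a y > 0"
 unfolding hc_def using c Lg_pos[of "min y (1/2)"] by (intro mult_pos_pos) auto

lemma hc_nonneg: "hc c \<alpha> a y \<ge> 0"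
 unfolding hc_def using c by (intro mult_nonneg_nonneg) auto

lemma hc_0: "hc c \<alpha> a 0 = 0"
 by (simp add: hc_def)

lemma hc_mono_aux:
 assumes "0 < x" "x <= y" shows "c * x powr \<alpha> * Lg x powr (- a) <= c * y powr \<alpha> * Lg y powr (- a)"
proof (intro mult_mono mult_left_mono)
 show "x powr \<alpha> <= y powr \<alpha>" using assms \<alpha> by (intro powr_mono2) auto
 show "Lg x powr - a <= Lg y powr - a" using assms a Lg_antimono Lg_pos by (intro powr_mono2') auto
qed (use c in auto)

lemma hc_mono: "0 <= x ==> x <= y ==> hc c \<alpha> a x <= hc c \<alpha> a y"
proof (cases "x = 0")
 case False
 assume "0 <= x" "x <= y"
 then have "0 < min x (1/2)" "min x (1/2) <= min y (1/2)" using False by (auto simp: min_def)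
 from hc_mono_aux[OF this] show ?thesis by (simp only: hc_def)
qed (simp add: hc_0 hc_nonneg)

lemma hc_le: "y > 0 ==> hc c \<alpha> a y <= c * y powr \<alpha> * Lg y powr (- a)"
 unfolding hc_def by (rule hc_mono_aux) auto

lemma hc_le_linear:
 assumes "y > 0" shows "hc c \<alpha> a y <= c * y"
proof -
 define m where "m = min y (1/2)"
 have m: "0 < m" "m <= y" "m <= 1" using assms by (auto simp: m_def)
 have "m powr \<alpha> <= m powr 1" using m \<alpha> by (intro powr_mono') auto
 moreover have "Lg m powr (- a) <= 1" using Lg_ge_one[of m] m a by (simp add: powr_minus_divide ge_one_powr_ge_zero)
 ultimately have "m powr \<alpha> * Lg m powr (- a) <= m * 1" using m by (intro mult_mono) auto
 also have "m * 1 <= y" using m by simp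
 finally show ?thesis using c unfolding hc_def m_def[symmetric] by (simp add: mult.assoc mult_left_mono)
qed

text \<open>Convex-type scaling, which replaces a Lipschitz bound in the proof that \<open>Om\<close> is starlike.\<close>

lemma hc_scale:
 assumes v: "0 <= v" "v <= 1" and y: "y \<ge> 0" and N: "\<alpha> + a <= real N"
 shows "v ^ N * hc c \<alpha> a y <= hc c \<alpha> a (v * y)"
proof (cases "y = 0 \<or> v = 0")
 case True
 have "N > 0" using N \<alpha> a by (cases N) auto
 then show ?thesis using True hc_0 hc_nonneg by (auto simp: zero_power)
next
 case False
 then have y: "y > 0" and v: "0 < v" "v <= 1" using y v by auto
 define m where "m = min y (1/2)"
 have m: "0 < m" "m <= 1" using y by (auto simp: m_def)
 have vm: "v * m <= min (v * y) (1/2)" "0 < v * m"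
  using v m mult_mono[of v 1 m "1/2"] by (auto simp: m_def min_def)
 \<comment> \<open>Scaling by v costs the logarithm at most a factor 1 / v; this adds a to the
   exponent \<alpha>.\<close>
 have "Lg (v * m) <= Lg m - ln v" by (rule Lg_scale[OF v m(1)])
 also have "\<dots> <= Lg m * (1 - ln v)"
  using mult_right_mono[OF Lg_ge_one[OF m], of "- ln v"] v by (simp add: algebra_simps)
 also have "\<dots> <= Lg m * (1 / v)"
  using ln_le_minus_one[of "1 / v"] v Lg_pos[OF m(1)] by (intro mult_left_mono) (auto simp: ln_div)
 finally have L: "Lg (v * m) <= Lg m / v" by simp
 have "v ^ N = v powr real N" using v by (simp add: powr_realpow)
 also have "\<dots> <= v powr (\<alpha> + a)" using v N by (intro powr_mono') auto
 finally have "v ^ N * hc c \<alpha> a y <= v powr (\<alpha> + a) * hc c \<alpha> a y" by (intro mult_right_mono hc_nonneg)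
 also have "\<dots> = c * (v * m) powr \<alpha> * (Lg m / v) powr (- a)"
  using v m Lg_pos[OF m(1)] unfolding hc_def m_def[symmetric]
  by (simp add: powr_mult powr_divide powr_minus_divide powr_add)
 also have "\<dots> <= c * (v * m) powr \<alpha> * Lg (v * m) powr (- a)"
  using L a Lg_pos[OF vm(2)] c by (intro mult_left_mono powr_mono2') auto
 also have "\<dots> <= hc c \<alpha> a (v * y)"
  unfolding hc_def by (rule hc_mono_aux[OF vm(2,1)])
 finally show ?thesis .
qed

text \<open>\<open>Lg\<close> is singular at height 0, so the region is split into the right
  half-strip, where the inequality on the real part is automatic, and the part off the real axis,
  where \<open>hc\<close> is continuous.\<close>

lemma open_Om: "open (Om c \<alpha> a Z)"
proof -
 define S where "S = {z. \<bar>Im z\<bar> < Z} \<inter> - {z. Im z = 0}"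
 have o1: "open {z. \<bar>Im z\<bar> < Z}" by (intro open_Collect_less continuous_intros)
 have oS: "open S" unfolding S_def
  by (intro open_Int o1 open_Compl closed_Collect_eq continuous_intros)
 have "continuous_on S (%z. Re z + 2 * hc c \<alpha> a \<bar>Im z\<bar>)"
  unfolding hc_def Lg_def
 proof (intro continuous_intros ballI)
  fix z assume "z \<in> S"
  then have p: "min \<bar>Im z\<bar> (1/2) > 0" by (auto simp: S_def)
  then show "min \<bar>Im z\<bar> (1/2) ~= 0" "min \<bar>Im z\<bar> (1/2) ~= 0" by linarith+
  have "0 < 1 / min \<bar>Im z\<bar> (1/2)" using p by (intro divide_pos_pos) auto
  moreover have "2 + x ~= 0" if "0 < x" for x :: real using that by simp
  ultimately show "2 + 1 / min \<bar>Im z\<bar> (1/2) ~= 0" by blast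
  show "ln (2 + 1 / min \<bar>Im z\<bar> (1/2)) ~= 0" using Lg_pos[OF p] by (simp only: Lg_def)
 qed
 from continuous_open_preimage[OF this oS open_greaterThan[of 0]]
 have "open (({z. \<bar>Im z\<bar> < Z} \<inter> {z. 0 < Re z}) \<union> (S \<inter> (%z. Re z + 2 * hc c \<alpha> a \<bar>Im z\<bar>) -` {0<..}))"
  by (rule open_Un[OF open_Int[OF o1 open_halfspace_Re_gt]])
 also have "\<dots> = Om c \<alpha> a Z"
 proof (intro set_eqI)
  fix z
  show "z \<in> ({z. \<bar>Im z\<bar> < Z} \<inter> {z. 0 < Re z}) \<union> (S \<inter> (%z. Re z + 2 * hc c \<alpha> a \<bar>Im z\<bar>) -` {0<..}) \<longleftrightarrow> z \<in> Om c \<alpha> a Z"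
   using hc_nonneg[of "\<bar>Im z\<bar>"] by (cases "Im z = 0") (auto simp: Om_def S_def hc_0)
 qed
 finally show ?thesis .
qed

text \<open>The centre b is far out on the positive axis. Moving a point x towards it shrinks the
  height to \<open>u * \<bar>Im x\<bar>\<close>; by \<open>hc_scale\<close> this keeps at least the
  fraction \<open>u ^ N\<close> of \<open>hc\<close>, and Bernoulli's inequality bounds the loss by
  \<open>N * (1 - u)\<close>, which the shift \<open>(1 - u) * b\<close> to the right
  outweighs.\<close>

lemma starlike_Om:
 assumes "Z > 0" shows "starlike (Om c \<alpha> a Z)"
proof -
 obtain N :: nat where N: "\<alpha> + a <= real N" using real_arch_simple by blast
 define \<kappa> where "\<kappa> = hc c \<alpha> a (1/2)"
 \<comment> \<open>The term with N pays for Bernoulli's inequality, and the added 1 makes the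
   resulting inequality strict.\<close>
 define b where "b = 2 * real N * \<kappa> + 1"
 have k: "\<kappa> \<ge> 0" unfolding \<kappa>_def by (rule hc_nonneg)
 have hk: "hc c \<alpha> a y <= \<kappa>" if "y \<ge> 0" for y
 proof (cases "y <= 1/2")
  case True then show ?thesis unfolding \<kappa>_def using that by (intro hc_mono) auto
 next
  case False then show ?thesis by (simp add: \<kappa>_def hc_def)
 qed
 have b: "b > 0" using k by (simp add: b_def add_nonneg_pos)
 show ?thesis unfolding starlike_def
 proof (intro bexI[of _ "complex_of_real b"] ballI subsetI)
  show "complex_of_real b \<in> Om c \<alpha> a Z" using assms b by (simp add: Om_def hc_0)
  fix x z assume x: "x \<in> Om c \<alpha> a Z" and "z \<in> closed_segment (complex_of_real b) x"
  then obtain u where u: "0 <= u" "u <= 1" "z = (1 - u) *\<^sub>R complex_of_real b + u *\<^sub>R x" by (auto simp: in_segment)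
  have Re: "Re z = (1 - u) * b + u * Re x" and Im: "\<bar>Im z\<bar> = u * \<bar>Im x\<bar>" using u by (auto simp: abs_mult)
  let ?y = "\<bar>Im x\<bar>"
  have Bern: "1 - real N * (1 - u) <= u ^ N" using Bernoulli_inequality[of "u - 1" N] u by (simp add: algebra_simps)
  have "u * ?y <= 1 * ?y" using u by (intro mult_right_mono) auto
  then have "\<bar>Im z\<bar> < Z" using x by (simp add: Im Om_def)
  moreover have "- 2 * hc c \<alpha> a \<bar>Im z\<bar> < Re z"
  proof (cases "u = 1")
   case True then show ?thesis using u x by (simp add: Om_def)
  next
   case False
   then have u1: "1 - u > 0" using u by simp
   have "u ^ N * hc c \<alpha> a ?y <= hc c \<alpha> a \<bar>Im z\<bar>" unfolding Im using u N by (intro hc_scale) auto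
   moreover have "(1 - real N * (1 - u)) * hc c \<alpha> a ?y <= u ^ N * hc c \<alpha> a ?y" by (rule mult_right_mono[OF Bern hc_nonneg])
   moreover have "(1 - u) * (real N * hc c \<alpha> a ?y) <= (1 - u) * (real N * \<kappa>)"
    using u1 by (intro mult_left_mono hk) auto
   moreover have "u * (- 2 * hc c \<alpha> a ?y) <= u * Re x" using x u by (intro mult_left_mono) (auto simp: Om_def)
   moreover have "u * hc c \<alpha> a ?y <= 1 * hc c \<alpha> a ?y" using u hc_nonneg by (intro mult_right_mono) auto
   moreover have "(1 - u) * b = 2 * ((1 - u) * (real N * \<kappa>)) + (1 - u)" by (simp add: b_def algebra_simps)
   ultimately show ?thesis unfolding Re using u1 by (simp add: algebra_simps)
  qed
  ultimately show "z \<in> Om c \<alpha> a Z" by (simp add: Om_def)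
 qed
qed

lemma Om_primitive:
 assumes "Z > 0" "g holomorphic_on Om c \<alpha> a Z"
 obtains G where "!!z. z \<in> Om c \<alpha> a Z ==> (G has_field_derivative g z) (at z)"
proof -
 have "\<exists>G. \<forall>z\<in>Om c \<alpha> a Z. (G has_field_derivative g z) (at z)"
  by (rule holomorphic_starlike_primitive[where k="{}"])
   (use assms starlike_Om open_Om in \<open>auto simp: holomorphic_on_open field_differentiable_def holomorphic_on_imp_continuous_on\<close>)
 then show thesis using that by blast
qed

text \<open>The product rule gives two terms, at most \<alpha> and a up to the factor c:
  \<open>y^(\<alpha> - 1)\<close> and negative powers of \<open>Lg y\<close> do not exceed 1, and
  the derivative of the logarithm is at most \<open>1 / y\<close>, paid by one power of y. The
  result bounds the speed of the parametrised contour.\<close>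

lemma hc_curve_derivative:
 assumes y: "0 < y" "y < 1/2"
 obtains h' where "(hc c \<alpha> a has_real_derivative h') (at y)" "\<bar>h'\<bar> <= c * (\<alpha> + a)"
proof -
 let ?h = "%y. c * (y powr \<alpha> * Lg y powr (- a))"
 have L: "Lg y \<ge> 1" using y by (intro Lg_ge_one) auto
 have d1: "((%y. y powr \<alpha>) has_real_derivative \<alpha> * y powr (\<alpha> - 1)) (at y)" by (rule has_real_derivative_powr[OF y(1)])
 have "((%y. 2 + 1 / y) has_real_derivative - (1 / y\<^sup>2)) (at y)"
  using y by (auto intro!: derivative_eq_intros simp: power2_eq_square)
 from DERIV_chain2[OF DERIV_ln_divide this] y
 have "(Lg has_real_derivative 1 / (2 + 1 / y) * - (1 / y\<^sup>2)) (at y)"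
  unfolding Lg_def[abs_def] by (simp add: add_pos_pos)
 moreover have "1 / (2 + 1 / y) * - (1 / y\<^sup>2) = - (1 / (2 * y\<^sup>2 + y))"
  using y by (simp add: power2_eq_square distrib_right)
 ultimately have d2: "(Lg has_real_derivative - (1 / (2 * y\<^sup>2 + y))) (at y)" by simp
 have d3: "((%y. Lg y powr (- a)) has_real_derivative (- a) * Lg y powr (- a - of_nat 1) * (- (1 / (2 * y\<^sup>2 + y)))) (at y)"
  by (rule DERIV_fun_powr[OF d2]) (use L in simp)
 let ?d = "c * (\<alpha> * y powr (\<alpha> - 1) * Lg y powr (- a) + (- a) * Lg y powr (- a - of_nat 1) * (- (1 / (2 * y\<^sup>2 + y))) * y powr \<alpha>)"
 have "(?h has_real_derivative ?d) (at y)" by (rule DERIV_cmult[OF DERIV_mult[OF d1 d3]])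
 moreover have "\<forall>\<^sub>F x in nhds y. x \<in> {0<..<1/2}" using y by (intro eventually_nhds_in_open) auto
 then have "\<forall>\<^sub>F x in nhds y. hc c \<alpha> a x = ?h x" by eventually_elim (auto simp: hc_def min_def)
 ultimately have D: "(hc c \<alpha> a has_real_derivative ?d) (at y)" by (subst DERIV_cong_ev[OF refl _ refl])
 have p1: "Lg y powr (- a) <= 1" "Lg y powr (- a - of_nat 1) <= 1"
  using L a powr_mono[of "-a" 0 "Lg y"] powr_mono[of "-a-1" 0 "Lg y"] by auto
 have p2: "y powr (\<alpha> - 1) <= 1" using powr_mono2[of "\<alpha>-1" y 1] y \<alpha> by simp
 have "1 / (2 * y\<^sup>2 + y) * y powr \<alpha> <= 1 / y * y powr \<alpha>" using y by (intro mult_right_mono divide_left_mono) (auto intro!: mult_pos_pos add_pos_pos)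
 also have "\<dots> = y powr (\<alpha> - 1)" using y by (simp add: powr_diff)
 finally have p3: "1 / (2 * y\<^sup>2 + y) * y powr \<alpha> <= 1" using p2 by linarith
 have "\<alpha> * y powr (\<alpha> - 1) * Lg y powr (- a) <= \<alpha> * 1 * 1" using p1 p2 \<alpha> by (intro mult_mono) auto
 moreover have "a * Lg y powr (- a - of_nat 1) * (1 / (2 * y\<^sup>2 + y) * y powr \<alpha>) <= a * 1 * 1"
  using p1(2) p3 a y by (intro mult_mono) auto
 moreover have "0 <= \<alpha> * y powr (\<alpha> - 1) * Lg y powr (- a)" "0 <= a * Lg y powr (- a - of_nat 1) * (1 / (2 * y\<^sup>2 + y) * y powr \<alpha>)"
  using \<alpha> a y by (intro mult_nonneg_nonneg divide_nonneg_nonneg add_nonneg_nonneg; simp)+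
 ultimately have "\<bar>\<alpha> * y powr (\<alpha> - 1) * Lg y powr (- a) + a * Lg y powr (- a - of_nat 1) * (1 / (2 * y\<^sup>2 + y) * y powr \<alpha>)\<bar> <= \<alpha> + a" by linarith
 then have "c * \<bar>\<alpha> * y powr (\<alpha> - 1) * Lg y powr (- a) + a * Lg y powr (- a - of_nat 1) * (1 / (2 * y\<^sup>2 + y) * y powr \<alpha>)\<bar> <= c * (\<alpha> + a)"
  using c by (intro mult_left_mono) auto
 moreover have "?d = c * (\<alpha> * y powr (\<alpha> - 1) * Lg y powr (- a) + a * Lg y powr (- a - of_nat 1) * (1 / (2 * y\<^sup>2 + y) * y powr \<alpha>))" by simp
 ultimately have "\<bar>?d\<bar> <= c * (\<alpha> + a)" using c by (simp only: abs_mult abs_of_pos)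
 with D show thesis by (rule that)
qed

text \<open>First the curve from height \<delta> to 1/2, then the segments at scale \<delta> around
  the origin. On the curve exponential decay is traded for \<open>(h * t)^(-m)\<close>; on the
  segments \<open>exp (Re z * t)\<close> is bounded and the length is at most
  \<open>2 * \<delta>\<close>.\<close>

lemma half_path:
 fixes sg :: real
 assumes ac: "c <= 1/2" and \<sigma>: "\<sigma> > \<alpha> - 1" and m: "m = (\<sigma> + 1) / \<alpha> - 1" and t: "t \<ge> 1" and K: "K \<ge> 0"
  and Z: "Z > 1/2" and sg: "sg = 1 \<or> sg = -1"
  and D: "!!z. z \<in> Om c \<alpha> a Z ==> Re z <= 1/2 ==> (G has_field_derivative g z) (at z)"
  and bd: "!!z y. z \<in> Om c \<alpha> a Z ==> Re z <= 1/2 ==> 0 < y ==> y <= cmod z ==> cmod z <= 2 * y ==> y <= 1/2 ==>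
   cmod (g z) <= exp (Re z * t) * (K * (y powr (\<sigma> - \<alpha>) * Lg y powr a))"
  and Km: "!!s. s > 0 ==> exp (- s) <= Km * s powr (- m)"
  and \<delta>: "\<delta> = 1 / (2 * t)"
 shows "cmod (G (Complex (- hc c \<alpha> a (1/2)) (sg * (1/2))) - G (Complex (- hc c \<alpha> a \<delta>) (sg * \<delta>)))
   <= K * Km * (1 + c * (\<alpha> + a)) * c powr (- m) * t powr (- m) * Lg \<delta> powr (a * (m + 1)) * ln t"
  and "!!z w. Re z \<in> {- hc c \<alpha> a \<delta>..\<delta>} ==> Re w \<in> {- hc c \<alpha> a \<delta>..\<delta>} ==> Im z = sg * \<delta> ==> Im w = sg * \<delta> ==>
   cmod (G z - G w) <= 6 * K * t powr (- m) * Lg \<delta> powr (a * (m + 1))"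
  and "cmod (G (Complex \<delta> \<delta>) - G (Complex \<delta> (- \<delta>))) <= 6 * K * t powr (- m) * Lg \<delta> powr (a * (m + 1))"
proof -
 have d: "0 < \<delta>" "\<delta> <= 1/2" "\<delta> <= 1 / t" using t by (auto simp: \<delta> field_simps)
 have m0: "m > 0" using \<sigma> \<alpha> by (simp add: m field_simps)
 \<comment> \<open>The relation that collects the powers of y on the curve into
   \<open>1 / y\<close>.\<close>
 have am: "\<alpha> * m = \<sigma> + 1 - \<alpha>" using \<alpha> by (simp add: m field_simps)
 have L1: "Lg \<delta> \<ge> 1" using d by (intro Lg_ge_one) auto
 have Km0: "Km \<ge> 0" using Km[of 1] exp_ge_zero[of "-1"] by (simp del: exp_ge_zero)
 define \<gamma> where "\<gamma> = (%y. Complex (- hc c \<alpha> a y) (sg * y))"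
 define \<Lambda> where "\<Lambda> = 1 + c * (\<alpha> + a)"
 have \<Lambda>: "\<Lambda> > 0" using c \<alpha> a by (simp add: \<Lambda>_def add_pos_pos)
 define B where "B = K * Km * \<Lambda> * c powr (- m) * t powr (- m) * Lg \<delta> powr (a * (m + 1))"
 have B0: "B \<ge> 0" unfolding B_def using K Km0 \<Lambda> by (intro mult_nonneg_nonneg) auto
 have \<gamma>\<Omega>: "\<gamma> y \<in> Om c \<alpha> a Z" if "0 < y" "y <= 1/2" for y
  using that sg Z hc_pos[of y] by (auto simp: \<gamma>_def Om_def)
 have \<gamma>re: "Re (\<gamma> y) <= 1/2" for y using hc_nonneg[of y] by (simp add: \<gamma>_def)
 have hcont: "continuous_on {\<delta>..1/2} (hc c \<alpha> a)"
 proof -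
  have "continuous_on {\<delta>..1/2} (%y. c * y powr \<alpha> * Lg y powr (- a))"
   unfolding Lg_def
  proof (intro continuous_intros ballI)
   fix y assume y: "y \<in> {\<delta>..1/2}"
   then have p: "y > 0" using d by auto
   have "0 < 1 / y" using p by (intro divide_pos_pos) auto
   then show "2 + 1 / y ~= 0" by linarith
   show "ln (2 + 1 / y) ~= 0" using Lg_pos[OF p] by (simp only: Lg_def)
  qed (use d in auto)
  then show ?thesis by (rule continuous_on_eq) (simp add: hc_def min_def)
 qed
 have \<gamma>cont: "continuous_on {\<delta>..1/2} \<gamma>"
  unfolding \<gamma>_def Complex_eq by (intro continuous_intros hcont)
 have Gcont: "continuous_on (Om c \<alpha> a Z \<inter> {z. Re z <= 1/2}) G"
  by (intro continuous_at_imp_continuous_on ballI DERIV_isCont) (use D in blast)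
 \<comment> \<open>The bound B / y for the derivative along the curve compares G with
   \<open>B * ln y\<close>. With \<delta> = 1 / (2 t) the difference of the two logarithms is ln
   t.\<close>
 have "cmod ((G \<circ> \<gamma>) (1/2) - (G \<circ> \<gamma>) \<delta>) <= B * ln (1/2) - B * ln \<delta>"
 proof (cases "\<delta> < 1/2")
  case False
  then have eq: "\<delta> = 1/2" using d by simp
  show ?thesis unfolding eq by simp
 next
  case True
  have "\<exists>f'. \<exists>\<phi>'. \<forall>y. \<delta> < y \<and> y < 1/2 --> ((G \<circ> \<gamma>) has_vector_derivative f' y) (at y) \<and>
   ((%y. B * ln y) has_vector_derivative \<phi>' y) (at y) \<and> norm (f' y) <= \<phi>' y"
  proof -
   have "\<exists>d. ((G \<circ> \<gamma>) has_vector_derivative d) (at y) \<and> norm d <= B / y" if y: "\<delta> < y" "y < 1/2" for y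
   proof -
    have y0: "0 < y" "y < 1/2" using d y by auto
    obtain h' where h': "(hc c \<alpha> a has_real_derivative h') (at y)" "\<bar>h'\<bar> <= c * (\<alpha> + a)"
     using hc_curve_derivative[OF y0] by blast
    have g1: "(\<gamma> has_vector_derivative Complex (- h') sg) (at y)"
     unfolding \<gamma>_def has_vector_derivative_complex_iff
     using h'(1) by (auto intro!: derivative_eq_intros simp: has_real_derivative_iff_has_vector_derivative[symmetric])
    have g2: "(G has_field_derivative g (\<gamma> y)) (at (\<gamma> y))" by (intro D \<gamma>\<Omega> \<gamma>re) (use y0 in auto)
    have D1: "((G \<circ> \<gamma>) has_vector_derivative (Complex (- h') sg * g (\<gamma> y))) (at y)"
     by (rule field_vector_diff_chain_at[OF g1 g2])
    have nh: "cmod (Complex (- h') sg) <= \<Lambda>"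
     using cmod_le[of "Complex (- h') sg"] h'(2) sg by (auto simp: \<Lambda>_def)
    let ?h = "hc c \<alpha> a y"
    have hp: "?h = c * y powr \<alpha> * Lg y powr (- a)" using y0 by (simp add: hc_def min_def)
    have hpos: "?h > 0" by (rule hc_pos[OF y0(1)])
    have Ly: "1 <= Lg y" "Lg y <= Lg \<delta>" using y0 d y by (auto intro: Lg_ge_one Lg_antimono)
    have ny: "y <= cmod (\<gamma> y)" "cmod (\<gamma> y) <= 2 * y"
    proof -
     show "y <= cmod (\<gamma> y)" using abs_Im_le_cmod[of "\<gamma> y"] sg y0 by (auto simp: \<gamma>_def)
     have "?h <= c * y" by (rule hc_le_linear[OF y0(1)])
     also have "\<dots> <= 1 * y" using ac y0 by (intro mult_right_mono) auto
     finally show "cmod (\<gamma> y) <= 2 * y"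
      using cmod_le[of "\<gamma> y"] hpos sg y0 by (auto simp: \<gamma>_def)
    qed
    have "cmod (g (\<gamma> y)) <= exp (- (?h * t)) * (K * (y powr (\<sigma> - \<alpha>) * Lg y powr a))"
     using bd[OF \<gamma>\<Omega> \<gamma>re, of y y] y0 ny by (simp add: \<gamma>_def)
    also have "\<dots> <= (Km * (?h * t) powr (- m)) * (K * (y powr (\<sigma> - \<alpha>) * Lg y powr a))"
     using K hpos t by (intro mult_right_mono Km) auto
    also have "(?h * t) powr (- m) = c powr (- m) * t powr (- m) * (y powr (- (\<alpha> * m)) * Lg y powr (a * m))"
     unfolding hp using c y0 t Ly by (simp add: powr_mult powr_powr)
    also have "Km * (c powr (- m) * t powr (- m) * (y powr (- (\<alpha> * m)) * Lg y powr (a * m))) * (K * (y powr (\<sigma> - \<alpha>) * Lg y powr a))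
     = K * Km * c powr (- m) * t powr (- m) * ((y powr (- (\<alpha> * m)) * y powr (\<sigma> - \<alpha>)) * (Lg y powr (a * m) * Lg y powr a))"
     by (simp add: mult_ac)
    also have "y powr (- (\<alpha> * m)) * y powr (\<sigma> - \<alpha>) = 1 / y"
     using y0 by (simp add: am powr_minus_divide flip: powr_add)
    also have "Lg y powr (a * m) * Lg y powr a = Lg y powr (a * (m + 1))"
     by (simp add: algebra_simps flip: powr_add)
    also have "K * Km * c powr (- m) * t powr (- m) * (1 / y * Lg y powr (a * (m + 1))) <=
     K * Km * c powr (- m) * t powr (- m) * (1 / y * Lg \<delta> powr (a * (m + 1)))"
     using Ly a m0 K Km0 y0 by (intro mult_left_mono powr_mono2 mult_nonneg_nonneg) auto
    finally have gb: "cmod (g (\<gamma> y)) <= K * Km * c powr (- m) * t powr (- m) * (1 / y * Lg \<delta> powr (a * (m + 1)))" .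
    have "cmod (Complex (- h') sg * g (\<gamma> y)) <= \<Lambda> * (K * Km * c powr (- m) * t powr (- m) * (1 / y * Lg \<delta> powr (a * (m + 1))))"
     unfolding norm_mult using \<Lambda> by (intro mult_mono nh gb) auto
    also have "\<dots> = B / y" by (simp add: B_def)
    finally show ?thesis using D1 by blast
   qed
   then obtain f' where f': "!!y. \<delta> < y ==> y < 1/2 ==> ((G \<circ> \<gamma>) has_vector_derivative f' y) (at y) \<and> norm (f' y) <= B / y" by metis
   have "((%y. B * ln y) has_vector_derivative B / y) (at y)" if "\<delta> < y" for y
    using that d by (auto intro!: derivative_eq_intros simp flip: has_real_derivative_iff_has_vector_derivative)
   then show ?thesis using f' by blast
  qed
  then obtain f' \<phi>' where f': "!!y. \<delta> < y ==> y < 1/2 ==> ((G \<circ> \<gamma>) has_vector_derivative f' y) (at y)"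
   "!!y. \<delta> < y ==> y < 1/2 ==> ((%y. B * ln y) has_vector_derivative \<phi>' y) (at y)"
   "!!y. \<delta> < y ==> y < 1/2 ==> norm (f' y) <= \<phi>' y" by blast
  show ?thesis
  proof (rule differentiable_bound_general[OF True _ _ f'])
   show "continuous_on {\<delta>..1/2} (G \<circ> \<gamma>)"
    by (rule continuous_on_compose[OF \<gamma>cont continuous_on_subset[OF Gcont]]) (use \<gamma>\<Omega> \<gamma>re d in auto)
   show "continuous_on {\<delta>..1/2} (%y. B * ln y)" using d by (intro continuous_intros) auto
  qed
 qed
 also have "\<dots> = B * ln t" using t by (simp add: \<delta> ln_div ln_mult algebra_simps)
 finally show "cmod (G (Complex (- hc c \<alpha> a (1/2)) (sg * (1/2))) - G (Complex (- hc c \<alpha> a \<delta>) (sg * \<delta>)))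
   <= K * Km * (1 + c * (\<alpha> + a)) * c powr (- m) * t powr (- m) * Lg \<delta> powr (a * (m + 1)) * ln t"
  by (simp add: \<gamma>_def B_def \<Lambda>_def)
 have hd: "hc c \<alpha> a \<delta> <= \<delta>" "0 < hc c \<alpha> a \<delta>"
 proof -
  have "hc c \<alpha> a \<delta> <= c * \<delta>" by (rule hc_le_linear[OF d(1)])
  also have "\<dots> <= 1 * \<delta>" using ac d by (intro mult_right_mono) auto
  finally show "hc c \<alpha> a \<delta> <= \<delta>" by simp
 qed (rule hc_pos[OF d(1)])
 \<comment> \<open>The horizontal and vertical segments are treated alike. The 6 is 3, a bound for
   e, times the 2 of the length; \<open>\<delta> powr (\<alpha> * m)\<close> is at most
   \<open>t powr (- m)\<close> because \<alpha> is at least 1.\<close>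
 have key: "cmod (G z - G w) <= 6 * K * t powr (- m) * Lg \<delta> powr (a * (m + 1))"
  if S: "closed_segment w z \<subseteq> {x. x \<in> Om c \<alpha> a Z \<and> Re x <= \<delta> \<and> \<delta> <= cmod x \<and> cmod x <= 2 * \<delta>}" and len: "cmod (z - w) <= 2 * \<delta>" for z w
 proof -
  have "cmod (G z - G w) <= (3 * (K * (\<delta> powr (\<sigma> - \<alpha>) * Lg \<delta> powr a))) * cmod (z - w)"
  proof (rule field_differentiable_bound[where S="closed_segment w z" and f'=g])
   fix x assume "x \<in> closed_segment w z"
   then have x: "x \<in> Om c \<alpha> a Z" "Re x <= \<delta>" "\<delta> <= cmod x" "cmod x <= 2 * \<delta>" using S by auto
   have "Re x <= 1/2" using x(2) d(2) by linarith
   then show "(G has_field_derivative g x) (at x within closed_segment w z)"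
    by (rule has_field_derivative_at_within[OF D[OF x(1)]])
   have "Re x * t <= \<delta> * t" using x t by (intro mult_right_mono) auto
   also have "\<dots> <= 1" using t by (simp add: \<delta>)
   finally have "exp (Re x * t) <= exp 1" by simp
   also have "exp 1 <= (3::real)" by (rule exp_le)
   finally have e: "exp (Re x * t) <= 3" .
   have "cmod (g x) <= exp (Re x * t) * (K * (\<delta> powr (\<sigma> - \<alpha>) * Lg \<delta> powr a))"
    using x d by (intro bd) auto
   also have "\<dots> <= 3 * (K * (\<delta> powr (\<sigma> - \<alpha>) * Lg \<delta> powr a))"
    using e K by (intro mult_right_mono mult_nonneg_nonneg) auto
   finally show "cmod (g x) <= 3 * (K * (\<delta> powr (\<sigma> - \<alpha>) * Lg \<delta> powr a))" .
  qed auto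
  also have "\<dots> <= (3 * (K * (\<delta> powr (\<sigma> - \<alpha>) * Lg \<delta> powr a))) * (2 * \<delta>)"
   using K len by (intro mult_left_mono mult_nonneg_nonneg) auto
  also have "\<dots> = 6 * K * (\<delta> powr (\<sigma> - \<alpha>) * \<delta> powr 1) * Lg \<delta> powr a" using d by simp
  also have "\<delta> powr (\<sigma> - \<alpha>) * \<delta> powr 1 = \<delta> powr (\<alpha> * m)"
   unfolding am powr_add[symmetric] by (simp add: algebra_simps)
  also have "6 * K * \<delta> powr (\<alpha> * m) * Lg \<delta> powr a <= 6 * K * t powr (- m) * Lg \<delta> powr (a * (m + 1))"
  proof (intro mult_mono mult_left_mono)
   have "m <= \<alpha> * m" using \<alpha> m0 by simp
   then have "\<delta> powr (\<alpha> * m) <= \<delta> powr m" using d by (intro powr_mono') auto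
   also have "\<dots> <= (1 / t) powr m" using d m0 by (intro powr_mono2) auto
   also have "\<dots> = t powr (- m)" using t by (simp add: powr_divide powr_minus_divide)
   finally show "\<delta> powr (\<alpha> * m) <= t powr (- m)" .
   show "Lg \<delta> powr a <= Lg \<delta> powr (a * (m + 1))" using L1 a m0 by (intro powr_mono) (auto simp: algebra_simps)
  qed (use K in auto)
  finally show ?thesis .
 qed
 show "cmod (G z - G w) <= 6 * K * t powr (- m) * Lg \<delta> powr (a * (m + 1))"
  if "Re z \<in> {- hc c \<alpha> a \<delta>..\<delta>}" "Re w \<in> {- hc c \<alpha> a \<delta>..\<delta>}" "Im z = sg * \<delta>" "Im w = sg * \<delta>" for z w
 proof (rule key)
  have S1: "closed_segment w z \<subseteq> {x. - hc c \<alpha> a \<delta> <= Re x} \<inter> {x. Re x <= \<delta>} \<inter> {x. sg * \<delta> <= Im x} \<inter> {x. Im x <= sg * \<delta>}"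
   by (rule closed_segment_subset) (use that in \<open>auto intro!: convex_Int convex_halfspace_Re_ge convex_halfspace_Re_le convex_halfspace_Im_ge convex_halfspace_Im_le\<close>)
  have S2: "x \<in> Om c \<alpha> a Z \<and> \<delta> <= cmod x \<and> cmod x <= 2 * \<delta>"
   if x: "- hc c \<alpha> a \<delta> <= Re x" "Re x <= \<delta>" "Im x = sg * \<delta>" for x
  proof -
   have i: "\<bar>Im x\<bar> = \<delta>" using x sg d by auto
   have "\<bar>Re x\<bar> <= \<delta>" using x hd by auto
   then show ?thesis using i x hd abs_Im_le_cmod[of x] cmod_le[of x] Z d by (auto simp: Om_def)
  qed
  show "closed_segment w z \<subseteq> {x. x \<in> Om c \<alpha> a Z \<and> Re x <= \<delta> \<and> \<delta> <= cmod x \<and> cmod x <= 2 * \<delta>}"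
  proof
   fix x assume "x \<in> closed_segment w z"
   from subsetD[OF S1 this] have x: "- hc c \<alpha> a \<delta> <= Re x" "Re x <= \<delta>" "Im x = sg * \<delta>" by auto
   from S2[OF this] x(2) show "x \<in> {x. x \<in> Om c \<alpha> a Z \<and> Re x <= \<delta> \<and> \<delta> <= cmod x \<and> cmod x <= 2 * \<delta>}" by simp
  qed
  show "cmod (z - w) <= 2 * \<delta>" using that hd cmod_le[of "z - w"] by auto
 qed
 show "cmod (G (Complex \<delta> \<delta>) - G (Complex \<delta> (- \<delta>))) <= 6 * K * t powr (- m) * Lg \<delta> powr (a * (m + 1))"
 proof (rule key)
  have S1: "closed_segment (Complex \<delta> (- \<delta>)) (Complex \<delta> \<delta>) \<subseteq> {x. Re x <= \<delta>} \<inter> {x. \<delta> <= Re x} \<inter> {x. Im x <= \<delta>} \<inter> {x. - \<delta> <= Im x}"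
   by (rule closed_segment_subset) (use d in \<open>auto intro!: convex_Int convex_halfspace_Im_ge convex_halfspace_Im_le convex_halfspace_Re_ge convex_halfspace_Re_le\<close>)
  have S2: "x \<in> Om c \<alpha> a Z \<and> \<delta> <= cmod x \<and> cmod x <= 2 * \<delta>"
   if x: "Re x = \<delta>" "Im x <= \<delta>" "- \<delta> <= Im x" for x
  proof -
   have "\<bar>Im x\<bar> <= \<delta>" using x by auto
   moreover have "- 2 * hc c \<alpha> a \<bar>Im x\<bar> < Re x" using hc_nonneg[of "\<bar>Im x\<bar>"] x d by linarith
   ultimately show ?thesis using x abs_Re_le_cmod[of x] cmod_le[of x] Z d by (auto simp: Om_def)
  qed
  show "closed_segment (Complex \<delta> (- \<delta>)) (Complex \<delta> \<delta>) \<subseteq> {x. x \<in> Om c \<alpha> a Z \<and> Re x <= \<delta> \<and> \<delta> <= cmod x \<and> cmod x <= 2 * \<delta>}"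
  proof
   fix x assume "x \<in> closed_segment (Complex \<delta> (- \<delta>)) (Complex \<delta> \<delta>)"
   from subsetD[OF S1 this] have x: "Re x = \<delta>" "Im x <= \<delta>" "- \<delta> <= Im x" by auto
   from S2[OF this] x(1) show "x \<in> {x. x \<in> Om c \<alpha> a Z \<and> Re x <= \<delta> \<and> \<delta> <= cmod x \<and> cmod x <= 2 * \<delta>}" by simp
  qed
  show "cmod (Complex \<delta> \<delta> - Complex \<delta> (- \<delta>)) <= 2 * \<delta>" using d cmod_le[of "Complex \<delta> \<delta> - Complex \<delta> (- \<delta>)"] by auto
 qed
qed

lemma path_estimate:
 assumes ac: "c <= 1/2" and \<sigma>: "\<sigma> > \<alpha> - 1" and m: "m = (\<sigma> + 1) / \<alpha> - 1" and t: "t \<ge> 1" and K: "K \<ge> 0"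
  and Z: "Z > 1/2"
  and D: "!!z. z \<in> Om c \<alpha> a Z ==> Re z <= 1/2 ==> (G has_field_derivative g z) (at z)"
  and bd: "!!z y. z \<in> Om c \<alpha> a Z ==> Re z <= 1/2 ==> 0 < y ==> y <= cmod z ==> cmod z <= 2 * y ==> y <= 1/2 ==>
   cmod (g z) <= exp (Re z * t) * (K * (y powr (\<sigma> - \<alpha>) * Lg y powr a))"
  and Km: "!!s. s > 0 ==> exp (- s) <= Km * s powr (- m)"
 shows "cmod (G (Complex (- hc c \<alpha> a (1/2)) (1/2)) - G (Complex (- hc c \<alpha> a (1/2)) (- (1/2))))
   <= K * (2 * Km * (1 + c * (\<alpha> + a)) * c powr (- m) + 18) * (t powr (- m) * Lg (1 / (2 * t)) powr (a * (m + 1)) * (ln t + 1))"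
proof -
 define \<delta> where "\<delta> = 1 / (2 * t)"
 define P where "P = t powr (- m) * Lg \<delta> powr (a * (m + 1))"
 define c1 where "c1 = Km * (1 + c * (\<alpha> + a)) * c powr (- m)"
 have Km0: "Km \<ge> 0" using Km[of 1] exp_ge_zero[of "-1"] by (simp del: exp_ge_zero)
 have c10: "c1 \<ge> 0" unfolding c1_def using Km0 c \<alpha> a by (intro mult_nonneg_nonneg add_nonneg_nonneg) auto
 have P0: "P \<ge> 0" by (simp add: P_def)
 have d: "\<delta> > 0" using t by (simp add: \<delta>_def)
 note hp = half_path[OF ac \<sigma> m t K Z _ D bd Km \<delta>_def]
 let ?v = "%s. Complex (- hc c \<alpha> a (1/2)) (s * (1/2))" and ?u = "%s. Complex (- hc c \<alpha> a \<delta>) (s * \<delta>)" and ?x = "%s. Complex \<delta> (s * \<delta>)"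
 have 1: "cmod (G (?v s) - G (?u s)) <= K * c1 * P * ln t" if "s = 1 \<or> s = -1" for s
  using hp(1)[OF that] by (simp add: c1_def P_def mult_ac)
 have 2: "cmod (G (?u s) - G (?x s)) <= 6 * K * P" if "s = 1 \<or> s = -1" for s
  using hp(2)[OF that, of "?u s" "?x s"] hc_nonneg[of \<delta>] d by (simp add: P_def mult_ac)
 have 3: "cmod (G (?x 1) - G (?x (-1))) <= 6 * K * P"
  using hp(3)[of 1] by (simp add: P_def mult_ac)
 have tri: "norm (v - v') <= norm (v - u) + norm (u - x) + norm (x - x') + norm (u' - x') + norm (v' - u')" for v v' u u' x x' :: complex
 proof -
  have "v - v' = (v - u) + (u - x) + (x - x') - (u' - x') - (v' - u')" by simp
  then show ?thesis
   using norm_triangle_ineq4[of "(v - u) + (u - x) + (x - x') - (u' - x')" "v' - u'"]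
    norm_triangle_ineq4[of "(v - u) + (u - x) + (x - x')" "u' - x'"]
    norm_triangle_ineq[of "(v - u) + (u - x)" "x - x'"] norm_triangle_ineq[of "v - u" "u - x"] by (simp only:)
 qed
 have "cmod (G (?v 1) - G (?v (-1))) <= K * c1 * P * ln t + 6 * K * P + 6 * K * P + 6 * K * P + K * c1 * P * ln t"
  using tri[of "G (?v 1)" "G (?v (-1))" "G (?u 1)" "G (?x 1)" "G (?x (-1))" "G (?u (-1))"]
   1[OF disjI1[OF refl]] 1[OF disjI2[OF refl]] 2[OF disjI1[OF refl]] 2[OF disjI2[OF refl]] 3 by linarith
 \<comment> \<open>Two copies of the curve and three segments with constant 6.\<close>
 also have "\<dots> = K * P * (2 * c1 * ln t + 18)" by (simp add: algebra_simps)
 also have "\<dots> <= K * P * ((2 * c1 + 18) * (ln t + 1))"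
  using K P0 c10 ln_ge_zero[OF t] by (intro mult_left_mono mult_nonneg_nonneg) (auto simp: algebra_simps)
 also have "\<dots> = K * (2 * Km * (1 + c * (\<alpha> + a)) * c powr (- m) + 18) * (t powr (- m) * Lg (1 / (2 * t)) powr (a * (m + 1)) * (ln t + 1))"
  by (simp add: P_def \<delta>_def c1_def mult_ac)
 finally show ?thesis by simp
qed

end

text \<open>The two halves of \<open>half_contour\<close> are subtracted at l, where
  \<open>sector_cauchy\<close> gives f(t). At the end points \<open>Complex (- \<kappa>) Y\<close>
  and its conjugate the ray integrals carry \<open>exp (- \<kappa> * t)\<close>, and so does the
  increment of R, since the transform of \<tau> - f is bounded on \<open>Re z = - \<kappa>\<close>.
  What is left is the increment of Q.\<close>

lemma contour_bound:
 assumes hol: "f holomorphic_on sector \<xi>" and \<xi>: "\<xi> <= pi"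
  and bd: "!!z. z \<in> sector \<xi> ==> cmod (f z) <= M * exp (w * cmod z)" and w: "w \<ge> 0"
  and \<psi>: "0 < \<psi>" "\<psi> < \<xi>" "\<psi> < pi / 2" and t: "t \<ge> 1"
  and \<kappa>: "0 < \<kappa>" "\<kappa> <= 1/4" "2 * \<kappa> < \<epsilon>" and Y: "w + 2 <= Y * sin \<psi>"
  and \<Omega>: "!!z. \<bar>Im z\<bar> < Y + 1 ==> Re z > 0 \<or> \<bar>Im z\<bar> > 1/2 \<and> Re z > - 2 * \<kappa> ==> z \<in> \<Omega>"
  and \<rho>: "\<rho> holomorphic_on \<Omega>"
  and Q: "!!z. z \<in> \<Omega> ==> (Q has_field_derivative exp (z * of_real t) * \<rho> z) (at z)"
  and \<tau>: "continuous_on {0<..} \<tau>" "!!r. r > 0 ==> cmod (\<tau> r - f (of_real r)) <= N * exp (- \<epsilon> * r)"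
  and lap: "!!p. p > l0 ==> integral {0<..} (%r. exp (- of_real p * of_real r) * \<tau> r) = \<rho> (of_real p)"
  and C1: "!!r. r > 0 ==> exp (- r) <= C1 * mp 1 r"
  and C2: "!!r. r > 0 ==> exp (- (\<epsilon> - \<kappa>) * r) <= C2 * mp 1 r"
 shows "2 * pi * cmod (f (of_real t)) <=
  (2 * M * C1 / sqrt ((1 - cos \<psi>) / 2) + 2 * Y * N * C2) * integral {0<..} (mp 1) * exp (- \<kappa> * t)
  + cmod (Q (Complex (- \<kappa>) Y) - Q (Complex (- \<kappa>) (- Y)))"
proof -
 define J where "J = integral {0<..} (mp 1)"
 have t0: "t > 0" using t by simp
 have cp: "cos \<psi> > 0" "cos \<psi> <= 1" using \<psi> by (auto intro: cos_gt_zero)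
 have sp: "sin \<psi> > 0" using \<psi> by (auto intro: sin_gt_zero)
 have Y0: "Y > 0"
 proof -
  have "0 < Y * sin \<psi>" using Y w by linarith
  then show ?thesis using sp by (simp add: zero_less_mult_iff)
 qed
 have pos: "complex_of_real r \<in> sector \<xi>" if "r > 0" for r using that \<psi> by (auto simp: sector_def Arg_eq_0)
 have bd': "cmod (f (of_real r)) <= M * exp (w * r)" if "r > 0" for r using bd[OF pos[OF that]] that by simp
 have M0: "M \<ge> 0" using order_trans[OF norm_ge_zero bd'[of 1]] by (simp add: zero_le_mult_iff)
 have N0: "N \<ge> 0" using order_trans[OF norm_ge_zero \<tau>(2)[of 1]] by (simp add: zero_le_mult_iff)
 have cf: "continuous_on {0<..} (%r. f (of_real r))"
  by (rule continuous_on_compose2[OF holomorphic_on_imp_continuous_on[OF hol]]) (use pos in \<open>auto intro!: continuous_intros\<close>)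
 define g where "g = (%r. \<tau> r - f (of_real r))"
 have cg: "continuous_on {0<..} g" unfolding g_def by (intro continuous_intros cf \<tau>)
 have gb: "cmod (g r) <= N * exp (- \<epsilon> * r)" if "r > 0" for r using \<tau>(2)[OF that] by (simp add: g_def)
 \<comment> \<open>The Laplace transform of \<tau> - f; the decay rate \<epsilon> makes it
   holomorphic to the right of - \<epsilon>, in particular to the right of - 2 \<kappa>.\<close>
 define \<upsilon> where "\<upsilon> = (%p. integral {0<..} (%r. g r * exp (p * (of_real 0 - of_real r * 1))))"
 have \<upsilon>d: "\<exists>d. (\<upsilon> has_field_derivative d) (at p)" if p: "Re p > - 2 * \<kappa>" for p
 proof -
  have p': "- \<epsilon> < Re (p * 1)" using that \<kappa> by simp
  show ?thesis unfolding \<upsilon>_def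
   by (rule exI, rule laplace_deriv[OF cg gb norm_one order_refl p'])
 qed
 have oH: "open {z. Re z > - 2 * \<kappa>}" by (rule open_halfspace_Re_gt)
 have \<upsilon>h: "\<upsilon> holomorphic_on {z. Re z > - 2 * \<kappa>}" unfolding holomorphic_on_open[OF oH] using \<upsilon>d by blast
 have "(%z. exp (z * of_real t) * \<upsilon> z) holomorphic_on {z. Re z > - 2 * \<kappa>}" by (intro holomorphic_intros \<upsilon>h)
 from holomorphic_convex_primitive'[OF convex_halfspace_Re_gt oH this]
 obtain R where "!!z. z \<in> {z. Re z > - 2 * \<kappa>} ==> (R has_field_derivative exp (z * of_real t) * \<upsilon> z) (at z within {z. Re z > - 2 * \<kappa>})" by blast
 then have R: "(R has_field_derivative exp (z * of_real t) * \<upsilon> z) (at z)" if "Re z > - 2 * \<kappa>" for z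
  using that at_within_open[OF _ oH, of z] by (metis (mono_tags) mem_Collect_eq)
 \<comment> \<open>Beyond l0 and w, and large enough for w < l cos \<psi>, which makes both ray
   integrals converge at l.\<close>
 define l where "l = \<bar>l0\<bar> + \<bar>w / cos \<psi>\<bar> + \<bar>w\<bar> + 1"
 have l: "l0 < l" "w / cos \<psi> < l" "w < l" "1 / 2 < l" unfolding l_def by linarith+
 have lw: "w < l * cos \<psi>" using l(2) cp by (simp add: field_simps)
 have eq: "integral {0<..} (%r. exp (- of_real p * of_real r) * f (of_real r)) = \<rho> (of_real p) - \<upsilon> (of_real p)" if p: "p > max l0 (max w 0)" for p
 proof -
  have "p - w > 0" using p by simp
  then obtain C where C: "!!r. r > 0 ==> exp (- (p - w) * r) <= C * mp 1 r" using exp_le_mp[of "p - w"] by blast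
  have i1: "(%r. exp (- of_real p * of_real r) * f (of_real r)) integrable_on {0<..}"
  proof (rule integrable_mp[where u=1 and C="M * C"])
   fix r :: real assume r: "r > 0"
   have "norm (exp (- of_real p * of_real r) * f (of_real r)) <= exp (- p * r) * (M * exp (w * r))"
    using bd'[OF r] by (simp add: norm_mult norm_exp_eq_Re mult_left_mono)
   also have "\<dots> = M * exp (- (p - w) * r)" by (simp add: algebra_simps flip: exp_add)
   also have "\<dots> <= M * (C * mp 1 r)" using M0 by (intro mult_left_mono C r)
   finally show "norm (exp (- of_real p * of_real r) * f (of_real r)) <= M * C * mp 1 r" by (simp add: mult.assoc)
  qed (auto intro!: continuous_intros cf)
  have i2: "(%r. exp (- of_real p * of_real r) * g r) integrable_on {0<..}"
  proof (rule integrable_mp[where u=1 and C="N * C2"])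
   fix r :: real assume r: "r > 0"
   have "norm (exp (- of_real p * of_real r) * g r) <= exp (- p * r) * (N * exp (- \<epsilon> * r))"
    using gb[OF r] by (simp add: norm_mult norm_exp_eq_Re mult_left_mono)
   also have "\<dots> = N * exp (- (\<epsilon> + p) * r)" by (simp add: algebra_simps flip: exp_add)
   also have "\<dots> <= N * exp (- (\<epsilon> - \<kappa>) * r)"
   proof -
    have "- (\<epsilon> + p) * r <= - (\<epsilon> - \<kappa>) * r" using p \<kappa> r by (intro mult_right_mono) auto
    then show ?thesis using N0 by (intro mult_left_mono) (simp_all only: exp_le_cancel_iff)
   qed
   also have "\<dots> <= N * (C2 * mp 1 r)" using N0 by (intro mult_left_mono C2 r)
   finally show "norm (exp (- of_real p * of_real r) * g r) <= N * C2 * mp 1 r" by (simp add: mult.assoc)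
  qed (auto intro!: continuous_intros cg)
  have "\<rho> (of_real p) = integral {0<..} (%r. exp (- of_real p * of_real r) * f (of_real r) + exp (- of_real p * of_real r) * g r)"
   using lap[of p] p by (simp add: g_def algebra_simps)
  also have "\<dots> = integral {0<..} (%r. exp (- of_real p * of_real r) * f (of_real r)) + integral {0<..} (%r. exp (- of_real p * of_real r) * g r)"
   by (rule integral_add[OF i1 i2])
  also have "integral {0<..} (%r. exp (- of_real p * of_real r) * g r) = \<upsilon> (of_real p)"
   by (simp add: \<upsilon>_def mult.commute)
  finally show ?thesis by simp
 qed
 define E where "E = (%sg p. integral {0<..} (%r. f (rcis r (- sg * \<psi>)) / (rcis r (- sg * \<psi>) - of_real t) *
   exp (p * (of_real t - rcis r (- sg * \<psi>))) * cis (- sg * \<psi>)))"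
 have ll: "l > max l0 (max w 0)" using l w by auto
 have half: "E sg (of_real l) + Q (of_real l) - R (of_real l) =
  E sg (Complex (-\<kappa>) (sg * Y)) + Q (Complex (-\<kappa>) (sg * Y)) - R (Complex (-\<kappa>) (sg * Y))" if sg: "sg = 1 \<or> sg = (-1::real)" for sg
  by (rule half_contour[OF hol \<xi> bd w \<psi> sg t0 \<kappa>(1,2) Y \<Omega> \<rho> \<upsilon>h Q R eq _ ll lw l(4)]) (simp_all add: E_def)
 have cau: "E 1 (of_real l) - E (-1) (of_real l) = 2 * of_real pi * \<i> * f (of_real t)"
  using sector_cauchy[OF hol \<xi> bd w \<psi> lw t0] by (simp add: E_def)
 let ?p = "Complex (- \<kappa>) Y" and ?m = "Complex (- \<kappa>) (- Y)"
 have rep: "2 * of_real pi * \<i> * f (of_real t) = E 1 ?p - E (-1) ?m + (Q ?p - Q ?m) - (R ?p - R ?m)"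
 proof -
  have "2 * of_real pi * \<i> * f (of_real t) = (E 1 (of_real l) + Q (of_real l) - R (of_real l)) - (E (-1) (of_real l) + Q (of_real l) - R (of_real l))"
   unfolding cau[symmetric] by simp
  also have "\<dots> = (E 1 (Complex (-\<kappa>) (1 * Y)) + Q (Complex (-\<kappa>) (1 * Y)) - R (Complex (-\<kappa>) (1 * Y)))
   - (E (-1) (Complex (-\<kappa>) (-1 * Y)) + Q (Complex (-\<kappa>) (-1 * Y)) - R (Complex (-\<kappa>) (-1 * Y)))"
   unfolding half[OF disjI1[OF refl]] half[OF disjI2[OF refl]] ..
  also have "\<dots> = E 1 ?p - E (-1) ?m + (Q ?p - Q ?m) - (R ?p - R ?m)" by simp
  finally show ?thesis .
 qed
 have Eb: "cmod (E sg (Complex (-\<kappa>) (sg * Y))) <= M / sqrt ((1 - cos \<psi>) / 2) * exp (- \<kappa> * t) * C1 * J" if sg: "sg = 1 \<or> sg = (-1::real)" for sg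
 proof -
  define s where "s = sqrt ((1 - cos \<psi>) / 2)"
  have "cos \<psi> < 1" using cos_monotone_0_pi[of 0 \<psi>] \<psi> by auto
  then have s: "s > 0" by (simp add: s_def)
  have th: "- sg * \<psi> = \<psi> \<or> - sg * \<psi> = - \<psi>" using sg by auto
  \<comment> \<open>The shift to the left loses at most 1/4, while the height contributes
    \<open>Y * sin \<psi>\<close>, which is at least w + 2.\<close>
  have "\<kappa> * cos \<psi> <= 1/4 * 1" using \<kappa> cp by (intro mult_mono) auto
  then have re: "w + 1 <= Re (Complex (-\<kappa>) (sg * Y) * cis (- sg * \<psi>))" using sg Y by auto
  have "cmod (E sg (Complex (-\<kappa>) (sg * Y))) <= M / (s * t) * exp (Re (Complex (-\<kappa>) (sg * Y)) * t) * C1 * J"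
   unfolding E_def s_def J_def by (rule ray_laplace(3)[OF hol \<xi> bd w \<psi> th re t0 C1])
  also have "\<dots> = M / (s * t) * exp (- \<kappa> * t) * (C1 * J)" by simp
  also have "\<dots> <= M / s * exp (- \<kappa> * t) * (C1 * J)"
  proof (intro mult_right_mono divide_left_mono)
   show "s <= s * t" using s t by simp
   have "C1 \<ge> 0" using order_trans[OF exp_ge_zero C1[of 1]] mp_nonneg[of 1 1] by (simp add: mp_def)
   then show "0 <= C1 * J" unfolding J_def
    by (intro mult_nonneg_nonneg integral_nonneg mp_integrable mp_nonneg) auto
  qed (use M0 s t in auto)
  finally show ?thesis by (simp add: s_def)
 qed
 have \<upsilon>b: "cmod (\<upsilon> z) <= N * C2 * J" if z: "Re z = - \<kappa>" for z
  unfolding \<upsilon>_def J_def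
 proof (rule norm_integral_mp_le)
  show "continuous_on {0<..} (%r. g r * exp (z * (of_real 0 - of_real r * 1)))" by (intro continuous_intros cg)
  fix r :: real assume r: "r > 0"
  have "norm (g r * exp (z * (of_real 0 - of_real r * 1))) = cmod (g r) * exp (\<kappa> * r)"
   using z by (simp add: norm_mult norm_exp_eq_Re)
  also have "\<dots> <= N * exp (- \<epsilon> * r) * exp (\<kappa> * r)" using gb[OF r] by (intro mult_right_mono) auto
  also have "\<dots> = N * exp (- (\<epsilon> - \<kappa>) * r)" by (simp add: algebra_simps flip: exp_add)
  also have "\<dots> <= N * (C2 * mp 1 r)" using N0 by (intro mult_left_mono C2 r)
  finally show "norm (g r * exp (z * (of_real 0 - of_real r * 1))) <= N * C2 * mp 1 r" by (simp add: mult.assoc)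
 qed simp
 have Rb: "cmod (R ?p - R ?m) <= exp (- \<kappa> * t) * (N * C2 * J) * (2 * Y)"
 proof -
  have "cmod (R ?p - R ?m) <= exp (- \<kappa> * t) * (N * C2 * J) * cmod (?p - ?m)"
  proof (rule field_differentiable_bound[where S="{z. Re z = - \<kappa>}" and f'="%z. exp (z * of_real t) * \<upsilon> z"])
   show "convex {z. Re z = - \<kappa>}"
   proof -
    have "{z. Re z = - \<kappa>} = {z. Re z <= - \<kappa>} \<inter> {z. Re z \<ge> - \<kappa>}" by auto
    then show ?thesis by (simp add: convex_Int convex_halfspace_Re_le convex_halfspace_Re_ge)
   qed
   fix z assume "z \<in> {z. Re z = - \<kappa>}"
   then have z: "Re z = - \<kappa>" by simp
   show "(R has_field_derivative exp (z * of_real t) * \<upsilon> z) (at z within {z. Re z = - \<kappa>})"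
    by (rule has_field_derivative_at_within[OF R]) (use z \<kappa> in simp)
   show "cmod (exp (z * of_real t) * \<upsilon> z) <= exp (- \<kappa> * t) * (N * C2 * J)"
    using \<upsilon>b[OF z] z by (simp add: norm_mult norm_exp_eq_Re mult_left_mono)
  qed auto
  also have "?p - ?m = of_real (2 * Y) * \<i>" by (simp add: complex_eq_iff)
  also have "cmod (of_real (2 * Y) * \<i>) = 2 * Y" using Y0 by (simp add: norm_mult)
  finally show ?thesis .
 qed
 define B where "B = M / sqrt ((1 - cos \<psi>) / 2) * exp (- \<kappa> * t) * C1 * J"
 have tri: "norm (a - b + q - r) <= norm a + norm b + norm q + norm r" for a b q r :: complex
  using norm_triangle_ineq4[of "a - b + q" r] norm_triangle_ineq[of "a - b" q] norm_triangle_ineq4[of a b] by linarith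
 have "2 * pi * cmod (f (of_real t)) = cmod (2 * of_real pi * \<i> * f (of_real t))" by (simp add: norm_mult)
 also have "\<dots> <= cmod (E 1 ?p) + cmod (E (-1) ?m) + cmod (Q ?p - Q ?m) + cmod (R ?p - R ?m)" unfolding rep by (rule tri)
 also have "\<dots> <= B + B + cmod (Q ?p - Q ?m) + exp (- \<kappa> * t) * (N * C2 * J) * (2 * Y)"
 proof -
  have "cmod (E 1 ?p) <= B" using Eb[OF disjI1[OF refl]] unfolding B_def[symmetric] by (simp only: mult_1)
  moreover have "cmod (E (-1) ?m) <= B" using Eb[OF disjI2[OF refl]] unfolding B_def[symmetric] by (simp only: mult_minus1)
  ultimately show ?thesis using Rb by linarith
 qed
 also have "\<dots> = (2 * M * C1 / sqrt ((1 - cos \<psi>) / 2) + 2 * Y * N * C2) * J * exp (- \<kappa> * t) + cmod (Q ?p - Q ?m)"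
  unfolding B_def by (simp add: algebra_simps)
 finally show ?thesis by (simp only: J_def)
qed

section \<open>Resolvent bounds left of the imaginary axis\<close>

lemma exp_le_powr:
 fixes m s :: real
 assumes "m > 0" "s > 0" shows "exp (- s) <= m powr m * s powr (- m)"
proof -
 have "s / m <= exp (s / m)" using exp_ge_add_one_self[of "s/m"] by linarith
 then have "(s / m) powr m <= exp (s / m) powr m" using assms by (intro powr_mono2) auto
 then have "s powr m <= m powr m * exp s" using assms by (simp add: powr_divide powr_def[of "exp (s/m)"] field_simps)
 then show ?thesis using assms by (simp add: exp_minus powr_minus field_simps)
qed

text \<open>Up to a function regular at the origin, each factor \<open>A (1 + A)\<^sup>-\<^sup>1\<close> multiplies the resolvent by \<open>- z / (1 - z)\<close>.\<close>

lemma lres_bpow: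
 fixes A :: "'a::complex_banach lop"
 assumes A: "linear_operator A" and m1: "-1 \<in> resolvent_set A"
 shows "\<exists>R\<ge>0. \<forall>x. \<forall>\<phi>\<in>(clinear_ops :: ('a \<Rightarrow>\<^sub>L complex) set). \<exists>r. r holomorphic_on {z. Re z < 1} \<and>
  (\<forall>z. - z \<in> resolvent_set A --> Re z < 1 -->
   blinfun_apply \<phi> (blinfun_apply (lres A z) (blinfun_apply (bpow (id_blinfun - pres A 1) n) x)) =
   (- z / (1 - z)) ^ n * blinfun_apply \<phi> (blinfun_apply (lres A z) x) + r z) \<and>
  (\<forall>z. Re z <= 0 --> cmod (r z) <= R * norm \<phi> * norm x)"
proof (induction n)
 case 0
 show ?case by (intro exI[of _ 0] conjI allI ballI exI[of _ "%_. 0"]) auto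
next
 case (Suc n)
 then obtain R where R: "R \<ge> 0" and IH: "\<forall>x. \<forall>\<phi>\<in>(clinear_ops :: ('a \<Rightarrow>\<^sub>L complex) set). \<exists>r. r holomorphic_on {z. Re z < 1} \<and>
  (\<forall>z. - z \<in> resolvent_set A --> Re z < 1 -->
   blinfun_apply \<phi> (blinfun_apply (lres A z) (blinfun_apply (bpow (id_blinfun - pres A 1) n) x)) =
   (- z / (1 - z)) ^ n * blinfun_apply \<phi> (blinfun_apply (lres A z) x) + r z) \<and>
  (\<forall>z. Re z <= 0 --> cmod (r z) <= R * norm \<phi> * norm x)" by blast
 let ?D = "id_blinfun - pres A 1"
 define L where "L = norm (lres A 1) * norm (bpow ?D n)"
 have L0: "L \<ge> 0" by (simp add: L_def)
 have P: "pres A 1 = lres A 1" by (simp add: pres_def lres_def)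
 show ?case
 proof (intro exI[of _ "R + L"] conjI allI ballI)
  show "0 <= R + L" using R by (simp add: L_def)
  fix x and \<phi> :: "'a \<Rightarrow>\<^sub>L complex" assume f: "\<phi> \<in> clinear_ops"
  obtain r where r: "r holomorphic_on {z. Re z < 1}"
   "!!z. - z \<in> resolvent_set A ==> Re z < 1 ==>
   blinfun_apply \<phi> (blinfun_apply (lres A z) (blinfun_apply (bpow ?D n) x)) =
   (- z / (1 - z)) ^ n * blinfun_apply \<phi> (blinfun_apply (lres A z) x) + r z"
   "!!z. Re z <= 0 ==> cmod (r z) <= R * norm \<phi> * norm x" using IH f by blast
  define y where "y = blinfun_apply (bpow ?D n) x"
  \<comment> \<open>With this k the next remainder is
    \<open>(- z / (1 - z)) * r z + k / (1 - z)\<close>. For \<open>Re z <= 0\<close> both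
    \<open>z / (1 - z)\<close> and \<open>1 / (1 - z)\<close> are at most 1 in size, so each factor
    adds at most L to the constant.\<close>
  define k where "k = blinfun_apply \<phi> (blinfun_apply (lres A 1) y)"
  have z1: "1 - z ~= 0" if "Re z < 1" for z :: complex using that by auto
  show "\<exists>r. r holomorphic_on {z. Re z < 1} \<and>
   (\<forall>z. - z \<in> resolvent_set A --> Re z < 1 -->
   blinfun_apply \<phi> (blinfun_apply (lres A z) (blinfun_apply (bpow ?D (Suc n)) x)) =
   (- z / (1 - z)) ^ Suc n * blinfun_apply \<phi> (blinfun_apply (lres A z) x) + r z) \<and>
   (\<forall>z. Re z <= 0 --> cmod (r z) <= (R + L) * norm \<phi> * norm x)"
  proof (intro exI[of _ "%z. (- z / (1 - z)) * r z + k / (1 - z)"] conjI allI impI)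
   show "(%z. (- z / (1 - z)) * r z + k / (1 - z)) holomorphic_on {z. Re z < 1}"
    by (intro holomorphic_intros r) (use z1 in auto)
   fix z
   show "blinfun_apply \<phi> (blinfun_apply (lres A z) (blinfun_apply (bpow ?D (Suc n)) x)) =
    (- z / (1 - z)) ^ Suc n * blinfun_apply \<phi> (blinfun_apply (lres A z) x) + ((- z / (1 - z)) * r z + k / (1 - z))"
    if z: "- z \<in> resolvent_set A" "Re z < 1"
   proof -
    have "blinfun_apply (lres A z) y - blinfun_apply (lres A 1) y = (1 - z) *\<^sub>C blinfun_apply (lres A z) (blinfun_apply (lres A 1) y)"
     using arg_cong[OF lres_identity[OF A z(1) m1], of "%B. blinfun_apply B y"]
     by (simp add: blinfun.diff_left scaleC_blinfun.rep_eq)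
    from arg_cong[OF this, of "blinfun_apply \<phi>"]
    have "blinfun_apply \<phi> (blinfun_apply (lres A z) y) - k = (1 - z) * blinfun_apply \<phi> (blinfun_apply (lres A z) (blinfun_apply (lres A 1) y))"
     by (simp add: blinfun.diff_right clinear_opsD[OF f] scaleC_complex_def k_def)
    then have e: "blinfun_apply \<phi> (blinfun_apply (lres A z) (blinfun_apply (lres A 1) y)) = (blinfun_apply \<phi> (blinfun_apply (lres A z) y) - k) / (1 - z)"
     using z1[OF z(2)] by (simp add: field_simps)
    have alg: "X - (X - k) / (1 - z) = (- z / (1 - z)) * X + k / (1 - z)" for X
    proof -
     have "X - (X - k) / (1 - z) = ((1 - z) * X - (X - k)) / (1 - z)" using z1[OF z(2)] by (simp add: diff_divide_distrib)
     also have "(1 - z) * X - (X - k) = - z * X + k" by (simp add: algebra_simps)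
     finally show ?thesis by (simp add: diff_divide_distrib)
    qed
    have "blinfun_apply \<phi> (blinfun_apply (lres A z) (blinfun_apply (bpow ?D (Suc n)) x)) =
     blinfun_apply \<phi> (blinfun_apply (lres A z) y) - blinfun_apply \<phi> (blinfun_apply (lres A z) (blinfun_apply (lres A 1) y))"
     by (simp add: y_def P blinfun.diff_left blinfun.diff_right)
    also have "\<dots> = (- z / (1 - z)) * blinfun_apply \<phi> (blinfun_apply (lres A z) y) + k / (1 - z)" unfolding e by (rule alg)
    finally show ?thesis using r(2)[OF z] by (simp add: y_def algebra_simps)
   qed
   assume z: "Re z <= 0"
   have d: "1 <= cmod (1 - z)" using complex_Re_le_cmod[of "1 - z"] z by simp
   have "(cmod z)\<^sup>2 <= (cmod (1 - z))\<^sup>2" unfolding cmod_power2 using z by (simp add: power2_eq_square algebra_simps)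
   then have "cmod z <= cmod (1 - z)" by (rule power2_le_imp_le) simp
   then have q: "cmod (- z / (1 - z)) <= 1" using d by (simp add: norm_divide divide_le_eq_1)
   have k: "cmod k <= L * norm \<phi> * norm x"
   proof -
    have "cmod k <= norm \<phi> * (norm (lres A 1) * norm y)"
     unfolding k_def by (rule order_trans[OF norm_blinfun mult_left_mono[OF norm_blinfun]]) simp
    also have "\<dots> <= norm \<phi> * (norm (lres A 1) * (norm (bpow ?D n) * norm x))"
     unfolding y_def by (intro mult_left_mono norm_blinfun) auto
    finally show ?thesis by (simp add: L_def mult_ac)
   qed
   have "cmod ((- z / (1 - z)) * r z + k / (1 - z)) <= cmod (- z / (1 - z)) * cmod (r z) + cmod k / cmod (1 - z)"
    by (rule order_trans[OF norm_triangle_ineq]) (simp add: norm_mult norm_divide)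
   also have "\<dots> <= 1 * (R * norm \<phi> * norm x) + (L * norm \<phi> * norm x) / 1"
    using R L0 by (intro add_mono mult_mono q r(3) z frac_le k d) auto
   finally show "cmod ((- z / (1 - z)) * r z + k / (1 - z)) <= (R + L) * norm \<phi> * norm x" by (simp add: algebra_simps)
  qed
 qed
qed

text \<open>Here \<open>lres_dfrac_bound\<close> is used with B the given resolvent bound and c = 1
  / C: for \<open>cmod l <= 1\<close> both \<open>cmod l powr (1 - \<alpha>)\<close> and the
  logarithmic factor are at least 1, so \<open>cmod l * B\<close> is at least C.\<close>

lemma lres_frac_bound:
 fixes A :: "'a::complex_banach lop"
 assumes A: "sectorial A" and s: "0 <= s" "s < 1" and \<alpha>: "\<alpha> \<ge> 1" and a: "a > 0" and C: "C > 0"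
  and bd: "!!l. l ~= 0 ==> Re l \<ge> 0 ==> cmod l <= 1 ==> - l \<in> resolvent_set A \<and> norm (lres A l) <= C * cmod l powr (- \<alpha>) * Lg (cmod l) powr a"
  and W: "W = (if s = 0 then id_blinfun else id_blinfun - dfrac_integral A 0 s)"
 obtains K where "K > 0" "!!l. l ~= 0 ==> Re l \<ge> 0 ==> cmod l <= 1 ==> norm (lres A l o\<^sub>L W) <= K * (cmod l powr (s - \<alpha>) * Lg (cmod l) powr a)"
proof (cases "s = 0")
 case True
 show thesis
 proof (rule that[OF C])
  fix l :: complex assume "l ~= 0" "Re l \<ge> 0" "cmod l <= 1"
  from bd[OF this] show "norm (lres A l o\<^sub>L W) <= C * (cmod l powr (s - \<alpha>) * Lg (cmod l) powr a)"
   using True by (simp add: W mult.assoc)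
 qed
next
 case False
 obtain M where M: "M > 0" "!!\<nu>. \<nu> > 0 ==> norm (pres A \<nu>) <= M / \<nu>" using pres_bound[OF A] by blast
 define K where "K = 2 * max (1 + M) (M * (1 + 1 / C)) * C"
 have "max (1 + M) (M * (1 + 1 / C)) > 0" using M by (simp add: less_max_iff_disj)
 then have K: "K > 0" using C by (simp add: K_def)
 show thesis
 proof (rule that[OF K])
  fix l :: complex assume l: "l ~= 0" "Re l \<ge> 0" "cmod l <= 1"
  define B where "B = C * cmod l powr (- \<alpha>) * Lg (cmod l) powr a"
  have L: "Lg (cmod l) \<ge> 1" using l by (intro Lg_ge_one) auto
  have "1 = cmod l powr 0" using l by simp
  also have "\<dots> <= cmod l powr (1 - \<alpha>)" using l \<alpha> by (intro powr_mono') auto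
  also have "\<dots> = cmod l * cmod l powr (- \<alpha>)" using l by (simp add: powr_diff powr_minus_divide)
  finally have 1: "1 <= cmod l * cmod l powr (- \<alpha>)" .
  have 2: "1 <= Lg (cmod l) powr a" using L a by (intro ge_one_powr_ge_zero) auto
  have "1 * 1 <= (cmod l * cmod l powr (- \<alpha>)) * Lg (cmod l) powr a" by (intro mult_mono 1 2) auto
  also have "\<dots> = 1 / C * (cmod l * B)" using C by (simp add: B_def)
  finally have c: "1 <= 1 / C * (cmod l * B)" by simp
  have "norm (lres A l o\<^sub>L (id_blinfun - dfrac_integral A 0 s)) <= 2 * max (1 + M) (M * (1 + 1 / C)) * B * cmod l powr s"
   by (rule lres_dfrac_bound[OF A M]) (use s False l bd[OF l] c C in \<open>auto simp: B_def\<close>)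
  also have "\<dots> = K * ((cmod l powr (- \<alpha>) * cmod l powr s) * Lg (cmod l) powr a)" by (simp add: K_def B_def mult_ac)
  also have "cmod l powr (- \<alpha>) * cmod l powr s = cmod l powr (s - \<alpha>)" by (simp flip: powr_add)
  finally show "norm (lres A l o\<^sub>L W) <= K * (cmod l powr (s - \<alpha>) * Lg (cmod l) powr a)" using False by (simp add: W)
 qed
qed

text \<open>A point left of the axis is within \<open>2 * hc\<close> of the point at the same height
  on the axis. Up to height 1/2 the powers in \<open>hc\<close> and in the resolvent bound cancel
  and leave \<open>2 * c * C <= 1/2\<close>; above, the distance is at most c and
  \<open>c * K <= 1/2\<close>. In both cases the Neumann ratio is at most 1/2.\<close>

lemma Om_resolvent:
 fixes A :: "'a::complex_banach lop"
 assumes A: "linear_operator A" and \<alpha>: "\<alpha> \<ge> 1" and a: "a > 0" and c: "c > 0" "c <= 1/2" "4 * c * C <= 1" "2 * c * K <= 1"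
  and res: "!!l. l ~= 0 ==> Re l \<ge> 0 ==> - l \<in> resolvent_set A"
  and bd: "!!l. l ~= 0 ==> Re l \<ge> 0 ==> cmod l <= 1 ==> norm (lres A l) <= C * cmod l powr (- \<alpha>) * Lg (cmod l) powr a"
  and K: "!!y. 1/2 <= \<bar>y\<bar> ==> \<bar>y\<bar> <= Z ==> norm (lres A (Complex 0 y)) <= K"
 shows "!!z. z \<in> Om c \<alpha> a Z ==> - z \<in> resolvent_set A"
  and "!!z W. z \<in> Om c \<alpha> a Z ==> Re z < 0 ==> norm (lres A z o\<^sub>L W) <= 2 * norm (lres A (Complex 0 (Im z)) o\<^sub>L W)"
proof -
 have key: "Im z ~= 0 \<and> cmod (z - Complex 0 (Im z)) * norm (lres A (Complex 0 (Im z))) <= 1/2" if z: "z \<in> Om c \<alpha> a Z" "Re z < 0" for z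
 proof
  show i: "Im z ~= 0" using z hc_0[OF c(1) \<alpha> a] by (auto simp: Om_def)
  define y where "y = \<bar>Im z\<bar>"
  have y: "y > 0" using i by (simp add: y_def)
  have "z - Complex 0 (Im z) = of_real (Re z)" by (simp add: complex_eq_iff)
  then have dz: "cmod (z - Complex 0 (Im z)) <= 2 * hc c \<alpha> a y" using z by (simp add: Om_def y_def)
  have nC: "cmod (Complex 0 (Im z)) = y" by (simp add: y_def cmod_def)
  show "cmod (z - Complex 0 (Im z)) * norm (lres A (Complex 0 (Im z))) <= 1/2"
  proof (cases "y <= 1/2")
   case True
   have ne: "Complex 0 (Im z) ~= 0" using i by (simp add: complex_eq_iff)
   have L: "Lg y > 0" by (rule Lg_pos[OF y])
   have "cmod (z - Complex 0 (Im z)) * norm (lres A (Complex 0 (Im z)))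
    <= (2 * (c * y powr \<alpha> * Lg y powr (- a))) * (C * y powr (- \<alpha>) * Lg y powr a)"
    using dz hc_le[OF c(1) \<alpha> a y] bd[OF ne] True nC c by (intro mult_mono) auto
   also have "\<dots> = 2 * c * C" using y L by (simp add: powr_minus_divide)
   finally show ?thesis using c by simp
  next
   case False
   have k: "norm (lres A (Complex 0 (Im z))) <= K" using False z by (intro K) (auto simp: y_def Om_def)
   have "hc c \<alpha> a y = hc c \<alpha> a (1/2)" using False by (simp add: hc_def)
   also have "\<dots> <= c * (1/2)" by (rule hc_le_linear[OF c(1) \<alpha> a]) simp
   finally have "cmod (z - Complex 0 (Im z)) <= c" using dz by simp
   then have "cmod (z - Complex 0 (Im z)) * norm (lres A (Complex 0 (Im z))) <= c * K" using k c by (intro mult_mono) auto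
   then show ?thesis using c by simp
  qed
 qed
 have r0: "- Complex 0 y \<in> resolvent_set A" if "y ~= 0" for y
  using that by (intro res) (auto simp: complex_eq_iff)
 show "- z \<in> resolvent_set A" if z: "z \<in> Om c \<alpha> a Z" for z
 proof (cases "Re z < 0")
  case True
  with norm_lres_le(1)[OF A r0] key[OF z] show ?thesis by blast
 next
  case False
  then have "z ~= 0" using z hc_0[OF c(1) \<alpha> a] by (auto simp: Om_def)
  then show ?thesis using False by (intro res) auto
 qed
 show "norm (lres A z o\<^sub>L W) <= 2 * norm (lres A (Complex 0 (Im z)) o\<^sub>L W)" if z: "z \<in> Om c \<alpha> a Z" "Re z < 0" for z W
  using norm_lres_le(2)[OF A r0] key[OF z] by blast
qed

text \<open>The majorant \<open>u^\<beta> * Lg u^a\<close> varies by a bounded factor for u between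
  y / 2 and 2 y. Left of the axis u is the height of z, which is comparable with its modulus because
  c is at most 1/2.\<close>

lemma lres_Om_frac:
 fixes A :: "'a::complex_banach lop"
 assumes A: "linear_operator A" and \<alpha>: "\<alpha> \<ge> 1" and a: "a > 0" and c: "c > 0" "c <= 1/2" "4 * c * C <= 1" "2 * c * K <= 1"
  and res: "!!l. l ~= 0 ==> Re l \<ge> 0 ==> - l \<in> resolvent_set A"
  and bd: "!!l. l ~= 0 ==> Re l \<ge> 0 ==> cmod l <= 1 ==> norm (lres A l) <= C * cmod l powr (- \<alpha>) * Lg (cmod l) powr a"
  and K: "!!y. 1/2 <= \<bar>y\<bar> ==> \<bar>y\<bar> <= Z ==> norm (lres A (Complex 0 y)) <= K"
  and KW: "KW > 0" "!!l. l ~= 0 ==> Re l \<ge> 0 ==> cmod l <= 1 ==> norm (lres A l o\<^sub>L W) <= KW * (cmod l powr \<beta> * Lg (cmod l) powr a)"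
  and z: "z \<in> Om c \<alpha> a Z" and y: "0 < y" "y <= cmod z" "cmod z <= 2 * y" "y <= 1/2"
 shows "norm (lres A z o\<^sub>L W) <= 2 * KW * 2 powr \<bar>\<beta>\<bar> * 2 powr a * (y powr \<beta> * Lg y powr a)"
proof -
 have cmp: "u powr \<beta> * Lg u powr a <= 2 powr \<bar>\<beta>\<bar> * 2 powr a * (y powr \<beta> * Lg y powr a)" if u: "y / 2 <= u" "u <= 2 * y" for u
 proof -
  have u0: "u > 0" using u y by linarith
  have "Lg u <= Lg (y / 2)" using u y by (intro Lg_antimono) auto
  also have "\<dots> <= 2 * Lg y" using y by (intro Lg_half) auto
  finally have "Lg u powr a <= (2 * Lg y) powr a" using a Lg_pos[OF u0] by (intro powr_mono2) auto
  then have "Lg u powr a <= 2 powr a * Lg y powr a" using Lg_pos[OF y(1)] by (simp add: powr_mult)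
  then have "u powr \<beta> * Lg u powr a <= (2 powr \<bar>\<beta>\<bar> * y powr \<beta>) * (2 powr a * Lg y powr a)"
   by (intro mult_mono powr_le_doubling y u) auto
  then show ?thesis by (simp add: mult_ac)
 qed
 let ?B = "2 powr \<bar>\<beta>\<bar> * 2 powr a * (y powr \<beta> * Lg y powr a)"
 have B0: "?B \<ge> 0" by simp
 have eqB: "2 * KW * 2 powr \<bar>\<beta>\<bar> * 2 powr a * (y powr \<beta> * Lg y powr a) = 2 * (KW * ?B)" by simp
 show ?thesis
 proof (cases "Re z < 0")
  case False
  have "norm (lres A z o\<^sub>L W) <= KW * (cmod z powr \<beta> * Lg (cmod z) powr a)" using False y by (intro KW) auto
  also have "\<dots> <= KW * ?B" using KW y by (intro mult_left_mono cmp) auto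
  finally show ?thesis unfolding eqB using KW B0 mult_nonneg_nonneg[of KW ?B] by linarith
 next
  case True
  define u where "u = \<bar>Im z\<bar>"
  have u0: "u > 0" using z True hc_0[OF c(1) \<alpha> a] by (cases "Im z = 0") (auto simp: Om_def u_def)
  have "\<bar>Re z\<bar> < 2 * hc c \<alpha> a u" using z True by (simp add: Om_def u_def)
  also have "\<dots> <= 2 * (c * u)" using hc_le_linear[OF c(1) \<alpha> a u0] by simp
  also have "\<dots> <= 2 * (1/2 * u)" using c u0 by (intro mult_left_mono mult_right_mono) auto
  finally have "cmod z <= 2 * u" using cmod_le[of z] by (simp add: u_def)
  then have u: "y / 2 <= u" "u <= 2 * y" using y abs_Im_le_cmod[of z] by (auto simp: u_def)
  have nC: "cmod (Complex 0 (Im z)) = u" by (simp add: u_def cmod_def)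
  have "norm (lres A z o\<^sub>L W) <= 2 * norm (lres A (Complex 0 (Im z)) o\<^sub>L W)"
   by (rule Om_resolvent(2)[OF A \<alpha> a c res bd K z True])
  also have "norm (lres A (Complex 0 (Im z)) o\<^sub>L W) <= KW * (u powr \<beta> * Lg u powr a)"
  proof -
   have nz: "Complex 0 (Im z) ~= 0" using u0 by (auto simp: u_def complex_eq_iff)
   show ?thesis using KW(2)[OF nz] unfolding nC using u y by simp
  qed
  also have "\<dots> <= KW * ?B" using KW by (intro mult_left_mono cmp u) auto
  finally show ?thesis unfolding eqB by simp
 qed
qed

text \<open>The constant X is independent of t, x and \<phi>, as \<phi> is later chosen for each t
  and x. The integer power of \<open>A (1 + A)^(-1)\<close> yields the factor \<open>z^n\<close>
  only up to the remainder of \<open>lres_bpow\<close>. That remainder is regular at the origin, so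
  the increment of its primitive G is estimated on the line \<open>Re z = - \<kappa>\<close>, and Q
  - G is estimated along the curve.\<close>

lemma contour_integral_estimate:
 fixes A :: "'a::complex_banach lop"
 assumes A: "sectorial A" and \<alpha>: "\<alpha> \<ge> 1" and a: "a > 0" and c: "c > 0" "c <= 1/2" "4 * c * C <= 1" "2 * c * K <= 1" and C: "C > 0"
  and res: "!!l. l ~= 0 ==> Re l \<ge> 0 ==> - l \<in> resolvent_set A"
  and bd: "!!l. l ~= 0 ==> Re l \<ge> 0 ==> cmod l <= 1 ==> norm (lres A l) <= C * cmod l powr (- \<alpha>) * Lg (cmod l) powr a"
  and K: "!!y. 1/2 <= \<bar>y\<bar> ==> \<bar>y\<bar> <= Y + 1 ==> norm (lres A (Complex 0 y)) <= K" and Y: "Y \<ge> 1"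
  and \<sigma>: "\<sigma> > \<alpha> - 1" and m: "m = (\<sigma> + 1) / \<alpha> - 1" and \<kappa>: "\<kappa> = hc c \<alpha> a (1/2)"
 obtains X where "X \<ge> 0" "!!t x \<phi> Q. t \<ge> 1 ==> \<phi> \<in> clinear_ops ==> norm \<phi> <= 2 ==>
  (!!z. z \<in> Om c \<alpha> a (Y + 1) ==> (Q has_field_derivative exp (z * of_real t) * \<phi> (lres A z (dop A 0 \<sigma> x))) (at z)) ==>
  cmod (Q (Complex (- \<kappa>) Y) - Q (Complex (- \<kappa>) (- Y))) <= X * norm x * (exp (- \<kappa> * t) + t powr (- m) * Lg (1 / (2 * t)) powr (a * (m + 1)) * (ln t + 1))"
proof -
 have lin: "linear_operator A" using A by (auto simp: sectorial_def sectorial_of_angle_def)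
 define s where "s = frac \<sigma>"
 define n where "n = nat \<lfloor>\<sigma>\<rfloor>"
 define W where "W = (if s = 0 then id_blinfun else id_blinfun - dfrac_integral A 0 s)"
 have \<sigma>0: "\<sigma> > 0" using \<sigma> \<alpha> by simp
 have ns: "\<sigma> = real n + s" using frac_split[of \<sigma>] \<sigma>0 by (simp add: n_def s_def)
 have s: "0 <= s" "s < 1" by (simp_all add: s_def frac_lt_1)
 have dop: "dop A 0 \<sigma> = bpow (id_blinfun - pres A 1) n o\<^sub>L W" by (simp add: dop_def n_def s_def W_def)
 obtain KW where KW: "KW > 0" "!!l. l ~= 0 ==> Re l \<ge> 0 ==> cmod l <= 1 ==> norm (lres A l o\<^sub>L W) <= KW * (cmod l powr (s - \<alpha>) * Lg (cmod l) powr a)"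
  by (rule lres_frac_bound[OF A s \<alpha> a C _ W_def]) (use res bd in blast)+
 have m1: "-1 \<in> resolvent_set A" using res[of 1] by simp
 obtain R where R: "R \<ge> 0" "!!x (\<phi> :: 'a \<Rightarrow>\<^sub>L complex). \<phi> \<in> clinear_ops ==> \<exists>r. r holomorphic_on {z. Re z < 1} \<and>
  (\<forall>z. - z \<in> resolvent_set A --> Re z < 1 -->
   \<phi> (lres A z (bpow (id_blinfun - pres A 1) n x)) =
   (- z / (1 - z)) ^ n * \<phi> (lres A z x) + r z) \<and>
  (\<forall>z. Re z <= 0 --> cmod (r z) <= R * norm \<phi> * norm x)" using lres_bpow[OF lin m1, of n] by blast
 define K2 where "K2 = 2 * KW * 2 powr \<bar>s - \<alpha>\<bar> * 2 powr a"
 have K20: "K2 > 0" using KW by (simp add: K2_def)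
 have m0: "m > 0" using \<sigma> \<alpha> by (simp add: m field_simps)
 define Kp where "Kp = 2 * (m powr m) * (1 + c * (\<alpha> + a)) * c powr (- m) + 18"
 have Kp0: "Kp \<ge> 0" unfolding Kp_def using c \<alpha> a by (intro add_nonneg_nonneg mult_nonneg_nonneg) auto
 define \<Phi> where "\<Phi> = dop A 0 \<sigma>"
 have K0: "K \<ge> 0" using order_trans[OF norm_ge_zero K[of 1]] Y by simp
 have \<kappa>0: "\<kappa> > 0" unfolding \<kappa> by (rule hc_pos[OF c(1) \<alpha> a]) simp
 let ?O = "Om c \<alpha> a (Y + 1)"
 have resO: "- z \<in> resolvent_set A" if "z \<in> ?O" for z by (rule Om_resolvent(1)[OF lin \<alpha> a c res bd K that])
 define X1 where "X1 = 2 * (4 * K * norm \<Phi>) * Y + 2 * R * norm W"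
 define X2 where "X2 = 2 * 4 ^ n * K2 * Kp"
 have X: "X1 \<ge> 0" "X2 \<ge> 0" unfolding X1_def X2_def using K0 R K20 Kp0 Y by (intro add_nonneg_nonneg mult_nonneg_nonneg; simp)+
 show thesis
 proof (rule that[of "X1 + X2"])
  show "X1 + X2 \<ge> 0" using X by simp
  fix t :: real and x and \<phi> :: "'a \<Rightarrow>\<^sub>L complex" and Q
  assume t: "t \<ge> 1" and f: "\<phi> \<in> clinear_ops" "norm \<phi> <= 2"
   and Q: "!!z. z \<in> ?O ==> (Q has_field_derivative exp (z * of_real t) * \<phi> (lres A z (dop A 0 \<sigma> x))) (at z)"
  define P where "P = t powr (- m) * Lg (1 / (2 * t)) powr (a * (m + 1)) * (ln t + 1)"
  have P0: "P \<ge> 0" unfolding P_def using ln_ge_zero[OF t] by (intro mult_nonneg_nonneg) auto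
  let ?v = "%y. Complex (- \<kappa>) y"
  have nphi: "cmod (\<phi> v) <= 2 * norm v" for v
   by (rule order_trans[OF norm_blinfun mult_right_mono]) (use f in auto)
  have far: "cmod (Q (?v (sg * Y)) - Q (?v (sg * (1/2)))) <= exp (- \<kappa> * t) * (4 * K * norm \<Phi> * norm x) * Y" if sg: "sg = 1 \<or> sg = (-1::real)" for sg
  proof -
   \<comment> \<open>The condition with \<open>\<i> * of_real sg\<close> says
     \<open>sg * Im z >= 1/2\<close>, so the set is one of the two vertical segments, written as an
     intersection of half-planes.\<close>
   let ?S = "{z. Re z <= - \<kappa>} \<inter> {z. Re z \<ge> - \<kappa>} \<inter> {z. 1/2 <= Re (- (\<i> * of_real sg) * z)} \<inter> {z. Im z <= Y} \<inter> {z. - Y <= Im z}"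
   have "cmod (Q (?v (sg * Y)) - Q (?v (sg * (1/2)))) <= exp (- \<kappa> * t) * (4 * K * norm \<Phi> * norm x) * cmod (?v (sg * Y) - ?v (sg * (1/2)))"
   proof (rule field_differentiable_bound[where S="?S"])
    have e: "{z. 1/2 <= Re (- (\<i> * of_real sg) * z)} = {z. (\<i> * of_real sg) \<bullet> z \<ge> 1/2}" by (auto simp: inner_complex_def)
    have cv: "convex {z. 1/2 <= Re (- (\<i> * of_real sg) * z)}" unfolding e by (rule convex_halfspace_ge)
    show "convex ?S"
     by (intro convex_Int convex_halfspace_Re_le convex_halfspace_Re_ge convex_halfspace_Im_le convex_halfspace_Im_ge cv)
    fix z assume "z \<in> ?S"
    then have z: "Re z = - \<kappa>" "1/2 <= \<bar>Im z\<bar>" "\<bar>Im z\<bar> <= Y" using sg by auto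
    have "hc c \<alpha> a \<bar>Im z\<bar> = \<kappa>" using z(2) unfolding \<kappa> hc_def by (simp add: min_absorb2)
    then have zO: "z \<in> ?O" using z \<kappa>0 by (simp add: Om_def)
    show "(Q has_field_derivative exp (z * of_real t) * \<phi> (lres A z (dop A 0 \<sigma> x)))
     (at z within ?S)"
     by (rule has_field_derivative_at_within[OF Q[OF zO]])
    have "norm (lres A z) <= 2 * norm (lres A (Complex 0 (Im z)))"
     using Om_resolvent(2)[OF lin \<alpha> a c res bd K zO, where W=id_blinfun] z \<kappa>0 by simp
    also have "\<dots> <= 2 * K" using K[of "Im z"] z by simp
    finally have nl: "norm (lres A z) <= 2 * K" .
    have "norm (lres A z (\<Phi> x)) <= 2 * K * (norm \<Phi> * norm x)"
     by (rule order_trans[OF norm_blinfun]) (use nl norm_blinfun[of \<Phi> x] K0 in \<open>intro mult_mono, auto\<close>)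
    then have "cmod (\<phi> (lres A z (\<Phi> x))) <= 4 * K * norm \<Phi> * norm x"
     using nphi[of "lres A z (\<Phi> x)"] by simp
    then show "cmod (exp (z * of_real t) * \<phi> (lres A z (dop A 0 \<sigma> x))) <= exp (- \<kappa> * t) * (4 * K * norm \<Phi> * norm x)"
     using z by (simp add: norm_mult norm_exp_eq_Re \<Phi>_def)
   qed (use Y sg in auto)
   also have "\<dots> <= exp (- \<kappa> * t) * (4 * K * norm \<Phi> * norm x) * Y"
   proof (intro mult_left_mono)
    have "?v (sg * Y) - ?v (sg * (1/2)) = of_real (sg * (Y - 1/2)) * \<i>" by (simp add: complex_eq_iff algebra_simps)
    then have "cmod (?v (sg * Y) - ?v (sg * (1/2))) = \<bar>sg * (Y - 1/2)\<bar>" by (simp only: norm_mult norm_of_real norm_ii mult_1_right)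
    then show "cmod (?v (sg * Y) - ?v (sg * (1/2))) <= Y" using sg Y by auto
   qed (use K0 in auto)
   finally show ?thesis .
  qed
  define u where "u = W x"
  obtain r where r: "r holomorphic_on {z. Re z < 1}"
   "!!z. - z \<in> resolvent_set A ==> Re z < 1 ==>
    \<phi> (lres A z (bpow (id_blinfun - pres A 1) n u)) =
    (- z / (1 - z)) ^ n * \<phi> (lres A z u) + r z"
   "!!z. Re z <= 0 ==> cmod (r z) <= R * norm \<phi> * norm u" using R(2)[OF f(1), of u] by blast
  have oH: "open {z. Re z < 1}" by (rule open_halfspace_Re_lt)
  \<comment> \<open>The half-plane \<open>Re z < 1\<close> contains the origin: G is defined across
    the possible singularity of the resolvent.\<close>
  have "(%z. exp (z * of_real t) * r z) holomorphic_on {z. Re z < 1}" by (intro holomorphic_intros r)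
  from holomorphic_convex_primitive'[OF convex_halfspace_Re_lt oH this]
  obtain G where "!!z. z \<in> {z. Re z < 1} ==> (G has_field_derivative exp (z * of_real t) * r z) (at z within {z. Re z < 1})" by blast
  then have G: "(G has_field_derivative exp (z * of_real t) * r z) (at z)" if "Re z < 1" for z
   using that at_within_open[OF _ oH, of z] by (metis (mono_tags) mem_Collect_eq)
  define g where "g = (%z. exp (z * of_real t) * ((- z / (1 - z)) ^ n * \<phi> (lres A z u)))"
  have D: "((%z. Q z - G z) has_field_derivative g z) (at z)" if z: "z \<in> ?O" "Re z <= 1/2" for z
  proof -
   have z1: "Re z < 1" using z by simp
   have "g z = exp (z * of_real t) * \<phi> (lres A z (dop A 0 \<sigma> x)) - exp (z * of_real t) * r z"
    using r(2)[OF resO[OF z(1)] z1] by (simp add: g_def dop u_def algebra_simps)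
   then show ?thesis using DERIV_diff[OF Q[OF z(1)] G[OF z1]] by simp
  qed
  have gb: "cmod (g z) <= exp (Re z * t) * ((2 * 4 ^ n * K2 * norm x) * (y powr (\<sigma> - \<alpha>) * Lg y powr a))"
   if z: "z \<in> ?O" "Re z <= 1/2" and y: "0 < y" "y <= cmod z" "cmod z <= 2 * y" "y <= 1/2" for z y
  proof -
   have l: "norm (lres A z o\<^sub>L W) <= K2 * (y powr (s - \<alpha>) * Lg y powr a)"
    unfolding K2_def by (rule lres_Om_frac[OF lin \<alpha> a c res bd K KW z(1) y])
   have "norm (lres A z u) <= norm (lres A z o\<^sub>L W) * norm x"
    using norm_blinfun[of "lres A z o\<^sub>L W" x] by (simp add: u_def)
   also have "\<dots> <= K2 * (y powr (s - \<alpha>) * Lg y powr a) * norm x" by (intro mult_right_mono l) auto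
   finally have n1: "cmod (\<phi> (lres A z u)) <= 2 * (K2 * (y powr (s - \<alpha>) * Lg y powr a) * norm x)"
    using nphi[of "lres A z u"] by linarith
   \<comment> \<open>The restriction \<open>Re z <= 1/2\<close> on the path keeps z away from 1;
     this gives the 4 in \<open>4 ^ n\<close>.\<close>
   have "1/2 <= cmod (1 - z)" using complex_Re_le_cmod[of "1 - z"] z by simp
   then have "cmod (- z / (1 - z)) <= (2 * y) / (1/2)" unfolding norm_divide norm_minus_cancel using y by (intro frac_le) auto
   then have q: "cmod (- z / (1 - z)) ^ n <= (4 * y) ^ n" by (intro power_mono) auto
   have "cmod (g z) = exp (Re z * t) * (cmod (- z / (1 - z)) ^ n * cmod (\<phi> (lres A z u)))"
    unfolding g_def norm_mult norm_power norm_exp_eq_Re by simp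
   also have "\<dots> <= exp (Re z * t) * ((4 * y) ^ n * (2 * (K2 * (y powr (s - \<alpha>) * Lg y powr a) * norm x)))"
    using y by (intro mult_left_mono mult_mono q n1) auto
   also have "(4 * y) ^ n * (2 * (K2 * (y powr (s - \<alpha>) * Lg y powr a) * norm x)) = (2 * 4 ^ n * K2 * norm x) * ((y powr real n * y powr (s - \<alpha>)) * Lg y powr a)"
    using y by (simp add: power_mult_distrib powr_realpow mult_ac)
   also have "y powr real n * y powr (s - \<alpha>) = y powr (\<sigma> - \<alpha>)" by (simp add: ns algebra_simps flip: powr_add)
   finally show ?thesis .
  qed
  have mid: "cmod ((Q (?v (1/2)) - G (?v (1/2))) - (Q (?v (- (1/2))) - G (?v (- (1/2))))) <= (2 * 4 ^ n * K2 * norm x) * Kp * P"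
   unfolding \<kappa> Kp_def P_def
   by (rule path_estimate[OF c(1) \<alpha> a c(2) \<sigma> m t _ _ D gb exp_le_powr[OF m0]]) (use K20 Y in auto)
  have reg: "cmod (G (?v (1/2)) - G (?v (- (1/2)))) <= exp (- \<kappa> * t) * (2 * R * norm W * norm x)"
  proof -
   have "cmod (G (?v (1/2)) - G (?v (- (1/2)))) <= exp (- \<kappa> * t) * (2 * R * norm W * norm x) * cmod (?v (1/2) - ?v (- (1/2)))"
   proof (rule field_differentiable_bound[where S="{z. Re z <= - \<kappa>} \<inter> {z. Re z \<ge> - \<kappa>}"])
    show "convex ({z. Re z <= - \<kappa>} \<inter> {z. Re z \<ge> - \<kappa>})"
     by (intro convex_Int convex_halfspace_Re_le convex_halfspace_Re_ge)
    fix z assume "z \<in> {z. Re z <= - \<kappa>} \<inter> {z. Re z \<ge> - \<kappa>}"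
    then have z: "Re z = - \<kappa>" by auto
    show "(G has_field_derivative exp (z * of_real t) * r z) (at z within ({z. Re z <= - \<kappa>} \<inter> {z. Re z \<ge> - \<kappa>}))"
     by (rule has_field_derivative_at_within[OF G]) (use z \<kappa>0 in simp)
    have "cmod (r z) <= R * norm \<phi> * norm u" using z \<kappa>0 by (intro r(3)) simp
    also have "\<dots> <= R * 2 * (norm W * norm x)" using R f norm_blinfun[of W x] by (intro mult_mono mult_left_mono) (auto simp: u_def)
    finally show "cmod (exp (z * of_real t) * r z) <= exp (- \<kappa> * t) * (2 * R * norm W * norm x)"
     using z by (simp add: norm_mult norm_exp_eq_Re mult_ac)
   qed auto
   also have "?v (1/2) - ?v (- (1/2)) = \<i>" by (simp add: complex_eq_iff)
   finally show ?thesis by simp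
  qed
  have tri: "norm (p1 - p2) <= norm (p1 - v1) + norm (p2 - v2) + norm ((v1 - g1) - (v2 - g2)) + norm (g1 - g2)" for p1 p2 v1 v2 g1 g2 :: complex
  proof -
   have "norm (p1 - p2) = norm (((p1 - v1) - (p2 - v2)) + (((v1 - g1) - (v2 - g2)) + (g1 - g2)))" by simp
   also have "\<dots> <= norm ((p1 - v1) - (p2 - v2)) + norm (((v1 - g1) - (v2 - g2)) + (g1 - g2))" by (rule norm_triangle_ineq)
   also have "\<dots> <= (norm (p1 - v1) + norm (p2 - v2)) + (norm ((v1 - g1) - (v2 - g2)) + norm (g1 - g2))"
    by (rule add_mono[OF norm_triangle_ineq4 norm_triangle_ineq])
   finally show ?thesis by (simp only: add.assoc)
  qed
  have "cmod (Q (?v Y) - Q (?v (- Y))) <= exp (- \<kappa> * t) * (4 * K * norm \<Phi> * norm x) * Y + exp (- \<kappa> * t) * (4 * K * norm \<Phi> * norm x) * Y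
   + (2 * 4 ^ n * K2 * norm x) * Kp * P + exp (- \<kappa> * t) * (2 * R * norm W * norm x)"
   using tri[of "Q (?v Y)" "Q (?v (- Y))" "Q (?v (1/2))" "Q (?v (- (1/2)))" "G (?v (1/2))" "G (?v (- (1/2)))"]
    far[OF disjI1[OF refl], unfolded mult_1] far[OF disjI2[OF refl], unfolded mult_minus1] mid reg by linarith
  also have "\<dots> = X1 * norm x * exp (- \<kappa> * t) + X2 * norm x * P" by (simp add: X1_def X2_def algebra_simps)
  also have "\<dots> <= (X1 + X2) * norm x * exp (- \<kappa> * t) + (X1 + X2) * norm x * P"
   using X P0 by (intro add_mono mult_right_mono) auto
  finally show "cmod (Q (?v Y) - Q (?v (- Y))) <= (X1 + X2) * norm x * (exp (- \<kappa> * t) + t powr (- m) * Lg (1 / (2 * t)) powr (a * (m + 1)) * (ln t + 1))"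
   by (simp add: P_def distrib_left)
 qed
qed

section \<open>The decay estimate\<close>

lemma asymptotically_analyticE:
 fixes T :: "real => 'a::complex_banach \<Rightarrow>\<^sub>L 'a"
 assumes "asymptotically_analytic T"
 obtains \<epsilon> \<xi> w M N F where "\<epsilon> > 0" "0 < \<xi>" "\<xi> <= pi" "w \<ge> 0" "M \<ge> 0" "N \<ge> 0"
  "!!z. z \<in> sector \<xi> ==> F z \<in> clinear_ops" "banach_holomorphic_on F (sector \<xi>)"
  "!!z. z \<in> sector \<xi> ==> norm (F z) <= M * exp (w * cmod z)"
  "!!t. t > 0 ==> norm (T t - F (of_real t)) <= N * exp (- \<epsilon> * t)"
proof -
 \<comment> \<open>A negative infimum provides an exponent w0 < 0 in the set itself; the decay rate
   is - w0.\<close>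
 obtain w0 S where w0: "w0 < 0" and S: "S \<in> exp_bounded_analytic" "bdd_above ((%t. exp (- t * w0) * norm (T t - S t)) ` {0<..})"
  using assms unfolding asymptotically_analytic_def nonanalytic_growth_bound_def Inf_less_iff
  by (auto simp: zero_ereal_def)
 obtain \<xi> F M w where F: "0 < \<xi>" "\<xi> <= pi" "\<forall>z\<in>sector \<xi>. F z \<in> clinear_ops" "banach_holomorphic_on F (sector \<xi>)"
  "\<forall>t>0. F (of_real t) = S t" "\<forall>z\<in>sector \<xi>. norm (F z) <= M * exp (w * cmod z)"
  using S(1) unfolding exp_bounded_analytic_def by blast
 obtain N where N: "!!t. t > 0 ==> exp (- t * w0) * norm (T t - S t) <= N"
  using S(2) unfolding bdd_above_def by auto
 show thesis
 proof (rule that[of "- w0" \<xi> "max w 0" "\<bar>M\<bar>" "\<bar>N\<bar>" F])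
  fix z assume z: "z \<in> sector \<xi>"
  have "norm (F z) <= M * exp (w * cmod z)" using F(6) z by blast
  also have "\<dots> <= \<bar>M\<bar> * exp (max w 0 * cmod z)" by (intro mult_mono) (auto intro: mult_right_mono)
  finally show "norm (F z) <= \<bar>M\<bar> * exp (max w 0 * cmod z)" .
 next
  fix t :: real assume t: "t > 0"
  have "norm (T t - S t) = exp (t * w0) * (exp (- t * w0) * norm (T t - S t))"
   unfolding mult.assoc[symmetric] exp_add[symmetric] by simp
  also have "\<dots> <= exp (t * w0) * \<bar>N\<bar>" using N[OF t] by (intro mult_left_mono) auto
  finally show "norm (T t - F (of_real t)) <= \<bar>N\<bar> * exp (- (- w0) * t)" using F(5) t by (simp add: mult.commute)
 qed (use w0 F in auto)
qed

lemma functional_banach_holomorphic: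
 fixes \<phi> :: "'a::complex_banach \<Rightarrow>\<^sub>L complex" and F :: "complex => 'a \<Rightarrow>\<^sub>L 'a"
 assumes "banach_holomorphic_on F S" "\<phi> \<in> clinear_ops"
 shows "(%z. \<phi> (F z x)) holomorphic_on S"
proof (rule holomorphic_onI)
 fix z assume "z \<in> S"
 then obtain D where D: "(F has_derivative (%h. h *\<^sub>C D)) (at z within S)" using assms(1) by (auto simp: banach_holomorphic_on_def)
 have bl: "bounded_linear (%B::'a \<Rightarrow>\<^sub>L 'a. \<phi> (B x))"
  by (intro bounded_linear_compose[OF blinfun.bounded_linear_right] blinfun.bounded_linear_left)
 from bounded_linear.has_derivative[OF bl D]
 have "((%z. \<phi> (F z x)) has_derivative (%h. \<phi> (D x) * h)) (at z within S)"
  by (simp add: scaleC_blinfun.rep_eq clinear_opsD[OF assms(2)] scaleC_complex_def mult.commute)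
 then show "(%z. \<phi> (F z x)) field_differentiable at z within S"
  unfolding field_differentiable_def has_field_derivative_def by (intro exI) simp
qed

text \<open>Compactness: heights between 1/2 and Z in size stay away from 0, the only point of the
  imaginary axis where the resolvent may be singular.\<close>

lemma lres_imaginary_bounded:
 fixes A :: "'a::complex_banach lop"
 assumes A: "linear_operator A" and res: "!!l. l ~= 0 ==> Re l \<ge> 0 ==> - l \<in> resolvent_set A"
 obtains K where "K > 0" "!!y. 1/2 <= \<bar>y\<bar> ==> \<bar>y\<bar> <= Z ==> norm (lres A (Complex 0 y)) <= K"
proof -
 let ?I = "{- Z..-1/2} \<union> {1/2..Z}"
 have "continuous_on ?I (%y. lres A (Complex 0 y))"
  unfolding lres_def
 proof (rule continuous_on_minus, rule continuous_on_resolvent[OF A])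
  show "continuous_on ?I (%y. - Complex 0 y)" unfolding Complex_eq by (intro continuous_intros)
  show "(%y. - Complex 0 y) ` ?I \<subseteq> resolvent_set A" using res by (auto simp: complex_eq_iff)
 qed
 then have "compact ((%y. lres A (Complex 0 y)) ` ?I)" by (rule compact_continuous_image) auto
 then have "bounded ((%y. lres A (Complex 0 y)) ` ?I)" by (rule compact_imp_bounded)
 then obtain K where Kb: "\<forall>v\<in>(%y. lres A (Complex 0 y)) ` ?I. norm v <= K" unfolding bounded_iff ..
 have K: "norm (lres A (Complex 0 y)) <= K" if "y \<in> ?I" for y by (rule bspec[OF Kb imageI[OF that]])
 show thesis
 proof (rule that[of "\<bar>K\<bar> + 1"])
  fix y assume "1/2 <= \<bar>y\<bar>" "\<bar>y\<bar> <= Z"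
  then have "y \<in> ?I" by auto
  from K[OF this] show "norm (lres A (Complex 0 y)) <= \<bar>K\<bar> + 1" by linarith
 qed simp
qed

text \<open>Norms are read off with a norming functional that depends on t and x, so all constants
  are fixed before it. They are chosen in the order \<psi>, Y, K, c, \<kappa>, X, because c depends
  on the resolvent bound K up to height Y + 1.\<close>

lemma semigroup_decay:
 fixes A :: "'a::complex_banach lop" and T :: "real => 'a \<Rightarrow>\<^sub>L 'a"
 assumes A: "sectorial A" and T: "C0_semigroup T" and gen: "generator T = neg_op A" and aa: "asymptotically_analytic T"
  and \<alpha>: "\<alpha> \<ge> 1" and a: "a > 0" and C: "C > 0"
  and res: "!!l. l ~= 0 ==> Re l \<ge> 0 ==> - l \<in> resolvent_set A"
  and bd: "!!l. l ~= 0 ==> Re l \<ge> 0 ==> cmod l <= 1 ==> norm (lres A l) <= C * cmod l powr (- \<alpha>) * Lg (cmod l) powr a"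
  and \<sigma>: "\<sigma> > \<alpha> - 1" and m: "m = (\<sigma> + 1) / \<alpha> - 1"
 obtains B where "B > 0" "!!t. t \<ge> 1 ==> norm (T t o\<^sub>L dop A 0 \<sigma>) <= B * (t powr (- m) * Lg (1 / (2 * t)) powr (a * (m + 1)) * (ln t + 1))"
proof (rule asymptotically_analyticE[OF aa])
 have lin: "linear_operator A" using A by (auto simp: sectorial_def sectorial_of_angle_def)
 fix \<epsilon> \<xi> w M N and F :: "complex => 'a \<Rightarrow>\<^sub>L 'a"
 assume eps: "\<epsilon> > 0" and \<xi>: "0 < \<xi>" "\<xi> <= pi" and w: "w \<ge> 0" and M: "M \<ge> 0" and N: "N \<ge> 0"
  and Fc: "!!z. z \<in> sector \<xi> ==> F z \<in> clinear_ops" and Fh: "banach_holomorphic_on F (sector \<xi>)"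
  and Fb: "!!z. z \<in> sector \<xi> ==> norm (F z) <= M * exp (w * cmod z)"
  and TF: "!!t. t > 0 ==> norm (T t - F (of_real t)) <= N * exp (- \<epsilon> * t)"
 have Tb: "norm (T t) <= (M + N + 1) * exp (w * t)" if "t \<ge> 0" for t
 proof (cases "t = 0")
  case True
  have "T 0 = id_blinfun" using T by (simp add: C0_semigroup_def)
  then have "norm (T 0) <= 1" by (simp add: norm_blinfun_id_le)
  then show ?thesis using True M N by simp
 next
  case False
  then have t: "t > 0" using that by simp
  then have "complex_of_real t \<in> sector \<xi>" using \<xi> by (auto simp: sector_def Arg_eq_0)
  from Fb[OF this] have 1: "norm (F (of_real t)) <= M * exp (w * t)" using t by simp
  have "- \<epsilon> * t <= 0" using eps t by simp
  moreover have "0 <= w * t" using w t by simp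
  ultimately have "exp (- \<epsilon> * t) <= exp (w * t)" by (simp only: exp_le_cancel_iff)
  then have 2: "N * exp (- \<epsilon> * t) <= N * exp (w * t)" using N by (intro mult_left_mono)
  have "norm (T t) <= norm (F (of_real t)) + norm (T t - F (of_real t))" using norm_triangle_ineq[of "F (of_real t)" "T t - F (of_real t)"] by simp
  then have "norm (T t) <= M * exp (w * t) + N * exp (w * t)" using 1 2 TF[OF t] by linarith
  moreover have "(M + N + 1) * exp (w * t) = M * exp (w * t) + N * exp (w * t) + exp (w * t)" by (simp add: distrib_right)
  ultimately show ?thesis using exp_ge_zero[of "w * t"] by linarith
 qed
 \<comment> \<open>Half of the minimum is strictly below both \<xi> and pi / 2, so the rays lie in
   the sector and sine and cosine are positive.\<close>
 define \<psi> where "\<psi> = min \<xi> (pi / 2) / 2"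
 have \<psi>: "0 < \<psi>" "\<psi> < \<xi>" "\<psi> < pi / 2" using \<xi> pi_gt_zero by (auto simp: \<psi>_def min_def)
 have sp: "0 < sin \<psi>" "sin \<psi> <= 1" using \<psi> by (auto intro: sin_gt_zero)
 \<comment> \<open>At this height the ray integrals still converge at the end points of the path,
   although these have negative real part.\<close>
 define Y where "Y = (w + 2) / sin \<psi>"
 have Y: "w + 2 <= Y * sin \<psi>" using sp by (simp add: Y_def)
 have Y1: "Y \<ge> 1"
 proof -
  have "(w + 2) / 1 <= Y" unfolding Y_def using sp w by (intro divide_left_mono) auto
  then show ?thesis using w by simp
 qed
 obtain K where K: "K > 0" "!!y. 1/2 <= \<bar>y\<bar> ==> \<bar>y\<bar> <= Y + 1 ==> norm (lres A (Complex 0 y)) <= K"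
  using lres_imaginary_bounded[OF lin res] by blast
 \<comment> \<open>The bound 1/2 keeps the curve in a cone around the imaginary axis,
   \<open>1 / (4 * C)\<close> and \<open>1 / (2 * K)\<close> are for the Neumann series below and
   above height 1/2, and \<open>\<epsilon> / 2\<close> yields 2 \<kappa> < \<epsilon>.\<close>
 define c where "c = min (min (1/2) (1 / (4 * C))) (min (1 / (2 * K)) (\<epsilon> / 2))"
 have c: "0 < c" "c <= 1/2" "c <= 1 / (4 * C)" "c <= 1 / (2 * K)" "c <= \<epsilon> / 2" using C K eps by (auto simp: c_def)
 have c34: "4 * c * C <= 1" "2 * c * K <= 1" using c(3,4) C K by (auto simp: field_simps)
 define \<kappa> where "\<kappa> = hc c \<alpha> a (1/2)"
 have "\<kappa> <= c * (1/2)" unfolding \<kappa>_def by (rule hc_le_linear[OF c(1) \<alpha> a]) simp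
 then have \<kappa>: "0 < \<kappa>" "\<kappa> <= 1/4" "2 * \<kappa> < \<epsilon>" using hc_pos[OF c(1) \<alpha> a, of "1/2"] c eps by (auto simp: \<kappa>_def)
 obtain X where X: "X \<ge> 0" "!!t x (\<phi> :: 'a \<Rightarrow>\<^sub>L complex) Q. t \<ge> 1 ==> \<phi> \<in> clinear_ops ==> norm \<phi> <= 2 ==>
  (!!z. z \<in> Om c \<alpha> a (Y + 1) ==> (Q has_field_derivative exp (z * of_real t) * blinfun_apply \<phi> (blinfun_apply (lres A z) (blinfun_apply (dop A 0 \<sigma>) x))) (at z)) ==>
  cmod (Q (Complex (- \<kappa>) Y) - Q (Complex (- \<kappa>) (- Y))) <= X * norm x * (exp (- \<kappa> * t) + t powr (- m) * Lg (1 / (2 * t)) powr (a * (m + 1)) * (ln t + 1))"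
  using contour_integral_estimate[OF A \<alpha> a c(1,2) c34 C res bd K(2) Y1 \<sigma> m \<kappa>_def] by blast
 obtain C1 where C1: "C1 > 0" "!!r. r > 0 ==> exp (- 1 * r) <= C1 * mp 1 r" using exp_le_mp[of 1] by auto
 have C1': "exp (- r) <= C1 * mp 1 r" if "r > 0" for r using C1(2)[OF that] by simp
 have "\<epsilon> - \<kappa> > 0" using \<kappa> by simp
 then obtain C2 where C2: "C2 > 0" "!!r. r > 0 ==> exp (- (\<epsilon> - \<kappa>) * r) <= C2 * mp 1 r" using exp_le_mp by blast
 define \<Phi> where "\<Phi> = dop A 0 \<sigma>"
 define J where "J = integral {0<..} (mp 1)"
 have J: "J \<ge> 0" unfolding J_def by (intro integral_nonneg mp_integrable mp_nonneg) auto
 define s where "s = sqrt ((1 - cos \<psi>) / 2)"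
 have s: "s \<ge> 0" using cos_le_one[of \<psi>] by (simp add: s_def del: cos_le_one)
 define X3 where "X3 = (2 * (2 * M * norm \<Phi>) * C1 / s + 2 * Y * (2 * N * norm \<Phi>) * C2) * J"
 have X3: "X3 \<ge> 0" unfolding X3_def using M N C1 C2 J s Y1 by (intro mult_nonneg_nonneg add_nonneg_nonneg divide_nonneg_nonneg) auto
 have m0: "m > 0" using \<sigma> \<alpha> by (simp add: m field_simps)
 \<comment> \<open>The exponentially small terms are absorbed into the main term by
   \<open>exp (- \<kappa> * t) <= E * t powr (- m)\<close>.\<close>
 define E where "E = m powr m * \<kappa> powr (- m)"
 have E0: "E \<ge> 0" by (simp add: E_def)
 define B where "B = (X3 + X + 2 * N * norm \<Phi>) * E + X + 1"
 have B: "B > 0" unfolding B_def using X3 X N E0 by (intro add_nonneg_pos add_nonneg_nonneg mult_nonneg_nonneg) auto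
 let ?O = "Om c \<alpha> a (Y + 1)"
 have resO: "uminus ` ?O \<subseteq> resolvent_set A" using Om_resolvent(1)[OF lin \<alpha> a c(1,2) c34 res bd K(2)] by blast
 show thesis
 proof (rule that[OF B])
  fix t :: real assume t: "t \<ge> 1"
  define P where "P = t powr (- m) * Lg (1 / (2 * t)) powr (a * (m + 1)) * (ln t + 1)"
  have Lt: "Lg (1 / (2 * t)) \<ge> 1" using t by (intro Lg_ge_one) auto
  have "t powr (- m) * 1 * 1 <= P" unfolding P_def
   using Lt a m0 ln_ge_zero[OF t] by (intro mult_mono ge_one_powr_ge_zero) auto
  then have P1: "t powr (- m) <= P" by simp
  then have P0: "P \<ge> 0" using order_trans[OF powr_ge_zero] by blast
  have "exp (- \<kappa> * t) <= m powr m * (\<kappa> * t) powr (- m)" using exp_le_powr[OF m0, of "\<kappa> * t"] \<kappa> t by simp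
  also have "\<dots> = E * t powr (- m)" using \<kappa> t by (simp add: E_def powr_mult)
  also have "\<dots> <= E * P" using E0 P1 by (intro mult_left_mono)
  finally have ek: "exp (- \<kappa> * t) <= E * P" .
  show "norm (T t o\<^sub>L dop A 0 \<sigma>) <= B * (t powr (- m) * Lg (1 / (2 * t)) powr (a * (m + 1)) * (ln t + 1))"
   unfolding P_def[symmetric]
  proof (rule norm_blinfun_bound)
   show "0 <= B * P" using B P0 by simp
   fix x
   define v where "v = blinfun_apply \<Phi> x"
   have nv: "norm v <= norm \<Phi> * norm x" unfolding v_def by (rule norm_blinfun)
   \<comment> \<open>The functional recovers the norm of \<open>T t v\<close>, so it suffices to
     bound one complex number; the bound 2 for its norm enters the constants.\<close>
   obtain \<phi> :: "'a \<Rightarrow>\<^sub>L complex" where f: "\<phi> \<in> clinear_ops" "norm \<phi> <= 2" "Re (blinfun_apply \<phi> (blinfun_apply (T t) v)) = norm (blinfun_apply (T t) v)"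
    using norming_functional by blast
   have nphi: "cmod (blinfun_apply \<phi> (blinfun_apply W v)) <= b * (2 * norm \<Phi> * norm x)" if "norm W <= b" for W :: "'a \<Rightarrow>\<^sub>L 'a" and b
   proof -
    have "b \<ge> 0" using that norm_ge_zero order_trans by blast
    have "cmod (blinfun_apply \<phi> (blinfun_apply W v)) <= norm \<phi> * (norm W * norm v)"
     by (rule order_trans[OF norm_blinfun mult_left_mono[OF norm_blinfun]]) simp
    also have "\<dots> <= 2 * (b * (norm \<Phi> * norm x))" using f that nv \<open>b \<ge> 0\<close> by (intro mult_mono) auto
    finally show ?thesis by (simp add: mult_ac)
   qed
   define \<rho> where "\<rho> = (%z. blinfun_apply \<phi> (blinfun_apply (lres A z) v))"
   have \<rho>h: "\<rho> holomorphic_on ?O" unfolding \<rho>_def by (rule functional_lres_holomorphic[OF lin f(1) resO])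
   have Zp: "Y + 1 > 0" using Y1 by simp
   have "(%z. exp (z * of_real t) * \<rho> z) holomorphic_on ?O" by (intro holomorphic_intros \<rho>h)
   from Om_primitive[OF c(1) \<alpha> a Zp this] obtain Q where Q: "!!z. z \<in> ?O ==> (Q has_field_derivative exp (z * of_real t) * \<rho> z) (at z)" by blast
   have Qb: "cmod (Q (Complex (- \<kappa>) Y) - Q (Complex (- \<kappa>) (- Y))) <= X * norm x * (exp (- \<kappa> * t) + P)"
    unfolding P_def by (rule X(2)[OF t f(1,2)]) (use Q in \<open>simp add: \<rho>_def v_def \<Phi>_def\<close>)
   define S where "S = (%z. blinfun_apply \<phi> (blinfun_apply (F z) v))"
   have Sh: "S holomorphic_on sector \<xi>" unfolding S_def by (rule functional_banach_holomorphic[OF Fh f(1)])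
   have Sb: "cmod (S z) <= (2 * M * norm \<Phi> * norm x) * exp (w * cmod z)" if "z \<in> sector \<xi>" for z
    using nphi[OF Fb[OF that]] by (simp add: S_def mult_ac)
   define \<tau> where "\<tau> = (%r. blinfun_apply \<phi> (blinfun_apply (T r) v))"
   have \<tau>c: "continuous_on {0<..} \<tau>" unfolding \<tau>_def
    by (intro bounded_linear.continuous_on[OF blinfun.bounded_linear_right] semigroup_continuous_on[OF T Tb])
   have \<tau>S: "cmod (\<tau> r - S (of_real r)) <= (2 * N * norm \<Phi> * norm x) * exp (- \<epsilon> * r)" if "r > 0" for r
    using nphi[OF TF[OF that]] by (simp add: S_def \<tau>_def blinfun.diff_left blinfun.diff_right mult_ac)
   have lap: "integral {0<..} (%r. exp (- of_real p * of_real r) * \<tau> r) = \<rho> (of_real p)" if "p > w" for p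
    unfolding \<tau>_def \<rho>_def
    by (rule laplace_semigroup[OF lin T gen Tb _ _ f(1)]) (use res[of "of_real p"] that w in auto)
   have \<Omega>: "z \<in> ?O" if "\<bar>Im z\<bar> < Y + 1" "Re z > 0 \<or> \<bar>Im z\<bar> > 1/2 \<and> Re z > - 2 * \<kappa>" for z
   proof -
    have "\<bar>Im z\<bar> > 1/2 ==> hc c \<alpha> a \<bar>Im z\<bar> = \<kappa>" by (simp add: hc_def \<kappa>_def)
    then show ?thesis using that hc_nonneg[OF c(1) \<alpha> a, of "\<bar>Im z\<bar>"] by (auto simp: Om_def)
   qed
   have "2 * pi * cmod (S (of_real t)) <=
    (2 * (2 * M * norm \<Phi> * norm x) * C1 / sqrt ((1 - cos \<psi>) / 2) + 2 * Y * (2 * N * norm \<Phi> * norm x) * C2) * integral {0<..} (mp 1) * exp (- \<kappa> * t)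
    + cmod (Q (Complex (- \<kappa>) Y) - Q (Complex (- \<kappa>) (- Y)))"
    by (rule contour_bound[OF Sh \<xi>(2) Sb w \<psi> t \<kappa> Y \<Omega> \<rho>h Q \<tau>c \<tau>S lap C1' C2(2)])
   also have "(2 * (2 * M * norm \<Phi> * norm x) * C1 / sqrt ((1 - cos \<psi>) / 2) + 2 * Y * (2 * N * norm \<Phi> * norm x) * C2) * integral {0<..} (mp 1) = X3 * norm x"
    unfolding X3_def J_def[symmetric] s_def[symmetric] by (simp add: algebra_simps)
   finally have S2: "2 * pi * cmod (S (of_real t)) <= X3 * norm x * exp (- \<kappa> * t) + X * norm x * (exp (- \<kappa> * t) + P)" using Qb by linarith
   have "1 * cmod (S (of_real t)) <= 2 * pi * cmod (S (of_real t))" using pi_gt3 by (intro mult_right_mono) auto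
   then have S1: "cmod (S (of_real t)) <= X3 * norm x * exp (- \<kappa> * t) + X * norm x * (exp (- \<kappa> * t) + P)" using S2 by linarith
   have "- \<epsilon> * t <= - \<kappa> * t" using \<kappa> t by (intro mult_right_mono) auto
   then have "exp (- \<epsilon> * t) <= exp (- \<kappa> * t)" by (simp only: exp_le_cancel_iff)
   then have ee: "(2 * N * norm \<Phi> * norm x) * exp (- \<epsilon> * t) <= (2 * N * norm \<Phi> * norm x) * exp (- \<kappa> * t)"
    using N by (intro mult_left_mono) auto
   have "norm (blinfun_apply (T t) v) <= cmod (\<tau> t)" using f(3) complex_Re_le_cmod[of "\<tau> t"] by (simp add: \<tau>_def)
   also have "\<dots> <= cmod (S (of_real t)) + cmod (\<tau> t - S (of_real t))" using norm_triangle_ineq[of "S (of_real t)" "\<tau> t - S (of_real t)"] by simp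
   also have "\<dots> <= X3 * norm x * exp (- \<kappa> * t) + X * norm x * (exp (- \<kappa> * t) + P) + (2 * N * norm \<Phi> * norm x) * exp (- \<kappa> * t)"
    using S1 \<tau>S[of t] ee t by linarith
   also have "\<dots> = (X3 + X + 2 * N * norm \<Phi>) * norm x * exp (- \<kappa> * t) + X * norm x * P" by (simp add: algebra_simps)
   also have "\<dots> <= (X3 + X + 2 * N * norm \<Phi>) * norm x * (E * P) + X * norm x * P"
    using X3 X N by (intro add_right_mono mult_left_mono ek mult_nonneg_nonneg add_nonneg_nonneg) auto
   also have "\<dots> <= (X3 + X + 2 * N * norm \<Phi>) * norm x * (E * P) + X * norm x * P + norm x * P" using P0 by simp
   also have "\<dots> = B * P * norm x" by (simp add: B_def algebra_simps)
   finally show "norm (blinfun_apply (T t o\<^sub>L dop A 0 \<sigma>) x) <= B * P * norm x" by (simp add: v_def \<Phi>_def)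
  qed
 qed
qed

text \<open>For t >= 1, \<open>2 + 2 * t <= (1 + t)^2\<close> compares \<open>Lg\<close> with
  \<open>2 * ln (1 + t)\<close>, and \<open>ln (1 + t) >= ln 2\<close> absorbs the summand 1 and the
  surplus exponent \<delta>.\<close>

lemma Lg_log_bound:
 assumes t: "t \<ge> 1" and e: "e \<ge> 0" "\<delta> \<ge> 0"
 shows "Lg (1 / (2 * t)) powr e * (ln t + 1) <= 2 powr e * (1 + 1 / ln 2) * ln 2 powr (- \<delta>) * ln (1 + t) powr (e + 1 + \<delta>)"
proof -
 define u where "u = ln (1 + t)"
 have l2: "ln 2 > (0::real)" by simp
 have u: "ln 2 <= u" unfolding u_def using t by (subst ln_le_cancel_iff) auto
 then have u0: "u > 0" using l2 by linarith
 have "2 + 2 * t <= (1 + t) * (1 + t)" using t by (simp add: algebra_simps) (metis mult_left_mono mult_1_right order_trans zero_le_one)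
 then have "ln (2 + 2 * t) <= ln ((1 + t) * (1 + t))" using t by (subst ln_le_cancel_iff) auto
 also have "\<dots> = 2 * u" using t by (simp add: u_def ln_mult)
 finally have "Lg (1 / (2 * t)) <= 2 * u" by (simp add: Lg_def)
 moreover have "Lg (1 / (2 * t)) > 0" using t by (intro Lg_pos) auto
 ultimately have 1: "Lg (1 / (2 * t)) powr e <= 2 powr e * u powr e" using e u0 powr_mono2[of e "Lg (1 / (2 * t))" "2 * u"] by (simp add: powr_mult)
 have "ln t <= u" unfolding u_def using t by (subst ln_le_cancel_iff) auto
 moreover have "1 <= u / ln 2" using u l2 by simp
 moreover have "(1 + 1 / ln 2) * u = u + u / ln 2" by (simp add: distrib_right)
 ultimately have 2: "ln t + 1 <= (1 + 1 / ln 2) * u" by linarith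
 have "1 <= (u / ln 2) powr \<delta>" using u l2 e by (intro ge_one_powr_ge_zero) auto
 then have 3: "1 <= ln 2 powr (- \<delta>) * u powr \<delta>" using u0 l2 by (simp add: powr_divide powr_minus_divide)
 have "Lg (1 / (2 * t)) powr e * (ln t + 1) <= (2 powr e * u powr e) * ((1 + 1 / ln 2) * u)"
  using 1 2 t ln_ge_zero[OF t] by (intro mult_mono) auto
 also have "\<dots> * 1 <= \<dots> * (ln 2 powr (- \<delta>) * u powr \<delta>)" using u0 by (intro mult_left_mono 3) auto
 finally have "Lg (1 / (2 * t)) powr e * (ln t + 1) <= (2 powr e * u powr e) * ((1 + 1 / ln 2) * u) * (ln 2 powr (- \<delta>) * u powr \<delta>)" by simp
 also have "\<dots> = 2 powr e * (1 + 1 / ln 2) * ln 2 powr (- \<delta>) * (u powr e * u powr 1 * u powr \<delta>)" using u0 by simp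
 also have "u powr e * u powr 1 * u powr \<delta> = u powr (e + 1 + \<delta>)" by (simp only: powr_add)
 finally show ?thesis by (simp add: u_def)
qed

theorem theorem1p12:
 fixes A :: "'a::complex_banach lop"
  and T :: "real \<Rightarrow> 'a \<Rightarrow>\<^sub>L 'a"
  and \<alpha> a C \<sigma> :: real
 assumes "sectorial A" and "injective_operator A"
  and "C0_semigroup T" and "generator T = neg_op A"
  and "asymptotically_analytic T"
  and "closure {z. Re z < 0} - {0} \<subseteq> resolvent_set A"
  and "\<alpha> \<ge> 1" and "a > 0" and "C > 0"
  and "\<And>l. l \<in> closure {z. Re z < 0} - {0} \<Longrightarrow> cmod l \<le> 1 \<Longrightarrow>
     norm (resolvent A l) \<le> C * cmod l powr (- \<alpha>) * ln (2 + 1 / cmod l) powr a"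
  and "\<sigma> > \<alpha> - 1"
 shows "\<forall>\<delta>>0. \<exists>c>0. \<forall>t\<ge>1. \<exists>B\<in>clinear_ops.
     graph_of B = frac_power (shift_op 1 A) (- \<sigma>) O frac_power A \<sigma> O graph_of (T t) \<and>
     norm B \<le> c * t powr (1 - (\<sigma> + 1) / \<alpha>)
           * ln (1 + t) powr (a * (\<sigma> + 1) / \<alpha> + 1 + \<delta>)"
proof -
 define m where "m = (\<sigma> + 1) / \<alpha> - 1"
 have \<sigma>0: "\<sigma> \<ge> 0" using assms(7,11) by simp
 have m0: "m > 0" using assms(7,11) by (simp add: m_def field_simps)
 have "{z. Re z < 0} = {z. 1 \<bullet> z < 0}" by (simp add: inner_complex_def)
 then have cl: "closure {z. Re z < 0} = {z. Re z <= 0}"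
  using closure_halfspace_lt[of "1::complex" 0] by (simp add: inner_complex_def)
 \<comment> \<open>\<open>lres\<close> carries a sign, so the hypotheses on the left half-plane
   become statements for l in the right half-plane.\<close>
 have mem: "- l \<in> closure {z. Re z < 0} - {0}" if "l ~= 0" "Re l \<ge> 0" for l using that by (simp add: cl)
 have res: "- l \<in> resolvent_set A" if "l ~= 0" "Re l \<ge> 0" for l using mem[OF that] assms(6) by blast
 have bd: "norm (lres A l) <= C * cmod l powr (- \<alpha>) * Lg (cmod l) powr a" if "l ~= 0" "Re l \<ge> 0" "cmod l <= 1" for l
  using assms(10)[OF mem[OF that(1,2)]] that(3) by (simp add: lres_def Lg_def)
 obtain B where B: "B > 0" "!!t. t \<ge> 1 ==> norm (T t o\<^sub>L dop A 0 \<sigma>) <= B * (t powr (- m) * Lg (1 / (2 * t)) powr (a * (m + 1)) * (ln t + 1))"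
  using semigroup_decay[OF assms(1,3,4,5,7,8,9) res bd assms(11) m_def] by blast
 have dopc: "dop A 0 \<sigma> \<in> clinear_ops" by (rule representsD(1)[OF represents_dop[OF assms(1) order_refl \<sigma>0]])
 show ?thesis
 proof (intro allI impI)
  fix \<delta> :: real assume \<delta>: "\<delta> > 0"
  \<comment> \<open>The constant of \<open>Lg_log_bound\<close> for the exponent
    \<open>a * (m + 1)\<close>, which equals \<open>a * (\<sigma> + 1) / \<alpha>\<close>.\<close>
  define k where "k = 2 powr (a * (m + 1)) * (1 + 1 / ln 2) * ln 2 powr (- \<delta>)"
  have k: "k > 0" unfolding k_def by (intro mult_pos_pos add_pos_pos) auto
  show "\<exists>c>0. \<forall>t\<ge>1. \<exists>B\<in>clinear_ops.
     graph_of B = frac_power (shift_op 1 A) (- \<sigma>) O frac_power A \<sigma> O graph_of (T t) \<and>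
     norm B <= c * t powr (1 - (\<sigma> + 1) / \<alpha>) * ln (1 + t) powr (a * (\<sigma> + 1) / \<alpha> + 1 + \<delta>)"
  proof (intro exI[of _ "B * k"] conjI allI impI)
   show "0 < B * k" using B k by simp
   fix t :: real assume t: "t \<ge> 1"
   show "\<exists>B'\<in>clinear_ops.
     graph_of B' = frac_power (shift_op 1 A) (- \<sigma>) O frac_power A \<sigma> O graph_of (T t) \<and>
     norm B' <= B * k * t powr (1 - (\<sigma> + 1) / \<alpha>) * ln (1 + t) powr (a * (\<sigma> + 1) / \<alpha> + 1 + \<delta>)"
   proof (intro bexI conjI)
    have Tc: "T t \<in> clinear_ops" using assms(3) t by (simp add: C0_semigroup_def)
    show "T t o\<^sub>L dop A 0 \<sigma> \<in> clinear_ops" by (intro clinear_ops_compose Tc dopc)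
    \<comment> \<open>Composition of graphs runs from left to right, so
      \<open>dop A 0 \<sigma>\<close> acts first and \<open>T t\<close> last.\<close>
    have "graph_of (T t o\<^sub>L dop A 0 \<sigma>) = graph_of (dop A 0 \<sigma>) O graph_of (T t)" by (auto simp: graph_of_def relcomp_unfold)
    then show "graph_of (T t o\<^sub>L dop A 0 \<sigma>) = frac_power (shift_op 1 A) (- \<sigma>) O frac_power A \<sigma> O graph_of (T t)"
     by (simp only: frac_power_composition[OF assms(1,2) \<sigma>0, symmetric] O_assoc)
    have "B * (t powr (- m) * Lg (1 / (2 * t)) powr (a * (m + 1)) * (ln t + 1)) = B * t powr (- m) * (Lg (1 / (2 * t)) powr (a * (m + 1)) * (ln t + 1))" by simp
    also have "\<dots> <= B * t powr (- m) * (k * ln (1 + t) powr (a * (m + 1) + 1 + \<delta>))"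
     unfolding k_def using assms(8) m0 \<delta> B t by (intro mult_left_mono Lg_log_bound) auto
    finally show "norm (T t o\<^sub>L dop A 0 \<sigma>) <= B * k * t powr (1 - (\<sigma> + 1) / \<alpha>) * ln (1 + t) powr (a * (\<sigma> + 1) / \<alpha> + 1 + \<delta>)"
     using B(2)[OF t] by (simp add: m_def mult_ac)
   qed
  qed
 qed
qed

end
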